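(* Assume (H1), (H3) and (H4) with $\alpha=p^*-1$. Then there exists $\Lambda_{**}>0$ such that for every $\lambda\in(0,\Lambda_{**})$ problem (P) admits at least one weak solution $u_0\in W_0^{1,\mathcal H}(\Omega)$ with $I_\lambda(u_0)<0$.
   Context: Let $\Omega\subset\mathbb R^N$, $N\ge2$, be a bounded Lipschitz domain. $H:\mathbb R^N\to[0,\infty)$ is a Finsler–Minkowski norm: $H(\xi)=0$ iff $\xi=0$, $H\in C^\infty(\mathbb R^N\setminus\{0\})$, $H(t\xi)=|t|H(\xi)$ for all $t\in\mathbb R$, and the Hessian of $H^2/2$ is positive definite at every $\xi\neq0$; $\nabla_\eta H$ denotes the gradient of $H$. Hypothesis (H1): $\lambda>0$, $0<\delta<1$, $2\le p<q<N$, $q<\alpha+1\le p^*:=\frac{Np}{N-p}$, $\frac qp<1+\frac1N$, and $0\le\mu\in C^{0,1}(\overline\Omega)$. Hypotheses for the critical case $\alpha+1=p^*$: (H3) $a>0$ a.e. in $\Omega$ and $a\in L^{p^*/(p^*-1+\delta)}(\Omega)$; (H4) $b\in L^\infty(\Omega)$, possibly sign-changing, with $b^+\not\equiv0$. Let $\mathcal H(x,t)=t^p+\mu(x)t^q$, $L^{\mathcal H}(\Omega)=\{u \text{ measurable}:\int_\Omega\mathcal H(x,|u|)dx<\infty\}$ with Luxemburg norm $\|u\|_{\mathcal H}=\inf\{\tau>0:\int_\Omega\mathcal H(x,|u|/\tau)dx\le1\}$, and $W_0^{1,\mathcal H}(\Omega)$ the completion of $C_c^\infty(\Omega)$ in $\{u\in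 L^{\mathcal H}(\Omega):H(\nabla u)\in L^{\mathcal H}(\Omega)\}$, normed by $\|u\|=\|H(\nabla u)\|_{\mathcal H}$. Problem (P): $-\mathrm{div}\big((H(\nabla u)^{p-1}+\mu(x)H(\nabla u)^{q-1})\nabla_\eta H(\nabla u)\big)=a(x)u^{-\delta}+\lambda b(x)u^\alpha$ in $\Omega$, $u>0$ in $\Omega$, $u=0$ on $\partial\Omega$. A weak solution of (P) is $u\in W_0^{1,\mathcal H}(\Omega)$ with $u>0$ a.e. in $\Omega$ and $\int_\Omega(H(\nabla u)^{p-1}+\mu(x)H(\nabla u)^{q-1})\nabla_\eta H(\nabla u)\cdot\nabla\phi\,dx=\int_\Omega(a(x)u^{-\delta}+\lambda b(x)u^\alpha)\phi\,dx$ for all $\phi\in C_c^1(\Omega)$. The energy functional is $I_\lambda(u)=\int_\Omega\big(\frac{H(\nabla u)^p}{p}+\mu(x)\frac{H(\nabla u)^q}{q}\big)dx-\frac1{1-\delta}\int_\Omega a|u|^{1-\delta}dx-\frac{\lambda}{\alpha+1}\int_\Omega b|u|^{\alpha+1}dx$. *)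

theory Defs
  imports "HOL-Analysis.Analysis"
begin

text \<open>C-infinity on an open set S: differentiable, and every directional
  derivative is again C-infinity (greatest fixed point = all iterated
  directional derivatives exist).\<close>
coinductive smooth_on :: "'a::euclidean_space set \<Rightarrow> ('a \<Rightarrow> real) \<Rightarrow> bool"
  for S where
  "f differentiable_on S \<Longrightarrow> (\<forall>v. smooth_on S (\<lambda>x. frechet_derivative f (at x) v))
     \<Longrightarrow> smooth_on S f"

definition grad :: "('a::euclidean_space \<Rightarrow> real) \<Rightarrow> 'a \<Rightarrow> 'a" where
  "grad f x = (\<Sum>b\<in>Basis. frechet_derivative f (at x) b *\<^sub>R b)"

definition hessian_quad :: "('a::euclidean_space \<Rightarrow> real) \<Rightarrow> 'a \<Rightarrow> 'a \<Rightarrow> real" where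
  "hessian_quad F xi v = frechet_derivative (\<lambda>x. frechet_derivative F (at x) v) (at xi) v"

definition tsupp :: "('a::euclidean_space \<Rightarrow> real) \<Rightarrow> 'a set" where
  "tsupp f = closure {x. f x \<noteq> 0}"

definition Cc_infty :: "'a::euclidean_space set \<Rightarrow> ('a \<Rightarrow> real) set" where
  "Cc_infty \<Omega> = {f. smooth_on UNIV f \<and> compact (tsupp f) \<and> tsupp f \<subseteq> \<Omega>}"

definition Cc_1 :: "'a::euclidean_space set \<Rightarrow> ('a \<Rightarrow> real) set" where
  "Cc_1 \<Omega> = {f. (\<exists>f'. (\<forall>x. (f has_derivative blinfun_apply (f' x)) (at x))
                        \<and> continuous_on UNIV f')
               \<and> compact (tsupp f) \<and> tsupp f \<subseteq> \<Omega>}"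

definition lipschitz_domain :: "'a::euclidean_space set \<Rightarrow> bool" where
  "lipschitz_domain \<Omega> \<longleftrightarrow> open \<Omega> \<and> connected \<Omega> \<and> \<Omega> \<noteq> {} \<and>
     (\<forall>x0\<in>frontier \<Omega>. \<exists>r>0. \<exists>e g L. norm e = 1 \<and>
        lipschitz_on L {z. z \<bullet> e = 0} g \<and>
        \<Omega> \<inter> ball x0 r = {y \<in> ball x0 r. y \<bullet> e > g (y - (y \<bullet> e) *\<^sub>R e)})"

definition finsler_minkowski :: "('a::euclidean_space \<Rightarrow> real) \<Rightarrow> bool" where
  "finsler_minkowski H \<longleftrightarrow>
     (\<forall>\<xi>. H \<xi> \<ge> 0) \<and> (\<forall>\<xi>. H \<xi> = 0 \<longleftrightarrow> \<xi> = 0) \<and>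
     smooth_on (UNIV - {0}) H \<and>
     (\<forall>t \<xi>. H (t *\<^sub>R \<xi>) = \<bar>t\<bar> * H \<xi>) \<and>
     (\<forall>\<xi>. \<xi> \<noteq> 0 \<longrightarrow> (\<forall>v. v \<noteq> 0 \<longrightarrow> hessian_quad (\<lambda>x. (H x)\<^sup>2 / 2) \<xi> v > 0))"

definition dpH :: "real \<Rightarrow> real \<Rightarrow> ('a \<Rightarrow> real) \<Rightarrow> 'a \<Rightarrow> real \<Rightarrow> real" where
  "dpH p q \<mu> x t = t powr p + \<mu> x * t powr q"

definition modular :: "real \<Rightarrow> real \<Rightarrow> ('a::euclidean_space \<Rightarrow> real) \<Rightarrow> 'a set \<Rightarrow> ('a \<Rightarrow> real) \<Rightarrow> ennreal" where
  "modular p q \<mu> \<Omega> u = (\<integral>\<^sup>+ x. ennreal (dpH p q \<mu> x \<bar>u x\<bar>) \<partial>lebesgue_on \<Omega>)"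

definition in_LH :: "real \<Rightarrow> real \<Rightarrow> ('a::euclidean_space \<Rightarrow> real) \<Rightarrow> 'a set \<Rightarrow> ('a \<Rightarrow> real) \<Rightarrow> bool" where
  "in_LH p q \<mu> \<Omega> u \<longleftrightarrow> u \<in> borel_measurable (lebesgue_on \<Omega>) \<and> modular p q \<mu> \<Omega> u < \<infinity>"

definition lux_norm :: "real \<Rightarrow> real \<Rightarrow> ('a::euclidean_space \<Rightarrow> real) \<Rightarrow> 'a set \<Rightarrow> ('a \<Rightarrow> real) \<Rightarrow> real" where
  "lux_norm p q \<mu> \<Omega> u = Inf {\<tau>. \<tau> > 0 \<and> modular p q \<mu> \<Omega> (\<lambda>x. u x / \<tau>) \<le> 1}"

definition weak_gradient :: "'a::euclidean_space set \<Rightarrow> ('a \<Rightarrow> real) \<Rightarrow> ('a \<Rightarrow> 'a) \<Rightarrow> bool" where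
  "weak_gradient \<Omega> u G \<longleftrightarrow>
     u \<in> borel_measurable (lebesgue_on \<Omega>) \<and> G \<in> borel_measurable (lebesgue_on \<Omega>) \<and>
     (\<forall>K. compact K \<and> K \<subseteq> \<Omega> \<longrightarrow> set_integrable lebesgue K u \<and> set_integrable lebesgue K G) \<and>
     (\<forall>\<psi>\<in>Cc_infty \<Omega>. \<forall>b\<in>Basis.
        (\<integral>x. u x * frechet_derivative \<psi> (at x) b \<partial>lebesgue_on \<Omega>)
          = - (\<integral>x. (G x \<bullet> b) * \<psi> x \<partial>lebesgue_on \<Omega>))"

definition W0H :: "('a::euclidean_space \<Rightarrow> real) \<Rightarrow> real \<Rightarrow> real \<Rightarrow> ('a \<Rightarrow> real) \<Rightarrow> 'a set
     \<Rightarrow> ('a \<Rightarrow> real) \<Rightarrow> bool" where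
  "W0H H p q \<mu> \<Omega> u \<longleftrightarrow> (\<exists>G. weak_gradient \<Omega> u G \<and>
     in_LH p q \<mu> \<Omega> u \<and> in_LH p q \<mu> \<Omega> (\<lambda>x. H (G x)) \<and>
     (\<exists>\<phi>. (\<forall>k. \<phi> k \<in> Cc_infty \<Omega>) \<and>
        (\<lambda>k. lux_norm p q \<mu> \<Omega> (\<lambda>x. \<phi> k x - u x)) \<longlonglongrightarrow> 0 \<and>
        (\<lambda>k. lux_norm p q \<mu> \<Omega> (\<lambda>x. H (grad (\<phi> k) x - G x))) \<longlonglongrightarrow> 0))"

definition crit_exp :: "real \<Rightarrow> real \<Rightarrow> real" where
  "crit_exp N p = N * p / (N - p)"

definition flux :: "('a::euclidean_space \<Rightarrow> real) \<Rightarrow> real \<Rightarrow> real \<Rightarrow> real \<Rightarrow> 'a \<Rightarrow> 'a \<Rightarrow> real" where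
  "flux H p q m g w = (H g powr (p - 1) + m * H g powr (q - 1)) * (grad H g \<bullet> w)"

definition weak_solution :: "('a::euclidean_space \<Rightarrow> real) \<Rightarrow> real \<Rightarrow> real \<Rightarrow> ('a \<Rightarrow> real) \<Rightarrow> 'a set
     \<Rightarrow> ('a \<Rightarrow> real) \<Rightarrow> ('a \<Rightarrow> real) \<Rightarrow> real \<Rightarrow> real \<Rightarrow> real
     \<Rightarrow> ('a \<Rightarrow> real) \<Rightarrow> ('a \<Rightarrow> 'a) \<Rightarrow> bool" where
  "weak_solution H p q \<mu> \<Omega> a b \<delta> lam \<alpha> u G \<longleftrightarrow>
     W0H H p q \<mu> \<Omega> u \<and> weak_gradient \<Omega> u G \<and>
     (AE x in lebesgue_on \<Omega>. u x > 0) \<and>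
     (\<forall>\<phi>\<in>Cc_1 \<Omega>.
        integrable (lebesgue_on \<Omega>) (\<lambda>x. flux H p q (\<mu> x) (G x) (grad \<phi> x)) \<and>
        integrable (lebesgue_on \<Omega>) (\<lambda>x. (a x * u x powr (- \<delta>) + lam * b x * u x powr \<alpha>) * \<phi> x) \<and>
        (\<integral>x. flux H p q (\<mu> x) (G x) (grad \<phi> x) \<partial>lebesgue_on \<Omega>)
          = (\<integral>x. (a x * u x powr (- \<delta>) + lam * b x * u x powr \<alpha>) * \<phi> x \<partial>lebesgue_on \<Omega>))"

definition energy :: "('a::euclidean_space \<Rightarrow> real) \<Rightarrow> real \<Rightarrow> real \<Rightarrow> ('a \<Rightarrow> real) \<Rightarrow> 'a set
     \<Rightarrow> ('a \<Rightarrow> real) \<Rightarrow> ('a \<Rightarrow> real) \<Rightarrow> real \<Rightarrow> real \<Rightarrow> real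
     \<Rightarrow> ('a \<Rightarrow> real) \<Rightarrow> ('a \<Rightarrow> 'a) \<Rightarrow> real" where
  "energy H p q \<mu> \<Omega> a b \<delta> lam \<alpha> u G =
     (\<integral>x. H (G x) powr p / p + \<mu> x * H (G x) powr q / q \<partial>lebesgue_on \<Omega>)
     - 1 / (1 - \<delta>) * (\<integral>x. a x * \<bar>u x\<bar> powr (1 - \<delta>) \<partial>lebesgue_on \<Omega>)
     - lam / (\<alpha> + 1) * (\<integral>x. b x * \<bar>u x\<bar> powr (\<alpha> + 1) \<partial>lebesgue_on \<Omega>)"

end

theory Submission
  imports Defs "HOL-Complex_Analysis.Great_Picard" "HOL-Real_Asymp.Real_Asymp"
begin

text \<open>
  The energy is minimised over a ball {\<Phi> \<le> \<rho>} of the gradient modular \<Phi>. The singular term is sublinear, so \<rho> can be chosen such that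
  \<Phi> dominates it on the sphere \<Phi> = \<rho>; for small \<lambda> the energy is then nonnegative there, while small multiples of a
  nonnegative bump have negative energy.

  Take a minimising sequence of nonnegative C^1 functions with compact support. As p \<ge> 2, H^p is uniformly convex, so comparing the energy
  of midpoints with the infimum controls the modular of the gradient differences by the midpoint defects of the other two terms. The
  singular term is concave and its defect has the right sign. Rellich compactness gives an a.e. limit u, and by dominated convergence the
  defect of the critical term is, up to o(1), controlled by the distances to u in the critical norm, hence by Fatou and the Sobolev inequality
  by the gradient differences themselves; for small \<lambda> it is absorbed. The sequence is therefore Cauchy, and u is an interior minimiser of
  negative energy.

  Since u^(1-\<delta>) has infinite slope at 0, difference quotients of the energy and Fatou's lemma give u > 0 a.e. and the integrability of
  a u^(-\<delta>) \<phi>. The bound ||u + s|^(1-\<delta>) - u^(1-\<delta>)| \<le> u^(-\<delta>) |s| then allows passage to the limit in the difference quotients.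
\<close>

text \<open>The critical embedding is not compact, so weak limits alone give no control of the term
  with exponent \<open>r\<close>. Two facts compensate. The Sobolev bound for differences has
  exponent r/p > 1 in the gradient modular, so on a ball {\<Phi> \<le> \<rho>} it becomes linear,
  with a constant governed by \<rho>. And the midpoint defect of the critical term carries the
  factor \<lambda>, while the convexity gain of the gradient term does not. Hence the order of the
  constants: \<rho> is fixed without reference to \<lambda>, and only then is \<lambda> restricted,
  once for the absorption and once for the lower bound near the sphere. Competitors are C^1 with
  compact support because this class is closed under composition with merely C^1 functions vanishing
  at 0, so truncations and explicit bumps stay inside it and the chain rule is elementary. Smooth
  functions are needed only to match the definitions of weak gradient and of the completion.
  Minimality passes to u + t\<phi> by approximation, so no calculus of Sobolev functions is
  required.\<close>

section \<open>Compactly supported C^1 functions paired with their gradients\<close>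

text \<open>The gradient is an explicit second argument: algebraic operations then come with a
  formula for it, and limits of functions and of gradients can be taken separately.\<close>

definition C1c :: "'a::euclidean_space set \<Rightarrow> ('a \<Rightarrow> real) \<Rightarrow> ('a \<Rightarrow> 'a) \<Rightarrow> bool" where
  "C1c \<Omega> f g \<longleftrightarrow> (\<forall>x. (f has_derivative (\<lambda>h. g x \<bullet> h)) (at x)) \<and> continuous_on UNIV g
     \<and> compact (tsupp f) \<and> tsupp f \<subseteq> \<Omega>"

lemma tsupp_vanish: "x \<notin> tsupp f \<Longrightarrow> f x = 0"
  using closure_subset[of "{x. f x \<noteq> 0}"] unfolding tsupp_def by auto

lemma closed_tsupp: "closed (tsupp f)"
  by (simp add: tsupp_def)

lemma tsupp_subset: "closed K \<Longrightarrow> (\<And>x. x \<notin> K \<Longrightarrow> f x = 0) \<Longrightarrow> tsupp f \<subseteq> K"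
  unfolding tsupp_def by (rule closure_minimal) auto

lemma C1cD:
  assumes "C1c \<Omega> f g"
  shows "(f has_derivative (\<lambda>h. g x \<bullet> h)) (at x)" "continuous_on UNIV g" "continuous_on UNIV f"
    "compact (tsupp f)" "tsupp f \<subseteq> \<Omega>"
proof -
  show d: "(f has_derivative (\<lambda>h. g x \<bullet> h)) (at x)" for x using assms by (simp add: C1c_def)
  show "continuous_on UNIV f"
    using has_derivative_continuous[OF d] by (simp add: continuous_on_eq_continuous_at)
qed (use assms in \<open>auto simp: C1c_def\<close>)

lemma C1cI:
  assumes "\<And>x. (f has_derivative (\<lambda>h. g x \<bullet> h)) (at x)" "continuous_on UNIV g"
    "compact K" "K \<subseteq> \<Omega>" "\<And>x. x \<notin> K \<Longrightarrow> f x = 0"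
  shows "C1c \<Omega> f g"
proof -
  have "tsupp f \<subseteq> K" using assms by (intro tsupp_subset compact_imp_closed)
  moreover have "compact (tsupp f)"
    using compact_Int_closed[OF assms(3) closed_tsupp[of f]] calculation
    by (simp add: Int_absorb1)
  ultimately show ?thesis using assms unfolding C1c_def by auto
qed

text \<open>Off the closed support f vanishes on a whole neighbourhood, so its derivative there is
  that of the zero function.\<close>

lemma C1c_grad_vanish:
  assumes "C1c \<Omega> f g" "x \<notin> tsupp f" shows "g x = 0"
proof -
  have "(f has_derivative (\<lambda>h. 0)) (at x)"
    using has_derivative_transform_within_open[of "\<lambda>x. 0" "\<lambda>h. 0" x UNIV "- tsupp f" f]
      assms(2) closed_tsupp[of f] tsupp_vanish[of _ f] by (auto simp: open_Compl)
  from has_derivative_unique[OF C1cD(1)[OF assms(1)] this] have "g x \<bullet> g x = 0" by meson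
  then show ?thesis by simp
qed

text \<open>Brings the test functions of the weak formulation into this class. The operator-valued
  derivative and the coordinate sum \<open>grad\<close> determine each other by expanding a vector
  in the basis.\<close>

lemma Cc_1_iff: "f \<in> Cc_1 \<Omega> \<longleftrightarrow> C1c \<Omega> f (grad f)"
proof
  assume "f \<in> Cc_1 \<Omega>"
  then obtain f' where f': "\<And>x. (f has_derivative blinfun_apply (f' x)) (at x)"
    "continuous_on UNIV f'" and s: "compact (tsupp f)" "tsupp f \<subseteq> \<Omega>"
    unfolding Cc_1_def by blast
  have g: "grad f x = (\<Sum>b\<in>Basis. blinfun_apply (f' x) b *\<^sub>R b)" for x
    unfolding grad_def frechet_derivative_at[OF f'(1), symmetric] ..
  have gf: "grad f x \<bullet> h = blinfun_apply (f' x) h" for x h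
  proof -
    have "blinfun_apply (f' x) h = blinfun_apply (f' x) (\<Sum>b\<in>Basis. (h \<bullet> b) *\<^sub>R b)"
      by (simp add: euclidean_representation)
    also have "\<dots> = (\<Sum>b\<in>Basis. (h \<bullet> b) * blinfun_apply (f' x) b)"
      by (simp add: blinfun.sum_right blinfun.scaleR_right)
    finally show ?thesis
      by (simp add: g inner_sum_left mult.commute inner_commute[of h])
  qed
  have "(f has_derivative (\<bullet>) (grad f x)) (at x)" for x
    by (rule has_derivative_eq_rhs[OF f'(1)]) (simp add: fun_eq_iff gf)
  moreover have "continuous_on UNIV (grad f)"
    unfolding g by (intro continuous_intros f'(2))
  ultimately show "C1c \<Omega> f (grad f)" using f'(1) s unfolding C1c_def by blast
next
  assume C: "C1c \<Omega> f (grad f)"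
  show "f \<in> Cc_1 \<Omega>" unfolding Cc_1_def mem_Collect_eq
  proof (intro conjI exI[of _ "\<lambda>x. blinfun_inner_right (grad f x)"] allI)
    show "continuous_on UNIV (\<lambda>x. blinfun_inner_right (grad f x))"
      using C1cD(2)[OF C] by (intro continuous_intros)
    show "(f has_derivative blinfun_apply (blinfun_inner_right (grad f x))) (at x)" for x
      using C1cD(1)[OF C] by simp
  qed (fact C1cD(4,5)[OF C])+
qed

lemma C1c_mono: "C1c A f g \<Longrightarrow> A \<subseteq> B \<Longrightarrow> C1c B f g"
  unfolding C1c_def by auto

lemma C1c_add:
  assumes "C1c \<Omega> f g" "C1c \<Omega> f' g'"
  shows "C1c \<Omega> (\<lambda>x. f x + f' x) (\<lambda>x. g x + g' x)"
proof (rule C1cI[where K="tsupp f \<union> tsupp f'"])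
  show "((\<lambda>x. f x + f' x) has_derivative (\<bullet>) (g x + g' x)) (at x)" for x
    by (rule has_derivative_eq_rhs[OF has_derivative_add[OF C1cD(1)[OF assms(1)] C1cD(1)[OF assms(2)]]])
      (simp add: inner_add_left fun_eq_iff)
  show "continuous_on UNIV (\<lambda>x. g x + g' x)"
    by (intro continuous_on_add C1cD(2)[OF assms(1)] C1cD(2)[OF assms(2)])
qed (use C1cD(4,5)[OF assms(1)] C1cD(4,5)[OF assms(2)] in \<open>auto simp: tsupp_vanish\<close>)

lemma C1c_scale:
  assumes "C1c \<Omega> f g" shows "C1c \<Omega> (\<lambda>x. c * f x) (\<lambda>x. c *\<^sub>R g x)"
proof (rule C1cI[where K="tsupp f"])
  show "((\<lambda>x. c * f x) has_derivative (\<bullet>) (c *\<^sub>R g x)) (at x)" for x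
    by (rule has_derivative_eq_rhs[OF has_derivative_mult_right[OF C1cD(1)[OF assms]]])
      (simp add: fun_eq_iff)
  show "continuous_on UNIV (\<lambda>x. c *\<^sub>R g x)"
    by (intro continuous_on_scaleR continuous_on_const C1cD(2)[OF assms])
qed (use C1cD(4,5)[OF assms] in \<open>auto simp: tsupp_vanish\<close>)

lemma C1c_diff:
  assumes "C1c \<Omega> f g" "C1c \<Omega> f' g'"
  shows "C1c \<Omega> (\<lambda>x. f x - f' x) (\<lambda>x. g x - g' x)"
  using C1c_add[OF assms(1) C1c_scale[OF assms(2), of "-1"]] by simp

text \<open>The condition \<open>\<theta> 0 = 0\<close> keeps the support inside that of f;
  truncations and regularised absolute values are of this kind.\<close>

lemma C1c_comp:
  assumes "C1c \<Omega> f g" "\<And>s. (\<theta> has_real_derivative \<theta>' s) (at s)" "continuous_on UNIV \<theta>'" "\<theta> 0 = 0"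
  shows "C1c \<Omega> (\<lambda>x. \<theta> (f x)) (\<lambda>x. \<theta>' (f x) *\<^sub>R g x)"
proof (rule C1cI[where K="tsupp f"])
  fix x
  show "((\<lambda>x. \<theta> (f x)) has_derivative (\<bullet>) (\<theta>' (f x) *\<^sub>R g x)) (at x)"
    by (rule has_derivative_eq_rhs[OF has_derivative_compose[OF C1cD(1)[OF assms(1)]
            assms(2)[unfolded has_field_derivative_def]]])
      (simp add: fun_eq_iff)
  show "continuous_on UNIV (\<lambda>x. \<theta>' (f x) *\<^sub>R g x)"
    using continuous_on_compose2[OF assms(3) C1cD(3)[OF assms(1)]]
    by (intro continuous_intros C1cD(2)[OF assms(1)]) auto
qed (use assms(4) C1cD(4,5)[OF assms(1)] in \<open>simp_all add: tsupp_vanish\<close>)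

lemma continuous_cpt_integrable:
  fixes h :: "'a::euclidean_space \<Rightarrow> 'b::{banach, second_countable_topology}"
  assumes "continuous_on UNIV h" "compact K" "\<And>x. x \<notin> K \<Longrightarrow> h x = 0"
  shows "integrable lborel h"
proof -
  have "(\<lambda>x. indicator K x *\<^sub>R h x) = h" using assms(3) by (auto simp: indicator_def)
  then show ?thesis
    using borel_integrable_compact[OF assms(2) continuous_on_subset[OF assms(1)]] by auto
qed

lemma continuous_cpt_bounded:
  fixes h :: "'a::euclidean_space \<Rightarrow> 'b::real_normed_vector"
  assumes "continuous_on UNIV h" "compact K" "\<And>x. x \<notin> K \<Longrightarrow> h x = 0"
  obtains B where "B > 0" "\<And>x. norm (h x) \<le> B"
proof -
  have "bounded (h ` K)"
    using assms by (meson compact_continuous_image compact_imp_bounded continuous_on_subset top_greatest)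
  then obtain B where B: "B > 0" "\<And>x. x \<in> K \<Longrightarrow> norm (h x) \<le> B"
    unfolding bounded_pos by auto
  then have "norm (h x) \<le> B" for x using assms(3)[of x] by (cases "x \<in> K") auto
  with B that show ?thesis by blast
qed

section \<open>Sobolev inequality by truncation at dyadic levels\<close>

lemma powr_above_tangent:
  fixes p :: real assumes "1 \<le> p" "0 < m" "0 \<le> s"
  shows "m powr p + p * m powr (p - 1) * (s - m) \<le> s powr p"
proof (cases "s = 0")
  case True
  have "m powr p = m powr (p - 1) * m" using assms by (simp add: powr_mult_base mult.commute)
  then have "m powr p + p * m powr (p - 1) * (0 - m) = (1 - p) * m powr p"
    by (simp add: algebra_simps)
  also have "\<dots> \<le> 0" using assms by (simp add: mult_nonpos_nonneg)
  finally show ?thesis using True by simp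
next
  case False
  have "s powr p - m powr p \<ge> (p * m powr (p - 1)) * (s - m)"
    using assms False
    by (intro convex_on_imp_above_tangent[OF powr_convex[OF assms(1)]])
      (auto simp: interior_open intro!: derivative_eq_intros)
  then show ?thesis by simp
qed

text \<open>Jensen's inequality on the unit interval: integrate the tangent line of the power at the
  mean value \<open>m\<close>; its linear part has integral zero.\<close>

lemma powr_integral_le:
  fixes k :: "real \<Rightarrow> real"
  assumes "1 \<le> p" "continuous_on {0..1} k" "\<And>s. 0 \<le> k s"
  shows "integral {0..1} k powr p \<le> integral {0..1} (\<lambda>s. k s powr p)"
proof -
  define m where "m = integral {0..1} k"
  have c: "continuous_on {0..1} (\<lambda>s. k s powr p)"
    using assms by (intro continuous_on_powr') auto
  have m0: "0 \<le> m" unfolding m_def using assms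
    by (intro integral_nonneg integrable_continuous_interval) auto
  show ?thesis
  proof (cases "m = 0")
    case True
    then show ?thesis unfolding m_def[symmetric]
      using assms c by (simp add: integral_nonneg integrable_continuous_interval)
  next
    case False
    have "m powr p = integral {0..1} (\<lambda>s. m powr p + p * m powr (p - 1) * (k s - m))"
    proof -
      have "((\<lambda>s. m powr p + p * m powr (p - 1) * (k s - m)) has_integral
         (measure lborel {0..1::real} *\<^sub>R (m powr p) + p * m powr (p - 1) * (m - measure lborel {0..1::real} *\<^sub>R m))) {0..1}"
        unfolding m_def
        by (intro has_integral_add has_integral_mult_right has_integral_diff has_integral_const_real
            integrable_integral integrable_continuous_interval assms(2))
      then show ?thesis by (simp add: integral_unique)
    qed
    also have "\<dots> \<le> integral {0..1} (\<lambda>s. k s powr p)"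
      using assms c m0 False
      by (intro integral_le integrable_continuous_interval continuous_intros c powr_above_tangent) auto
    finally show ?thesis unfolding m_def .
  qed
qed

lemma nn_integral_translate:
  fixes h :: "'a::euclidean_space \<Rightarrow> ennreal"
  assumes [measurable]: "h \<in> borel_measurable borel"
  shows "(\<integral>\<^sup>+x. h (x + c) \<partial>lborel) = (\<integral>\<^sup>+x. h x \<partial>lborel)"
proof -
  have "(\<integral>\<^sup>+x. h x \<partial>lborel) = (\<integral>\<^sup>+x. h x \<partial>distr lborel borel ((+) c))"
    by (simp add: lborel_distr_plus)
  also have "\<dots> = (\<integral>\<^sup>+x. h (c + x) \<partial>lborel)"
    by (subst nn_integral_distr) auto
  finally show ?thesis by (simp add: add.commute)
qed

text \<open>The increment is the integral of the directional derivative along the segment, and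
  Jensen moves the power inside. The right side is an extended integral over s so that Tonelli
  applies directly.\<close>

lemma C1c_translate_pointwise:
  assumes C: "C1c \<Omega> f g" and p: "1 \<le> p"
  shows "ennreal (\<bar>f (x + z) - f x\<bar> powr p)
    \<le> (\<integral>\<^sup>+s. indicator {0..1} s * ennreal ((norm z * norm (g (x + s *\<^sub>R z))) powr p) \<partial>lborel)"
proof -
  have cg: "continuous_on S (\<lambda>s. g (x + s *\<^sub>R z))" for S
    by (rule continuous_on_compose2[OF C1cD(2)[OF C]]) (auto intro!: continuous_intros)
  have "((\<lambda>s. g (x + s *\<^sub>R z) \<bullet> z) has_integral f (x + 1 *\<^sub>R z) - f (x + 0 *\<^sub>R z)) {0..1}"
  proof (rule fundamental_theorem_of_calculus)
    fix s :: real
    have "((\<lambda>s. f (x + s *\<^sub>R z)) has_derivative (\<lambda>h. g (x + s *\<^sub>R z) \<bullet> (h *\<^sub>R z))) (at s)"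
      by (rule has_derivative_compose[OF _ C1cD(1)[OF C]]) (auto intro!: derivative_eq_intros)
    then show "((\<lambda>s. f (x + s *\<^sub>R z)) has_vector_derivative g (x + s *\<^sub>R z) \<bullet> z) (at s within {0..1})"
      unfolding has_vector_derivative_def
      by (auto intro: has_derivative_at_withinI)
  qed simp
  then have "\<bar>f (x + z) - f x\<bar> = norm (integral {0..1} (\<lambda>s. g (x + s *\<^sub>R z) \<bullet> z))"
    by (simp add: integral_unique)
  also have "\<dots> \<le> integral {0..1} (\<lambda>s. norm z * norm (g (x + s *\<^sub>R z)))"
    by (intro integral_norm_bound_integral integrable_continuous_interval continuous_intros cg)
      (metis Cauchy_Schwarz_ineq2 mult.commute real_norm_def)
  finally have "\<bar>f (x + z) - f x\<bar> powr p \<le> integral {0..1} (\<lambda>s. norm z * norm (g (x + s *\<^sub>R z))) powr p"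
    using p by (intro powr_mono2) auto
  also have "\<dots> \<le> integral {0..1} (\<lambda>s. (norm z * norm (g (x + s *\<^sub>R z))) powr p)"
    by (intro powr_integral_le p continuous_on_mult continuous_on_norm continuous_on_const cg) auto
  finally have "ennreal (\<bar>f (x + z) - f x\<bar> powr p)
     \<le> ennreal (integral {0..1} (\<lambda>s. (norm z * norm (g (x + s *\<^sub>R z))) powr p))"
    by (rule ennreal_leI)
  also have "\<dots> = integral\<^sup>N lborel (\<lambda>s. indicator {0..1} s * ennreal ((norm z * norm (g (x + s *\<^sub>R z))) powr p))"
  proof -
    have "((\<lambda>s. (norm z * norm (g (x + s *\<^sub>R z))) powr p) has_integral
      integral {0..1} (\<lambda>s. (norm z * norm (g (x + s *\<^sub>R z))) powr p)) {0..1}"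
      using p by (intro integrable_integral integrable_continuous_interval continuous_on_powr' continuous_on_mult continuous_on_norm continuous_on_const cg) auto
    from nn_integral_has_integral_lebesgue[OF _ this]
    have "(\<integral>\<^sup>+s. ennreal (indicator {0..1} s * (norm z * norm (g (x + s *\<^sub>R z))) powr p) \<partial>lborel)
      = ennreal (integral {0..1} (\<lambda>s. (norm z * norm (g (x + s *\<^sub>R z))) powr p))"
      by simp
    moreover have "(\<integral>\<^sup>+s. ennreal (indicator {0..1} s * (norm z * norm (g (x + s *\<^sub>R z))) powr p) \<partial>lborel)
      = (\<integral>\<^sup>+s. indicator {0..1} s * ennreal ((norm z * norm (g (x + s *\<^sub>R z))) powr p) \<partial>lborel)"
      by (intro nn_integral_cong) (simp split: split_indicator)
    ultimately show ?thesis by simp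
  qed
  finally show ?thesis .
qed

text \<open>After swapping the integrals, every slice s contributes the same amount by translation
  invariance, and the slices have total length 1.\<close>

lemma C1c_translate:
  assumes C: "C1c \<Omega> f g" and p: "1 \<le> p"
  shows "(\<integral>\<^sup>+x. ennreal (\<bar>f (x + z) - f x\<bar> powr p) \<partial>lborel)
    \<le> ennreal (norm z powr p) * (\<integral>\<^sup>+x. ennreal (norm (g x) powr p) \<partial>lborel)"
proof -
  have [measurable]: "g \<in> borel_measurable borel"
    using C1cD(2)[OF C] by (rule borel_measurable_continuous_onI)
  let ?F = "\<lambda>x s. indicator {0..1} s * ennreal ((norm z * norm (g (x + s *\<^sub>R z))) powr p)"
  have "(\<integral>\<^sup>+x. ennreal (\<bar>f (x + z) - f x\<bar> powr p) \<partial>lborel) \<le> (\<integral>\<^sup>+x. (\<integral>\<^sup>+s. ?F x s \<partial>lborel) \<partial>lborel)"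
    by (intro nn_integral_mono C1c_translate_pointwise[OF C p])
  also have "\<dots> = (\<integral>\<^sup>+s. (\<integral>\<^sup>+x. ?F x s \<partial>lborel) \<partial>lborel)"
    by (rule lborel_pair.Fubini'[symmetric]) measurable
  also have "\<dots> = (\<integral>\<^sup>+s. indicator {0..1::real} s * (ennreal (norm z powr p) * (\<integral>\<^sup>+x. ennreal (norm (g x) powr p) \<partial>lborel)) \<partial>lborel)"
  proof (rule nn_integral_cong)
    fix s :: real
    have "(\<integral>\<^sup>+x. ?F x s \<partial>lborel)
       = indicator {0..1::real} s * (\<integral>\<^sup>+x. ennreal ((norm z * norm (g (x + s *\<^sub>R z))) powr p) \<partial>lborel)"
      by (rule nn_integral_cmult) measurable
    also have "(\<integral>\<^sup>+x. ennreal ((norm z * norm (g (x + s *\<^sub>R z))) powr p) \<partial>lborel)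
       = (\<integral>\<^sup>+x. ennreal ((norm z * norm (g x)) powr p) \<partial>lborel)"
      by (rule nn_integral_translate[of "\<lambda>x. ennreal ((norm z * norm (g x)) powr p)"]) measurable
    also have "\<dots> = ennreal (norm z powr p) * (\<integral>\<^sup>+x. ennreal (norm (g x) powr p) \<partial>lborel)"
      by (subst nn_integral_cmult[symmetric]) (auto simp: powr_mult ennreal_mult)
    finally show "(\<integral>\<^sup>+x. ?F x s \<partial>lborel)
      = indicator {0..1::real} s * (ennreal (norm z powr p) * (\<integral>\<^sup>+x. ennreal (norm (g x) powr p) \<partial>lborel))" .
  qed
  also have "\<dots> = ennreal (norm z powr p) * (\<integral>\<^sup>+x. ennreal (norm (g x) powr p) \<partial>lborel)"
    by (subst nn_integral_multc) simp_all
  finally show ?thesis .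
qed

section \<open>Truncation between two levels and the level estimate\<close>

text \<open>Building block of the C^1 cutoffs \<open>sigm\<close> and \<open>C1c_bump\<close>; only
  the kink at 0 needs the difference quotient itself.\<close>

lemma has_derivative_max0_square:
  "((\<lambda>y::real. (max 0 y)\<^sup>2) has_real_derivative 2 * max 0 y) (at y)"
proof (cases y "0::real" rule: linorder_cases)
  case less
  have "((\<lambda>y::real. (max 0 y)\<^sup>2) has_real_derivative 0) (at y)"
    by (rule has_field_derivative_transform_within_open[of "\<lambda>_. 0" _ _ "{..<0}"]) (use less in auto)
  then show ?thesis using less by simp
next
  case greater
  have "((\<lambda>y::real. (max 0 y)\<^sup>2) has_real_derivative 2 * y) (at y)"
    by (rule has_field_derivative_transform_within_open[of "\<lambda>y. y\<^sup>2" _ _ "{0<..}"])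
      (use greater in \<open>auto intro!: derivative_eq_intros\<close>)
  then show ?thesis using greater by simp
next
  case equal
  have "(\<lambda>h::real. ((max 0 h)\<^sup>2 - 0) / h) \<midarrow>0\<rightarrow> 0"
  proof (rule Lim_null_comparison)
    show "\<forall>\<^sub>F h in at 0. norm (((max 0 h)\<^sup>2 - 0) / h) \<le> \<bar>h::real\<bar>"
      by (intro always_eventually allI) (auto simp: max_def power2_eq_square)
    show "(\<lambda>h::real. \<bar>h\<bar>) \<midarrow>0\<rightarrow> 0" by (rule tendsto_rabs_zero) simp
  qed
  then show ?thesis using equal by (simp add: DERIV_def)
qed

text \<open>A piecewise quadratic C^1 step from 0 to 1, so that truncation keeps functions in C^1.\<close>

definition sigm :: "real \<Rightarrow> real" where
  "sigm y = 2 * ((max 0 y)\<^sup>2 - 2 * (max 0 (y - 1/2))\<^sup>2 + (max 0 (y - 1))\<^sup>2)"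

definition sigm' :: "real \<Rightarrow> real" where
  "sigm' y = 4 * (max 0 y - 2 * max 0 (y - 1/2) + max 0 (y - 1))"

lemma sigm_simps: "y \<le> 0 \<Longrightarrow> sigm y = 0" "1 \<le> y \<Longrightarrow> sigm y = 1"
  by (auto simp: sigm_def max_def power2_eq_square algebra_simps)

lemma sigm'_simps: "y \<le> 0 \<Longrightarrow> sigm' y = 0" "1 \<le> y \<Longrightarrow> sigm' y = 0" "0 \<le> sigm' y" "sigm' y \<le> 2"
  by (auto simp: sigm'_def max_def)

lemma sigm_deriv: "(sigm has_real_derivative sigm' y) (at y)"
proof -
  have a: "((\<lambda>y. (max 0 (y - c))\<^sup>2) has_real_derivative 2 * max 0 (y - c)) (at y)" for c
  proof -
    have "((\<lambda>y. (max 0 (y - c))\<^sup>2) has_real_derivative 2 * max 0 (y - c) * 1) (at y)"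
      by (rule DERIV_chain2[where f="\<lambda>y. (max 0 y)\<^sup>2" and g="\<lambda>y. y - c", OF has_derivative_max0_square])
        (auto intro!: derivative_eq_intros)
    then show ?thesis by simp
  qed
  show ?thesis unfolding sigm_def[abs_def] sigm'_def
    by (rule derivative_eq_intros has_derivative_max0_square a refl)+ simp
qed

text \<open>The step is evaluated at a function of s^2, so that no absolute value is differentiated.
  The normalisation is 3t^2 = (2t)^2 - t^2: the transition takes place exactly for t < |s| <
  2t.\<close>

definition trunc :: "real \<Rightarrow> real \<Rightarrow> real" where
  "trunc t s = t * sigm ((s\<^sup>2 - t\<^sup>2) / (3 * t\<^sup>2))"

definition trunc' :: "real \<Rightarrow> real \<Rightarrow> real" where
  "trunc' t s = t * (sigm' ((s\<^sup>2 - t\<^sup>2) / (3 * t\<^sup>2)) * (2 * s / (3 * t\<^sup>2)))"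

lemma trunc_deriv: "0 < t \<Longrightarrow> (trunc t has_real_derivative trunc' t s) (at s)"
  unfolding trunc_def[abs_def] trunc'_def
  by (rule derivative_eq_intros DERIV_chain2[OF sigm_deriv] refl | simp)+
    (simp add: field_simps power2_eq_square power4_eq_xxxx)

lemma trunc'_cont: "continuous_on UNIV (trunc' t)"
proof (cases "t = 0")
  case True then show ?thesis by (simp add: trunc'_def[abs_def])
next
  case False then show ?thesis unfolding trunc'_def[abs_def] sigm'_def
    by (auto intro!: continuous_intros)
qed

lemma trunc_simps:
  assumes "0 < t"
  shows "\<bar>s\<bar> \<le> t \<Longrightarrow> trunc t s = 0" "2 * t \<le> \<bar>s\<bar> \<Longrightarrow> trunc t s = t"
    "\<not> (t < \<bar>s\<bar> \<and> \<bar>s\<bar> < 2 * t) \<Longrightarrow> trunc' t s = 0" "\<bar>trunc' t s\<bar> \<le> 3"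
proof -
  have a: "(s\<^sup>2 - t\<^sup>2) / (3 * t\<^sup>2) \<le> 0" if "\<bar>s\<bar> \<le> t"
    using that assms by (intro divide_nonpos_nonneg) (auto simp: abs_le_square_iff[symmetric])
  have b: "1 \<le> (s\<^sup>2 - t\<^sup>2) / (3 * t\<^sup>2)" if "2 * t \<le> \<bar>s\<bar>"
  proof -
    have "(2 * t)\<^sup>2 \<le> s\<^sup>2" by (subst abs_le_square_iff[symmetric]) (use that assms in simp)
    then show ?thesis using assms by (simp add: power_mult_distrib)
  qed
  show "\<bar>s\<bar> \<le> t \<Longrightarrow> trunc t s = 0" "2 * t \<le> \<bar>s\<bar> \<Longrightarrow> trunc t s = t"
    using a b by (auto simp: trunc_def sigm_simps)
  show z: "\<not> (t < \<bar>s\<bar> \<and> \<bar>s\<bar> < 2 * t) \<Longrightarrow> trunc' t s = 0"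
    using a b by (auto simp: trunc'_def sigm'_simps not_less)
  show "\<bar>trunc' t s\<bar> \<le> 3"
  proof (cases "t < \<bar>s\<bar> \<and> \<bar>s\<bar> < 2 * t")
    case True
    have "\<bar>trunc' t s\<bar> = sigm' ((s\<^sup>2 - t\<^sup>2) / (3 * t\<^sup>2)) * (2 * \<bar>s\<bar> / (3 * t))"
      using assms by (simp add: trunc'_def abs_mult sigm'_simps power2_eq_square)
    \<comment> \<open>\<open>sigm'\<close> is at most 2, and 2|s|/(3t) is at most 4/3 in the
      transition zone; the resulting 8/3 is rounded up to 3.\<close>
    also have "\<dots> \<le> 2 * (4/3)"
      using True assms by (intro mult_mono sigm'_simps) (auto simp: field_simps)
    finally show ?thesis by simp
  qed (use z in auto)
qed

lemma C1c_measurable: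
  assumes "C1c \<Omega> f g"
  shows "f \<in> borel_measurable borel" "g \<in> borel_measurable borel"
  using C1cD(2,3)[OF assms] by (auto intro: borel_measurable_continuous_onI)

lemma C1c_level_finite:
  assumes "C1c \<Omega> f g" "0 < t"
  shows "emeasure lborel {x. t < \<bar>f x\<bar>} < \<infinity>" "emeasure lborel {x. t \<le> \<bar>f x\<bar>} < \<infinity>"
    "{x. t < \<bar>f x\<bar>} \<in> sets lborel"  "{x. t \<le> \<bar>f x\<bar>} \<in> sets lborel"
proof -
  have [measurable]: "f \<in> borel_measurable borel" using C1c_measurable[OF assms(1)] by simp
  show "{x. t < \<bar>f x\<bar>} \<in> sets lborel"  "{x. t \<le> \<bar>f x\<bar>} \<in> sets lborel" by measurable
  have "emeasure lborel (tsupp f) < \<infinity>" using C1cD(4)[OF assms(1)] by (rule emeasure_compact_finite)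
  moreover have "emeasure lborel {x. t < \<bar>f x\<bar>} \<le> emeasure lborel (tsupp f)"
    "emeasure lborel {x. t \<le> \<bar>f x\<bar>} \<le> emeasure lborel (tsupp f)"
    using assms(2) tsupp_vanish[of _ f] closed_tsupp[of f] by (force intro!: emeasure_mono)+
  ultimately show "emeasure lborel {x. t < \<bar>f x\<bar>} < \<infinity>" "emeasure lborel {x. t \<le> \<bar>f x\<bar>} < \<infinity>"
    by (auto intro: le_less_trans)
qed

lemma continuous_on_powr_nonneg:
  fixes f :: "'a::topological_space \<Rightarrow> real"
  shows "continuous_on S f \<Longrightarrow> (\<And>x. 0 \<le> f x) \<Longrightarrow> 0 < p \<Longrightarrow> continuous_on S (\<lambda>x. f x powr p)"
  by (intro continuous_on_powr' continuous_on_const) auto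

lemma C1c_powr_integrable:
  assumes "C1c \<Omega> f g" "0 < p"
  shows "integrable lborel (\<lambda>x. \<bar>f x\<bar> powr p)" "integrable lborel (\<lambda>x. norm (g x) powr p)"
proof -
  have "continuous_on UNIV (\<lambda>x. \<bar>f x\<bar> powr p)" "continuous_on UNIV (\<lambda>x. norm (g x) powr p)"
    using C1cD(2,3)[OF assms(1)] assms(2)
    by (intro continuous_on_powr_nonneg continuous_intros; simp)+
  then show "integrable lborel (\<lambda>x. \<bar>f x\<bar> powr p)" "integrable lborel (\<lambda>x. norm (g x) powr p)"
    using C1cD(4)[OF assms(1)] C1c_grad_vanish[OF assms(1)] tsupp_vanish[of _ f]
    by (auto intro!: continuous_cpt_integrable)
qed

text \<open>The set where |f| > t fills at most half of any ball of radius h, so the truncation of f between the levels t and 2t vanishes at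
  x + y for at least half of the vectors |y| < h; averaging the translation estimate over y then gives the bound.\<close>

lemma level_estimate:
  fixes f :: "'a::euclidean_space \<Rightarrow> real"
  assumes C: "C1c UNIV f g" and p: "1 \<le> p" and t: "0 < t" and h: "0 < h"
    and V: "2 * measure lborel {x. t < \<bar>f x\<bar>} \<le> measure lborel (ball (0::'a) h)"
  shows "t powr p * measure lborel {x. 2 * t \<le> \<bar>f x\<bar>}
    \<le> 2 * (3 * h) powr p * (\<integral>x. indicator {x. t < \<bar>f x\<bar> \<and> \<bar>f x\<bar> < 2 * t} x * norm (g x) powr p \<partial>lborel)"
proof -
  define E where "E = (\<integral>x. indicator {x. t < \<bar>f x\<bar> \<and> \<bar>f x\<bar> < 2 * t} x * norm (g x) powr p \<partial>lborel)"
  define \<phi> where "\<phi> = (\<lambda>x. trunc t (f x))"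
  define \<phi>' where "\<phi>' = (\<lambda>x. trunc' t (f x) *\<^sub>R g x)"
  define B where "B = ball (0::'a) h"
  define S where "S = {x. 2 * t \<le> \<bar>f x\<bar>}"
  note [measurable] = C1c_measurable[OF C]
  have C\<phi>: "C1c UNIV \<phi> \<phi>'"
    unfolding \<phi>_def \<phi>'_def using t
    by (intro C1c_comp[OF C] trunc_deriv trunc'_cont) (auto simp: trunc_simps)
  note [measurable] = C1c_measurable[OF C\<phi>]
  have mB: "emeasure lborel B = ennreal (measure lborel B)" and Bs: "B \<in> sets borel"
    unfolding B_def using emeasure_bounded_finite[of "ball (0::'a) h"]
    by (auto intro!: emeasure_eq_ennreal_measure)
  note [measurable] = Bs
  have mBp: "measure lborel B > 0" unfolding B_def using h by (rule content_ball_pos)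
  have intE: "integrable lborel (\<lambda>x. indicator {x. t < \<bar>f x\<bar> \<and> \<bar>f x\<bar> < 2 * t} x * norm (g x) powr p)"
    by (rule Bochner_Integration.integrable_bound[OF C1c_powr_integrable(2)[OF C, of p]])
      (use p in \<open>auto split: split_indicator\<close>)
  have E0: "0 \<le> E" unfolding E_def by simp
  \<comment> \<open>The gradient of the truncation lives on the shell t < |f| < 2t and is at most
    three times that of f there.\<close>
  have grad: "(\<integral>\<^sup>+x. ennreal (norm (\<phi>' x) powr p) \<partial>lborel) \<le> ennreal (3 powr p * E)"
  proof -
    have "(\<integral>\<^sup>+x. ennreal (norm (\<phi>' x) powr p) \<partial>lborel)
      \<le> (\<integral>\<^sup>+x. ennreal (3 powr p * (indicator {x. t < \<bar>f x\<bar> \<and> \<bar>f x\<bar> < 2 * t} x * norm (g x) powr p)) \<partial>lborel)"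
    proof (intro nn_integral_mono ennreal_leI)
      fix x
      show "norm (\<phi>' x) powr p \<le> 3 powr p * (indicator {x. t < \<bar>f x\<bar> \<and> \<bar>f x\<bar> < 2 * t} x * norm (g x) powr p)"
      proof (cases "t < \<bar>f x\<bar> \<and> \<bar>f x\<bar> < 2 * t")
        case True
        have "norm (\<phi>' x) powr p \<le> (3 * norm (g x)) powr p"
          using trunc_simps(4)[OF t, of "f x"] p unfolding \<phi>'_def
          by (intro powr_mono2) (auto intro: mult_right_mono)
        then show ?thesis using True by (simp add: powr_mult)
      next
        case False
        then have "\<phi>' x = 0" unfolding \<phi>'_def using trunc_simps(3)[OF t] by auto
        then show ?thesis by simp
      qed
    qed
    also have "\<dots> = ennreal (3 powr p * E)"
      unfolding E_def using intE
      by (subst nn_integral_eq_integral) (auto intro!: Bochner_Integration.integrable_mult_right)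
    finally show ?thesis .
  qed
  \<comment> \<open>The double integral of \<open>?F\<close> is estimated twice: from above by the
    translation estimate for each fixed z, from below by restricting x to \<open>S\<close>.
    Comparing the two gives the claim.\<close>
  let ?F = "\<lambda>x z. indicator B z * ennreal (\<bar>\<phi> (x + z) - \<phi> x\<bar> powr p)"
  have up: "(\<integral>\<^sup>+z. (\<integral>\<^sup>+x. ?F x z \<partial>lborel) \<partial>lborel) \<le> ennreal ((3 * h) powr p * E * measure lborel B)"
  proof -
    have "(\<integral>\<^sup>+x. ?F x z \<partial>lborel) \<le> ennreal ((3 * h) powr p * E) * indicator B z" for z
    proof (cases "z \<in> B")
      case True
      then have z: "norm z powr p \<le> h powr p" using p by (auto simp: B_def intro!: powr_mono2)
      have "(\<integral>\<^sup>+x. ?F x z \<partial>lborel) = (\<integral>\<^sup>+x. ennreal (\<bar>\<phi> (x + z) - \<phi> x\<bar> powr p) \<partial>lborel)"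
        using True by simp
      also have "\<dots> \<le> ennreal (norm z powr p) * (\<integral>\<^sup>+x. ennreal (norm (\<phi>' x) powr p) \<partial>lborel)"
        by (rule C1c_translate[OF C\<phi> p])
      also have "\<dots> \<le> ennreal (h powr p) * ennreal (3 powr p * E)"
        by (intro mult_mono grad ennreal_leI z) auto
      also have "\<dots> = ennreal ((3 * h) powr p * E)"
        using E0 h by (simp add: ennreal_mult[symmetric] powr_mult mult_ac)
      finally show ?thesis using True by simp
    qed simp
    then have "(\<integral>\<^sup>+z. (\<integral>\<^sup>+x. ?F x z \<partial>lborel) \<partial>lborel)
      \<le> (\<integral>\<^sup>+z. ennreal ((3 * h) powr p * E) * indicator B z \<partial>lborel)"
      by (rule nn_integral_mono)
    also have "\<dots> = ennreal ((3 * h) powr p * E) * emeasure lborel B"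
      by (rule nn_integral_cmult_indicator) simp
    finally show ?thesis using E0 by (simp add: mB ennreal_mult)
  qed
  have low: "ennreal (t powr p * (measure lborel B / 2)) * emeasure lborel S
      \<le> (\<integral>\<^sup>+x. (\<integral>\<^sup>+z. ?F x z \<partial>lborel) \<partial>lborel)"
  proof -
    have "ennreal (t powr p * (measure lborel B / 2)) * indicator S x \<le> (\<integral>\<^sup>+z. ?F x z \<partial>lborel)" for x
    proof (cases "x \<in> S")
      case True
      then have \<phi>x: "\<phi> x = t" using t by (auto simp: S_def \<phi>_def trunc_simps)
      \<comment> \<open>These z move x to a point where the truncation vanishes, while it equals t
        at x. By hypothesis \<open>V\<close> the excluded z fill at most half of the ball, so
        \<open>Q\<close> has at least half of its measure.\<close>
      define Q where "Q = {z \<in> B. \<bar>f (x + z)\<bar> \<le> t}"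
      have [measurable]: "Q \<in> sets borel"
        unfolding Q_def by measurable
      have tr: "emeasure lborel {z. t < \<bar>f (z + x)\<bar>} = emeasure lborel {z. t < \<bar>f z\<bar>}"
      proof -
        have "(\<integral>\<^sup>+z. indicator {z. t < \<bar>f z\<bar>} (z + x) \<partial>lborel) = (\<integral>\<^sup>+z. indicator {z. t < \<bar>f z\<bar>} z \<partial>lborel)"
          by (rule nn_integral_translate) measurable
        moreover have "(\<lambda>z. indicator {z. t < \<bar>f z\<bar>} (z + x) :: ennreal) = indicator {z. t < \<bar>f (z + x)\<bar>}"
          by (auto simp: indicator_def fun_eq_iff)
        ultimately show ?thesis by simp
      qed
      have "emeasure lborel B \<le> emeasure lborel (Q \<union> {z. t < \<bar>f (z + x)\<bar>})"
        by (intro emeasure_mono) (auto simp: Q_def add.commute)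
      also have "\<dots> \<le> emeasure lborel Q + emeasure lborel {z. t < \<bar>f (z + x)\<bar>}"
        by (intro emeasure_subadditive) auto
      also have "\<dots> = emeasure lborel Q + ennreal (measure lborel {z. t < \<bar>f z\<bar>})"
        unfolding tr using C1c_level_finite(1)[OF C t]
        by (subst emeasure_eq_ennreal_measure[of lborel "{z. t < \<bar>f z\<bar>}"]) (auto simp: less_top)
      also have "\<dots> \<le> emeasure lborel Q + ennreal (measure lborel B / 2)"
        using V unfolding B_def by (intro add_left_mono ennreal_leI) simp
      finally have q: "ennreal (measure lborel B) \<le> emeasure lborel Q + ennreal (measure lborel B / 2)"
        by (simp add: mB)
      have fin: "emeasure lborel Q \<noteq> top"
      proof -
        have "emeasure lborel Q \<le> emeasure lborel B" by (intro emeasure_mono) (auto simp: Q_def)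
        then show ?thesis using mB by (auto simp: top_unique)
      qed
      then have "emeasure lborel Q = ennreal (measure lborel Q)" by (rule emeasure_eq_ennreal_measure)
      with q have q': "ennreal (measure lborel B / 2) \<le> emeasure lborel Q"
        by (auto simp: ennreal_plus[symmetric] simp del: ennreal_plus)
      have "ennreal (t powr p * (measure lborel B / 2)) = ennreal (t powr p) * ennreal (measure lborel B / 2)"
        by (rule ennreal_mult) auto
      also have "\<dots> \<le> ennreal (t powr p) * emeasure lborel Q"
        by (intro mult_left_mono q') simp
      also have "\<dots> = (\<integral>\<^sup>+z. ennreal (t powr p) * indicator Q z \<partial>lborel)"
        by (rule nn_integral_cmult_indicator[symmetric]) simp
      also have "\<dots> \<le> (\<integral>\<^sup>+z. ?F x z \<partial>lborel)"
      proof (rule nn_integral_mono)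
        fix z
        show "ennreal (t powr p) * indicator Q z \<le> ?F x z"
        proof (cases "z \<in> Q")
          case True
          then have "\<phi> (x + z) = 0" "z \<in> B" using t by (auto simp: Q_def \<phi>_def trunc_simps)
          then show ?thesis using \<phi>x t by (simp split: split_indicator)
        qed simp
      qed
      finally show ?thesis using True by simp
    qed simp
    then have "(\<integral>\<^sup>+x. ennreal (t powr p * (measure lborel B / 2)) * indicator S x \<partial>lborel)
       \<le> (\<integral>\<^sup>+x. (\<integral>\<^sup>+z. ?F x z \<partial>lborel) \<partial>lborel)" by (rule nn_integral_mono)
    moreover have "S \<in> sets lborel" unfolding S_def using C1c_level_finite(4)[OF C, of "2*t"] t by simp
    ultimately show ?thesis by (subst (asm) nn_integral_cmult_indicator) auto
  qed
  have "(\<integral>\<^sup>+z. (\<integral>\<^sup>+x. ?F x z \<partial>lborel) \<partial>lborel) = (\<integral>\<^sup>+x. (\<integral>\<^sup>+z. ?F x z \<partial>lborel) \<partial>lborel)"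
    by (rule lborel_pair.Fubini') measurable
  with up low have "ennreal (t powr p * (measure lborel B / 2)) * emeasure lborel S
     \<le> ennreal ((3 * h) powr p * E * measure lborel B)" by simp
  moreover have "emeasure lborel S = ennreal (measure lborel S)"
    unfolding S_def using C1c_level_finite(2)[OF C, of "2*t"] t by (intro emeasure_eq_ennreal_measure) auto
  ultimately have "t powr p * (measure lborel B / 2) * measure lborel S \<le> (3 * h) powr p * E * measure lborel B"
    using E0 by (simp add: ennreal_mult[symmetric])
  then have "measure lborel B * (t powr p * measure lborel S) \<le> measure lborel B * (2 * (3 * h) powr p * E)"
    by (simp add: algebra_simps)
  then show ?thesis using mBp unfolding E_def S_def by simp
qed

text \<open>Optimises the radius in \<open>level_estimate\<close>: the smallest admissible ball has
  twice the measure of the level set, so h^p turns into a multiple of that measure to the power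
  p/N.\<close>

lemma level_estimate_measure:
  assumes p: "1 \<le> p"
  shows "\<exists>K>0. \<forall>f g t. C1c (UNIV::'a::euclidean_space set) f g \<longrightarrow> 0 < t \<longrightarrow>
    t powr p * measure lborel {x. 2 * t \<le> \<bar>f x\<bar>} \<le> K * measure lborel {x. t < \<bar>f x\<bar>} powr (p / DIM('a))
      * (\<integral>x. indicator {x. t < \<bar>f x\<bar> \<and> \<bar>f x\<bar> < 2 * t} x * norm (g x) powr p \<partial>lborel)"
proof -
  define c where "c = measure lborel (ball (0::'a) 1)"
  define N where "N = real DIM('a)"
  have N: "N > 0" unfolding N_def by simp
  have c: "c > 0" unfolding c_def by (rule content_ball_pos) simp
  define K where "K = 2 * 3 powr p * (2 / c) powr (p / N)"
  have "K > 0" unfolding K_def using c by simp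
  moreover have "t powr p * measure lborel {x. 2 * t \<le> \<bar>f x\<bar>} \<le> K * measure lborel {x. t < \<bar>f x\<bar>} powr (p / N)
      * (\<integral>x. indicator {x. t < \<bar>f x\<bar> \<and> \<bar>f x\<bar> < 2 * t} x * norm (g x) powr p \<partial>lborel)" (is "_ \<le> K * ?V powr _ * ?E")
    if C: "C1c (UNIV::'a set) f g" and t: "0 < t" for f g t
  proof (cases "?V = 0")
    case True
    have "measure lborel {x. 2 * t \<le> \<bar>f x\<bar>} \<le> ?V"
      using C1c_level_finite(1,3)[OF C, of t] C1c_level_finite(2,4)[OF C, of "2*t"] t
      by (intro measure_mono_fmeasurable) (auto simp: fmeasurable_def)
    then show ?thesis using True by (simp add: measure_le_0_iff)
  next
    case False
    then have V: "?V > 0" using zero_less_measure_iff by blast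
    \<comment> \<open>Solves c h^N = 2V, where c is the volume of the unit ball.\<close>
    define h where "h = (2 * ?V / c) powr (1 / N)"
    have h: "h > 0" unfolding h_def using V c by simp
    have "measure lborel (ball (0::'a) h) = h ^ DIM('a) * c"
      unfolding c_def using h by (subst content_ball_conv_unit_ball) simp_all
    also have "h ^ DIM('a) = h powr N" unfolding N_def using h by (rule powr_realpow[symmetric])
    also have "\<dots> = 2 * ?V / c" unfolding h_def using N V c by (simp add: powr_powr)
    finally have "2 * ?V \<le> measure lborel (ball (0::'a) h)" using c by simp
    from level_estimate[OF C p t h this]
    have "t powr p * measure lborel {x. 2 * t \<le> \<bar>f x\<bar>} \<le> 2 * (3 * h) powr p * ?E" .
    also have "2 * (3 * h) powr p = K * ?V powr (p / N)"
    proof -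
      have "h powr p = (2 / c * ?V) powr (p / N)" unfolding h_def by (simp add: powr_powr)
      also have "\<dots> = (2 / c) powr (p / N) * ?V powr (p / N)" by (rule powr_mult)
      finally show ?thesis by (simp add: K_def powr_mult)
    qed
    finally show ?thesis .
  qed
  ultimately show ?thesis unfolding N_def by (intro exI[of _ K]) simp
qed

text \<open>With A i the contribution of the i-th dyadic level to the critical integral and E i the gradient energy of that level, the bound
  is independent of n; the self-improvement comes from \<theta> < 1.\<close>

lemma sum_recursive_bound:
  fixes A E :: "nat \<Rightarrow> real"
  assumes A: "\<And>i. 0 \<le> A i" and E: "\<And>i. 0 \<le> E i" and \<theta>: "0 < \<theta>" "\<theta> < 1" and K: "0 < K"
    and rec: "\<And>i. A (Suc i) \<le> K * A i powr \<theta> * E i" and X: "(\<Sum>i<n. E i) \<le> X"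
  shows "(\<Sum>i\<le>n. A i) \<le> 2 * A 0 + (2 * K * X) powr (1 / (1 - \<theta>))"
proof -
  define B where "B = (\<Sum>i\<le>n. A i)"
  have B0: "0 \<le> B" unfolding B_def by (intro sum_nonneg A)
  have X0: "0 \<le> X" using X E by (meson order_trans sum_nonneg)
  have AB: "A i \<le> B" if "i \<le> n" for i unfolding B_def using that A by (intro member_le_sum) auto
  have "B = A 0 + (\<Sum>i<n. A (Suc i))"
    unfolding B_def by (simp add: sum.atMost_shift)
  also have "(\<Sum>i<n. A (Suc i)) \<le> (\<Sum>i<n. K * B powr \<theta> * E i)"
  proof (rule sum_mono)
    fix i assume "i \<in> {..<n}"
    then have "K * A i powr \<theta> * E i \<le> K * B powr \<theta> * E i"
      using A E \<theta> K AB[of i] by (intro mult_right_mono mult_left_mono powr_mono2) auto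
    with rec[of i] show "A (Suc i) \<le> K * B powr \<theta> * E i" by linarith
  qed
  also have "\<dots> = K * B powr \<theta> * (\<Sum>i<n. E i)" by (simp add: sum_distrib_left)
  also have "\<dots> \<le> K * B powr \<theta> * X" using K by (intro mult_left_mono X) auto
  finally have main: "B \<le> A 0 + K * B powr \<theta> * X" by simp
  show ?thesis
  \<comment> \<open>Either the lowest level carries half of the sum, or it is absorbed on the left;
    in the second case B is bounded by a multiple of its power \<theta> < 1, which can be solved for
    B.\<close>
  proof (cases "A 0 \<ge> B / 2")
    case True
    have "0 \<le> (2 * K * X) powr (1 / (1 - \<theta>))" by simp
    with True show ?thesis unfolding B_def[symmetric] by linarith
  next
    case False
    then have Bp: "B > 0" using A[of 0] by linarith
    have "B \<le> 2 * K * X * B powr \<theta>" using main False by (simp add: algebra_simps)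
    then have "B powr (1 - \<theta>) \<le> 2 * K * X"
      using Bp by (simp add: powr_diff field_simps)
    then have "(B powr (1 - \<theta>)) powr (1 / (1 - \<theta>)) \<le> (2 * K * X) powr (1 / (1 - \<theta>))"
      using \<theta> by (intro powr_mono2) auto
    then have "B \<le> (2 * K * X) powr (1 / (1 - \<theta>))" using \<theta> Bp by (simp add: powr_powr)
    then show ?thesis unfolding B_def[symmetric] using A[of 0] by linarith
  qed
qed

lemma dyadic_level_exists:
  fixes y e :: real
  assumes "e < y" "y \<le> e * 2 ^ Suc n"
  shows "\<exists>i\<le>n. e * 2 ^ i < y \<and> y \<le> e * 2 ^ Suc i"
  using assms
proof (induction n)
  case 0 then show ?case by auto
next
  case (Suc n)
  then show ?case by (cases "y \<le> e * 2 ^ Suc n") (auto intro: le_SucI)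
qed

text \<open>On dyadic levels t_i the quantities t_i^r |{|f| > t_i}| satisfy the recursion of
  \<open>sum_recursive_bound\<close>, and the shell energies add up to at most the full gradient
  energy because the shells are disjoint.\<close>

lemma sobolev:
  fixes p :: real
  assumes p: "1 \<le> p" "p < DIM('a)"
  defines "r \<equiv> crit_exp (real DIM('a)) p"
  shows "\<exists>S>0. \<forall>f g. C1c (UNIV::'a::euclidean_space set) f g \<longrightarrow>
    (\<integral>x. \<bar>f x\<bar> powr r \<partial>lborel) \<le> S * (\<integral>x. norm (g x) powr p \<partial>lborel) powr (r / p)"
proof -
  define N where "N = real DIM('a)"
  have N: "p < N" "0 < N" using p unfolding N_def by auto
  have r: "r = N * p / (N - p)" by (simp add: r_def crit_exp_def N_def)
  have rp: "0 < r" using N p unfolding r by simp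
  \<comment> \<open>Here the critical exponent enters: r - p = rp/N makes the powers of the level
    match in the recursion, and 1/(1 - p/N) = r/p is the homogeneity of the final bound.\<close>
  have expo: "r - p = r * (p / N)" using N p unfolding r by (simp add: field_simps)
  have expo2: "1 / (1 - p / N) = r / p" using N p unfolding r by (simp add: field_simps)
  obtain K where K: "K > 0" and lev: "\<And>f g t. C1c (UNIV::'a set) f g \<Longrightarrow> 0 < t \<Longrightarrow>
    t powr p * measure lborel {x. 2 * t \<le> \<bar>f x\<bar>} \<le> K * measure lborel {x. t < \<bar>f x\<bar>} powr (p / N)
      * (\<integral>x. indicator {x. t < \<bar>f x\<bar> \<and> \<bar>f x\<bar> < 2 * t} x * norm (g x) powr p \<partial>lborel)"
    using level_estimate_measure[OF p(1), where 'a='a] unfolding N_def by auto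
  define K' where "K' = 2 powr r * K"
  have K': "K' > 0" using K by (simp add: K'_def)
  define S where "S = 2 powr r * (2 * K') powr (r / p)"
  have S: "S > 0" unfolding S_def using K' by simp
  have "(\<integral>x. \<bar>f x\<bar> powr r \<partial>lborel) \<le> S * (\<integral>x. norm (g x) powr p \<partial>lborel) powr (r / p)"
    if C: "C1c (UNIV::'a set) f g" for f g
  proof -
    define X where "X = (\<integral>x. norm (g x) powr p \<partial>lborel)"
    define m where "m = measure lborel (tsupp f)"
    have X0: "0 \<le> X" unfolding X_def by simp
    note [measurable] = C1c_measurable[OF C]
    have ts[measurable]: "tsupp f \<in> sets borel" by (rule borel_closed[OF closed_tsupp])
    have tsf: "emeasure lborel (tsupp f) < \<infinity>" using C1cD(4)[OF C] by (rule emeasure_compact_finite)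
    obtain M where M: "M > 0" "\<And>x. norm (f x) \<le> M"
      using continuous_cpt_bounded[OF C1cD(3,4)[OF C]] tsupp_vanish[of _ f] by metis
    \<comment> \<open>The levels start at an arbitrary e > 0; values of |f| below e cost at most e^r
      times the measure of the support.\<close>
    have bound: "(\<integral>x. \<bar>f x\<bar> powr r \<partial>lborel) \<le> e powr r * ((1 + 2 * 2 powr r) * m) + S * X powr (r / p)"
      if e: "0 < e" for e
    proof -
      define t where "t = (\<lambda>i::nat. e * 2 ^ i)"
      have t: "t i > 0" "t (Suc i) = 2 * t i" for i using e by (auto simp: t_def)
      define V where "V = (\<lambda>i. measure lborel {x. t i < \<bar>f x\<bar>})"
      define A where "A = (\<lambda>i. t i powr r * V i)"
      define E where "E = (\<lambda>i. \<integral>x. indicator {x. t i < \<bar>f x\<bar> \<and> \<bar>f x\<bar> < 2 * t i} x * norm (g x) powr p \<partial>lborel)"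
      have V0: "0 \<le> V i" for i by (simp add: V_def)
      have rec: "A (Suc i) \<le> K' * A i powr (p / N) * E i" for i
      proof -
        have "V (Suc i) \<le> measure lborel {x. 2 * t i \<le> \<bar>f x\<bar>}"
          unfolding V_def using C1c_level_finite(1,3)[OF C, of "2 * t i"] C1c_level_finite(2,4)[OF C, of "2 * t i"] t(1)[of i]
          by (intro measure_mono_fmeasurable) (auto simp: fmeasurable_def t)
        then have "A (Suc i) \<le> (2 * t i) powr r * measure lborel {x. 2 * t i \<le> \<bar>f x\<bar>}"
          unfolding A_def t(2) by (intro mult_left_mono) auto
        also have "(2 * t i) powr r = 2 powr r * (t i powr (r - p) * t i powr p)"
          using t(1)[of i] by (simp add: powr_mult powr_add[symmetric])
        also have "\<dots> * measure lborel {x. 2 * t i \<le> \<bar>f x\<bar>}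
          = 2 powr r * t i powr (r - p) * (t i powr p * measure lborel {x. 2 * t i \<le> \<bar>f x\<bar>})"
          by simp
        also have "\<dots> \<le> 2 powr r * t i powr (r - p) * (K * V i powr (p / N) * E i)"
          unfolding V_def E_def using lev[OF C t(1)[of i]] by (intro mult_left_mono) auto
        also have "\<dots> = K' * A i powr (p / N) * E i"
          unfolding A_def K'_def expo using V0[of i] by (simp add: powr_mult powr_powr)
        finally show ?thesis .
      qed
      obtain n where n: "M \<le> e * 2 ^ Suc n"
      proof -
        obtain k where "M / e < 2 ^ k" using real_arch_pow[of 2 "M / e"] by auto
        also have "(2::real) ^ k \<le> 2 ^ Suc k" by simp
        finally show ?thesis using that[of k] e by (simp add: field_simps)
      qed
      have "(\<Sum>i<n. E i) = (\<integral>x. (\<Sum>i<n. indicator {x. t i < \<bar>f x\<bar> \<and> \<bar>f x\<bar> < 2 * t i} x * norm (g x) powr p) \<partial>lborel)"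
        unfolding E_def
      proof (rule Bochner_Integration.integral_sum[symmetric])
        show "integrable lborel (\<lambda>x. indicator {x. t i < \<bar>f x\<bar> \<and> \<bar>f x\<bar> < 2 * t i} x * norm (g x) powr p)" for i
          by (rule Bochner_Integration.integrable_bound[OF C1c_powr_integrable(2)[OF C, of p]])
            (use p in \<open>auto split: split_indicator\<close>)
      qed
      also have "\<dots> \<le> X" unfolding X_def
      proof (rule integral_mono')
        show "integrable lborel (\<lambda>x. norm (g x) powr p)" using C1c_powr_integrable(2)[OF C, of p] p by simp
        fix x
        \<comment> \<open>Each point lies in at most one shell.\<close>
        have "(\<Sum>i<n. indicator {x. t i < \<bar>f x\<bar> \<and> \<bar>f x\<bar> < 2 * t i} x :: real) \<le> 1"
        proof (cases "\<exists>j<n. t j < \<bar>f x\<bar> \<and> \<bar>f x\<bar> < 2 * t j")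
          case True
          then obtain j where j: "j < n" "t j < \<bar>f x\<bar>" "\<bar>f x\<bar> < 2 * t j" by auto
          have "\<not> (t i < \<bar>f x\<bar> \<and> \<bar>f x\<bar> < 2 * t i)" if "i \<noteq> j" for i
          proof
            assume i: "t i < \<bar>f x\<bar> \<and> \<bar>f x\<bar> < 2 * t i"
            have mon: "t (Suc k) \<le> t l" if "k < l" for k l
              unfolding t_def using that e by (intro mult_left_mono power_increasing) auto
            from \<open>i \<noteq> j\<close> consider "i < j" | "j < i" by linarith
            then show False
              using i j mon[of i j] mon[of j i] t(2)[of i] t(2)[of j] by cases auto
          qed
          then have "(\<Sum>i<n. indicator {x. t i < \<bar>f x\<bar> \<and> \<bar>f x\<bar> < 2 * t i} x :: real)
             = (\<Sum>i\<in>{j}. indicator {x. t i < \<bar>f x\<bar> \<and> \<bar>f x\<bar> < 2 * t i} x)"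
            using j by (intro sum.mono_neutral_right) auto
          then show ?thesis by simp
        next
          case False
          then have "(\<Sum>i<n. indicator {x. t i < \<bar>f x\<bar> \<and> \<bar>f x\<bar> < 2 * t i} x :: real) = 0"
            by (intro sum.neutral) auto
          then show ?thesis by simp
        qed
        then show "(\<Sum>i<n. indicator {x. t i < \<bar>f x\<bar> \<and> \<bar>f x\<bar> < 2 * t i} x * norm (g x) powr p) \<le> norm (g x) powr p"
          unfolding sum_distrib_right[symmetric] by (simp add: mult_left_le_one_le sum_nonneg)
      qed simp
      finally have SE: "(\<Sum>i<n. E i) \<le> X" .
      have A0: "A 0 \<le> e powr r * m"
        unfolding A_def V_def m_def t_def
        using C1c_level_finite(1,3)[OF C, of e] e tsf ts tsupp_vanish[of _ f]
        by (force intro!: mult_left_mono measure_mono_fmeasurable simp: fmeasurable_def)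
      have "(\<Sum>i\<le>n. A i) \<le> 2 * A 0 + (2 * K' * X) powr (1 / (1 - p / N))"
        using p N by (intro sum_recursive_bound[OF _ _ _ _ K' rec SE]) (auto simp: A_def V0 E_def)
      also have "\<dots> \<le> 2 * (e powr r * m) + (2 * K') powr (r / p) * X powr (r / p)"
        unfolding expo2 using A0 by (simp add: powr_mult)
      finally have SA: "(\<Sum>i\<le>n. A i) \<le> 2 * (e powr r * m) + (2 * K') powr (r / p) * X powr (r / p)" .
      have intT: "integrable lborel (\<lambda>x. e powr r * indicator (tsupp f) x)"
        using tsf by (intro Bochner_Integration.integrable_mult_right integrable_real_indicator) auto
      have intV: "integrable lborel (\<lambda>x. 2 powr r * (t i powr r * indicator {x. t i < \<bar>f x\<bar>} x))" for i
        using C1c_level_finite(1,3)[OF C t(1)[of i]]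
        by (intro Bochner_Integration.integrable_mult_right integrable_real_indicator) auto
      \<comment> \<open>Pointwise layer bound: a value above e lies in some dyadic interval from t_i
        to 2 t_i and is charged to the level t_i at the price 2^r.\<close>
      have "(\<integral>x. \<bar>f x\<bar> powr r \<partial>lborel)
        \<le> (\<integral>x. e powr r * indicator (tsupp f) x + (\<Sum>i\<le>n. 2 powr r * (t i powr r * indicator {x. t i < \<bar>f x\<bar>} x)) \<partial>lborel)"
      proof (rule integral_mono')
        show "integrable lborel (\<lambda>x. e powr r * indicator (tsupp f) x + (\<Sum>i\<le>n. 2 powr r * (t i powr r * indicator {x. t i < \<bar>f x\<bar>} x)))"
          by (intro Bochner_Integration.integrable_add Bochner_Integration.integrable_sum intT intV)
        fix x
        have s0: "0 \<le> (\<Sum>i\<le>n. 2 powr r * (t i powr r * indicator {x. t i < \<bar>f x\<bar>} x))"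
          by (intro sum_nonneg) auto
        consider "x \<notin> tsupp f" | "x \<in> tsupp f" "\<bar>f x\<bar> \<le> e" | "e < \<bar>f x\<bar>" by linarith
        then show "\<bar>f x\<bar> powr r \<le> e powr r * indicator (tsupp f) x + (\<Sum>i\<le>n. 2 powr r * (t i powr r * indicator {x. t i < \<bar>f x\<bar>} x))"
        proof cases
          case 1 then show ?thesis using s0 tsupp_vanish[of x f] by simp
        next
          case 2
          then have "\<bar>f x\<bar> powr r \<le> e powr r" using rp by (intro powr_mono2) auto
          then show ?thesis using s0 2 by simp
        next
          case 3
          have "\<bar>f x\<bar> \<le> e * 2 ^ Suc n" using M(2)[of x] n by simp
          from dyadic_level_exists[OF 3 this] obtain i where i: "i \<le> n" "t i < \<bar>f x\<bar>" "\<bar>f x\<bar> \<le> 2 * t i"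
            unfolding t_def by auto
          have "\<bar>f x\<bar> powr r \<le> (2 * t i) powr r" using i rp by (intro powr_mono2) auto
          also have "\<dots> = 2 powr r * (t i powr r * indicator {x. t i < \<bar>f x\<bar>} x)" using i by (simp add: powr_mult)
          also have "\<dots> \<le> (\<Sum>i\<le>n. 2 powr r * (t i powr r * indicator {x. t i < \<bar>f x\<bar>} x))"
            using i by (intro member_le_sum) auto
          finally show ?thesis by (simp add: add_increasing)
        qed
      qed (auto intro!: add_nonneg_nonneg sum_nonneg)
      also have "\<dots> = e powr r * m + 2 powr r * (\<Sum>i\<le>n. A i)"
        using intT intV C1c_level_finite(3)[OF C t(1)]
        by (subst Bochner_Integration.integral_add)
          (auto simp: Bochner_Integration.integral_sum A_def V_def m_def sum_distrib_left)
      also have "\<dots> \<le> e powr r * m + 2 powr r * (2 * (e powr r * m) + (2 * K') powr (r / p) * X powr (r / p))"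
        using SA by (intro add_left_mono mult_left_mono) auto
      finally show ?thesis by (simp add: S_def algebra_simps)
    qed
    \<comment> \<open>Letting e tend to 0 removes the contribution of the support's measure, so the
      constant does not depend on f.\<close>
    have "((\<lambda>e. e powr r * ((1 + 2 * 2 powr r) * m) + S * X powr (r / p)) \<longlongrightarrow> 0 * ((1 + 2 * 2 powr r) * m) + S * X powr (r / p)) (at_right 0)"
    proof (intro tendsto_intros)
      have "((\<lambda>e::real. e powr r) \<longlongrightarrow> 0 powr r) (at_right 0)"
        using rp by (intro tendsto_powr' tendsto_intros) (auto simp: eventually_at_right_less eventually_at_filter)
      then show "((\<lambda>e::real. e powr r) \<longlongrightarrow> 0) (at_right 0)" by simp
    qed
    moreover have "\<forall>\<^sub>F e in at_right 0. (\<integral>x. \<bar>f x\<bar> powr r \<partial>lborel) \<le> e powr r * ((1 + 2 * 2 powr r) * m) + S * X powr (r / p)"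
      using bound eventually_at_right_less[of "0::real"] by (auto elim!: eventually_mono)
    ultimately have "(\<integral>x. \<bar>f x\<bar> powr r \<partial>lborel) \<le> 0 * ((1 + 2 * 2 powr r) * m) + S * X powr (r / p)"
      by (rule tendsto_lowerbound) simp
    then show ?thesis by (simp add: X_def)
  qed
  with S show ?thesis by blast
qed

section \<open>Rellich compactness\<close>

text \<open>The argument of Riesz and Fischer: along a fast subsequence the L^1 norms of the
  increments are summable, so the telescoping series converges absolutely almost everywhere.\<close>

lemma L1_Cauchy_AE_subseq:
  fixes f :: "nat \<Rightarrow> 'a \<Rightarrow> 'b::{banach, second_countable_topology}"
  assumes meas[measurable]: "\<And>k. f k \<in> borel_measurable M"
    and cau: "\<And>e::real. 0 < e \<Longrightarrow> \<exists>n. \<forall>j\<ge>n. \<forall>k\<ge>n. (\<integral>\<^sup>+x. norm (f j x - f k x) \<partial>M) \<le> ennreal e"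
  shows "\<exists>s::nat\<Rightarrow>nat. strict_mono s \<and> (AE x in M. convergent (\<lambda>i. f (s i) x))"
proof -
  have "\<forall>i. \<exists>n. \<forall>j\<ge>n. \<forall>k\<ge>n. (\<integral>\<^sup>+x. norm (f j x - f k x) \<partial>M) \<le> ennreal ((1/2) ^ i)"
    by (intro allI cau) simp
  then obtain N where N: "\<And>i j k. N i \<le> j \<Longrightarrow> N i \<le> k \<Longrightarrow> (\<integral>\<^sup>+x. norm (f j x - f k x) \<partial>M) \<le> ennreal ((1/2) ^ i)"
    by metis
  \<comment> \<open>The maximum with \<open>Suc m\<close> forces strict growth while
    \<open>s i\<close> stays beyond \<open>N i\<close>.\<close>
  define s where "s = rec_nat (N 0) (\<lambda>i m. max (N (Suc i)) (Suc m))"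
  have s: "s 0 = N 0" "s (Suc i) = max (N (Suc i)) (Suc (s i))" for i by (simp_all add: s_def)
  have mono: "strict_mono s" unfolding strict_mono_Suc_iff by (simp add: s max_def)
  have Ns: "N i \<le> s i" for i by (cases i) (simp_all add: s)
  have "(\<integral>\<^sup>+x. (\<Sum>i. ennreal (norm (f (s (Suc i)) x - f (s i) x))) \<partial>M)
    = (\<Sum>i. \<integral>\<^sup>+x. norm (f (s (Suc i)) x - f (s i) x) \<partial>M)"
    by (rule nn_integral_suminf) measurable
  also have "\<dots> \<le> (\<Sum>i. ennreal ((1/2) ^ i))"
  proof (rule suminf_le)
    fix i
    have "N i \<le> s (Suc i)" using Ns[of i] s(2)[of i] by simp
    then show "(\<integral>\<^sup>+x. norm (f (s (Suc i)) x - f (s i) x) \<partial>M) \<le> ennreal ((1/2) ^ i)"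
      by (rule N[OF _ Ns])
  qed auto
  also have "\<dots> = ennreal (\<Sum>i. (1/2) ^ i)"
    by (rule suminf_ennreal2) (auto intro: summable_geometric)
  also have "\<dots> < \<infinity>" by simp
  finally have "(\<integral>\<^sup>+x. (\<Sum>i. ennreal (norm (f (s (Suc i)) x - f (s i) x))) \<partial>M) \<noteq> \<infinity>" by simp
  then have "AE x in M. (\<Sum>i. ennreal (norm (f (s (Suc i)) x - f (s i) x))) \<noteq> \<infinity>"
    by (intro nn_integral_noteq_infinite) measurable
  then have "AE x in M. convergent (\<lambda>i. f (s i) x)"
  proof eventually_elim
    case (elim x)
    then have "summable (\<lambda>i. norm (f (s (Suc i)) x - f (s i) x))"
      by (intro summable_suminf_not_top) auto
    then have "summable (\<lambda>i. f (s (Suc i)) x - f (s i) x)" by (rule summable_norm_cancel)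
    then have "(\<lambda>n. f (s 0) x + (\<Sum>i<n. f (s (Suc i)) x - f (s i) x)) \<longlonglongrightarrow> f (s 0) x + (\<Sum>i. f (s (Suc i)) x - f (s i) x)"
      by (intro tendsto_intros summable_LIMSEQ)
    moreover have "(\<Sum>i<n. f (s (Suc i)) x - f (s i) x) = f (s n) x - f (s 0) x" for n
      by (rule sum_lessThan_telescope)
    ultimately show ?case unfolding convergent_def by auto
  qed
  with mono show ?thesis by blast
qed

section \<open>Averages against a Lipschitz cone and their compactness\<close>

text \<open>An unnormalised cone kernel of radius 1/(n+1). Values in [0,1] and Lipschitz constant
  n+1 are what make the averages of an L^1-bounded family equibounded and equicontinuous.\<close>

definition tent :: "nat \<Rightarrow> 'a::euclidean_space \<Rightarrow> real" where
  "tent n w = max 0 (1 - real (Suc n) * norm w)"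

lemma tent_props:
  shows "0 \<le> tent n w" "tent n w \<le> 1" "continuous_on S (tent n)"
    "1 / real (Suc n) \<le> norm w \<Longrightarrow> tent n w = 0"
    "\<bar>tent n w - tent n w'\<bar> \<le> real (Suc n) * norm (w - w')"
proof -
  show "continuous_on S (tent n)" unfolding tent_def[abs_def] by (intro continuous_intros)
  show "1 / real (Suc n) \<le> norm w \<Longrightarrow> tent n w = 0"
    by (simp add: tent_def pos_divide_le_eq mult.commute del: of_nat_Suc)
  have "\<bar>norm w - norm w'\<bar> \<le> norm (w - w')" by (rule norm_triangle_ineq3)
  then have "real (Suc n) * \<bar>norm w - norm w'\<bar> \<le> real (Suc n) * norm (w - w')"
    by (intro mult_left_mono) auto
  moreover have "\<bar>tent n w - tent n w'\<bar> \<le> \<bar>real (Suc n) * norm w - real (Suc n) * norm w'\<bar>"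
    unfolding tent_def by (auto simp: max_def)
  moreover have "\<bar>real (Suc n) * norm w - real (Suc n) * norm w'\<bar> = real (Suc n) * \<bar>norm w - norm w'\<bar>"
    by (simp add: right_diff_distrib[symmetric] abs_mult del: of_nat_Suc)
  ultimately show "\<bar>tent n w - tent n w'\<bar> \<le> real (Suc n) * norm (w - w')"
    by linarith
  show "0 \<le> tent n w" "tent n w \<le> 1" by (simp_all add: tent_def del: of_nat_Suc)
qed

lemma tent_integral:
  shows "integrable lborel (tent n :: 'a::euclidean_space \<Rightarrow> real)"
    "0 < (\<integral>w. tent n (w::'a) \<partial>lborel)"
proof -
  show i: "integrable lborel (tent n :: 'a \<Rightarrow> real)"
  proof (rule continuous_cpt_integrable[of _ "cball 0 1"])
    fix x :: 'a assume "x \<notin> cball 0 1"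
    then have "1 < norm x" by simp
    moreover have "1 / real (Suc n) \<le> 1" by (simp add: divide_le_eq)
    ultimately have "1 / real (Suc n) \<le> norm x" by linarith
    then show "tent n x = 0" by (rule tent_props(4))
  qed (auto intro: tent_props)
  \<comment> \<open>On the ball of half the radius the cone is at least 1/2, so its integral is
    positive.\<close>
  define B where "B = ball (0::'a) (1 / (2 * real (Suc n)))"
  have "0 < 1/2 * measure lborel B" unfolding B_def by (simp add: content_ball_pos)
  also have "\<dots> = (\<integral>w. 1/2 * indicator B (w::'a) \<partial>lborel)" by simp
  also have "\<dots> \<le> (\<integral>w. tent n (w::'a) \<partial>lborel)"
  proof (rule integral_mono'[OF i])
    show "1/2 * indicator B w \<le> tent n w" for w
      by (auto simp: tent_def B_def field_simps split: split_indicator)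
  qed (rule tent_props)
  finally show "0 < (\<integral>w. tent n (w::'a) \<partial>lborel)" .
qed

definition tavg :: "nat \<Rightarrow> ('a::euclidean_space \<Rightarrow> real) \<Rightarrow> 'a \<Rightarrow> real" where
  "tavg n f x = (\<integral>y. tent n (y - x) * f y \<partial>lborel)"

lemma tavg_integrable:
  assumes "integrable lborel f"
  shows "integrable lborel (\<lambda>y. tent n (y - x) * f y)"
proof (rule Bochner_Integration.integrable_bound[OF assms])
  have [measurable]: "tent n \<in> borel_measurable borel"
    by (intro borel_measurable_continuous_onI tent_props)
  show "(\<lambda>y. tent n (y - x) * f y) \<in> borel_measurable lborel" using assms by measurable
  show "AE y in lborel. norm (tent n (y - x) * f y) \<le> norm (f y)"
    using tent_props(1,2)[of n "y - x" for y] by (auto simp: abs_mult intro!: mult_left_le_one_le)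
qed

text \<open>For fixed n both bounds involve f only through its L^1 norm; these are the two
  ingredients of an Arzela-Ascoli argument.\<close>

lemma tavg_bounds:
  assumes f: "integrable lborel f"
  shows "\<bar>tavg n f x\<bar> \<le> (\<integral>y. \<bar>f y\<bar> \<partial>lborel)"
    "\<bar>tavg n f x - tavg n f x'\<bar> \<le> real (Suc n) * norm (x - x') * (\<integral>y. \<bar>f y\<bar> \<partial>lborel)"
proof -
  have "\<bar>tavg n f x\<bar> \<le> (\<integral>y. \<bar>tent n (y - x) * f y\<bar> \<partial>lborel)"
    unfolding tavg_def using integral_norm_bound[of lborel "\<lambda>y. tent n (y - x) * f y"] by simp
  also have "\<dots> \<le> (\<integral>y. \<bar>f y\<bar> \<partial>lborel)"
    using f tent_props(1,2)[of n "y - x" for y]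
    by (intro integral_mono') (auto simp: abs_mult intro!: mult_left_le_one_le)
  finally show "\<bar>tavg n f x\<bar> \<le> (\<integral>y. \<bar>f y\<bar> \<partial>lborel)" .
  have "\<bar>tavg n f x - tavg n f x'\<bar> = \<bar>\<integral>y. tent n (y - x) * f y - tent n (y - x') * f y \<partial>lborel\<bar>"
    unfolding tavg_def by (simp add: tavg_integrable[OF f])
  also have "\<dots> \<le> (\<integral>y. \<bar>tent n (y - x) * f y - tent n (y - x') * f y\<bar> \<partial>lborel)"
    using integral_norm_bound[of lborel "\<lambda>y. tent n (y - x) * f y - tent n (y - x') * f y"] by simp
  also have "\<dots> \<le> (\<integral>y. real (Suc n) * norm (x - x') * \<bar>f y\<bar> \<partial>lborel)"
  proof (rule integral_mono')
    fix y
    show "\<bar>tent n (y - x) * f y - tent n (y - x') * f y\<bar> \<le> real (Suc n) * norm (x - x') * \<bar>f y\<bar>"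
      unfolding left_diff_distrib[symmetric] abs_mult
      using tent_props(5)[of n "y - x" "y - x'"] by (intro mult_right_mono) (simp_all add: norm_minus_commute)
  qed (use f in auto)
  finally show "\<bar>tavg n f x - tavg n f x'\<bar> \<le> real (Suc n) * norm (x - x') * (\<integral>y. \<bar>f y\<bar> \<partial>lborel)"
    by simp
qed

lemma tavg_measurable:
  assumes f: "integrable lborel f"
  shows "tavg n f \<in> borel_measurable borel"
proof -
  define L where "L = real (Suc n) * (\<integral>y. \<bar>f y\<bar> \<partial>lborel)"
  have "L-lipschitz_on UNIV (tavg n f)"
    using tavg_bounds(2)[OF f, of n] unfolding L_def
    by (intro lipschitz_onI) (auto simp: dist_norm mult_ac)
  then show ?thesis
    by (intro borel_measurable_continuous_onI lipschitz_on_continuous_on)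
qed

text \<open>The normalised average is a mean of translates of f by vectors shorter than 1/(n+1), and
  each translate moves f in L^1 by at most its length times the L^1 norm of the gradient. The bound
  is uniform over gradient-bounded families.\<close>

lemma tavg_approx:
  fixes f :: "'a::euclidean_space \<Rightarrow> real" and n :: nat
  assumes C: "C1c UNIV f g"
  defines "c \<equiv> (\<integral>w. tent n (w::'a) \<partial>lborel)"
  shows "(\<integral>\<^sup>+x. ennreal \<bar>f x - tavg n f x / c\<bar> \<partial>lborel) \<le> ennreal ((\<integral>x. norm (g x) \<partial>lborel) / real (Suc n))"
proof -
  note [measurable] = C1c_measurable[OF C]
  have [measurable]: "tent n \<in> borel_measurable borel"
    by (intro borel_measurable_continuous_onI tent_props)
  have c: "c > 0" unfolding c_def by (rule tent_integral)
  have fi: "integrable lborel f"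
    using continuous_cpt_integrable[OF C1cD(3,4)[OF C]] tsupp_vanish[of _ f] by auto
  have gi: "integrable lborel g"
    using continuous_cpt_integrable[OF C1cD(2,4)[OF C]] C1c_grad_vanish[OF C] by auto
  define R where "R = (\<integral>x. norm (g x) \<partial>lborel)"
  have R0: "0 \<le> R" by (simp add: R_def)
  have tr: "integrable lborel (\<lambda>z. tent n z * f (x + z))" "tavg n f x = (\<integral>z. tent n z * f (x + z) \<partial>lborel)" for x
  proof -
    have d: "lborel = distr lborel borel ((+) x)" by (simp add: lborel_distr_plus)
    have "integrable (distr lborel borel ((+) x)) (\<lambda>y. tent n (y - x) * f y)"
      using tavg_integrable[OF fi] by (simp add: lborel_distr_plus)
    then show "integrable lborel (\<lambda>z. tent n z * f (x + z))"
      by (subst (asm) integrable_distr_eq) auto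
    have "tavg n f x = (\<integral>y. tent n (y - x) * f y \<partial>distr lborel borel ((+) x))"
      unfolding tavg_def by (simp add: lborel_distr_plus)
    also have "\<dots> = (\<integral>z. tent n z * f (x + z) \<partial>lborel)"
      by (subst integral_distr) auto
    finally show "tavg n f x = (\<integral>z. tent n z * f (x + z) \<partial>lborel)" .
  qed
  have pt: "ennreal \<bar>f x - tavg n f x / c\<bar> \<le> (\<integral>\<^sup>+z. ennreal (tent n z / c) * ennreal (\<bar>f (x + z) - f x\<bar> powr 1) \<partial>lborel)" for x
  proof -
    have i1: "integrable lborel (\<lambda>z. tent n z * (f (x + z) - f x) / c)"
      unfolding right_diff_distrib
      by (intro Bochner_Integration.integrable_divide Bochner_Integration.integrable_diff tr(1) integrable_mult_left tent_integral(1))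
    have "f x - tavg n f x / c = - (\<integral>z. tent n z * (f (x + z) - f x) / c \<partial>lborel)"
      unfolding right_diff_distrib tr(2)
      using c tr(1)[of x] tent_integral(1)[of n, where 'a='a]
      by (simp add: c_def[symmetric] diff_divide_distrib)
    then have "ennreal \<bar>f x - tavg n f x / c\<bar> = ennreal (norm (\<integral>z. tent n z * (f (x + z) - f x) / c \<partial>lborel))"
      by simp
    also have "\<dots> \<le> (\<integral>\<^sup>+z. ennreal (norm (tent n z * (f (x + z) - f x) / c)) \<partial>lborel)"
      by (rule integral_norm_bound_ennreal[OF i1])
    also have "\<dots> = (\<integral>\<^sup>+z. ennreal (tent n z / c) * ennreal (\<bar>f (x + z) - f x\<bar> powr 1) \<partial>lborel)"
      using c by (intro nn_integral_cong, subst ennreal_mult[symmetric]) (auto simp: abs_mult tent_props(1))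
    finally show ?thesis .
  qed
  have "(\<integral>\<^sup>+x. ennreal \<bar>f x - tavg n f x / c\<bar> \<partial>lborel)
     \<le> (\<integral>\<^sup>+x. (\<integral>\<^sup>+z. ennreal (tent n z / c) * ennreal (\<bar>f (x + z) - f x\<bar> powr 1) \<partial>lborel) \<partial>lborel)"
    by (intro nn_integral_mono pt)
  also have "\<dots> = (\<integral>\<^sup>+z. (\<integral>\<^sup>+x. ennreal (tent n z / c) * ennreal (\<bar>f (x + z) - f x\<bar> powr 1) \<partial>lborel) \<partial>lborel)"
    by (rule lborel_pair.Fubini'[symmetric]) measurable
  also have "\<dots> \<le> (\<integral>\<^sup>+z. ennreal (tent n (z::'a) / c * (R / real (Suc n))) \<partial>lborel)"
  proof (rule nn_integral_mono)
    fix z :: 'a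
    show "(\<integral>\<^sup>+x. ennreal (tent n z / c) * ennreal (\<bar>f (x + z) - f x\<bar> powr 1) \<partial>lborel) \<le> ennreal (tent n z / c * (R / real (Suc n)))"
    proof (cases "1 / real (Suc n) \<le> norm z")
      case True then show ?thesis by (simp add: tent_props(4))
    next
      case False
      have "(\<integral>\<^sup>+x. ennreal (tent n z / c) * ennreal (\<bar>f (x + z) - f x\<bar> powr 1) \<partial>lborel)
        = ennreal (tent n z / c) * (\<integral>\<^sup>+x. ennreal (\<bar>f (x + z) - f x\<bar> powr 1) \<partial>lborel)"
        by (rule nn_integral_cmult) measurable
      also have "\<dots> \<le> ennreal (tent n z / c) * (ennreal (norm z powr 1) * (\<integral>\<^sup>+x. ennreal (norm (g x) powr 1) \<partial>lborel))"
        by (intro mult_left_mono C1c_translate[OF C]) auto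
      also have "(\<integral>\<^sup>+x. ennreal (norm (g x) powr 1) \<partial>lborel) = ennreal R"
        unfolding R_def using gi by (simp add: nn_integral_eq_integral)
      also have "ennreal (tent n z / c) * (ennreal (norm z powr 1) * ennreal R) \<le> ennreal (tent n z / c) * (ennreal (1 / real (Suc n)) * ennreal R)"
        using False by (intro mult_left_mono mult_right_mono ennreal_leI) auto
      also have "\<dots> = ennreal (tent n z / c * (R / real (Suc n)))"
        using c R0 tent_props(1)[of n z] by (simp add: ennreal_mult[symmetric] del: of_nat_Suc)
      finally show ?thesis .
    qed
  qed
  also have "\<dots> = ennreal (\<integral>z. tent n (z::'a) / c * (R / real (Suc n)) \<partial>lborel)"
    using tent_integral(1)[of n, where 'a='a] c R0
    by (intro nn_integral_eq_integral) (auto simp: tent_props(1))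
  also have "(\<integral>z. tent n (z::'a) / c * (R / real (Suc n)) \<partial>lborel) = R / real (Suc n)"
    using c by (simp add: c_def[symmetric])
  finally show ?thesis unfolding R_def .
qed

text \<open>For each n the cone averages converge pointwise along a common subsequence, hence in L^1
  of the bounded set. Since averages approximate the functions uniformly in k, the functions
  themselves are L^1-Cauchy along that subsequence.\<close>

lemma rellich:
  fixes \<psi> :: "nat \<Rightarrow> 'a::euclidean_space \<Rightarrow> real"
  assumes C: "\<And>k. C1c B (\<psi> k) (\<psi>' k)" and B: "bounded B" "B \<in> sets borel"
    and R0: "\<And>k. (\<integral>x. \<bar>\<psi> k x\<bar> \<partial>lborel) \<le> R0" and R: "\<And>k. (\<integral>x. norm (\<psi>' k x) \<partial>lborel) \<le> R"
  shows "\<exists>s::nat\<Rightarrow>nat. strict_mono s \<and> (AE x in lborel. convergent (\<lambda>i. \<psi> (s i) x))"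
proof -
  have CU: "C1c UNIV (\<psi> k) (\<psi>' k)" for k using C1c_mono[OF C] by simp
  note [measurable] = C1c_measurable[OF CU] B(2)
  have fi: "integrable lborel (\<psi> k)" for k
    using continuous_cpt_integrable[OF C1cD(3,4)[OF C]] tsupp_vanish[of _ "\<psi> k"] by auto
  note [measurable] = tavg_measurable[OF fi]
  obtain D :: "'a set" where D: "countable D" "\<And>X. open X \<Longrightarrow> X \<noteq> {} \<Longrightarrow> \<exists>d\<in>D. d \<in> X"
    using countable_dense_exists[where 'a='a] by auto
  \<comment> \<open>Indexing by pairs of a kernel radius and a point of a dense set lets one
    diagonal extraction serve all n at once.\<close>
  have cnt: "countable (UNIV \<times> D :: (nat \<times> 'a) set)" using D(1) by simp
  have bd: "norm (tavg (fst w) (\<psi> k) (snd w)) \<le> R0" if "w \<in> UNIV \<times> D" for k and w :: "nat \<times> 'a"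
    using tavg_bounds(1)[OF fi, of "fst w" k "snd w"] R0[of k] by simp
  obtain s :: "nat \<Rightarrow> nat" where s: "strict_mono s"
    and lim: "\<And>w. w \<in> UNIV \<times> D \<Longrightarrow> \<exists>l. (\<lambda>k. tavg (fst w) (\<psi> (s k)) (snd w)) \<longlonglongrightarrow> l"
    by (rule function_convergent_subsequence[where f="\<lambda>k w. tavg (fst w) (\<psi> k) (snd w)", OF cnt bd])
      (assumption, rule that)
  have conv: "convergent (\<lambda>k. tavg n (\<psi> (s k)) x)" for n x
  proof -
    have "Cauchy (\<lambda>k. tavg n (\<psi> (s k)) x)"
    proof (rule metric_CauchyI)
      fix e :: real assume e: "0 < e"
      have R00: "0 \<le> R0" 
        by (rule order_trans[OF _ R0[of 0]]) simp
      \<comment> \<open>A common Lipschitz constant of all averages; \<open>R0 + 1\<close> keeps it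
        positive. It carries convergence from the dense set to every point.\<close>
      define A where "A = real (Suc n) * (R0 + 1)"
      have A: "0 < A" unfolding A_def using R00 by (intro mult_pos_pos) auto
      define d where "d = e / (3 * A)"
      have d: "0 < d" unfolding d_def using e A by simp
      obtain y where y: "y \<in> D" "y \<in> ball x d" using D(2)[of "ball x d"] d by auto
      have near: "\<bar>tavg n (\<psi> k) x - tavg n (\<psi> k) y\<bar> < e / 3" for k
      proof -
        have "\<bar>tavg n (\<psi> k) x - tavg n (\<psi> k) y\<bar> \<le> real (Suc n) * norm (x - y) * (\<integral>y. \<bar>\<psi> k y\<bar> \<partial>lborel)"
          by (rule tavg_bounds(2)[OF fi])
        also have "\<dots> \<le> real (Suc n) * norm (x - y) * (R0 + 1)"
          using R0[of k] by (intro mult_left_mono) auto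
        also have "\<dots> = A * norm (x - y)" by (simp add: A_def)
        also have "\<dots> < A * d"
          using y A by (intro mult_strict_left_mono) (auto simp: dist_norm)
        also have "\<dots> = e / 3" unfolding d_def using A by simp
        finally show ?thesis .
      qed
      have "Cauchy (\<lambda>k. tavg n (\<psi> (s k)) y)"
        using lim[of "(n, y)"] y by (intro convergent_Cauchy) (auto simp: convergent_def)
      then obtain K where K: "\<And>j k. j \<ge> K \<Longrightarrow> k \<ge> K \<Longrightarrow> dist (tavg n (\<psi> (s j)) y) (tavg n (\<psi> (s k)) y) < e / 3"
        using metric_CauchyD[of "\<lambda>k. tavg n (\<psi> (s k)) y" "e / 3"] e by auto
      show "\<exists>K. \<forall>j\<ge>K. \<forall>k\<ge>K. dist (tavg n (\<psi> (s j)) x) (tavg n (\<psi> (s k)) x) < e"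
      proof (intro exI[of _ K] allI impI)
        fix j k assume "K \<le> j" "K \<le> k"
        from K[OF this] near[of "s j"] near[of "s k"]
        show "dist (tavg n (\<psi> (s j)) x) (tavg n (\<psi> (s k)) x) < e"
          unfolding dist_real_def by linarith
      qed
    qed
    then show ?thesis by (simp add: Cauchy_convergent_iff)
  qed
  define \<Gamma> where "\<Gamma> = (\<lambda>n x. lim (\<lambda>k. tavg n (\<psi> (s k)) x))"
  have [measurable]: "\<Gamma> n \<in> borel_measurable borel" for n unfolding \<Gamma>_def by measurable
  have \<Gamma>: "(\<lambda>k. tavg n (\<psi> (s k)) x) \<longlonglongrightarrow> \<Gamma> n x" for n x
    unfolding \<Gamma>_def using conv[of n x] by (simp add: convergent_LIMSEQ_iff)
  have \<Gamma>b: "\<bar>\<Gamma> n x\<bar> \<le> R0" for n x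
  proof (rule LIMSEQ_le_const2[OF tendsto_rabs[OF \<Gamma>]])
    show "\<exists>N. \<forall>k\<ge>N. \<bar>tavg n (\<psi> (s k)) x\<bar> \<le> R0"
      using order_trans[OF tavg_bounds(1)[OF fi] R0] by blast
  qed
  have Bf: "emeasure lborel B < \<infinity>" by (rule emeasure_bounded_finite[OF B(1)])
  have L1: "(\<lambda>k. \<integral>\<^sup>+x. indicator B x * ennreal \<bar>tavg n (\<psi> (s k)) x - \<Gamma> n x\<bar> \<partial>lborel) \<longlonglongrightarrow> 0" for n
  proof -
    have "(\<lambda>k. \<integral>\<^sup>+x. indicator B x * ennreal \<bar>tavg n (\<psi> (s k)) x - \<Gamma> n x\<bar> \<partial>lborel) \<longlonglongrightarrow> (\<integral>\<^sup>+x. (0::ennreal) \<partial>(lborel::'a measure))"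
    proof (rule nn_integral_dominated_convergence[where w="\<lambda>x. indicator B x * ennreal (2 * R0)"])
      show "(\<integral>\<^sup>+x. indicator B x * ennreal (2 * R0) \<partial>lborel) < \<infinity>"
        using Bf by (subst nn_integral_multc) (auto simp: ennreal_mult_less_top)
      show "AE x in lborel. indicator B x * ennreal \<bar>tavg n (\<psi> (s k)) x - \<Gamma> n x\<bar> \<le> indicator B x * ennreal (2 * R0)" for k
      proof (intro AE_I2 mult_left_mono ennreal_leI)
        fix x
        show "\<bar>tavg n (\<psi> (s k)) x - \<Gamma> n x\<bar> \<le> 2 * R0"
          using order_trans[OF tavg_bounds(1)[OF fi] R0, of n "s k" x] \<Gamma>b[of n x] by linarith
      qed simp
      show "AE x in lborel. (\<lambda>k. indicator B x * ennreal \<bar>tavg n (\<psi> (s k)) x - \<Gamma> n x\<bar>) \<longlonglongrightarrow> 0"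
      proof (intro AE_I2)
        fix x
        have "(\<lambda>k. \<bar>tavg n (\<psi> (s k)) x - \<Gamma> n x\<bar>) \<longlonglongrightarrow> 0"
          using LIM_zero[OF \<Gamma>[of n x]] by (rule tendsto_rabs_zero)
        then have "(\<lambda>k. ennreal \<bar>tavg n (\<psi> (s k)) x - \<Gamma> n x\<bar>) \<longlonglongrightarrow> ennreal 0"
          by (rule tendsto_ennrealI)
        then show "(\<lambda>k. indicator B x * ennreal \<bar>tavg n (\<psi> (s k)) x - \<Gamma> n x\<bar>) \<longlonglongrightarrow> 0"
          by (cases "x \<in> B") auto
      qed
    qed measurable
    then show ?thesis by simp
  qed
  have "\<exists>t::nat\<Rightarrow>nat. strict_mono t \<and> (AE x in lborel. convergent (\<lambda>i. \<psi> (s (t i)) x))"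
  proof (rule L1_Cauchy_AE_subseq[of "\<lambda>k. \<psi> (s k)" lborel])
    fix e :: real assume e: "0 < e"
    have Rn: "0 \<le> R" 
      by (rule order_trans[OF _ R[of 0]]) simp
    obtain n where n: "4 * R / e < real n" using reals_Archimedean2 by blast
    have Re: "R / real (Suc n) \<le> e / 4"
    proof -
      have "4 * R / e \<le> real (Suc n)" using n by simp
      then show ?thesis using e by (simp add: field_simps)
    qed
    define c where "c = (\<integral>w. tent n (w::'a) \<partial>lborel)"
    have c: "c > 0" unfolding c_def by (rule tent_integral)
    have "\<forall>\<^sub>F k in sequentially. (\<integral>\<^sup>+x. indicator B x * ennreal \<bar>tavg n (\<psi> (s k)) x - \<Gamma> n x\<bar> \<partial>lborel) < ennreal (c * e / 4)"
      using order_tendstoD(2)[OF L1[of n], of "ennreal (c * e / 4)"] c e by simp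
    then obtain K where K: "\<And>k. k \<ge> K \<Longrightarrow> (\<integral>\<^sup>+x. indicator B x * ennreal \<bar>tavg n (\<psi> (s k)) x - \<Gamma> n x\<bar> \<partial>lborel) \<le> ennreal (c * e / 4)"
      unfolding eventually_sequentially by (meson less_imp_le)
    have K': "(\<integral>\<^sup>+x. ennreal (1 / c) * (indicator B x * ennreal \<bar>tavg n (\<psi> (s k)) x - \<Gamma> n x\<bar>) \<partial>lborel) \<le> ennreal (e / 4)" if "k \<ge> K" for k
    proof -
      have "(\<integral>\<^sup>+x. ennreal (1 / c) * (indicator B x * ennreal \<bar>tavg n (\<psi> (s k)) x - \<Gamma> n x\<bar>) \<partial>lborel)
         = ennreal (1 / c) * (\<integral>\<^sup>+x. indicator B x * ennreal \<bar>tavg n (\<psi> (s k)) x - \<Gamma> n x\<bar> \<partial>lborel)"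
        by (rule nn_integral_cmult) measurable
      also have "\<dots> \<le> ennreal (1 / c) * ennreal (c * e / 4)" by (intro mult_left_mono K that) simp
      also have "\<dots> = ennreal (e / 4)" using c e by (simp add: ennreal_mult[symmetric])
      finally show ?thesis .
    qed
    have T: "(\<integral>\<^sup>+x. ennreal \<bar>\<psi> (s k) x - tavg n (\<psi> (s k)) x / c\<bar> \<partial>lborel) \<le> ennreal (e / 4)" for k
    proof -
      have "(\<integral>x. norm (\<psi>' (s k) x) \<partial>lborel) / real (Suc n) \<le> R / real (Suc n)"
        by (intro divide_right_mono R) simp
      with Re have "(\<integral>x. norm (\<psi>' (s k) x) \<partial>lborel) / real (Suc n) \<le> e / 4" by linarith
      then show ?thesis
        using tavg_approx[OF CU, of "s k" n] unfolding c_def[symmetric] by (meson ennreal_leI order_trans)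
    qed
    show "\<exists>K. \<forall>j\<ge>K. \<forall>k\<ge>K. (\<integral>\<^sup>+x. norm (\<psi> (s j) x - \<psi> (s k) x) \<partial>lborel) \<le> ennreal e"
    proof (intro exI[of _ K] allI impI)
      fix j k assume jk: "K \<le> j" "K \<le> k"
      define P where "P = (\<lambda>k x. ennreal \<bar>\<psi> (s k) x - tavg n (\<psi> (s k)) x / c\<bar>)"
      define Q where "Q = (\<lambda>k x. ennreal (1 / c) * (indicator B x * ennreal \<bar>tavg n (\<psi> (s k)) x - \<Gamma> n x\<bar>))"
      have [measurable]: "P k \<in> borel_measurable borel" "Q k \<in> borel_measurable borel" for k
        unfolding P_def Q_def by measurable
      have "(\<integral>\<^sup>+x. norm (\<psi> (s j) x - \<psi> (s k) x) \<partial>lborel) \<le> (\<integral>\<^sup>+x. (P j x + P k x) + (Q j x + Q k x) \<partial>lborel)"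
      proof (rule nn_integral_mono)
        fix x
        show "ennreal (norm (\<psi> (s j) x - \<psi> (s k) x)) \<le> (P j x + P k x) + (Q j x + Q k x)"
        proof (cases "x \<in> B")
          case False
          then have "\<psi> k x = 0" for k using C1cD(5)[OF C, of k] tsupp_vanish[of x "\<psi> k"] by auto
          then show ?thesis by simp
        next
          case True
          let ?a = "tavg n (\<psi> (s j)) x / c" and ?b = "tavg n (\<psi> (s k)) x / c" and ?g = "\<Gamma> n x / c"
          have q: "\<bar>?a - ?g\<bar> = 1 / c * \<bar>tavg n (\<psi> (s j)) x - \<Gamma> n x\<bar>" "\<bar>?b - ?g\<bar> = 1 / c * \<bar>tavg n (\<psi> (s k)) x - \<Gamma> n x\<bar>"
            using c by (simp_all add: diff_divide_distrib[symmetric])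
          \<comment> \<open>Four errors of size e/4 each after integration: two between function and
            average, two between average and limit average.\<close>
          have "norm (\<psi> (s j) x - \<psi> (s k) x) \<le> (\<bar>\<psi> (s j) x - ?a\<bar> + \<bar>\<psi> (s k) x - ?b\<bar>) + (\<bar>?a - ?g\<bar> + \<bar>?b - ?g\<bar>)"
            unfolding real_norm_def by linarith
          then have "ennreal (norm (\<psi> (s j) x - \<psi> (s k) x)) \<le> ennreal ((\<bar>\<psi> (s j) x - ?a\<bar> + \<bar>\<psi> (s k) x - ?b\<bar>) + (\<bar>?a - ?g\<bar> + \<bar>?b - ?g\<bar>))"
            by (rule ennreal_leI)
          also have "\<dots> = (P j x + P k x) + (Q j x + Q k x)"
            unfolding P_def Q_def q using True c by (simp add: ennreal_mult[symmetric])
          finally show ?thesis .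
        qed
      qed
      also have "\<dots> = (integral\<^sup>N lborel (P j) + integral\<^sup>N lborel (P k)) + (integral\<^sup>N lborel (Q j) + integral\<^sup>N lborel (Q k))"
        by (simp add: nn_integral_add)
      also have "\<dots> \<le> (ennreal (e / 4) + ennreal (e / 4)) + (ennreal (e / 4) + ennreal (e / 4))"
        unfolding P_def Q_def using jk by (intro add_mono T K')
      also have "\<dots> = ennreal e" using e by (simp add: ennreal_plus[symmetric] del: ennreal_plus)
      finally show "(\<integral>\<^sup>+x. norm (\<psi> (s j) x - \<psi> (s k) x) \<partial>lborel) \<le> ennreal e" .
    qed
  qed measurable
  then obtain t :: "nat \<Rightarrow> nat" where "strict_mono t" "AE x in lborel. convergent (\<lambda>i. \<psi> (s (t i)) x)" by auto
  then show ?thesis using s by (intro exI[of _ "s \<circ> t"]) (auto simp: strict_mono_o)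
qed

section \<open>Smooth approximation\<close>

lemma smooth_onD:
  assumes "smooth_on S f"
  shows "f differentiable_on S" "smooth_on S (\<lambda>x. frechet_derivative f (at x) v)"
  using assms by (auto elim: smooth_on.cases)

text \<open>Coinduction with a whole class of functions as witness, since the iterated derivatives
  in the applications run through a family such as all convolutions with smooth kernels.\<close>

lemma smooth_on_class:
  assumes "P f" and "\<And>f. P f \<Longrightarrow> f differentiable_on S \<and> (\<forall>v. P (\<lambda>x. frechet_derivative f (at x) v))"
  shows "smooth_on S f"
  using assms(1) by (coinduction arbitrary: f rule: smooth_on.coinduct) (use assms(2) in blast)

text \<open>Differentiating exp(-1/t) produces powers of 1/t; including the power n makes the family
  closed under differentiation.\<close>

definition flat :: "nat \<Rightarrow> real \<Rightarrow> real" where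
  "flat n t = (if t \<le> 0 then 0 else (1 / t) ^ n * exp (- (1 / t)))"

lemma flat_deriv: "(flat n has_real_derivative (- real n * flat (Suc n) t + flat (Suc (Suc n)) t)) (at t)"
proof (cases t "0::real" rule: linorder_cases)
  case less
  have "(flat n has_real_derivative 0) (at t)"
    by (rule has_field_derivative_transform_within_open[of "\<lambda>_. 0" _ _ "{..<0}"]) (use less in \<open>auto simp: flat_def\<close>)
  then show ?thesis using less by (simp add: flat_def)
next
  case greater
  have d: "((\<lambda>t. (1 / t) ^ n) has_real_derivative - (real n * (1 / t) ^ Suc n)) (at t)"
  proof -
    have "((\<lambda>t. 1 / t) has_real_derivative - (1 / t * (1 / t))) (at t)"
      using greater by (auto intro!: derivative_eq_intros simp: power2_eq_square)
    from DERIV_power[OF this, of n] show ?thesis by (cases n) (simp_all add: algebra_simps)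
  qed
  have "((\<lambda>t. (1 / t) ^ n * exp (- (1 / t))) has_real_derivative (- real n * flat (Suc n) t + flat (Suc (Suc n)) t)) (at t)"
  proof -
    have "((\<lambda>t. exp (- (1 / t))) has_real_derivative exp (- (1 / t)) * (1 / t * (1 / t))) (at t)"
      using greater by (auto intro!: derivative_eq_intros simp: power2_eq_square)
    from DERIV_mult[OF d this] show ?thesis
      by (rule DERIV_cong) (use greater in \<open>simp add: flat_def algebra_simps\<close>)
  qed
  then show ?thesis
    by (rule has_field_derivative_transform_within_open[of _ _ _ "{0<..}"]) (use greater in \<open>auto simp: flat_def\<close>)
next
  case equal
  have "((\<lambda>h. (flat n h - flat n 0) / h) \<longlongrightarrow> 0) (at 0)"
  proof (rule filterlim_split_at)
    show "((\<lambda>h. (flat n h - flat n 0) / h) \<longlongrightarrow> 0) (at_left 0)"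
      by (rule tendsto_eventually) (auto simp: flat_def eventually_at_filter)
    \<comment> \<open>With y = 1/h the difference quotient at 0 becomes y^(n+1)/exp(y).\<close>
    have "((\<lambda>h. inverse h ^ Suc n / exp (inverse h)) \<longlongrightarrow> 0) (at_right (0::real))"
      by (rule filterlim_compose[OF tendsto_power_div_exp_0 filterlim_inverse_at_top_right])
    then show "((\<lambda>h. (flat n h - flat n 0) / h) \<longlongrightarrow> 0) (at_right 0)"
      by (rule Lim_transform_eventually)
        (auto simp: flat_def eventually_at_filter field_simps exp_minus)
  qed
  then show ?thesis using equal by (simp add: DERIV_def flat_def)
qed

text \<open>A class of functions closed under directional derivatives that contains the standard bump exp (- 1 / (1 - |x|^2)); this closure is
  what the coinductive smoothness predicate asks for.\<close>

inductive bump_alg :: "('a::euclidean_space \<Rightarrow> real) \<Rightarrow> bool" where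
  "bump_alg (\<lambda>x. c)"
| "bump_alg (\<lambda>x. x \<bullet> v)"
| "bump_alg (\<lambda>x. flat n (1 - x \<bullet> x))"
| "bump_alg f \<Longrightarrow> bump_alg g \<Longrightarrow> bump_alg (\<lambda>x. f x + g x)"
| "bump_alg f \<Longrightarrow> bump_alg g \<Longrightarrow> bump_alg (\<lambda>x. f x * g x)"

lemma bump_alg_deriv:
  "bump_alg f \<Longrightarrow> \<exists>D. (\<forall>x. (f has_derivative D x) (at x)) \<and> (\<forall>v. bump_alg (\<lambda>x. D x v))"
proof (induction rule: bump_alg.induct)
  case (1 c)
  show ?case by (intro exI[of _ "\<lambda>x v. 0"]) (auto intro: bump_alg.intros)
next
  case (2 v)
  show ?case by (intro exI[of _ "\<lambda>x h. h \<bullet> v"]) (auto intro: bump_alg.intros intro!: derivative_eq_intros)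
next
  case (3 n)
  let ?d = "\<lambda>x::'a. - real n * flat (Suc n) (1 - x \<bullet> x) + flat (Suc (Suc n)) (1 - x \<bullet> x)"
  have "((\<lambda>x. flat n (1 - x \<bullet> x)) has_derivative (\<lambda>v. ?d x * (- 2 * (x \<bullet> v)))) (at x)" for x :: 'a
  proof -
    have "((\<lambda>x::'a. 1 - x \<bullet> x) has_derivative (\<lambda>v. - 2 * (x \<bullet> v))) (at x)"
      by (auto intro!: derivative_eq_intros simp: inner_commute)
    from has_derivative_compose[OF this flat_deriv[unfolded has_field_derivative_def]]
    show ?thesis .
  qed
  moreover have "bump_alg (\<lambda>x::'a. ?d x * (- 2 * (x \<bullet> v)))" for v
    by (intro bump_alg.intros)
  ultimately show ?case
    by (intro exI[of _ "\<lambda>x v. ?d x * (- 2 * (x \<bullet> v))"] conjI allI)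
next
  case (4 f g)
  then obtain D E where D: "\<And>x. (f has_derivative D x) (at x)" "\<And>v. bump_alg (\<lambda>x. D x v)"
    and E: "\<And>x. (g has_derivative E x) (at x)" "\<And>v. bump_alg (\<lambda>x. E x v)" by blast
  show ?case
    by (intro exI[of _ "\<lambda>x v. D x v + E x v"] conjI allI has_derivative_add D E bump_alg.intros)
next
  case (5 f g)
  then obtain D E where D: "\<And>x. (f has_derivative D x) (at x)" "\<And>v. bump_alg (\<lambda>x. D x v)"
    and E: "\<And>x. (g has_derivative E x) (at x)" "\<And>v. bump_alg (\<lambda>x. E x v)" by blast
  show ?case
    by (intro exI[of _ "\<lambda>x v. f x * E x v + D x v * g x"] conjI allI has_derivative_mult D E bump_alg.intros 5)
qed

lemma bump_alg_smooth: "bump_alg f \<Longrightarrow> smooth_on UNIV f"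
proof (erule smooth_on_class)
  fix f :: "'a \<Rightarrow> real" assume "bump_alg f"
  then obtain D where D: "\<And>x. (f has_derivative D x) (at x)" "\<And>v. bump_alg (\<lambda>x. D x v)"
    using bump_alg_deriv by blast
  have "frechet_derivative f (at x) = D x" for x using D(1) by (metis frechet_derivative_at)
  with D show "f differentiable_on UNIV \<and> (\<forall>v. bump_alg (\<lambda>x. frechet_derivative f (at x) v))"
    by (auto simp: differentiable_on_def differentiable_def)
qed

lemma smooth_on_UNIV_deriv:
  assumes "smooth_on UNIV \<kappa>"
  shows "(\<kappa> has_derivative frechet_derivative \<kappa> (at x)) (at x)"
    "continuous_on UNIV (\<lambda>x. frechet_derivative \<kappa> (at x) v)" "continuous_on UNIV \<kappa>"
proof -
  show "(\<kappa> has_derivative frechet_derivative \<kappa> (at x)) (at x)"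
    using smooth_onD(1)[OF assms] by (auto simp: differentiable_on_def frechet_derivative_works)
  show "continuous_on UNIV (\<lambda>x. frechet_derivative \<kappa> (at x) v)"
    by (intro differentiable_imp_continuous_on smooth_onD(1) smooth_onD(2)[OF assms])
  show "continuous_on UNIV \<kappa>" by (intro differentiable_imp_continuous_on smooth_onD(1)[OF assms])
qed

section \<open>Convolution and uniform mollification\<close>

text \<open>All derivatives fall on the kernel, so f need only be continuous. The sign of v comes
  from the kernel argument y - x.\<close>

lemma smooth_convolution_deriv:
  fixes f \<kappa> :: "'a::euclidean_space \<Rightarrow> real"
  assumes f: "continuous_on UNIV f" and \<kappa>: "smooth_on UNIV \<kappa>"
  shows "((\<lambda>x. integral (cbox a b) (\<lambda>y. f y * \<kappa> (y - x))) has_derivative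
     (\<lambda>v. integral (cbox a b) (\<lambda>y. f y * frechet_derivative \<kappa> (at (y - x)) (- v)))) (at x)"
proof -
  note \<kappa>d = smooth_on_UNIV_deriv[OF \<kappa>]
  \<comment> \<open>Leibniz' rule asks for joint continuity of the derivative as a bounded operator;
    it is checked componentwise.\<close>
  define D where "D = (\<lambda>w. Blinfun (frechet_derivative \<kappa> (at w)))"
  have D: "blinfun_apply (D w) = frechet_derivative \<kappa> (at w)" for w
    unfolding D_def by (rule bounded_linear_Blinfun_apply[OF has_derivative_bounded_linear[OF \<kappa>d(1)]])
  have cD: "continuous_on UNIV D"
    by (rule continuous_on_blinfun_componentwise) (simp add: D \<kappa>d(2))
  define F where "F = (\<lambda>x t. - (f t *\<^sub>R D (t - x)))"
  have cF: "continuous_on (UNIV \<times> cbox a b) (\<lambda>(x, t). F x t)"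
    unfolding F_def case_prod_beta
    by (intro continuous_intros continuous_on_compose2[OF f] continuous_on_compose2[OF cD]) auto
  have cF1: "continuous_on (cbox a b) (F x)"
    unfolding F_def
    by (intro continuous_intros continuous_on_compose2[OF f] continuous_on_compose2[OF cD]) auto
  have "((\<lambda>x. integral (cbox a b) (\<lambda>y. f y * \<kappa> (y - x))) has_derivative
     blinfun_apply (integral (cbox a b) (F x))) (at x)"
  proof (rule leibniz_rule[of UNIV a b _ _ x, simplified])
    fix x t :: 'a
    have "((\<lambda>x. t - x) has_derivative (\<lambda>h. - h)) (at x)" by (auto intro!: derivative_eq_intros)
    from has_derivative_mult_right[OF has_derivative_compose[OF this \<kappa>d(1)[of "t - x"]], of "f t"]
    have "((\<lambda>x. f t * \<kappa> (t - x)) has_derivative (\<lambda>h. f t * frechet_derivative \<kappa> (at (t - x)) (- h))) (at x)" .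
    then show "((\<lambda>x. f t * \<kappa> (t - x)) has_derivative blinfun_apply (F x t)) (at x)"
      by (rule has_derivative_eq_rhs)
        (simp add: F_def fun_eq_iff D[symmetric] blinfun.bilinear_simps)
    show "(\<lambda>y. f y * \<kappa> (y - x)) integrable_on cbox a b"
      by (intro integrable_continuous continuous_intros continuous_on_compose2[OF f] continuous_on_compose2[OF \<kappa>d(3)]) auto
  qed (rule cF)
  then show ?thesis
  proof (rule has_derivative_eq_rhs)
    show "blinfun_apply (integral (cbox a b) (F x)) = (\<lambda>v. integral (cbox a b) (\<lambda>y. f y * frechet_derivative \<kappa> (at (y - x)) (- v)))"
    proof
      fix v
      have "blinfun_apply (integral (cbox a b) (F x)) v = integral (cbox a b) (\<lambda>y. blinfun_apply (F x y) v)"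
        by (rule blinfun_apply_integral[OF integrable_continuous[OF cF1]])
      then show "blinfun_apply (integral (cbox a b) (F x)) v = integral (cbox a b) (\<lambda>y. f y * frechet_derivative \<kappa> (at (y - x)) (- v))"
        by (simp add: F_def D[symmetric] blinfun.bilinear_simps)
    qed
  qed
qed

lemma smooth_convolution:
  fixes f \<kappa> :: "'a::euclidean_space \<Rightarrow> real"
  assumes f: "continuous_on UNIV f" and \<kappa>: "smooth_on UNIV \<kappa>"
  shows "smooth_on UNIV (\<lambda>x. integral (cbox a b) (\<lambda>y. f y * \<kappa> (y - x)))"
proof (rule smooth_on_class[where P="\<lambda>\<phi>. \<exists>\<kappa>. smooth_on UNIV \<kappa> \<and> \<phi> = (\<lambda>x. integral (cbox a b) (\<lambda>y. f y * \<kappa> (y - x)))"])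
  fix \<phi> :: "'a \<Rightarrow> real"
  assume "\<exists>\<kappa>. smooth_on UNIV \<kappa> \<and> \<phi> = (\<lambda>x. integral (cbox a b) (\<lambda>y. f y * \<kappa> (y - x)))"
  then obtain \<kappa> where \<kappa>: "smooth_on UNIV \<kappa>" and \<phi>: "\<phi> = (\<lambda>x. integral (cbox a b) (\<lambda>y. f y * \<kappa> (y - x)))" by blast
  note d = smooth_convolution_deriv[OF f \<kappa>, of a b, folded \<phi>]
  have "frechet_derivative \<phi> (at x) v = integral (cbox a b) (\<lambda>y. f y * frechet_derivative \<kappa> (at (y - x)) (- v))" for x v
    using frechet_derivative_at[OF d[of x]] by metis
  moreover have "\<exists>\<kappa>'. smooth_on UNIV \<kappa>' \<and> (\<lambda>x. integral (cbox a b) (\<lambda>y. f y * frechet_derivative \<kappa> (at (y - x)) (- v)))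
      = (\<lambda>x. integral (cbox a b) (\<lambda>y. f y * \<kappa>' (y - x)))" for v
    by (intro exI[of _ "\<lambda>x. frechet_derivative \<kappa> (at x) (- v)"] conjI smooth_onD(2)[OF \<kappa>] refl)
  ultimately show "\<phi> differentiable_on UNIV \<and> (\<forall>v. \<exists>\<kappa>. smooth_on UNIV \<kappa> \<and>
      (\<lambda>x. frechet_derivative \<phi> (at x) v) = (\<lambda>x. integral (cbox a b) (\<lambda>y. f y * \<kappa> (y - x))))"
    unfolding differentiable_on_def differentiable_def by (auto intro: d)
qed (use \<kappa> in auto)

lemma uniformly_continuous_cpt:
  fixes h :: "'a::euclidean_space \<Rightarrow> 'b::real_normed_vector"
  assumes h: "continuous_on UNIV h" and K: "compact K" and z: "\<And>x. x \<notin> K \<Longrightarrow> h x = 0" and e: "0 < e"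
  shows "\<exists>d>0. \<forall>x y. norm (y - x) < d \<longrightarrow> norm (h y - h x) < e"
proof -
  \<comment> \<open>Enlarging K by the unit ball ensures that two points at distance below 1, one of
    them in K, both lie in a compact set.\<close>
  define K2 where "K2 = {x + y |x y. x \<in> K \<and> y \<in> cball 0 1}"
  have "compact K2" unfolding K2_def by (intro compact_sums K compact_cball)
  then have "uniformly_continuous_on K2 h"
    using h by (intro compact_uniformly_continuous continuous_on_subset[OF h]) auto
  then obtain d where d: "d > 0" "\<And>x y. x \<in> K2 \<Longrightarrow> y \<in> K2 \<Longrightarrow> dist y x < d \<Longrightarrow> dist (h y) (h x) < e"
    using e unfolding uniformly_continuous_on_def by metis
  have K2: "y \<in> K2" if "x \<in> K" "norm (y - x) < 1" for x y
    unfolding K2_def using that by (intro CollectI exI[of _ x] exI[of _ "y - x"]) auto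
  have "norm (h y - h x) < e" if n: "norm (y - x) < min d 1" for x y
  proof -
    have s: "norm (x - y) < 1" using n by (simp add: norm_minus_commute)
    consider "x \<in> K" | "y \<in> K" | "x \<notin> K" "y \<notin> K" by blast
    then show ?thesis
    proof cases
      case 1 then show ?thesis using d(2)[of x y] K2[of x x] K2[of x y] n by (simp add: dist_norm)
    next
      case 2 then show ?thesis using d(2)[of x y] K2[of y x] K2[of y y] n s by (simp add: dist_norm)
    next
      case 3 then show ?thesis using z e by simp
    qed
  qed
  then show ?thesis using d(1) by (intro exI[of _ "min d 1"]) auto
qed

lemma mollifier_exists:
  assumes e: "0 < e"
  shows "\<exists>\<kappa>::'a::euclidean_space \<Rightarrow> real. smooth_on UNIV \<kappa> \<and> (\<forall>w. 0 \<le> \<kappa> w) \<and> (\<forall>w. e \<le> norm w \<longrightarrow> \<kappa> w = 0)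
    \<and> integrable lborel \<kappa> \<and> (\<integral>w. \<kappa> w \<partial>lborel) = 1"
proof -
  define \<eta> where "\<eta> = (\<lambda>w::'a. flat 0 (1 - (w /\<^sub>R e) \<bullet> (w /\<^sub>R e)))"
  have alg: "bump_alg (\<lambda>w::'a. flat 0 (1 - w \<bullet> w))" by (rule bump_alg.intros)
  \<comment> \<open>Rescaling keeps smoothness: the class is that of all rescaled smooth functions,
    with the factor 1/e absorbed into the direction.\<close>
  have sm: "smooth_on UNIV (\<lambda>w::'a. g (w /\<^sub>R e))" if "smooth_on UNIV g" for g
  proof (rule smooth_on_class[where P="\<lambda>h. \<exists>g. smooth_on UNIV g \<and> h = (\<lambda>w::'a. g (w /\<^sub>R e))"])
    fix h :: "'a \<Rightarrow> real" assume "\<exists>g. smooth_on UNIV g \<and> h = (\<lambda>w. g (w /\<^sub>R e))"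
    then obtain g where g: "smooth_on UNIV g" "h = (\<lambda>w. g (w /\<^sub>R e))" by blast
    have d: "(h has_derivative (\<lambda>v. frechet_derivative g (at (w /\<^sub>R e)) (v /\<^sub>R e))) (at w)" for w
      unfolding g(2)
      by (rule has_derivative_compose[where f="\<lambda>w. w /\<^sub>R e" and g=g])
        (auto intro!: derivative_eq_intros smooth_on_UNIV_deriv(1)[OF g(1)])
    have "(\<lambda>w. frechet_derivative h (at w) v) = (\<lambda>w. frechet_derivative g (at (w /\<^sub>R e)) (v /\<^sub>R e))" for v
      using frechet_derivative_at[OF d] by metis
    moreover have "\<exists>g'. smooth_on UNIV g' \<and> (\<lambda>w. frechet_derivative g (at (w /\<^sub>R e)) (v /\<^sub>R e)) = (\<lambda>w. g' (w /\<^sub>R e))" for v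
      by (intro exI[of _ "\<lambda>w. frechet_derivative g (at w) (v /\<^sub>R e)"] conjI smooth_onD(2)[OF g(1)] refl)
    ultimately show "h differentiable_on UNIV \<and> (\<forall>v. \<exists>g. smooth_on UNIV g \<and> (\<lambda>w. frechet_derivative h (at w) v) = (\<lambda>w. g (w /\<^sub>R e)))"
      unfolding differentiable_on_def differentiable_def by (auto intro: d)
  qed (use that in auto)
  have \<eta>s: "smooth_on UNIV \<eta>" unfolding \<eta>_def by (rule sm[OF bump_alg_smooth[OF alg]])
  have \<eta>0: "0 \<le> \<eta> w" for w by (simp add: \<eta>_def flat_def)
  have ww: "(w /\<^sub>R e) \<bullet> (w /\<^sub>R e) = (norm w / e)\<^sup>2" for w :: 'a
    using e by (simp add: power2_norm_eq_inner[symmetric] divide_inverse mult.commute)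
  have \<eta>z: "\<eta> w = 0" if "e \<le> norm w" for w
  proof -
    have "1 \<le> norm w / e" using that e by simp
    then show ?thesis unfolding \<eta>_def ww by (simp add: flat_def)
  qed
  \<comment> \<open>A lower bound on the half ball, where 1 - |w/e|^2 is at least 3/4; it makes the
    integral positive, so that normalisation is possible.\<close>
  have \<eta>p: "exp (- (4/3)) \<le> \<eta> w" if "norm w < e / 2" for w
  proof -
    have "(norm w / e)\<^sup>2 \<le> (1/2)\<^sup>2" using that e by (intro power_mono) (auto simp: field_simps)
    then have t: "3/4 \<le> 1 - (norm w / e)\<^sup>2" by (simp add: power2_eq_square)
    then have "1 / (1 - (norm w / e)\<^sup>2) \<le> 4/3" by (simp add: divide_le_eq)
    with t show ?thesis unfolding \<eta>_def ww by (simp add: flat_def)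
  qed
  have \<eta>i: "integrable lborel \<eta>"
    by (rule continuous_cpt_integrable[of _ "cball 0 e"]) (auto intro: smooth_on_UNIV_deriv(3)[OF \<eta>s] \<eta>z)
  define c where "c = (\<integral>w. \<eta> w \<partial>lborel)"
  have "0 < exp (- (4/3)) * measure lborel (ball (0::'a) (e / 2))" using e by (simp add: content_ball_pos)
  also have "\<dots> = (\<integral>w. exp (- (4/3)) * indicator (ball (0::'a) (e / 2)) w \<partial>lborel)" by simp
  also have "\<dots> \<le> c" unfolding c_def
    by (rule integral_mono'[OF \<eta>i]) (auto simp: \<eta>0 intro: \<eta>p split: split_indicator)
  finally have c: "c > 0" .
  have "smooth_on UNIV (\<lambda>w. \<eta> w / c)"
  proof (rule smooth_on_class[where P="\<lambda>h. \<exists>g. smooth_on UNIV g \<and> h = (\<lambda>w. g w / c)"])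
    fix h :: "'a \<Rightarrow> real" assume "\<exists>g. smooth_on UNIV g \<and> h = (\<lambda>w. g w / c)"
    then obtain g where g: "smooth_on UNIV g" "h = (\<lambda>w. g w / c)" by blast
    have d: "(h has_derivative (\<lambda>v. frechet_derivative g (at w) v / c)) (at w)" for w
      unfolding g(2) by (rule has_derivative_divide'[OF smooth_on_UNIV_deriv(1)[OF g(1)], of "\<lambda>_. c" "\<lambda>_. 0", THEN has_derivative_eq_rhs])
        (use c in \<open>auto simp: fun_eq_iff\<close>)
    have "(\<lambda>w. frechet_derivative h (at w) v) = (\<lambda>w. frechet_derivative g (at w) v / c)" for v
      using frechet_derivative_at[OF d] by metis
    then show "h differentiable_on UNIV \<and> (\<forall>v. \<exists>g. smooth_on UNIV g \<and> (\<lambda>w. frechet_derivative h (at w) v) = (\<lambda>w. g w / c))"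
      using smooth_onD(2)[OF g(1)] unfolding differentiable_on_def differentiable_def by (auto intro: d)
  qed (use \<eta>s in auto)
  with c \<eta>0 \<eta>z \<eta>i show ?thesis
    by (intro exI[of _ "\<lambda>w. \<eta> w / c"]) (auto simp: c_def[symmetric])
qed

lemma Cc_infty_C1c:
  assumes "\<phi> \<in> Cc_infty \<Omega>" shows "C1c \<Omega> \<phi> (grad \<phi>)"
proof -
  have s: "smooth_on UNIV \<phi>" "compact (tsupp \<phi>)" "tsupp \<phi> \<subseteq> \<Omega>" using assms by (auto simp: Cc_infty_def)
  note d = smooth_on_UNIV_deriv[OF s(1)]
  have "(\<phi> has_derivative (\<bullet>) (grad \<phi> x)) (at x)" for x
  proof (rule has_derivative_eq_rhs[OF d(1)])
    interpret bounded_linear "frechet_derivative \<phi> (at x)" by (rule has_derivative_bounded_linear[OF d(1)])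
    show "frechet_derivative \<phi> (at x) = (\<bullet>) (grad \<phi> x)"
    proof
      fix v
      have "frechet_derivative \<phi> (at x) v = frechet_derivative \<phi> (at x) (\<Sum>b\<in>Basis. (v \<bullet> b) *\<^sub>R b)"
        by (simp add: euclidean_representation)
      also have "\<dots> = grad \<phi> x \<bullet> v"
        by (simp add: sum scaleR grad_def inner_sum_left inner_commute[of v] mult.commute)
      finally show "frechet_derivative \<phi> (at x) v = grad \<phi> x \<bullet> v" .
    qed
  qed
  moreover have "continuous_on UNIV (grad \<phi>)"
    unfolding grad_def[abs_def] by (intro continuous_intros d(2))
  ultimately show ?thesis using s unfolding C1c_def by simp
qed

text \<open>The convolution is written in two ways. With x in the kernel it is smooth; with x in f
  its gradient is the kernel average of g. Averages of uniformly continuous functions over small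
  balls are uniformly close to them.\<close>

lemma mollify:
  fixes f :: "'a::euclidean_space \<Rightarrow> real"
  assumes C: "C1c \<Omega> f g" and \<Omega>: "open \<Omega>" and e: "0 < e"
  shows "\<exists>\<phi>\<in>Cc_infty \<Omega>. \<forall>x. \<bar>\<phi> x - f x\<bar> \<le> e \<and> norm (grad \<phi> x - g x) \<le> e"
proof -
  note Cf = C1cD[OF C]
  obtain d1 where d1: "d1 > 0" "\<And>x y. norm (y - x) < d1 \<Longrightarrow> norm (f y - f x) < e"
    using uniformly_continuous_cpt[OF Cf(3,4) tsupp_vanish[of _ f] e] by blast
  obtain d2 where d2: "d2 > 0" "\<And>x y. norm (y - x) < d2 \<Longrightarrow> norm (g y - g x) < e"
    using uniformly_continuous_cpt[OF Cf(2,4) C1c_grad_vanish[OF C] e] by blast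
  obtain d3 where d3: "d3 > 0" "(\<Union>x\<in>tsupp f. cball x d3) \<subseteq> \<Omega>"
    using compact_subset_open_imp_cball_epsilon_subset[OF Cf(4) \<Omega> Cf(5)] by blast
  define d where "d = min d1 (min d2 d3)"
  \<comment> \<open>One radius serves the moduli of continuity of f and of g and keeps the enlarged
    support inside \<Omega>.\<close>
  have d: "d > 0" "d \<le> d1" "d \<le> d2" "d \<le> d3" using d1 d2 d3 by (auto simp: d_def)
  obtain \<kappa> :: "'a \<Rightarrow> real" where \<kappa>: "smooth_on UNIV \<kappa>" "\<And>w. 0 \<le> \<kappa> w" "\<And>w. d \<le> norm w \<Longrightarrow> \<kappa> w = 0"
    "integrable lborel \<kappa>" "(\<integral>w. \<kappa> w \<partial>lborel) = 1"
    using mollifier_exists[OF d(1)] by blast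
  note \<kappa>c = smooth_on_UNIV_deriv(3)[OF \<kappa>(1)]
  obtain a where a: "tsupp f \<subseteq> cbox (-a) a"
    using bounded_subset_cbox_symmetric[OF compact_imp_bounded[OF Cf(4)]] by blast
  obtain b :: 'a where b: "cball 0 d \<subseteq> cbox (-b) b"
    using bounded_subset_cbox_symmetric[OF bounded_cball] by blast
  have kz: "\<kappa> z = 0" if "z \<notin> cbox (-b) b" for z
  proof -
    have "z \<notin> cball 0 d" using that b by blast
    then show ?thesis by (intro \<kappa>(3)) simp
  qed
  define \<phi> where "\<phi> = (\<lambda>x. integral (cbox (-a) a) (\<lambda>y. f y * \<kappa> (y - x)))"
  have sm: "smooth_on UNIV \<phi>" unfolding \<phi>_def by (rule smooth_convolution[OF Cf(3) \<kappa>(1)])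
  \<comment> \<open>Leibniz' rule is applied on boxes, translation invariance on the whole space;
    \<open>hk\<close> passes between the two integrals.\<close>
  have hk: "integral (cbox l u) h = (\<integral>x. h x \<partial>lborel)" if "continuous_on UNIV h" "\<And>x. x \<notin> cbox l u \<Longrightarrow> h x = 0"
    for l u and h :: "'a \<Rightarrow> real"
  proof -
    have "integrable lborel h" by (rule continuous_cpt_integrable[OF that(1) compact_cbox that(2)])
    then have "(\<integral>x. h x \<partial>lborel) = integral UNIV h" by (rule integral_lborel[symmetric])
    also have "\<dots> = integral (cbox l u) h"
      using that(2) by (subst integral_restrict_UNIV[symmetric]) (auto intro!: arg_cong[of _ _ "integral UNIV"])
    finally show ?thesis by simp
  qed
  have \<phi>1: "\<phi> x = (\<integral>y. f y * \<kappa> (y - x) \<partial>lborel)" for x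
    unfolding \<phi>_def using a tsupp_vanish[of _ f]
    by (intro hk continuous_intros Cf(3) continuous_on_compose2[OF \<kappa>c]) auto
  have \<phi>2: "\<phi> x = integral (cbox (-b) b) (\<lambda>z. f (x + z) * \<kappa> z)" for x
  proof -
    have "\<phi> x = (\<integral>y. f y * \<kappa> (y - x) \<partial>distr lborel borel ((+) x))"
      unfolding \<phi>1 by (simp add: lborel_distr_plus)
    also have "\<dots> = (\<integral>z. f (x + z) * \<kappa> z \<partial>lborel)"
    proof (subst integral_distr)
      have [measurable]: "f \<in> borel_measurable borel" "\<kappa> \<in> borel_measurable borel"
        using Cf(3) \<kappa>c by (auto intro: borel_measurable_continuous_onI)
      show "(\<lambda>y. f y * \<kappa> (y - x)) \<in> borel_measurable borel" by measurable
    qed auto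
    also have "\<dots> = integral (cbox (-b) b) (\<lambda>z. f (x + z) * \<kappa> z)"
    proof (rule hk[symmetric])
      show "continuous_on UNIV (\<lambda>z. f (x + z) * \<kappa> z)"
        by (intro continuous_intros \<kappa>c continuous_on_compose2[OF Cf(3)]) auto
      show "z \<notin> cbox (-b) b \<Longrightarrow> f (x + z) * \<kappa> z = 0" for z
        using kz by simp
    qed
    finally show ?thesis .
  qed
  have \<phi>d: "(\<phi> has_derivative (\<lambda>v. integral (cbox (-b) b) (\<lambda>z. (g (x + z) \<bullet> v) * \<kappa> z))) (at x)" for x
  proof -
    define F where "F = (\<lambda>x z. \<kappa> z *\<^sub>R blinfun_inner_right (g (x + z)))"
    have cF: "continuous_on (UNIV \<times> cbox (-b) b) (\<lambda>(x, t). F x t)"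
      unfolding F_def case_prod_beta
      by (intro continuous_intros continuous_on_compose2[OF \<kappa>c] continuous_on_compose2[OF Cf(2)]) auto
    have cF1: "continuous_on (cbox (-b) b) (F x)" for x
      unfolding F_def
      by (intro continuous_intros continuous_on_compose2[OF \<kappa>c] continuous_on_compose2[OF Cf(2)]) auto
    have "(\<phi> has_derivative blinfun_apply (integral (cbox (-b) b) (F x))) (at x)"
      unfolding \<phi>2[abs_def]
    proof (rule leibniz_rule[of UNIV "-b" b _ _ x, simplified])
      fix x t :: 'a
      have "((\<lambda>x. x + t) has_derivative (\<lambda>h. h)) (at x)" by (auto intro!: derivative_eq_intros)
      from has_derivative_mult_left[OF has_derivative_compose[OF this Cf(1)[of "x + t"]], of "\<kappa> t"]
      have "((\<lambda>x. f (x + t) * \<kappa> t) has_derivative (\<lambda>h. g (x + t) \<bullet> h * \<kappa> t)) (at x)" .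
      then show "((\<lambda>x. f (x + t) * \<kappa> t) has_derivative blinfun_apply (F x t)) (at x)"
        by (rule has_derivative_eq_rhs) (simp add: F_def fun_eq_iff blinfun.bilinear_simps mult.commute)
      show "(\<lambda>z. f (x + z) * \<kappa> z) integrable_on cbox (-b) b"
        by (intro integrable_continuous continuous_intros continuous_on_compose2[OF Cf(3)] continuous_on_compose2[OF \<kappa>c]) auto
    qed (rule cF)
    then show ?thesis
    proof (rule has_derivative_eq_rhs, intro ext)
      fix v
      have "blinfun_apply (integral (cbox (-b) b) (F x)) v = integral (cbox (-b) b) (\<lambda>z. blinfun_apply (F x z) v)"
        by (rule blinfun_apply_integral[OF integrable_continuous[OF cF1]])
      then show "blinfun_apply (integral (cbox (-b) b) (F x)) v = integral (cbox (-b) b) (\<lambda>z. (g (x + z) \<bullet> v) * \<kappa> z)"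
        by (simp add: F_def blinfun.bilinear_simps mult.commute)
    qed
  qed
  have supp: "\<phi> x = 0" if "x \<notin> (\<Union>x\<in>tsupp f. cball x d)" for x
  proof -
    have "f y * \<kappa> (y - x) = 0" for y
      using that \<kappa>(3)[of "y - x"] tsupp_vanish[of y f]
      by (cases "d \<le> norm (y - x)") (force simp: dist_norm)+
    then have "(\<lambda>y. f y * \<kappa> (y - x)) = (\<lambda>y. 0)" by (simp only: fun_eq_iff simp_thms)
    then show ?thesis unfolding \<phi>1 by simp
  qed
  have cptK: "compact (\<Union>x\<in>tsupp f. cball x d)"
  proof -
    have "(\<Union>x\<in>tsupp f. cball x d) = (\<Union>x\<in>tsupp f. \<Union>y\<in>cball 0 d. {x + y})"
    proof (intro SUP_cong refl set_eqI iffI)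
      fix x z :: 'a assume "z \<in> cball x d"
      then have "z - x \<in> cball 0 d" "z = x + (z - x)" by (auto simp: dist_norm norm_minus_commute)
      then show "z \<in> (\<Union>y\<in>cball 0 d. {x + y})" by blast
    qed (auto simp: dist_norm)
    then show ?thesis using compact_sums'[OF Cf(4) compact_cball[of 0 d]] by simp
  qed
  have Kss: "(\<Union>x\<in>tsupp f. cball x d) \<subseteq> \<Omega>" using d3(2) d(4) by (meson UN_mono order_refl subset_cball subset_trans)
  have ts: "tsupp \<phi> \<subseteq> (\<Union>x\<in>tsupp f. cball x d)"
    by (rule tsupp_subset[OF compact_imp_closed[OF cptK] supp])
  have "compact (tsupp \<phi>)"
    using compact_Int_closed[OF cptK closed_tsupp[of \<phi>]] ts by (simp add: Int_absorb1)
  with sm ts Kss have mem: "\<phi> \<in> Cc_infty \<Omega>" by (auto simp: Cc_infty_def)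
  have ki: "integrable lborel (\<lambda>z. h z * \<kappa> z)" "integral (cbox (-b) b) (\<lambda>z. h z * \<kappa> z) = (\<integral>z. h z * \<kappa> z \<partial>lborel)"
    if "continuous_on UNIV h" for h
  proof -
    have c: "continuous_on UNIV (\<lambda>z. h z * \<kappa> z)" by (intro continuous_intros that \<kappa>c)
    have z: "h z * \<kappa> z = 0" if "z \<notin> cbox (-b) b" for z
      using kz that by simp
    show "integrable lborel (\<lambda>z. h z * \<kappa> z)" by (rule continuous_cpt_integrable[OF c compact_cbox z])
    show "integral (cbox (-b) b) (\<lambda>z. h z * \<kappa> z) = (\<integral>z. h z * \<kappa> z \<partial>lborel)" by (rule hk[OF c z])
  qed
  have est: "\<bar>integral (cbox (-b) b) (\<lambda>z. h z * \<kappa> z) - h0\<bar> \<le> A"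
    if h: "continuous_on UNIV h" and A: "\<And>z. norm z < d \<Longrightarrow> \<bar>h z - h0\<bar> \<le> A" for h h0 A
  proof -
    have "(\<integral>z. h z * \<kappa> z \<partial>lborel) - h0 = (\<integral>z. h z * \<kappa> z \<partial>lborel) - (\<integral>z. h0 * \<kappa> z \<partial>lborel)" using \<kappa>(5) by simp
    also have "\<dots> = (\<integral>z. h z * \<kappa> z - h0 * \<kappa> z \<partial>lborel)"
      using ki(1)[OF h] \<kappa>(4) by (intro Bochner_Integration.integral_diff[symmetric]) auto
    finally have "\<bar>(\<integral>z. h z * \<kappa> z \<partial>lborel) - h0\<bar> \<le> (\<integral>z. \<bar>h z * \<kappa> z - h0 * \<kappa> z\<bar> \<partial>lborel)"
      using integral_norm_bound[of lborel "\<lambda>z. h z * \<kappa> z - h0 * \<kappa> z"] by simp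
    also have "\<dots> \<le> (\<integral>z. A * \<kappa> z \<partial>lborel)"
    proof (rule integral_mono')
      fix z
      show "\<bar>h z * \<kappa> z - h0 * \<kappa> z\<bar> \<le> A * \<kappa> z"
        unfolding left_diff_distrib[symmetric] abs_mult
        using A[of z] \<kappa>(2)[of z] \<kappa>(3)[of z] by (cases "d \<le> norm z") (auto intro!: mult_right_mono)
      have "0 \<le> A" using order_trans[OF abs_ge_zero A[of 0]] d(1) by simp
      then show "0 \<le> A * \<kappa> z" using \<kappa>(2) by simp
    qed (use \<kappa>(4) in auto)
    also have "\<dots> = A" using \<kappa>(5) by simp
    finally show ?thesis unfolding ki(2)[OF h] .
  qed
  have "\<bar>\<phi> x - f x\<bar> \<le> e" for x
    unfolding \<phi>2
  proof (rule est)
    show "continuous_on UNIV (\<lambda>z. f (x + z))" by (rule continuous_on_compose2[OF Cf(3)]) (auto intro!: continuous_intros)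
    show "\<bar>f (x + z) - f x\<bar> \<le> e" if "norm z < d" for z
      using d1(2)[of "x + z" x] that d(2) by simp
  qed
  moreover have "norm (grad \<phi> x - g x) \<le> e" for x
  proof -
    \<comment> \<open>Testing the gradient error against itself reduces the vector estimate to the
      scalar bound \<open>est\<close>.\<close>
    define v where "v = grad \<phi> x - g x"
    have "grad \<phi> x \<bullet> v = integral (cbox (-b) b) (\<lambda>z. (g (x + z) \<bullet> v) * \<kappa> z)"
      using has_derivative_unique[OF \<phi>d[of x] C1cD(1)[OF Cc_infty_C1c[OF mem]]] by metis
    also have "\<bar>\<dots> - g x \<bullet> v\<bar> \<le> e * norm v"
    proof (rule est)
      show "continuous_on UNIV (\<lambda>z. g (x + z) \<bullet> v)"
        by (intro continuous_intros continuous_on_compose2[OF Cf(2)]) auto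
      show "\<bar>g (x + z) \<bullet> v - g x \<bullet> v\<bar> \<le> e * norm v" if "norm z < d" for z
      proof -
        have "\<bar>(g (x + z) - g x) \<bullet> v\<bar> \<le> norm (g (x + z) - g x) * norm v" by (rule Cauchy_Schwarz_ineq2)
        also have "\<dots> \<le> e * norm v" using d2(2)[of "x + z" x] that d(3) by (intro mult_right_mono) auto
        finally show ?thesis by (simp add: inner_diff_left)
      qed
    qed
    finally have "\<bar>v \<bullet> v\<bar> \<le> e * norm v" unfolding v_def by (simp add: inner_diff_left)
    then have "norm v * norm v \<le> e * norm v" by (simp add: dot_square_norm power2_eq_square)
    then show ?thesis unfolding v_def[symmetric] using e by (cases "v = 0") auto
  qed
  ultimately show ?thesis using mem by blast
qed

section \<open>Uniform convexity of powers of the Finsler norm\<close>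

text \<open>Chain rule for y -> sy. The factor c is kept separate from s to cover both the absolute
  homogeneity of H, with c = |s|, and degree 0, with c = 1.\<close>

lemma frechet_derivative_homogeneous:
  fixes f :: "'a::euclidean_space \<Rightarrow> real"
  assumes d: "\<And>x. x \<noteq> 0 \<Longrightarrow> (f has_derivative f' x) (at x)"
    and hom: "\<And>x. x \<noteq> 0 \<Longrightarrow> f (s *\<^sub>R x) = c * f x" and s: "s \<noteq> 0" and x: "x \<noteq> 0"
  shows "f' (s *\<^sub>R x) v = c / s * f' x v"
proof -
  have "((\<lambda>y. s *\<^sub>R y) has_derivative (\<lambda>v. s *\<^sub>R v)) (at x)" by (auto intro!: derivative_eq_intros)
  from has_derivative_compose[OF this, of f] d[of "s *\<^sub>R x"] s x
  have 1: "((\<lambda>y. f (s *\<^sub>R y)) has_derivative (\<lambda>v. f' (s *\<^sub>R x) (s *\<^sub>R v))) (at x)" by auto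
  have "((\<lambda>y. c * f y) has_derivative (\<lambda>v. c * f' x v)) (at x)"
    by (intro has_derivative_mult_right d x)
  then have 2: "((\<lambda>y. f (s *\<^sub>R y)) has_derivative (\<lambda>v. c * f' x v)) (at x)"
    by (rule has_derivative_transform_within_open[where s="- {0}"]) (use x hom in auto)
  from has_derivative_unique[OF 1 2] have eq: "f' (s *\<^sub>R x) (s *\<^sub>R v) = c * f' x v" by metis
  interpret L: bounded_linear "f' (s *\<^sub>R x)" using d[of "s *\<^sub>R x"] s x by (auto intro: has_derivative_bounded_linear)
  have "s * f' (s *\<^sub>R x) v = c * f' x v" using eq by (simp add: L.scaleR)
  then show ?thesis using s by (simp add: field_simps)
qed

text \<open>A function of degree 0 is determined by its values on the unit sphere, which is compact.
  The point z where the minimum is attained is exposed so that positivity of \<open>m\<close> can be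
  read off.\<close>

lemma bound_on_nonzero:
  fixes f :: "'a::euclidean_space \<Rightarrow> real"
  assumes c: "continuous_on (- {0}) f" and hom: "\<And>s x. 0 < s \<Longrightarrow> x \<noteq> 0 \<Longrightarrow> f (s *\<^sub>R x) = f x"
  shows "\<exists>m M z. z \<noteq> 0 \<and> f z = m \<and> (\<forall>x. x \<noteq> 0 \<longrightarrow> m \<le> f x \<and> f x \<le> M)"
proof -
  have cs: "continuous_on (sphere 0 1) f" by (rule continuous_on_subset[OF c]) auto
  have ne: "sphere (0::'a) 1 \<noteq> {}" by simp
  obtain z where z: "z \<in> sphere 0 1" "\<And>y. y \<in> sphere 0 1 \<Longrightarrow> f z \<le> f y"
    using continuous_attains_inf[OF compact_sphere ne cs] by blast
  obtain w where w: "\<And>y. y \<in> sphere 0 1 \<Longrightarrow> f y \<le> f w"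
    using continuous_attains_sup[OF compact_sphere ne cs] by blast
  have sg: "sgn x \<in> sphere 0 1" "f (sgn x) = f x" if "x \<noteq> 0" for x
    using that hom[of "inverse (norm x)" x] by (auto simp: norm_sgn sgn_div_norm)
  have "z \<noteq> 0" using z(1) by auto
  moreover have "\<forall>x. x \<noteq> 0 \<longrightarrow> f z \<le> f x \<and> f x \<le> f w"
    using z(2) w sg by metis
  ultimately show ?thesis by blast
qed

lemma powr_superadditive:
  fixes a b s :: real assumes "0 \<le> a" "0 \<le> b" "1 \<le> s"
  shows "a powr s + b powr s \<le> (a + b) powr s"
proof (cases "a + b = 0")
  case False
  have e: "y powr s = y * y powr (s - 1)" if "0 \<le> y" for y
    using that assms by (cases "y = 0") (auto simp: powr_mult_base)
  have "a * a powr (s - 1) + b * b powr (s - 1) \<le> a * (a + b) powr (s - 1) + b * (a + b) powr (s - 1)"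
    using assms by (intro add_mono mult_left_mono powr_mono2) auto
  then show ?thesis using assms by (simp add: e distrib_right)
next
  case True
  then have "a = 0" "b = 0" using assms by auto
  then show ?thesis by simp
qed

lemma powr_midpoint:
  fixes a b s :: real assumes "0 \<le> a" "0 \<le> b" "1 \<le> s"
  shows "((a + b) / 2) powr s \<le> (a powr s + b powr s) / 2"
proof (cases "a + b = 0")
  case False
  then have m: "0 < (a + b) / 2" using assms by auto
  from powr_above_tangent[OF assms(3) m assms(1)] powr_above_tangent[OF assms(3) m assms(2)]
  have "2 * ((a + b) / 2) powr s + s * ((a + b) / 2) powr (s - 1) * (a - (a + b) / 2 + (b - (a + b) / 2)) \<le> a powr s + b powr s"
    unfolding distrib_left by linarith
  then show ?thesis by (simp add: field_simps)
qed (use assms in auto)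

locale finsler =
  fixes H :: "'a::euclidean_space \<Rightarrow> real"
  assumes fm: "finsler_minkowski H"
begin

lemma H_nonneg: "0 \<le> H x" and H_zero: "H x = 0 \<longleftrightarrow> x = 0" and H_scale: "H (t *\<^sub>R x) = \<bar>t\<bar> * H x"
  and H_smooth: "smooth_on (UNIV - {0}) H"
  and H_hess: "x \<noteq> 0 \<Longrightarrow> v \<noteq> 0 \<Longrightarrow> hessian_quad (\<lambda>x. (H x)\<^sup>2 / 2) x v > 0"
  using fm unfolding finsler_minkowski_def by auto

lemma H_0 [simp]: "H 0 = 0" by (simp add: H_zero)

lemma H_pos: "x \<noteq> 0 \<Longrightarrow> 0 < H x"
  using H_nonneg[of x] H_zero[of x] by linarith

lemma smooth_nz:
  assumes "smooth_on (UNIV - {0::'a}) f" "x \<noteq> 0"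
  shows "(f has_derivative frechet_derivative f (at x)) (at x)"
proof -
  have "f differentiable (at x within (UNIV - {0}))"
    using smooth_onD(1)[OF assms(1)] assms(2) by (auto simp: differentiable_on_def)
  then have "f differentiable (at x)"
    using assms(2) by (subst (asm) at_within_open) auto
  then show ?thesis by (simp add: frechet_derivative_works)
qed

lemma smooth_nz_cont: "smooth_on (UNIV - {0::'a}) f \<Longrightarrow> continuous_on (- {0}) f"
  using smooth_onD(1)[of _ f] by (metis Compl_eq_Diff_UNIV differentiable_imp_continuous_on)

text \<open>The directions come before the point, so that for fixed directions these are functions
  of the point to which smoothness applies.\<close>

definition H1 where "H1 v x = frechet_derivative H (at x) v"
definition H2 where "H2 v w x = frechet_derivative (H1 v) (at x) w"

lemma H1_smooth: "smooth_on (UNIV - {0}) (H1 v)"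
  unfolding H1_def[abs_def] by (rule smooth_onD(2)[OF H_smooth])

lemma H2_smooth: "smooth_on (UNIV - {0}) (H2 v w)"
  unfolding H2_def[abs_def] by (rule smooth_onD(2)[OF H1_smooth])

lemma H_deriv1: "x \<noteq> 0 \<Longrightarrow> (H has_derivative (\<lambda>v. H1 v x)) (at x)"
  using smooth_nz[OF H_smooth] by (simp add: H1_def)

lemma H1_deriv: "x \<noteq> 0 \<Longrightarrow> (H1 v has_derivative (\<lambda>w. H2 v w x)) (at x)"
  using smooth_nz[OF H1_smooth] by (simp add: H2_def)

lemma H1_sum: "x \<noteq> 0 \<Longrightarrow> H1 v x = (\<Sum>b\<in>Basis. (v \<bullet> b) * H1 b x)"
proof -
  assume "x \<noteq> 0"
  then interpret L: bounded_linear "\<lambda>v. H1 v x" using H_deriv1 by (auto intro: has_derivative_bounded_linear)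
  have "H1 v x = H1 (\<Sum>b\<in>Basis. (v \<bullet> b) *\<^sub>R b) x" by (simp add: euclidean_representation)
  then show ?thesis by (simp add: L.sum L.scaleR)
qed

lemma H1_grad: "x \<noteq> 0 \<Longrightarrow> H1 v x = grad H x \<bullet> v"
  by (subst H1_sum, assumption)
    (simp add: grad_def inner_sum_left H1_def[symmetric] inner_commute[of v] mult.commute)

lemma H_deriv: "x \<noteq> 0 \<Longrightarrow> (H has_derivative (\<lambda>v. grad H x \<bullet> v)) (at x)"
  using H_deriv1[of x] by (simp add: H1_grad)

lemma grad_H_cont: "continuous_on (- {0}) (grad H)"
  unfolding grad_def[abs_def] H1_def[symmetric]
  by (intro continuous_intros smooth_nz_cont H1_smooth)

text \<open>Expanding in a basis reduces joint continuity in the point and the directions to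
  finitely many coefficient functions of the point alone. Linearity in v follows by differentiating
  \<open>H1_sum\<close>.\<close>

lemma H2_sum: "x \<noteq> 0 \<Longrightarrow> H2 v w x = (\<Sum>b\<in>Basis. \<Sum>b'\<in>Basis. (v \<bullet> b) * (w \<bullet> b') * H2 b b' x)"
proof -
  assume x: "x \<noteq> 0"
  have "((\<lambda>y. \<Sum>b\<in>Basis. (v \<bullet> b) * H1 b y) has_derivative (\<lambda>w. \<Sum>b\<in>Basis. (v \<bullet> b) * H2 b w x)) (at x)"
    by (intro has_derivative_sum has_derivative_mult_right H1_deriv x)
  then have "(H1 v has_derivative (\<lambda>w. \<Sum>b\<in>Basis. (v \<bullet> b) * H2 b w x)) (at x)"
    by (rule has_derivative_transform_within_open[where s="- {0}"]) (use x H1_sum in auto)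
  from has_derivative_unique[OF H1_deriv[OF x] this]
  have 1: "H2 v w x = (\<Sum>b\<in>Basis. (v \<bullet> b) * H2 b w x)" by metis
  have "H2 b w x = (\<Sum>b'\<in>Basis. (w \<bullet> b') * H2 b b' x)" for b
  proof -
    interpret L: bounded_linear "\<lambda>w. H2 b w x" using H1_deriv[OF x] by (auto intro: has_derivative_bounded_linear)
    have "H2 b w x = H2 b (\<Sum>b'\<in>Basis. (w \<bullet> b') *\<^sub>R b') x" by (simp add: euclidean_representation)
    then show ?thesis by (simp add: L.sum L.scaleR)
  qed
  then show ?thesis using 1 by (simp add: sum_distrib_left mult.assoc)
qed

lemma H1_hom: "s \<noteq> 0 \<Longrightarrow> x \<noteq> 0 \<Longrightarrow> H1 v (s *\<^sub>R x) = \<bar>s\<bar> / s * H1 v x"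
  using frechet_derivative_homogeneous[of H "\<lambda>x v. H1 v x" s "\<bar>s\<bar>" x v] H_deriv1 H_scale by auto

lemma H2_hom: "0 < s \<Longrightarrow> x \<noteq> 0 \<Longrightarrow> H2 v w (s *\<^sub>R x) = H2 v w x / s"
  using frechet_derivative_homogeneous[of "H1 v" "\<lambda>x w. H2 v w x" s 1 x w] H1_deriv H1_hom[of s _ v] by auto

lemma half_square_deriv:
  assumes "x \<noteq> 0"
  shows "((\<lambda>x. (H x)\<^sup>2 / 2) has_derivative (\<lambda>v. H x * H1 v x)) (at x)"
    "((\<lambda>y. H y * H1 v y) has_derivative (\<lambda>w. H x * H2 v w x + H1 w x * H1 v x)) (at x)"
  using assms by (auto intro!: derivative_eq_intros H_deriv1 H1_deriv simp: fun_eq_iff)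

lemma hessian_eq:
  assumes x: "x \<noteq> 0"
  shows "hessian_quad (\<lambda>x. (H x)\<^sup>2 / 2) x v = H x * H2 v v x + H1 v x * H1 v x"
proof -
  have 1: "frechet_derivative (\<lambda>x. (H x)\<^sup>2 / 2) (at y) v = H y * H1 v y" if "y \<noteq> 0" for y
    using frechet_derivative_at[OF half_square_deriv(1)[OF that]] by metis
  have "((\<lambda>y. frechet_derivative (\<lambda>x. (H x)\<^sup>2 / 2) (at y) v) has_derivative (\<lambda>w. H x * H2 v w x + H1 w x * H1 v x)) (at x)"
    by (rule has_derivative_transform_within_open[OF half_square_deriv(2)[OF x], where s="- {0}"])
      (use x 1 in auto)
  from frechet_derivative_at[OF this] show ?thesis unfolding hessian_quad_def by metis
qed

lemma H_bounds: "\<exists>k>0. \<exists>K>0. \<forall>x. k * norm x \<le> H x \<and> H x \<le> K * norm x"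
proof -
  have "\<exists>m M z. z \<noteq> 0 \<and> H z / norm z = m \<and> (\<forall>x. x \<noteq> 0 \<longrightarrow> m \<le> H x / norm x \<and> H x / norm x \<le> M)"
    by (rule bound_on_nonzero[of "\<lambda>x. H x / norm x"])
      (auto intro!: continuous_on_divide smooth_nz_cont[OF H_smooth] continuous_on_norm_id simp: H_scale)
  then obtain m M z where z: "z \<noteq> 0" "H z / norm z = m" and
    b: "\<And>x. x \<noteq> 0 \<Longrightarrow> m \<le> H x / norm x" "\<And>x. x \<noteq> 0 \<Longrightarrow> H x / norm x \<le> M" by blast
  have m: "0 < m" using z H_pos by auto
  have "m \<le> M" using b z by fastforce
  moreover have "m * norm x \<le> H x \<and> H x \<le> M * norm x" for x
    using b[of x] by (cases "x = 0") (auto simp: field_simps)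
  ultimately show ?thesis using m by (intro exI[of _ m] conjI exI[of _ M]) auto
qed

lemma H_cont: "continuous_on UNIV H"
proof -
  obtain K where K: "\<And>x. H x \<le> K * norm x" using H_bounds by blast
  have "isCont H x" for x
  proof (cases "x = 0")
    case True
    have "(H \<longlongrightarrow> 0) (at 0)"
    proof (rule Lim_null_comparison)
      show "\<forall>\<^sub>F x in at 0. norm (H x) \<le> K * norm x" using K H_nonneg by (intro always_eventually) auto
      show "((\<lambda>x. K * norm x) \<longlongrightarrow> 0) (at 0)" by (auto intro!: tendsto_eq_intros)
    qed
    then show ?thesis using True by (simp add: isCont_def)
  next
    case False then show ?thesis using H_deriv has_derivative_continuous by blast
  qed
  then show ?thesis by (simp add: continuous_on_eq_continuous_at)
qed

lemma grad_H_bound: "\<exists>C>0. \<forall>x. x \<noteq> 0 \<longrightarrow> norm (grad H x) \<le> C"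
proof -
  have "norm (grad H (s *\<^sub>R x)) = norm (grad H x)" if "0 < s" "x \<noteq> 0" for s x
  proof -
    have "grad H (s *\<^sub>R x) = grad H x"
      unfolding grad_def H1_def[symmetric] using H1_hom[of s x] that by simp
    then show ?thesis by simp
  qed
  then obtain M where "\<And>x. x \<noteq> 0 \<Longrightarrow> norm (grad H x) \<le> M"
    using bound_on_nonzero[of "\<lambda>x. norm (grad H x)"] grad_H_cont by (metis continuous_on_norm)
  then show ?thesis by (intro exI[of _ "\<bar>M\<bar> + 1"]) (force intro: order_trans)
qed

text \<open>The form has degree 0 in x and 2 in v, so its minimum over the product of two unit
  spheres, positive by hypothesis, is a uniform constant.\<close>

lemma hessian_lower: "\<exists>c>0. \<forall>x v. x \<noteq> 0 \<longrightarrow> c * (norm v)\<^sup>2 \<le> H x * H2 v v x + H1 v x * H1 v x"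
proof -
  define Q where "Q = (\<lambda>w. H (fst w) * (\<Sum>b\<in>Basis. \<Sum>b'\<in>Basis. (snd w \<bullet> b) * (snd w \<bullet> b') * H2 b b' (fst w))
     + (grad H (fst w) \<bullet> snd w) * (grad H (fst w) \<bullet> snd w))"
  have Q: "Q (x, v) = H x * H2 v v x + H1 v x * H1 v x" if "x \<noteq> 0" for x v
    using that unfolding Q_def by (simp add: H1_grad H2_sum[of x v v])
  let ?S = "sphere (0::'a) 1 \<times> sphere (0::'a) 1"
  have fc: "continuous_on ?S (\<lambda>w. f (fst w))" if "continuous_on (- {0}) f" for f :: "'a \<Rightarrow> 'b::topological_space"
    by (rule continuous_on_compose2[OF that]) (auto intro!: continuous_intros)
  have "continuous_on ?S Q" unfolding Q_def
    by (intro continuous_intros fc smooth_nz_cont H_smooth H2_smooth grad_H_cont)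
  moreover have "compact ?S" by (intro compact_Times) auto
  moreover have "?S \<noteq> {}" by simp
  ultimately obtain z where z: "z \<in> ?S" "\<And>w. w \<in> ?S \<Longrightarrow> Q z \<le> Q w"
    using continuous_attains_inf by metis
  define c where "c = Q z"
  have "fst z \<noteq> 0" "snd z \<noteq> 0" using z(1) by auto
  then have c: "0 < c" using H_hess[of "fst z" "snd z"] Q[of "fst z" "snd z"]
    unfolding c_def by (simp add: hessian_eq)
  have "c * (norm v)\<^sup>2 \<le> H x * H2 v v x + H1 v x * H1 v x" if x: "x \<noteq> 0" for x v
  proof (cases "v = 0")
    case True
    then show ?thesis using x by (simp add: H1_grad H2_sum[of x 0])
  next
    case False
    have i: "H (sgn x) = inverse (norm x) * H x" by (simp add: sgn_div_norm H_scale)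
    have h2: "H2 b b' (sgn x) = norm x * H2 b b' x" for b b'
      unfolding sgn_div_norm using H2_hom[of "inverse (norm x)" x b b'] x
      by (simp add: divide_inverse mult.commute)
    have h1: "grad H (sgn x) = grad H x"
      unfolding grad_def H1_def[symmetric] sgn_div_norm using H1_hom[of "inverse (norm x)" x] x by simp
    have "c \<le> Q (sgn x, sgn v)"
      unfolding c_def using x False by (intro z(2)) (auto simp: norm_sgn)
    also have "Q (sgn x, sgn v) = Q (x, v) / (norm v)\<^sup>2"
    proof -
      have "H (sgn x) * (\<Sum>b\<in>Basis. \<Sum>b'\<in>Basis. (sgn v \<bullet> b) * (sgn v \<bullet> b') * H2 b b' (sgn x))
        = H x * (\<Sum>b\<in>Basis. \<Sum>b'\<in>Basis. (v \<bullet> b) * (v \<bullet> b') * H2 b b' x) / (norm v)\<^sup>2"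
      proof -
        have "(\<Sum>b\<in>Basis. \<Sum>b'\<in>Basis. (sgn v \<bullet> b) * (sgn v \<bullet> b') * (norm x * H2 b b' x))
          = norm x * (\<Sum>b\<in>Basis. \<Sum>b'\<in>Basis. (v \<bullet> b) * (v \<bullet> b') * H2 b b' x) / (norm v)\<^sup>2"
          by (simp add: sum_distrib_left sum_divide_distrib sgn_div_norm power2_eq_square divide_inverse mult_ac)
        then show ?thesis unfolding i h2 using x by simp
      qed
      moreover have "grad H (sgn x) \<bullet> sgn v = (grad H x \<bullet> v) / norm v"
        unfolding h1 by (simp add: sgn_div_norm divide_inverse mult.commute)
      ultimately show ?thesis by (simp add: Q_def power2_eq_square add_divide_distrib)
    qed
    finally show ?thesis using False Q[OF x, of v] by (simp add: field_simps)
  qed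
  with c show ?thesis by blast
qed

text \<open>Strong midpoint convexity: along a segment H^2/2 minus a small quadratic has nonnegative
  second derivative. This fails to make sense only if the segment meets 0, where H^2 need not be
  twice differentiable.\<close>

lemma H_square_convex:
  "\<exists>c>0. \<forall>x y. (H ((1/2) *\<^sub>R (x + y)))\<^sup>2 + c * (norm (x - y))\<^sup>2 \<le> ((H x)\<^sup>2 + (H y)\<^sup>2) / 2"
proof -
  obtain c where c: "c > 0" "\<And>x v. x \<noteq> 0 \<Longrightarrow> c * (norm v)\<^sup>2 \<le> H x * H2 v v x + H1 v x * H1 v x"
    using hessian_lower by blast
  obtain k where k: "k > 0" "\<And>x. k * norm x \<le> H x" using H_bounds by blast
  \<comment> \<open>The 4 comes from |x - y|^2 = 4|w|^2; k^2/4 is what the degenerate case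
    yields.\<close>
  define c' where "c' = min (c / 4) (k\<^sup>2 / 4)"
  have c': "c' > 0" "c' \<le> c / 4" "c' \<le> k\<^sup>2 / 4" using c k by (auto simp: c'_def)
  have "(H ((1/2) *\<^sub>R (x + y)))\<^sup>2 + c' * (norm (x - y))\<^sup>2 \<le> ((H x)\<^sup>2 + (H y)\<^sup>2) / 2" for x y
  proof -
    define m where "m = (1/2) *\<^sub>R (x + y)"
    define w where "w = (1/2) *\<^sub>R (x - y)"
    have xy: "x = m + 1 *\<^sub>R w" "y = m + (-1) *\<^sub>R w" "m = m + 0 *\<^sub>R w"
      unfolding m_def w_def by (auto simp: algebra_simps scaleR_left_distrib[symmetric])
    have nw: "(norm (x - y))\<^sup>2 = 4 * (norm w)\<^sup>2" unfolding w_def by (simp add: power_mult_distrib power2_eq_square)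
    have main: "2 * (H m)\<^sup>2 + 2 * (4 * c' * (norm w)\<^sup>2) \<le> (H x)\<^sup>2 + (H y)\<^sup>2"
    \<comment> \<open>If the segment passes through 0, then x, y and m are multiples of w and the
      parallelogram identity for H^2 holds along that line.\<close>
    proof (cases "\<exists>t\<in>{-1..1}. m + t *\<^sub>R w = 0")
      case True
      then obtain t where "m + t *\<^sub>R w = 0" by blast
      then have mt: "m = (- t) *\<^sub>R w" by (simp add: add_eq_0_iff2)
      have "x = (1 - t) *\<^sub>R w" "y = (- 1 - t) *\<^sub>R w" using xy(1,2) mt by (simp_all add: algebra_simps)
      then have "(H x)\<^sup>2 = (1 - t)\<^sup>2 * (H w)\<^sup>2" "(H y)\<^sup>2 = (- 1 - t)\<^sup>2 * (H w)\<^sup>2" "(H m)\<^sup>2 = t\<^sup>2 * (H w)\<^sup>2"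
        using mt by (simp_all only: H_scale power_mult_distrib power2_abs power2_minus)
      then have "(H x)\<^sup>2 + (H y)\<^sup>2 = 2 * (H m)\<^sup>2 + 2 * (H w)\<^sup>2"
        by (simp add: power2_eq_square algebra_simps)
      moreover have "4 * c' * (norm w)\<^sup>2 \<le> (H w)\<^sup>2"
      proof -
        have "4 * c' * (norm w)\<^sup>2 \<le> k\<^sup>2 * (norm w)\<^sup>2" using c' by (intro mult_right_mono) auto
        also have "\<dots> = (k * norm w)\<^sup>2" by (simp add: power_mult_distrib)
        also have "\<dots> \<le> (H w)\<^sup>2" using k by (intro power_mono) auto
        finally show ?thesis .
      qed
      ultimately show ?thesis by simp
    next
      case False
      define \<phi> where "\<phi> = (\<lambda>t. (H (m + t *\<^sub>R w))\<^sup>2 / 2 - c * (norm w)\<^sup>2 * (t\<^sup>2 / 2))"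
      define \<phi>1 where "\<phi>1 = (\<lambda>t. H (m + t *\<^sub>R w) * H1 w (m + t *\<^sub>R w) - c * (norm w)\<^sup>2 * t)"
      define \<phi>2 where "\<phi>2 = (\<lambda>t. H (m + t *\<^sub>R w) * H2 w w (m + t *\<^sub>R w) + H1 w (m + t *\<^sub>R w) * H1 w (m + t *\<^sub>R w) - c * (norm w)\<^sup>2)"
      have ln: "((\<lambda>t. m + t *\<^sub>R w) has_derivative (\<lambda>h. h *\<^sub>R w)) (at t)" for t
        by (auto intro!: derivative_eq_intros)
      have "convex_on {-1..1} \<phi>"
      proof (rule f''_ge0_imp_convex)
        fix t :: real assume t: "t \<in> {-1..1}"
        then have nz: "m + t *\<^sub>R w \<noteq> 0" using False by blast
        have l1: "H1 (h *\<^sub>R w) (m + t *\<^sub>R w) = h * H1 w (m + t *\<^sub>R w)" for h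
          using nz by (simp add: H1_grad)
        have l2: "H2 w (h *\<^sub>R w) (m + t *\<^sub>R w) = h * H2 w w (m + t *\<^sub>R w)" for h
          using linear_scale[OF bounded_linear.linear[OF has_derivative_bounded_linear[OF H1_deriv[OF nz, of w]]]] by simp
        have "((\<lambda>t. (H (m + t *\<^sub>R w))\<^sup>2 / 2) has_real_derivative H (m + t *\<^sub>R w) * H1 w (m + t *\<^sub>R w)) (at t)"
          unfolding has_field_derivative_def
          by (rule has_derivative_eq_rhs[OF has_derivative_compose[OF ln half_square_deriv(1)[OF nz]]])
            (simp add: fun_eq_iff l1)
        then show "(\<phi> has_real_derivative \<phi>1 t) (at t)"
          unfolding \<phi>_def \<phi>1_def by (rule DERIV_diff) (auto intro!: derivative_eq_intros)
        have "((\<lambda>t. H (m + t *\<^sub>R w) * H1 w (m + t *\<^sub>R w)) has_real_derivative H (m + t *\<^sub>R w) * H2 w w (m + t *\<^sub>R w) + H1 w (m + t *\<^sub>R w) * H1 w (m + t *\<^sub>R w)) (at t)"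
          unfolding has_field_derivative_def
          by (rule has_derivative_eq_rhs[OF has_derivative_compose[OF ln half_square_deriv(2)[OF nz]]])
            (simp add: fun_eq_iff l1 l2 algebra_simps)
        then show "(\<phi>1 has_real_derivative \<phi>2 t) (at t)"
          unfolding \<phi>1_def \<phi>2_def by (rule DERIV_diff) (auto intro!: derivative_eq_intros)
        show "0 \<le> \<phi>2 t" unfolding \<phi>2_def using c(2)[OF nz, of w] by simp
      qed simp
      then have "\<phi> ((1 - 1/2) *\<^sub>R (-1) + (1/2) *\<^sub>R 1) \<le> (1 - 1/2) * \<phi> (-1) + (1/2) * \<phi> 1"
        by (intro convex_onD) auto
      then have "2 * \<phi> 0 \<le> \<phi> (-1) + \<phi> 1" by simp
      moreover have "\<phi> 1 = (H x)\<^sup>2 / 2 - c * (norm w)\<^sup>2 / 2" "\<phi> (-1) = (H y)\<^sup>2 / 2 - c * (norm w)\<^sup>2 / 2" "\<phi> 0 = (H m)\<^sup>2 / 2"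
        unfolding \<phi>_def xy(1)[symmetric] xy(2)[symmetric] xy(3)[symmetric] by simp_all
      ultimately have "2 * (H m)\<^sup>2 + 2 * (c * (norm w)\<^sup>2) \<le> (H x)\<^sup>2 + (H y)\<^sup>2"
        by linarith
      moreover have "4 * c' * (norm w)\<^sup>2 \<le> c * (norm w)\<^sup>2" using c' by (intro mult_right_mono) auto
      ultimately show ?thesis by linarith
    qed
    show ?thesis unfolding nw m_def[symmetric] using main by simp
  qed
  with c'(1) show ?thesis by blast
qed

text \<open>Write H^p as (H^2)^(p/2) and raise the quadratic inequality to the power p/2 \<ge> 1,
  using superadditivity on the left and convexity on the right. With c inside the power, one
  constant serves both p and q.\<close>

lemma H_powr_convex:
  "\<exists>c>0. \<forall>p\<ge>2. \<forall>x y. H ((1/2) *\<^sub>R (x + y)) powr p + (c * norm (x - y)) powr p \<le> (H x powr p + H y powr p) / 2"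
proof -
  obtain c where c: "c > 0"
    "\<And>x y. (H ((1/2) *\<^sub>R (x + y)))\<^sup>2 + c * (norm (x - y))\<^sup>2 \<le> ((H x)\<^sup>2 + (H y)\<^sup>2) / 2"
    using H_square_convex by blast
  have sq: "h powr p = (h\<^sup>2) powr (p / 2)" if "0 \<le> h" for h p :: real
  proof -
    have "h\<^sup>2 = h powr 2" using that by simp
    then show ?thesis by (simp only: powr_powr) simp
  qed
  have "H ((1/2) *\<^sub>R (x + y)) powr p + (sqrt c * norm (x - y)) powr p \<le> (H x powr p + H y powr p) / 2"
    if p: "p \<ge> 2" for p x y
  proof -
    have e1: "H z powr p = ((H z)\<^sup>2) powr (p/2)" for z by (rule sq[OF H_nonneg])
    have e2: "(sqrt c * norm (x - y)) powr p = (c * (norm (x - y))\<^sup>2) powr (p/2)"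
      using c(1) by (subst sq) (auto simp: power_mult_distrib)
    have "H ((1/2) *\<^sub>R (x + y)) powr p + (sqrt c * norm (x - y)) powr p
      = ((H ((1/2) *\<^sub>R (x + y)))\<^sup>2) powr (p/2) + (c * (norm (x - y))\<^sup>2) powr (p/2)"
      unfolding e1 e2 ..
    also have "\<dots> \<le> ((H ((1/2) *\<^sub>R (x + y)))\<^sup>2 + c * (norm (x - y))\<^sup>2) powr (p/2)"
      using p c(1) by (intro powr_superadditive) auto
    also have "\<dots> \<le> (((H x)\<^sup>2 + (H y)\<^sup>2) / 2) powr (p/2)"
      using p c by (intro powr_mono2 c(2)) auto
    also have "\<dots> \<le> (((H x)\<^sup>2) powr (p/2) + ((H y)\<^sup>2) powr (p/2)) / 2"
      using p by (intro powr_midpoint) auto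
    finally show ?thesis unfolding e1 .
  qed
  then show ?thesis using c(1) by (intro exI[of _ "sqrt c"]) auto
qed

lemma H_powr_deriv:
  assumes p: "1 < p"
  shows "((\<lambda>x. H x powr p) has_derivative (\<lambda>h. p * (H x powr (p - 1) * (grad H x \<bullet> h)))) (at x)"
proof (cases "x = 0")
  case False
  then have "0 < H x" by (rule H_pos)
  then have d: "((\<lambda>y. y powr p) has_derivative (\<lambda>h. p * H x powr (p - 1) * h)) (at (H x))"
    unfolding has_field_derivative_def[symmetric] by (rule has_real_derivative_powr)
  show ?thesis
    by (rule has_derivative_eq_rhs[OF has_derivative_compose[OF H_deriv[OF False] d]]) (simp add: fun_eq_iff)
next
  \<comment> \<open>At the origin H^p is of order |h|^p with p > 1, so the derivative is 0. The
    formula agrees whatever value \<open>grad H 0\<close> has, because H 0 raised to p - 1 is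
    0.\<close>
  case True
  obtain K where K: "K > 0" "\<And>x. H x \<le> K * norm x" using H_bounds by blast
  have "((\<lambda>x. H x powr p) has_derivative (\<lambda>h. 0)) (at 0)"
    unfolding has_derivative_at
  proof (intro conjI bounded_linear_zero)
    show "(\<lambda>h. norm (H (0 + h) powr p - H 0 powr p - 0) / norm h) \<midarrow>0\<rightarrow> 0"
    proof (rule Lim_null_comparison)
      show "\<forall>\<^sub>F h in at 0. norm (norm (H (0 + h) powr p - H 0 powr p - 0) / norm h) \<le> K powr p * norm h powr (p - 1)"
      proof (intro always_eventually allI)
        fix h :: 'a
        have "H h powr p \<le> (K * norm h) powr p" using K p H_nonneg by (intro powr_mono2) auto
        also have "\<dots> = K powr p * norm h powr (p - 1) * norm h"
          by (cases "h = 0") (simp_all add: powr_mult powr_diff)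
        finally show "norm (norm (H (0 + h) powr p - H 0 powr p - 0) / norm h) \<le> K powr p * norm h powr (p - 1)"
          by (cases "h = 0") (simp_all add: divide_le_eq)
      qed
      have "isCont (\<lambda>h::'a. K powr p * norm h powr (p - 1)) 0"
        using p continuous_on_powr_nonneg[of UNIV "norm :: 'a \<Rightarrow> real" "p - 1"]
        by (intro continuous_intros) (auto simp: continuous_on_eq_continuous_at intro!: continuous_intros)
      then show "(\<lambda>h::'a. K powr p * norm h powr (p - 1)) \<midarrow>0\<rightarrow> 0"
        using p by (simp add: isCont_def)
    qed
  qed
  then show ?thesis using True p by simp
qed

end

section \<open>The double phase energy\<close>

text \<open>The majorant may depend on k up to a part that vanishes in L^1. This is how convergence
  in a modular or in L^r passes to nonlinear integrands of the same growth.\<close>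

lemma dominated_convergence_perturbed:
  fixes f :: "nat \<Rightarrow> 'a \<Rightarrow> real"
  assumes [measurable]: "\<And>k. f k \<in> borel_measurable M" "f0 \<in> borel_measurable M"
    and lim: "AE x in M. (\<lambda>k. f k x) \<longlonglongrightarrow> f0 x"
    and bd: "\<And>k. AE x in M. \<bar>f k x\<bar> \<le> w k x + g x" and bd0: "AE x in M. \<bar>f0 x\<bar> \<le> g x"
    and w: "\<And>k. integrable M (w k)" "\<And>k x. 0 \<le> w k x" "(\<lambda>k. \<integral>x. w k x \<partial>M) \<longlonglongrightarrow> 0"
    and g: "integrable M g"
  shows "integrable M f0 \<and> (\<lambda>k. \<integral>x. f k x \<partial>M) \<longlonglongrightarrow> (\<integral>x. f0 x \<partial>M)"
proof -
  note [measurable] = borel_measurable_integrable[OF w(1)] borel_measurable_integrable[OF g]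
  have fi: "integrable M (f k)" for k
  proof (rule Bochner_Integration.integrable_bound[OF Bochner_Integration.integrable_add[OF w(1)[of k] g]])
    show "AE x in M. norm (f k x) \<le> norm (w k x + g x)"
      using bd[of k] by eventually_elim simp
  qed measurable
  have f0i: "integrable M f0"
    by (rule Bochner_Integration.integrable_bound[OF g]) (use bd0 in \<open>auto elim!: eventually_mono\<close>)
  \<comment> \<open>The excess of |f k - f0| over w k is dominated by 2g. Conversion to
    \<open>ennreal\<close> truncates it at 0.\<close>
  have c: "(\<lambda>k. \<integral>\<^sup>+x. ennreal (\<bar>f k x - f0 x\<bar> - w k x) \<partial>M) \<longlonglongrightarrow> (\<integral>\<^sup>+x. 0 \<partial>M)"
  proof (rule nn_integral_dominated_convergence[where w="\<lambda>x. ennreal (2 * g x)"])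
    show "AE x in M. ennreal (\<bar>f k x - f0 x\<bar> - w k x) \<le> ennreal (2 * g x)" for k
      using bd[of k] bd0 by eventually_elim (auto intro!: ennreal_leI)
    show "(\<integral>\<^sup>+x. ennreal (2 * g x) \<partial>M) < \<infinity>"
    proof -
      have "integrable M (\<lambda>x. 2 * g x)" using g by simp
      then have "(\<integral>\<^sup>+x. ennreal (norm (2 * g x)) \<partial>M) < \<infinity>" unfolding integrable_iff_bounded by blast
      moreover have "(\<integral>\<^sup>+x. ennreal (2 * g x) \<partial>M) \<le> (\<integral>\<^sup>+x. ennreal (norm (2 * g x)) \<partial>M)"
        by (intro nn_integral_mono ennreal_leI) simp
      ultimately show ?thesis by (rule le_less_trans[rotated])
    qed
    show "AE x in M. (\<lambda>k. ennreal (\<bar>f k x - f0 x\<bar> - w k x)) \<longlonglongrightarrow> 0"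
      using lim
    proof eventually_elim
      case (elim x)
      have "(\<lambda>k. ennreal \<bar>f k x - f0 x\<bar>) \<longlonglongrightarrow> ennreal 0"
        by (intro tendsto_ennrealI tendsto_rabs_zero LIM_zero elim)
      then have up: "(\<lambda>k. ennreal \<bar>f k x - f0 x\<bar>) \<longlonglongrightarrow> 0" by simp
      show ?case
        by (rule tendsto_sandwich[OF _ _ tendsto_const up])
          (auto intro!: always_eventually ennreal_leI simp: w(2))
    qed
  qed measurable
  have "(\<lambda>k. \<integral>\<^sup>+x. ennreal (norm (f k x - f0 x)) \<partial>M) \<longlonglongrightarrow> 0"
  proof (rule tendsto_sandwich[OF _ _ tendsto_const])
    show "(\<lambda>k. ennreal (\<integral>x. w k x \<partial>M) + (\<integral>\<^sup>+x. ennreal (\<bar>f k x - f0 x\<bar> - w k x) \<partial>M)) \<longlonglongrightarrow> 0"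
      using tendsto_add[OF tendsto_ennrealI[OF w(3)] c] by simp
    show "\<forall>\<^sub>F k in sequentially. (\<integral>\<^sup>+x. ennreal (norm (f k x - f0 x)) \<partial>M)
       \<le> ennreal (\<integral>x. w k x \<partial>M) + (\<integral>\<^sup>+x. ennreal (\<bar>f k x - f0 x\<bar> - w k x) \<partial>M)"
    proof (intro always_eventually allI)
      fix k
      have "(\<integral>\<^sup>+x. ennreal (norm (f k x - f0 x)) \<partial>M)
        \<le> (\<integral>\<^sup>+x. ennreal (w k x) + ennreal (\<bar>f k x - f0 x\<bar> - w k x) \<partial>M)"
      proof (rule nn_integral_mono)
        fix x
        show "ennreal (norm (f k x - f0 x)) \<le> ennreal (w k x) + ennreal (\<bar>f k x - f0 x\<bar> - w k x)"
          using w(2)[of k x] by (cases "w k x \<le> \<bar>f k x - f0 x\<bar>")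
            (auto simp: ennreal_plus[symmetric] ennreal_neg ennreal_leI simp del: ennreal_plus)
      qed
      also have "\<dots> = (\<integral>\<^sup>+x. ennreal (w k x) \<partial>M) + (\<integral>\<^sup>+x. ennreal (\<bar>f k x - f0 x\<bar> - w k x) \<partial>M)"
        by (rule nn_integral_add) measurable
      also have "(\<integral>\<^sup>+x. ennreal (w k x) \<partial>M) = ennreal (\<integral>x. w k x \<partial>M)"
        using w(1,2) by (intro nn_integral_eq_integral) auto
      finally show "(\<integral>\<^sup>+x. ennreal (norm (f k x - f0 x)) \<partial>M)
       \<le> ennreal (\<integral>x. w k x \<partial>M) + (\<integral>\<^sup>+x. ennreal (\<bar>f k x - f0 x\<bar> - w k x) \<partial>M)" .
    qed
  qed auto
  then have "(\<lambda>k. \<integral>x. f k x \<partial>M) \<longlonglongrightarrow> (\<integral>x. f0 x \<partial>M)"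
    by (rule tendsto_L1_int[OF fi f0i])
  with f0i show ?thesis ..
qed

lemma powr_add_le:
  fixes s t p :: real assumes "0 \<le> s" "0 \<le> t" "0 \<le> p"
  shows "(s + t) powr p \<le> 2 powr p * (s powr p + t powr p)"
proof -
  have "(s + t) powr p \<le> (2 * max s t) powr p" using assms by (intro powr_mono2) auto
  also have "\<dots> = 2 powr p * (max s t) powr p" by (simp add: powr_mult)
  also have "\<dots> \<le> 2 powr p * (s powr p + t powr p)"
    by (intro mult_left_mono) (auto simp: max_def)
  finally show ?thesis .
qed

lemma dpH_nonneg: "0 \<le> \<mu> x \<Longrightarrow> 0 \<le> dpH p q \<mu> x t"
  by (simp add: dpH_def)

lemma dpH_mono:
  assumes "0 \<le> \<mu> x" "0 \<le> p" "0 \<le> q" "0 \<le> s" "s \<le> t"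
  shows "dpH p q \<mu> x s \<le> dpH p q \<mu> x t"
  unfolding dpH_def using assms by (intro add_mono mult_left_mono powr_mono2) auto

text \<open>The sum of both powers covers c below and above 1 at once.\<close>

lemma dpH_scale:
  assumes "0 \<le> \<mu> x" "0 \<le> c" "0 \<le> t"
  shows "dpH p q \<mu> x (c * t) \<le> (c powr p + c powr q) * dpH p q \<mu> x t"
proof -
  have "0 \<le> c powr p * (\<mu> x * t powr q)" "0 \<le> c powr q * t powr p" using assms by auto
  moreover have "dpH p q \<mu> x (c * t) = c powr p * t powr p + c powr q * (\<mu> x * t powr q)"
    using assms by (simp add: dpH_def powr_mult mult_ac)
  ultimately show ?thesis by (simp add: dpH_def algebra_simps)
qed

lemma dpH_add:
  assumes "0 \<le> \<mu> x" "0 \<le> p" "p \<le> q" "0 \<le> s" "0 \<le> t"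
  shows "dpH p q \<mu> x (s + t) \<le> 2 powr q * (dpH p q \<mu> x s + dpH p q \<mu> x t)"
proof -
  have "(s + t) powr p \<le> 2 powr p * (s powr p + t powr p)" using assms by (intro powr_add_le)
  also have "\<dots> \<le> 2 powr q * (s powr p + t powr p)" using assms by (intro mult_right_mono powr_mono) auto
  finally have 1: "(s + t) powr p \<le> 2 powr q * (s powr p + t powr p)" .
  have "\<mu> x * (s + t) powr q \<le> \<mu> x * (2 powr q * (s powr q + t powr q))"
    using assms by (intro mult_left_mono powr_add_le) auto
  with 1 show ?thesis by (simp add: dpH_def algebra_simps)
qed

text \<open>After scaling s by \<tau>, compare a with z^(r - 1 + \<delta>): on either side one of
  the two terms alone dominates, so no Young constants appear. The free \<tau> is later matched to
  \<rho>.\<close>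

lemma powr_young:
  fixes a s r \<delta> \<tau> :: real
  assumes "0 \<le> a" "0 \<le> s" "0 < \<tau>" "0 < \<delta>" "\<delta> < 1" "1 < r"
  shows "a * s powr (1 - \<delta>) \<le> \<tau> powr (1 - \<delta>) * (a powr (r / (r - 1 + \<delta>)) + s powr r / \<tau> powr r)"
proof -
  define z where "z = s / \<tau>"
  have z: "0 \<le> z" "s = \<tau> * z" using assms by (auto simp: z_def)
  have "a * z powr (1 - \<delta>) \<le> a powr (r / (r - 1 + \<delta>)) + z powr r"
  proof (cases "z = 0 \<or> a = 0")
    case True then show ?thesis using z by auto
  next
    case False
    then have pos: "0 < z" "0 < a" using z assms by auto
    define c where "c = r - 1 + \<delta>"
    have c: "0 < c" using assms by (simp add: c_def)
    show ?thesis
    proof (cases "a \<le> z powr c")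
      case True
      then have "a * z powr (1 - \<delta>) \<le> z powr c * z powr (1 - \<delta>)" by (intro mult_right_mono) auto
      also have "\<dots> = z powr r" using pos by (simp add: powr_add[symmetric] c_def)
      finally show ?thesis by (simp add: add_increasing)
    next
      case False
      then have "(z powr c) powr (1 / c) \<le> a powr (1 / c)" using c pos by (intro powr_mono2) auto
      then have "z \<le> a powr (1 / c)" using c pos by (simp add: powr_powr)
      then have "a * z powr (1 - \<delta>) \<le> a * (a powr (1 / c)) powr (1 - \<delta>)"
        using assms pos by (intro mult_left_mono powr_mono2) auto
      also have "\<dots> = a powr (1 + (1 - \<delta>) / c)" using pos by (simp add: powr_powr powr_add)
      also have "1 + (1 - \<delta>) / c = r / c" using c by (simp add: c_def field_simps)
      finally show ?thesis by (simp add: c_def add_increasing2)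
    qed
  qed
  then have "\<tau> powr (1 - \<delta>) * (a * z powr (1 - \<delta>)) \<le> \<tau> powr (1 - \<delta>) * (a powr (r / (r - 1 + \<delta>)) + z powr r)"
    by (intro mult_left_mono) auto
  moreover have "z powr r = s powr r / \<tau> powr r" using assms by (simp add: z_def powr_divide)
  moreover have "a * s powr (1 - \<delta>) = \<tau> powr (1 - \<delta>) * (a * z powr (1 - \<delta>))"
    by (subst z(2)) (simp add: powr_mult)
  ultimately show ?thesis by (simp only:)
qed

section \<open>The data, the functionals and their basic estimates\<close>

text \<open>Sign and size conditions are imposed at every point, so that inequalities between
  integrands need no null sets; the theorem instantiates the locale with corrected representatives
  of its data.\<close>

locale dphase = finsler H for H :: "'a::euclidean_space \<Rightarrow> real" +
  fixes \<Omega> :: "'a set" and \<mu> a b :: "'a \<Rightarrow> real" and p q \<delta> r M\<mu> Bb :: real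
  assumes \<Omega>: "open \<Omega>" "bounded \<Omega>" "\<Omega> \<noteq> {}"
    and pq: "2 \<le> p" "p < q" "q < real DIM('a)"
    and r: "r = crit_exp (real DIM('a)) p" "q < r"
    and \<delta>: "0 < \<delta>" "\<delta> < 1"
    and \<mu>: "\<And>x. 0 \<le> \<mu> x" "\<And>x. \<mu> x \<le> M\<mu>" "\<mu> \<in> borel_measurable (lebesgue_on \<Omega>)"
    and a: "\<And>x. 0 \<le> a x" "a \<in> borel_measurable (lebesgue_on \<Omega>)"
      "integrable (lebesgue_on \<Omega>) (\<lambda>x. a x powr (r / (r - 1 + \<delta>)))" "AE x in lebesgue_on \<Omega>. 0 < a x"
    and b: "\<And>x. \<bar>b x\<bar> \<le> Bb" "b \<in> borel_measurable (lebesgue_on \<Omega>)"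
begin

abbreviation "M \<equiv> lebesgue_on \<Omega>"

lemmas [measurable] = \<mu>(3) a(2) b(2)

text \<open>\<open>Fd\<close> is the energy density, \<open>An\<close> and \<open>Bn\<close> are the
  singular and the critical integral, and \<open>En lam\<close> is I_\<lambda> with \<open>r\<close>
  in place of \<alpha> + 1 and the gradient as a separate argument.\<close>

definition Fd where "Fd x \<xi> = H \<xi> powr p / p + \<mu> x * H \<xi> powr q / q"
definition \<Phi> where "\<Phi> G = (\<integral>x. Fd x (G x) \<partial>M)"
definition An where "An u = (\<integral>x. a x * \<bar>u x\<bar> powr (1 - \<delta>) \<partial>M)"
definition Bn where "Bn u = (\<integral>x. b x * \<bar>u x\<bar> powr r \<partial>M)"
definition En where "En lam u G = \<Phi> G - 1 / (1 - \<delta>) * An u - lam / r * Bn u"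
abbreviation dp where "dp \<equiv> dpH p q \<mu>"

lemma r_gt: "p < r" "2 < r" "0 < r" "1 < r" using pq r by auto

lemma meas_M: "f \<in> borel_measurable borel \<Longrightarrow> f \<in> borel_measurable M"
  for f :: "'a \<Rightarrow> 'c::topological_space"
  by (intro measurable_restrict_space1 measurable_completion) simp

lemma finM: "finite_measure M"
proof (rule finite_measure_lebesgue_on)
  show "\<Omega> \<in> lmeasurable" using \<Omega> by (simp add: lmeasurable_open)
qed

lemma integrable_bounded:
  fixes h :: "'a \<Rightarrow> 'c::{banach, second_countable_topology}"
  assumes "h \<in> borel_measurable M" "\<And>x. norm (h x) \<le> B"
  shows "integrable M h"
  by (rule finite_measure.integrable_const_bound[OF finM _ assms(1), of B]) (simp add: assms(2))

lemma H_meas [measurable]: "H \<in> borel_measurable borel"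
  by (rule borel_measurable_continuous_onI[OF H_cont])

lemma grad_H_meas [measurable]: "grad H \<in> borel_measurable borel"
proof -
  have "(\<lambda>x. if x \<in> - {0} then grad H x else grad H 0) \<in> borel_measurable borel"
    by (rule borel_measurable_continuous_on_if) (auto intro: grad_H_cont)
  then show ?thesis by (rule measurable_cong[THEN iffD1, rotated]) auto
qed

lemma Fd_meas [measurable]:
  assumes [measurable]: "G \<in> borel_measurable M"
  shows "(\<lambda>x. Fd x (G x)) \<in> borel_measurable M"
  unfolding Fd_def by measurable

lemma dp_meas [measurable]:
  assumes [measurable]: "h \<in> borel_measurable M"
  shows "(\<lambda>x. dp x (h x)) \<in> borel_measurable M"
  unfolding dpH_def by measurable

lemma dp_nonneg: "0 \<le> dp x t"
  by (rule dpH_nonneg[of \<mu> x, OF \<mu>(1)])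

lemma Fd_nonneg: "0 \<le> Fd x \<xi>"
  unfolding Fd_def using pq \<mu>(1)[of x] by (intro add_nonneg_nonneg) auto

lemma Fd_bounds: "\<exists>k>0. \<exists>K>0. \<forall>x \<xi>. k * dp x (norm \<xi>) \<le> Fd x \<xi> \<and> Fd x \<xi> \<le> K * dp x (norm \<xi>)
  \<and> dp x (H \<xi>) \<le> K * dp x (norm \<xi>)"
proof -
  obtain k K where kK: "k > 0" "K > 0" "\<And>x. k * norm x \<le> H x" "\<And>x. H x \<le> K * norm x"
    using H_bounds by blast
  define k1 where "k1 = min (k powr p / p) (k powr q / q)"
  define K1 where "K1 = K powr p + K powr q"
  have k1: "0 < k1" "k1 \<le> k powr p / p" "k1 \<le> k powr q / q" using kK pq by (auto simp: k1_def)
  have "k1 * dp x (norm \<xi>) \<le> Fd x \<xi>" for x \<xi>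
  proof -
    have 1: "k powr p * norm \<xi> powr p \<le> H \<xi> powr p" "k powr q * norm \<xi> powr q \<le> H \<xi> powr q"
      unfolding powr_mult[symmetric] using kK pq by (auto intro!: powr_mono2)
    have "k1 * norm \<xi> powr p \<le> k powr p / p * norm \<xi> powr p" by (intro mult_right_mono k1) auto
    also have "\<dots> \<le> H \<xi> powr p / p" using 1 pq by (simp add: divide_right_mono)
    finally have 2: "k1 * norm \<xi> powr p \<le> H \<xi> powr p / p" .
    have "k1 * norm \<xi> powr q \<le> k powr q / q * norm \<xi> powr q" by (intro mult_right_mono k1) auto
    also have "\<dots> \<le> H \<xi> powr q / q" using 1 pq by (simp add: divide_right_mono)
    finally have "\<mu> x * (k1 * norm \<xi> powr q) \<le> \<mu> x * (H \<xi> powr q / q)" by (rule mult_left_mono[OF _ \<mu>(1)])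
    with 2 show ?thesis unfolding Fd_def dpH_def by (simp add: algebra_simps)
  qed
  moreover have u: "dp x (H \<xi>) \<le> K1 * dp x (norm \<xi>)" for x \<xi>
  proof -
    have "dp x (H \<xi>) \<le> dp x (K * norm \<xi>)" using kK pq \<mu> H_nonneg by (intro dpH_mono) auto
    also have "\<dots> \<le> K1 * dp x (norm \<xi>)" unfolding K1_def using kK \<mu> by (intro dpH_scale) auto
    finally show ?thesis .
  qed
  moreover have "Fd x \<xi> \<le> dp x (H \<xi>)" for x \<xi>
  proof -
    have "H \<xi> powr p / p \<le> H \<xi> powr p / 1" "H \<xi> powr q / q \<le> H \<xi> powr q / 1"
      using pq by (intro divide_left_mono; simp)+
    moreover from this(2) have "\<mu> x * (H \<xi> powr q / q) \<le> \<mu> x * H \<xi> powr q"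
      by (intro mult_left_mono[OF _ \<mu>(1)]) simp
    ultimately show ?thesis unfolding Fd_def dpH_def by simp
  qed
  moreover have "0 < K1" using kK by (simp add: K1_def add_pos_pos)
  ultimately show ?thesis using k1(1) order_trans by blast
qed

text \<open>The convexity of powers of H is used at both exponents, weighted by \<mu> at q; the gain
  is then measured by the same modular as the energy.\<close>

lemma Fd_convex: "\<exists>c>0. \<forall>x \<xi> \<eta>. Fd x ((1/2) *\<^sub>R (\<xi> + \<eta>)) + c * dp x (norm (\<xi> - \<eta>)) \<le> (Fd x \<xi> + Fd x \<eta>) / 2"
proof -
  obtain c where c: "c > 0" "\<And>p x y. p \<ge> 2 \<Longrightarrow> H ((1/2) *\<^sub>R (x + y)) powr p + (c * norm (x - y)) powr p \<le> (H x powr p + H y powr p) / 2"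
    using H_powr_convex by blast
  define c1 where "c1 = min (c powr p / p) (c powr q / q)"
  have c1: "0 < c1" "c1 \<le> c powr p / p" "c1 \<le> c powr q / q" using c pq by (auto simp: c1_def)
  have "Fd x ((1/2) *\<^sub>R (\<xi> + \<eta>)) + c1 * dp x (norm (\<xi> - \<eta>)) \<le> (Fd x \<xi> + Fd x \<eta>) / 2" for x \<xi> \<eta>
  proof -
    have *: "H ((1/2) *\<^sub>R (\<xi> + \<eta>)) powr s / s + c1 * norm (\<xi> - \<eta>) powr s \<le> (H \<xi> powr s / s + H \<eta> powr s / s) / 2"
      if s: "s \<ge> 2" "c1 \<le> c powr s / s" for s
    proof -
      have "c1 * norm (\<xi> - \<eta>) powr s \<le> c powr s / s * norm (\<xi> - \<eta>) powr s" using s by (intro mult_right_mono) auto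
      also have "\<dots> = (c * norm (\<xi> - \<eta>)) powr s / s" by (simp add: powr_mult)
      finally have "H ((1/2) *\<^sub>R (\<xi> + \<eta>)) powr s / s + c1 * norm (\<xi> - \<eta>) powr s
        \<le> (H ((1/2) *\<^sub>R (\<xi> + \<eta>)) powr s + (c * norm (\<xi> - \<eta>)) powr s) / s" by (simp add: add_divide_distrib)
      also have "\<dots> \<le> ((H \<xi> powr s + H \<eta> powr s) / 2) / s" using s c(2)[of s \<xi> \<eta>] by (intro divide_right_mono) auto
      finally show ?thesis by (simp add: add_divide_distrib)
    qed
    have "\<mu> x * (H ((1/2) *\<^sub>R (\<xi> + \<eta>)) powr q / q + c1 * norm (\<xi> - \<eta>) powr q) \<le> \<mu> x * ((H \<xi> powr q / q + H \<eta> powr q / q) / 2)"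
      using pq c1 by (intro mult_left_mono[OF * \<mu>(1)]) auto
    moreover note *[of p]
    ultimately show ?thesis unfolding Fd_def dpH_def using pq c1
      by (simp add: algebra_simps add_divide_distrib)
  qed
  with c1(1) show ?thesis by blast
qed

lemma C1c_M:
  assumes C: "C1c \<Omega> f g"
  shows "f \<in> borel_measurable M" "g \<in> borel_measurable M"
    "0 \<le> s \<Longrightarrow> integrable M (\<lambda>x. \<bar>f x\<bar> powr s)"
    "integrable M (\<lambda>x. dp x (norm (g x)))" "integrable M (\<lambda>x. Fd x (g x))"
    "integrable M (\<lambda>x. a x * \<bar>f x\<bar> powr (1 - \<delta>))" "integrable M (\<lambda>x. b x * \<bar>f x\<bar> powr r)"
proof -
  show [measurable]: "f \<in> borel_measurable M" "g \<in> borel_measurable M"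
    using C1c_measurable[OF C] by (auto intro: meas_M)
  obtain Bf where Bf: "Bf > 0" "\<And>x. norm (f x) \<le> Bf"
    using continuous_cpt_bounded[OF C1cD(3,4)[OF C] tsupp_vanish[of _ f]] by blast
  obtain Bg where Bg: "Bg > 0" "\<And>x. norm (g x) \<le> Bg"
    using continuous_cpt_bounded[OF C1cD(2,4)[OF C] C1c_grad_vanish[OF C]] by blast
  show fs: "integrable M (\<lambda>x. \<bar>f x\<bar> powr s)" if "0 \<le> s" for s
    using Bf that by (intro integrable_bounded[of _ "Bf powr s"]) (auto intro!: powr_mono2)
  show dpi: "integrable M (\<lambda>x. dp x (norm (g x)))"
  proof (rule integrable_bounded[of _ "Bg powr p + M\<mu> * Bg powr q"])
    fix x
    have "norm (dp x (norm (g x))) = dp x (norm (g x))" using dp_nonneg by simp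
    also have "\<dots> \<le> Bg powr p + M\<mu> * Bg powr q"
      unfolding dpH_def using Bg pq \<mu>(1,2)[of x]
      by (intro add_mono mult_mono powr_mono2) (auto intro: order_trans[OF \<mu>(1)[of x] \<mu>(2)])
    finally show "norm (dp x (norm (g x))) \<le> Bg powr p + M\<mu> * Bg powr q" .
  qed measurable
  obtain K where K: "\<And>x \<xi>. Fd x \<xi> \<le> K * dp x (norm \<xi>)" using Fd_bounds by blast
  show "integrable M (\<lambda>x. Fd x (g x))"
    by (rule Bochner_Integration.integrable_bound[of _ "\<lambda>x. K * dp x (norm (g x))"])
      (use dpi in \<open>auto intro!: AE_I2 order_trans[OF K] simp: Fd_nonneg\<close>)
  show "integrable M (\<lambda>x. a x * \<bar>f x\<bar> powr (1 - \<delta>))"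
  proof (rule Bochner_Integration.integrable_bound[of _ "\<lambda>x. a x powr (r / (r - 1 + \<delta>)) + \<bar>f x\<bar> powr r"])
    show "integrable M (\<lambda>x. a x powr (r / (r - 1 + \<delta>)) + \<bar>f x\<bar> powr r)"
      using fs[of r] a(3) r_gt by simp
    show "AE x in M. norm (a x * \<bar>f x\<bar> powr (1 - \<delta>)) \<le> norm (a x powr (r / (r - 1 + \<delta>)) + \<bar>f x\<bar> powr r)"
      using powr_young[of "a x" "\<bar>f x\<bar>" 1 \<delta> r for x] a(1) \<delta> r_gt by (intro AE_I2) (simp add: abs_mult)
  qed measurable
  show "integrable M (\<lambda>x. b x * \<bar>f x\<bar> powr r)"
    by (rule Bochner_Integration.integrable_bound[of _ "\<lambda>x. Bb * \<bar>f x\<bar> powr r"])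
      (use fs[of r] r_gt in \<open>auto intro!: AE_I2 mult_right_mono order_trans[OF b(1) abs_ge_self] simp: abs_mult\<close>)
qed

lemma integral_M_lborel:
  fixes h :: "'a \<Rightarrow> real"
  assumes h: "h \<in> borel_measurable borel" and z: "\<And>x. x \<notin> \<Omega> \<Longrightarrow> h x = 0"
  shows "(\<integral>x. h x \<partial>M) = (\<integral>x. h x \<partial>lborel)"
proof -
  have "(\<integral>x. h x \<partial>M) = (\<integral>x. indicator \<Omega> x *\<^sub>R h x \<partial>lebesgue)"
    using \<Omega>(1) by (intro integral_restrict_space) auto
  also have "(\<lambda>x. indicator \<Omega> x *\<^sub>R h x) = h" using z by (auto simp: fun_eq_iff indicator_def)
  also have "(\<integral>x. h x \<partial>lebesgue) = (\<integral>x. h x \<partial>lborel)" using h by (intro integral_completion) simp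
  finally show ?thesis .
qed

lemma sobolev_M: "\<exists>S>0. \<forall>f g. C1c \<Omega> f g \<longrightarrow> (\<integral>x. \<bar>f x\<bar> powr r \<partial>M) \<le> S * (\<integral>x. dp x (norm (g x)) \<partial>M) powr (r / p)"
proof -
  obtain S where S: "S > 0" "\<And>f g. C1c (UNIV::'a set) f g \<Longrightarrow>
    (\<integral>x. \<bar>f x\<bar> powr r \<partial>lborel) \<le> S * (\<integral>x. norm (g x) powr p \<partial>lborel) powr (r / p)"
    using sobolev[of p, where 'a='a] pq unfolding r(1)[symmetric] by auto
  have "(\<integral>x. \<bar>f x\<bar> powr r \<partial>M) \<le> S * (\<integral>x. dp x (norm (g x)) \<partial>M) powr (r / p)" if C: "C1c \<Omega> f g" for f g
  proof -
    note [measurable] = C1c_measurable[OF C]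
    have 1: "(\<integral>x. \<bar>f x\<bar> powr r \<partial>M) = (\<integral>x. \<bar>f x\<bar> powr r \<partial>lborel)"
      using C1cD(5)[OF C] tsupp_vanish[of _ f] by (intro integral_M_lborel) auto
    have 2: "(\<integral>x. norm (g x) powr p \<partial>M) = (\<integral>x. norm (g x) powr p \<partial>lborel)"
      using C1cD(5)[OF C] C1c_grad_vanish[OF C] by (intro integral_M_lborel) auto
    have "(\<integral>x. norm (g x) powr p \<partial>M) \<le> (\<integral>x. dp x (norm (g x)) \<partial>M)"
      using C1c_M(4)[OF C] \<mu>(1) by (intro integral_mono') (auto simp: dpH_def)
    then have "S * (\<integral>x. norm (g x) powr p \<partial>lborel) powr (r / p) \<le> S * (\<integral>x. dp x (norm (g x)) \<partial>M) powr (r / p)"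
      unfolding 2[symmetric] using S(1) pq r_gt by (intro mult_left_mono powr_mono2) auto
    with S(2)[OF C1c_mono[OF C subset_UNIV]] show ?thesis unfolding 1 by simp
  qed
  with S(1) show ?thesis by blast
qed

text \<open>Membership of u in the energy space is encoded by an approximating sequence in C1c. No weak compactness is used, so the limit gradient
  G is obtained along with u.\<close>

definition sconv where
  "sconv \<psi> \<psi>' u G \<longleftrightarrow> (\<forall>k::nat. C1c \<Omega> (\<psi> k) (\<psi>' k)) \<and> u \<in> borel_measurable M \<and> G \<in> borel_measurable M \<and>
    (AE x in M. (\<lambda>k. \<psi> k x) \<longlonglongrightarrow> u x) \<and> (AE x in M. (\<lambda>k. \<psi>' k x) \<longlonglongrightarrow> G x) \<and>
    (\<forall>k. integrable M (\<lambda>x. \<bar>\<psi> k x - u x\<bar> powr r)) \<and> (\<lambda>k. \<integral>x. \<bar>\<psi> k x - u x\<bar> powr r \<partial>M) \<longlonglongrightarrow> 0 \<and>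
    (\<forall>k. integrable M (\<lambda>x. dp x (norm (\<psi>' k x - G x)))) \<and> (\<lambda>k. \<integral>x. dp x (norm (\<psi>' k x - G x)) \<partial>M) \<longlonglongrightarrow> 0"

lemma sconvD:
  assumes "sconv \<psi> \<psi>' u G"
  shows "C1c \<Omega> (\<psi> k) (\<psi>' k)" "u \<in> borel_measurable M" "G \<in> borel_measurable M"
    "AE x in M. (\<lambda>k. \<psi> k x) \<longlonglongrightarrow> u x" "AE x in M. (\<lambda>k. \<psi>' k x) \<longlonglongrightarrow> G x"
    "integrable M (\<lambda>x. \<bar>\<psi> k x - u x\<bar> powr r)" "(\<lambda>k. \<integral>x. \<bar>\<psi> k x - u x\<bar> powr r \<partial>M) \<longlonglongrightarrow> 0"
    "integrable M (\<lambda>x. dp x (norm (\<psi>' k x - G x)))" "(\<lambda>k. \<integral>x. dp x (norm (\<psi>' k x - G x)) \<partial>M) \<longlonglongrightarrow> 0"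
  using assms unfolding sconv_def by blast+

lemma powr_diff_le: "\<bar>s\<bar> powr r \<le> 2 powr r * (\<bar>s - t\<bar> powr r + \<bar>t\<bar> powr r)" for s t :: real
proof -
  have "\<bar>s\<bar> powr r \<le> (\<bar>s - t\<bar> + \<bar>t\<bar>) powr r" using r_gt by (intro powr_mono2) auto
  also have "\<dots> \<le> 2 powr r * (\<bar>s - t\<bar> powr r + \<bar>t\<bar> powr r)" using r_gt by (intro powr_add_le) auto
  finally show ?thesis .
qed

lemma dp_diff_le: "dp x (norm \<xi>) \<le> 2 powr q * (dp x (norm (\<xi> - \<eta>)) + dp x (norm \<eta>))"
proof -
  have "dp x (norm \<xi>) \<le> dp x (norm (\<xi> - \<eta>) + norm \<eta>)"
    using pq \<mu>(1) norm_triangle_ineq[of "\<xi> - \<eta>" \<eta>] by (intro dpH_mono) auto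
  also have "\<dots> \<le> 2 powr q * (dp x (norm (\<xi> - \<eta>)) + dp x (norm \<eta>))"
    using pq \<mu>(1) by (intro dpH_add) auto
  finally show ?thesis .
qed

lemma sconv_integrable:
  assumes s: "sconv \<psi> \<psi>' u G"
  shows "integrable M (\<lambda>x. \<bar>u x\<bar> powr r)" "integrable M (\<lambda>x. dp x (norm (G x)))"
proof -
  note sD = sconvD[OF s]
  note [measurable] = sD(2,3)
  show "integrable M (\<lambda>x. \<bar>u x\<bar> powr r)"
  proof (rule Bochner_Integration.integrable_bound[of _ "\<lambda>x. 2 powr r * (\<bar>\<psi> 0 x - u x\<bar> powr r + \<bar>\<psi> 0 x\<bar> powr r)"])
    show "integrable M (\<lambda>x. 2 powr r * (\<bar>\<psi> 0 x - u x\<bar> powr r + \<bar>\<psi> 0 x\<bar> powr r))"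
      using sD(6)[of 0] C1c_M(3)[OF sD(1)[of 0], of r] r_gt by simp
    show "AE x in M. norm (\<bar>u x\<bar> powr r) \<le> norm (2 powr r * (\<bar>\<psi> 0 x - u x\<bar> powr r + \<bar>\<psi> 0 x\<bar> powr r))"
      using powr_diff_le[of "u x" "\<psi> 0 x" for x] by (intro AE_I2) (simp add: abs_minus_commute)
  qed measurable
  show "integrable M (\<lambda>x. dp x (norm (G x)))"
  proof (rule Bochner_Integration.integrable_bound[of _ "\<lambda>x. 2 powr q * (dp x (norm (\<psi>' 0 x - G x)) + dp x (norm (\<psi>' 0 x)))"])
    show "integrable M (\<lambda>x. 2 powr q * (dp x (norm (\<psi>' 0 x - G x)) + dp x (norm (\<psi>' 0 x))))"
      using sD(8)[of 0] C1c_M(4)[OF sD(1)[of 0]] by simp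
    show "AE x in M. norm (dp x (norm (G x))) \<le> norm (2 powr q * (dp x (norm (\<psi>' 0 x - G x)) + dp x (norm (\<psi>' 0 x))))"
      using dp_diff_le[of x "G x" "\<psi>' 0 x" for x] dp_nonneg
      by (intro AE_I2) (simp add: norm_minus_commute)
  qed measurable
qed

lemma Fd_cont: "continuous_on UNIV (Fd x)"
  unfolding Fd_def[abs_def] using pq
  by (intro continuous_intros continuous_on_powr_nonneg H_cont H_nonneg) auto

text \<open>All parts of the energy have at most the growth of the two modulars that converge, so
  perturbed dominated convergence gives continuity. In particular the critical term, discontinuous
  under weak convergence, is continuous here.\<close>

lemma sconv_cont:
  assumes s: "sconv \<psi> \<psi>' u G"
  shows "integrable M (\<lambda>x. Fd x (G x))" "integrable M (\<lambda>x. a x * \<bar>u x\<bar> powr (1 - \<delta>))"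
    "integrable M (\<lambda>x. b x * \<bar>u x\<bar> powr r)"
    "(\<lambda>k. \<Phi> (\<psi>' k)) \<longlonglongrightarrow> \<Phi> G" "(\<lambda>k. An (\<psi> k)) \<longlonglongrightarrow> An u" "(\<lambda>k. Bn (\<psi> k)) \<longlonglongrightarrow> Bn u"
    "(\<lambda>k. \<integral>x. \<bar>\<psi> k x\<bar> powr r \<partial>M) \<longlonglongrightarrow> (\<integral>x. \<bar>u x\<bar> powr r \<partial>M)"
proof -
  note sD = sconvD[OF s] and sI = sconv_integrable[OF s]
  note [measurable] = sD(2,3) C1c_M(1,2)[OF sD(1)]
  obtain K where K: "K > 0" "\<And>x \<xi>. Fd x \<xi> \<le> K * dp x (norm \<xi>)" using Fd_bounds by blast
  have \<Phi>: "integrable M (\<lambda>x. Fd x (G x)) \<and> (\<lambda>k. \<integral>x. Fd x (\<psi>' k x) \<partial>M) \<longlonglongrightarrow> (\<integral>x. Fd x (G x) \<partial>M)"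
  proof (rule dominated_convergence_perturbed[where f="\<lambda>k x. Fd x (\<psi>' k x)" and
        w="\<lambda>k x. K * (2 powr q * dp x (norm (\<psi>' k x - G x)))" and g="\<lambda>x. K * (2 powr q * dp x (norm (G x)))"])
    show "AE x in M. (\<lambda>k. Fd x (\<psi>' k x)) \<longlonglongrightarrow> Fd x (G x)"
      using sD(5) by eventually_elim (rule continuous_on_tendsto_compose[OF Fd_cont], auto)
    show "AE x in M. \<bar>Fd x (\<psi>' k x)\<bar> \<le> K * (2 powr q * dp x (norm (\<psi>' k x - G x))) + K * (2 powr q * dp x (norm (G x)))" for k
    proof (rule AE_I2)
      fix x
      have "Fd x (\<psi>' k x) \<le> K * dp x (norm (\<psi>' k x))" by (rule K)
      also have "\<dots> \<le> K * (2 powr q * (dp x (norm (\<psi>' k x - G x)) + dp x (norm (G x))))"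
        using K(1) by (intro mult_left_mono dp_diff_le) auto
      finally show "\<bar>Fd x (\<psi>' k x)\<bar> \<le> K * (2 powr q * dp x (norm (\<psi>' k x - G x))) + K * (2 powr q * dp x (norm (G x)))"
        using Fd_nonneg by (simp add: algebra_simps)
    qed
    show "AE x in M. \<bar>Fd x (G x)\<bar> \<le> K * (2 powr q * dp x (norm (G x)))"
    proof (rule AE_I2)
      fix x
      have "Fd x (G x) \<le> K * (1 * dp x (norm (G x)))" using K by simp
      also have "\<dots> \<le> K * (2 powr q * dp x (norm (G x)))"
        using K(1) dp_nonneg pq by (intro mult_left_mono mult_right_mono) (auto simp: ge_one_powr_ge_zero)
      finally show "\<bar>Fd x (G x)\<bar> \<le> K * (2 powr q * dp x (norm (G x)))" using Fd_nonneg by simp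
    qed
    show "(\<lambda>k. \<integral>x. K * (2 powr q * dp x (norm (\<psi>' k x - G x))) \<partial>M) \<longlonglongrightarrow> 0"
      using tendsto_mult_right_zero[OF tendsto_mult_right_zero[OF sD(9)]] by simp
  qed (use K(1) dp_nonneg sD(8) sI(2) in auto)
  then show "integrable M (\<lambda>x. Fd x (G x))" "(\<lambda>k. \<Phi> (\<psi>' k)) \<longlonglongrightarrow> \<Phi> G" unfolding \<Phi>_def by auto
  have w0: "(\<lambda>k. \<integral>x. c * (2 powr r * \<bar>\<psi> k x - u x\<bar> powr r) \<partial>M) \<longlonglongrightarrow> 0" for c
    using tendsto_mult_right_zero[OF tendsto_mult_right_zero[OF sD(7)]] by simp
  have pw: "(\<lambda>k. \<bar>\<psi> k x\<bar> powr s) \<longlonglongrightarrow> \<bar>u x\<bar> powr s" if "(\<lambda>k. \<psi> k x) \<longlonglongrightarrow> u x" "0 < s" for x s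
    using that by (intro tendsto_powr' tendsto_intros) auto
  \<comment> \<open>One statement for the three integrals of powers of u: the singular one by
    Young's inequality, the critical one and the plain L^r one with h = 0.\<close>
  have gen: "integrable M (\<lambda>x. c x * \<bar>u x\<bar> powr s) \<and> (\<lambda>k. \<integral>x. c x * \<bar>\<psi> k x\<bar> powr s \<partial>M) \<longlonglongrightarrow> (\<integral>x. c x * \<bar>u x\<bar> powr s \<partial>M)"
    if c: "\<And>x t. \<bar>c x * \<bar>t\<bar> powr s\<bar> \<le> h x + C * \<bar>t\<bar> powr r" "integrable M h" "\<And>x. 0 \<le> h x" "0 \<le> C" "0 < s"
      and [measurable]: "c \<in> borel_measurable M" for c h :: "'a \<Rightarrow> real" and s C
  proof (rule dominated_convergence_perturbed[where f="\<lambda>k x. c x * \<bar>\<psi> k x\<bar> powr s" and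
        w="\<lambda>k x. C * (2 powr r * \<bar>\<psi> k x - u x\<bar> powr r)" and g="\<lambda>x. h x + C * (2 powr r * \<bar>u x\<bar> powr r)"])
    show "AE x in M. (\<lambda>k. c x * \<bar>\<psi> k x\<bar> powr s) \<longlonglongrightarrow> c x * \<bar>u x\<bar> powr s"
      using sD(4) by eventually_elim (intro tendsto_intros pw c)
    show "AE x in M. \<bar>c x * \<bar>\<psi> k x\<bar> powr s\<bar> \<le> C * (2 powr r * \<bar>\<psi> k x - u x\<bar> powr r) + (h x + C * (2 powr r * \<bar>u x\<bar> powr r))" for k
    proof (rule AE_I2)
      fix x
      have "C * \<bar>\<psi> k x\<bar> powr r \<le> C * (2 powr r * (\<bar>\<psi> k x - u x\<bar> powr r + \<bar>u x\<bar> powr r))"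
        by (intro mult_left_mono powr_diff_le c)
      with c(1)[of x "\<psi> k x"] show "\<bar>c x * \<bar>\<psi> k x\<bar> powr s\<bar> \<le> C * (2 powr r * \<bar>\<psi> k x - u x\<bar> powr r) + (h x + C * (2 powr r * \<bar>u x\<bar> powr r))"
        by (simp add: algebra_simps)
    qed
    show "AE x in M. \<bar>c x * \<bar>u x\<bar> powr s\<bar> \<le> h x + C * (2 powr r * \<bar>u x\<bar> powr r)"
    proof (rule AE_I2)
      fix x
      have "C * (1 * \<bar>u x\<bar> powr r) \<le> C * (2 powr r * \<bar>u x\<bar> powr r)"
        using r_gt by (intro mult_left_mono mult_right_mono c) (auto simp: ge_one_powr_ge_zero)
      with c(1)[of x "u x"] show "\<bar>c x * \<bar>u x\<bar> powr s\<bar> \<le> h x + C * (2 powr r * \<bar>u x\<bar> powr r)" by simp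
    qed
  qed (use c sD(6) sI(1) w0 in auto)
  have "\<bar>a x * \<bar>t\<bar> powr (1 - \<delta>)\<bar> \<le> a x powr (r / (r - 1 + \<delta>)) + 1 * \<bar>t\<bar> powr r" for x t
    using powr_young[of "a x" "\<bar>t\<bar>" 1 \<delta> r] a(1)[of x] \<delta> r_gt by (simp add: abs_mult)
  from gen[OF this a(3) _ _ _ a(2)] \<delta>
  show "integrable M (\<lambda>x. a x * \<bar>u x\<bar> powr (1 - \<delta>))" "(\<lambda>k. An (\<psi> k)) \<longlonglongrightarrow> An u"
    unfolding An_def by auto
  have Bb0: "0 \<le> Bb" using order_trans[OF abs_ge_zero b(1)] .
  have "\<bar>b x * \<bar>t\<bar> powr r\<bar> \<le> 0 + Bb * \<bar>t\<bar> powr r" for x t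
    by (simp add: abs_mult mult_right_mono b(1))
  from gen[OF this _ _ Bb0 _ b(2)] r_gt
  show "integrable M (\<lambda>x. b x * \<bar>u x\<bar> powr r)" "(\<lambda>k. Bn (\<psi> k)) \<longlonglongrightarrow> Bn u"
    unfolding Bn_def by auto
  from gen[of "\<lambda>_. 1" r "\<lambda>_. 0" 1] r_gt
  show "(\<lambda>k. \<integral>x. \<bar>\<psi> k x\<bar> powr r \<partial>M) \<longlonglongrightarrow> (\<integral>x. \<bar>u x\<bar> powr r \<partial>M)" by auto
qed

lemma sconv_add:
  assumes s: "sconv \<psi> \<psi>' u G" and C: "C1c \<Omega> \<phi> \<phi>'"
  shows "sconv (\<lambda>k x. \<psi> k x + \<phi> x) (\<lambda>k x. \<psi>' k x + \<phi>' x) (\<lambda>x. u x + \<phi> x) (\<lambda>x. G x + \<phi>' x)"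
  unfolding sconv_def
proof (intro conjI allI)
  note sD = sconvD[OF s]
  note [measurable] = sD(2,3) C1c_M(1,2)[OF C]
  show "C1c \<Omega> (\<lambda>x. \<psi> k x + \<phi> x) (\<lambda>x. \<psi>' k x + \<phi>' x)" for k by (intro C1c_add sD C)
  show "AE x in M. (\<lambda>k. \<psi> k x + \<phi> x) \<longlonglongrightarrow> u x + \<phi> x"
    using sD(4) by eventually_elim (intro tendsto_intros)
  show "AE x in M. (\<lambda>k. \<psi>' k x + \<phi>' x) \<longlonglongrightarrow> G x + \<phi>' x"
    using sD(5) by eventually_elim (intro tendsto_intros)
qed (use sconvD[OF s] C1c_M(1,2)[OF C] in auto)

end

section \<open>Strong convergence of minimising sequences\<close>

text \<open>Applied to the gradient distances D j k of a minimising sequence: up to o(1) the critical term reproduces at most half of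
  the limiting bound L on D, provided \<lambda> is small.\<close>

lemma double_limit_absorb:
  fixes D :: "nat \<Rightarrow> nat \<Rightarrow> real"
  assumes R: "\<And>j k. D j k \<le> R" "0 \<le> R" and e: "0 < e"
    and step: "\<And>L e. 0 \<le> L \<Longrightarrow> 0 < e \<Longrightarrow> \<exists>n. \<forall>j\<ge>n. \<forall>k\<ge>n. D j k \<le> L \<Longrightarrow> \<exists>n. \<forall>j\<ge>n. \<forall>k\<ge>n. D j k \<le> L / 2 + e"
  shows "\<exists>n. \<forall>j\<ge>n. \<forall>k\<ge>n. D j k \<le> e"
proof -
  \<comment> \<open>Each round halves the bound and adds e/4; since e/2 is the fixed point of that
    map, the excess over e/2 is halved.\<close>
  have it: "\<exists>n. \<forall>j\<ge>n. \<forall>k\<ge>n. D j k \<le> R / 2 ^ i + e / 2" for i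
  proof (induction i)
    case 0 show ?case using R(1) e by (intro exI[of _ 0]) (auto intro: add_increasing2)
  next
    case (Suc i)
    have eq: "(R / 2 ^ i + e / 2) / 2 + e / 4 = R / 2 ^ Suc i + e / 2" by (simp add: field_simps)
    show ?case using step[OF _ _ Suc.IH, of "e / 4"] R(2) e unfolding eq by simp
  qed
  obtain i where i: "2 * R / e < 2 ^ i" using real_arch_pow[of 2 "2 * R / e"] by auto
  have Ri: "R / 2 ^ i \<le> e / 2" using i e by (simp add: field_simps)
  from it[of i] obtain n where n: "\<And>j k. n \<le> j \<Longrightarrow> n \<le> k \<Longrightarrow> D j k \<le> R / 2 ^ i + e / 2" by blast
  have "D j k \<le> e" if "n \<le> j" "n \<le> k" for j k using n[OF that] Ri by linarith
  then show ?thesis by blast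
qed

text \<open>Fatou's lemma for real functions, giving integrability of the limit as well; the bound
  is required only from index n on.\<close>

lemma fatou_real:
  fixes f :: "nat \<Rightarrow> 'a \<Rightarrow> real"
  assumes f: "\<And>k. integrable M (f k)" "\<And>k x. 0 \<le> f k x" and F[measurable]: "F \<in> borel_measurable M"
    and lim: "AE x in M. (\<lambda>k. f k x) \<longlonglongrightarrow> F x" and bd: "\<And>k. n \<le> k \<Longrightarrow> (\<integral>x. f k x \<partial>M) \<le> L"
  shows "integrable M F \<and> (\<integral>x. F x \<partial>M) \<le> L"
proof -
  note [measurable] = borel_measurable_integrable[OF f(1)]
  have L0: "0 \<le> L" by (rule order_trans[OF _ bd[of n]]) (auto simp: f(2))
  have F0: "AE x in M. 0 \<le> F x"
    using lim by eventually_elim (rule LIMSEQ_le_const, auto simp: f(2))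
  have "(\<integral>\<^sup>+x. ennreal (F x) \<partial>M) = (\<integral>\<^sup>+x. liminf (\<lambda>k. ennreal (f k x)) \<partial>M)"
  proof (rule nn_integral_cong_AE)
    show "AE x in M. ennreal (F x) = liminf (\<lambda>k. ennreal (f k x))"
      using lim by eventually_elim (intro lim_imp_Liminf[symmetric] tendsto_ennrealI, auto)
  qed
  also have "\<dots> \<le> liminf (\<lambda>k. \<integral>\<^sup>+x. ennreal (f k x) \<partial>M)" by (rule nn_integral_liminf) measurable
  also have "\<dots> \<le> ennreal L"
  proof (rule order_trans[OF Liminf_mono[of _ "\<lambda>_. ennreal L"]])
    show "\<forall>\<^sub>F k in sequentially. (\<integral>\<^sup>+x. ennreal (f k x) \<partial>M) \<le> ennreal L"
      using eventually_ge_at_top[of n]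
    proof eventually_elim
      case (elim k)
      have "(\<integral>\<^sup>+x. ennreal (f k x) \<partial>M) = ennreal (\<integral>x. f k x \<partial>M)" using f by (intro nn_integral_eq_integral) auto
      then show ?case using bd[OF elim] by (simp add: ennreal_leI)
    qed
  qed (simp add: Liminf_const)
  finally have le: "(\<integral>\<^sup>+x. ennreal (F x) \<partial>M) \<le> ennreal L" .
  have i: "integrable M F"
    by (rule integrableI_nonneg[OF F F0]) (use le in \<open>auto intro: le_less_trans\<close>)
  have "ennreal (\<integral>x. F x \<partial>M) \<le> ennreal L" using le nn_integral_eq_integral[OF i F0] by simp
  then show ?thesis using i L0 by (simp add: ennreal_le_iff)
qed

section \<open>Midpoint defects and extraction of convergent subsequences\<close>

context dphase begin

text \<open>Midpoint convexity of the inverse power 1/(1 - \<delta>), applied to the powers of s and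
  t.\<close>

lemma powr_midpoint_concave:
  fixes s t :: real assumes "0 \<le> s" "0 \<le> t"
  shows "(s powr (1 - \<delta>) + t powr (1 - \<delta>)) / 2 \<le> ((s + t) / 2) powr (1 - \<delta>)"
proof -
  let ?x = "s powr (1 - \<delta>)" and ?y = "t powr (1 - \<delta>)"
  have "((?x + ?y) / 2) powr (1 / (1 - \<delta>)) \<le> (?x powr (1 / (1 - \<delta>)) + ?y powr (1 / (1 - \<delta>))) / 2"
    using \<delta> by (intro powr_midpoint) auto
  also have "\<dots> = (s + t) / 2" using assms \<delta> by (simp add: powr_powr)
  finally have "(((?x + ?y) / 2) powr (1 / (1 - \<delta>))) powr (1 - \<delta>) \<le> ((s + t) / 2) powr (1 - \<delta>)"
    using \<delta> by (intro powr_mono2) auto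
  moreover have "0 \<le> ?x + ?y" by simp
  ultimately show ?thesis using \<delta> by (simp add: powr_powr)
qed

text \<open>The midpoint defect of the critical term, the only term of the energy whose convexity has the wrong sign.\<close>

definition Err where "Err s t = (\<bar>s\<bar> powr r + \<bar>t\<bar> powr r) / 2 - \<bar>(s + t) / 2\<bar> powr r"

lemma Err_bounds: "0 \<le> Err s t" "Err s t \<le> (\<bar>s\<bar> powr r + \<bar>t\<bar> powr r) / 2"
proof -
  have "\<bar>(s + t) / 2\<bar> powr r \<le> ((\<bar>s\<bar> + \<bar>t\<bar>) / 2) powr r" using r_gt by (intro powr_mono2) auto
  also have "\<dots> \<le> (\<bar>s\<bar> powr r + \<bar>t\<bar> powr r) / 2" using r_gt by (intro powr_midpoint) auto
  finally show "0 \<le> Err s t" by (simp add: Err_def)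
  show "Err s t \<le> (\<bar>s\<bar> powr r + \<bar>t\<bar> powr r) / 2"
    using powr_ge_zero[of "\<bar>(s + t) / 2\<bar>" r] unfolding Err_def by linarith
qed

text \<open>Subtracting multiples of the distances to u from the defect leaves a function
  \<open>h\<close> below 2^r |u|^r that tends to 0 almost everywhere. Mass that fails to converge
  strongly is thus visible only through those distances.\<close>

lemma Err_integral:
  assumes \<psi>[measurable]: "\<And>k. \<psi> k \<in> borel_measurable M" "u \<in> borel_measurable M"
    and lim: "AE x in M. (\<lambda>k. \<psi> k x) \<longlonglongrightarrow> u x"
    and i: "\<And>k. integrable M (\<lambda>x. \<bar>\<psi> k x - u x\<bar> powr r)" "integrable M (\<lambda>x. \<bar>u x\<bar> powr r)" and e: "0 < e"
  shows "\<exists>n. \<forall>j\<ge>n. \<forall>k\<ge>n. (\<integral>x. Err (\<psi> j x) (\<psi> k x) \<partial>M)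
    \<le> e + 2 powr r * ((\<integral>x. \<bar>\<psi> j x - u x\<bar> powr r \<partial>M) + (\<integral>x. \<bar>\<psi> k x - u x\<bar> powr r \<partial>M))"
proof -
  define h where "h = (\<lambda>j k x. max 0 (Err (\<psi> j x) (\<psi> k x) - 2 powr r * (\<bar>\<psi> j x - u x\<bar> powr r + \<bar>\<psi> k x - u x\<bar> powr r)))"
  have gen: "E \<le> ((A + U) + (B + U)) / 2 \<Longrightarrow> 0 \<le> A \<Longrightarrow> 0 \<le> B \<Longrightarrow> E \<le> (A + B) + U" for E A B U :: real
    by (simp add: field_simps)
  have hb: "h j k x \<le> 2 powr r * \<bar>u x\<bar> powr r" for j k x
  proof -
    have "Err (\<psi> j x) (\<psi> k x) \<le> (2 powr r * (\<bar>\<psi> j x - u x\<bar> powr r + \<bar>u x\<bar> powr r) + 2 powr r * (\<bar>\<psi> k x - u x\<bar> powr r + \<bar>u x\<bar> powr r)) / 2"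
      by (rule order_trans[OF Err_bounds(2)]) (intro divide_right_mono add_mono powr_diff_le, simp)
    moreover have "0 \<le> 2 powr r * \<bar>\<psi> j x - u x\<bar> powr r" "0 \<le> 2 powr r * \<bar>\<psi> k x - u x\<bar> powr r" by auto
    ultimately have "Err (\<psi> j x) (\<psi> k x) \<le> 2 powr r * (\<bar>\<psi> j x - u x\<bar> powr r + \<bar>\<psi> k x - u x\<bar> powr r) + 2 powr r * \<bar>u x\<bar> powr r"
      unfolding distrib_left by (rule gen)
    then show ?thesis unfolding h_def by simp
  qed
  have [measurable]: "(\<lambda>x. Err (\<psi> j x) (\<psi> k x)) \<in> borel_measurable M" "h j k \<in> borel_measurable M" for j k
    unfolding h_def Err_def by measurable
  have iu: "integrable M (\<lambda>x. 2 powr r * \<bar>u x\<bar> powr r)" using i(2) by simp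
  have hi: "integrable M (h j k)" for j k
  proof (rule Bochner_Integration.integrable_bound[OF iu])
    have h0: "0 \<le> h j k x" for x by (simp add: h_def)
    show "AE x in M. norm (h j k x) \<le> norm (2 powr r * \<bar>u x\<bar> powr r)"
      using hb[of j k] h0 by (intro AE_I2) simp
  qed measurable
  have small: "\<exists>n. \<forall>j\<ge>n. \<forall>k\<ge>n. (\<integral>x. h j k x \<partial>M) \<le> e"
  \<comment> \<open>Failure of the double limit yields indices J n, K n \<ge> n, which reduces it to
    ordinary dominated convergence.\<close>
  proof (rule ccontr)
    assume "\<not> ?thesis"
    then have "\<forall>n. \<exists>j k. n \<le> j \<and> n \<le> k \<and> e < (\<integral>x. h j k x \<partial>M)" by (auto simp: not_le)
    then obtain J K where JK: "\<And>n. n \<le> J n" "\<And>n. n \<le> K n" "\<And>n. e < (\<integral>x. h (J n) (K n) x \<partial>M)" by metis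
    have fJ: "filterlim J at_top sequentially" "filterlim K at_top sequentially"
      using JK(1,2) by (auto intro: filterlim_at_top_mono[OF filterlim_ident] always_eventually)
    have "(\<lambda>n. \<integral>x. h (J n) (K n) x \<partial>M) \<longlonglongrightarrow> (\<integral>x. 0 \<partial>M)"
    proof (rule integral_dominated_convergence[OF _ _ iu])
      show "AE x in M. norm (h (J n) (K n) x) \<le> 2 powr r * \<bar>u x\<bar> powr r" for n
      proof -
        have h0: "0 \<le> h (J n) (K n) x" for x by (simp add: h_def)
        show ?thesis using hb h0 by (intro AE_I2) simp
      qed
      show "AE x in M. (\<lambda>n. h (J n) (K n) x) \<longlonglongrightarrow> 0"
        using lim
      proof eventually_elim
        case (elim x)
        have l: "(\<lambda>n. \<psi> (J n) x) \<longlonglongrightarrow> u x" "(\<lambda>n. \<psi> (K n) x) \<longlonglongrightarrow> u x"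
          using filterlim_compose[OF elim] fJ by auto
        have pw: "(\<lambda>n. \<bar>f n\<bar> powr r) \<longlonglongrightarrow> \<bar>l\<bar> powr r" if "f \<longlonglongrightarrow> l" for f :: "nat \<Rightarrow> real" and l
          using that r_gt by (intro tendsto_powr' tendsto_intros) auto
        have "(\<lambda>n. h (J n) (K n) x) \<longlonglongrightarrow> max 0 (((\<bar>u x\<bar> powr r + \<bar>u x\<bar> powr r) / 2 - \<bar>(u x + u x) / 2\<bar> powr r)
          - 2 powr r * (\<bar>u x - u x\<bar> powr r + \<bar>u x - u x\<bar> powr r))"
          unfolding h_def Err_def by (intro tendsto_max tendsto_const tendsto_diff tendsto_add tendsto_mult tendsto_divide pw l) auto
        then show ?case by simp
      qed
    qed measurable
    then have "(\<lambda>n. \<integral>x. h (J n) (K n) x \<partial>M) \<longlonglongrightarrow> 0" by simp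
    then have "\<forall>\<^sub>F n in sequentially. (\<integral>x. h (J n) (K n) x \<partial>M) < e" by (rule order_tendstoD(2)[OF _ e])
    then obtain n where "(\<integral>x. h (J n) (K n) x \<partial>M) < e" using eventually_happens trivial_limit_sequentially by blast
    with JK(3)[of n] show False by simp
  qed
  have "(\<integral>x. Err (\<psi> j x) (\<psi> k x) \<partial>M) \<le> (\<integral>x. h j k x \<partial>M) + 2 powr r * ((\<integral>x. \<bar>\<psi> j x - u x\<bar> powr r \<partial>M) + (\<integral>x. \<bar>\<psi> k x - u x\<bar> powr r \<partial>M))" for j k
  proof -
    have "(\<integral>x. Err (\<psi> j x) (\<psi> k x) \<partial>M) \<le> (\<integral>x. h j k x + 2 powr r * (\<bar>\<psi> j x - u x\<bar> powr r + \<bar>\<psi> k x - u x\<bar> powr r) \<partial>M)"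
    proof (rule integral_mono')
      show "integrable M (\<lambda>x. h j k x + 2 powr r * (\<bar>\<psi> j x - u x\<bar> powr r + \<bar>\<psi> k x - u x\<bar> powr r))"
        using hi i by simp
      fix x
      show le: "Err (\<psi> j x) (\<psi> k x) \<le> h j k x + 2 powr r * (\<bar>\<psi> j x - u x\<bar> powr r + \<bar>\<psi> k x - u x\<bar> powr r)"
        unfolding h_def by simp
      show "0 \<le> h j k x + 2 powr r * (\<bar>\<psi> j x - u x\<bar> powr r + \<bar>\<psi> k x - u x\<bar> powr r)"
        by (simp add: h_def)
    qed
    also have "\<dots> = (\<integral>x. h j k x \<partial>M) + 2 powr r * ((\<integral>x. \<bar>\<psi> j x - u x\<bar> powr r \<partial>M) + (\<integral>x. \<bar>\<psi> k x - u x\<bar> powr r \<partial>M))"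
      using hi i by simp
    finally show ?thesis .
  qed
  note le = this
  from small obtain n where n: "\<And>j k. n \<le> j \<Longrightarrow> n \<le> k \<Longrightarrow> (\<integral>x. h j k x \<partial>M) \<le> e" by blast
  show ?thesis by (intro exI[of _ n] allI impI order_trans[OF le] add_right_mono n)
qed

lemma AE_M_lborel: "AE x in lborel. P x \<Longrightarrow> AE x in M. P x"
  using \<Omega>(1) by (subst AE_restrict_space_iff) (auto intro: AE_completion)

text \<open>On a set of finite measure the bound on the gradient modular, with the Sobolev
  inequality, bounds the functions and their gradients in L^1, as Rellich's theorem
  requires.\<close>

lemma C1c_subseq_AE:
  assumes C: "\<And>k. C1c \<Omega> (\<psi> k) (\<psi>' k)" and R: "\<And>k. (\<integral>x. dp x (norm (\<psi>' k x)) \<partial>M) \<le> R"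
  shows "\<exists>s::nat\<Rightarrow>nat. strict_mono s \<and> (AE x in M. convergent (\<lambda>i. \<psi> (s i) x))"
proof -
  obtain S where S: "S > 0" "\<And>f g. C1c \<Omega> f g \<Longrightarrow> (\<integral>x. \<bar>f x\<bar> powr r \<partial>M) \<le> S * (\<integral>x. dp x (norm (g x)) \<partial>M) powr (r / p)"
    using sobolev_M by blast
  have one: "t \<le> 1 + t powr s" if "0 \<le> t" "1 \<le> s" for t s :: real
  proof (cases "t \<le> 1")
    case False
    then have "t powr 1 \<le> t powr s" using that by (intro powr_mono) auto
    then show ?thesis using that by simp
  qed (simp add: add_increasing2)
  have c1: "integrable M (\<lambda>x. 1::real)" by (rule finite_measure.integrable_const[OF finM])
  have "\<exists>s::nat\<Rightarrow>nat. strict_mono s \<and> (AE x in lborel. convergent (\<lambda>i. \<psi> (s i) x))"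
  proof (rule rellich[OF C \<Omega>(2)])
    show "\<Omega> \<in> sets borel" using \<Omega>(1) by simp
    fix k
    note [measurable] = C1c_measurable[OF C[of k]]
    have "(\<integral>x. \<bar>\<psi> k x\<bar> \<partial>lborel) = (\<integral>x. \<bar>\<psi> k x\<bar> \<partial>M)"
      using C1cD(5)[OF C[of k]] tsupp_vanish[of _ "\<psi> k"] by (intro integral_M_lborel[symmetric]) auto
    also have "\<dots> \<le> (\<integral>x. 1 + \<bar>\<psi> k x\<bar> powr r \<partial>M)"
      using c1 C1c_M(3)[OF C[of k], of r] r_gt one by (intro integral_mono') auto
    also have "\<dots> = (\<integral>x. 1 \<partial>M) + (\<integral>x. \<bar>\<psi> k x\<bar> powr r \<partial>M)"
      using c1 C1c_M(3)[OF C[of k], of r] r_gt by (intro Bochner_Integration.integral_add) auto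
    also have "\<dots> \<le> (\<integral>x. 1 \<partial>M) + S * R powr (r / p)"
    proof (intro add_left_mono order_trans[OF S(2)[OF C]] mult_left_mono powr_mono2 R)
      show "0 \<le> (\<integral>x. dp x (norm (\<psi>' k x)) \<partial>M)" by (simp add: dp_nonneg)
    qed (use S pq r_gt in auto)
    finally show "(\<integral>x. \<bar>\<psi> k x\<bar> \<partial>lborel) \<le> (\<integral>x. 1 \<partial>M) + S * R powr (r / p)" .
    have "(\<integral>x. norm (\<psi>' k x) \<partial>lborel) = (\<integral>x. norm (\<psi>' k x) \<partial>M)"
      using C1cD(5)[OF C[of k]] C1c_grad_vanish[OF C[of k]] by (intro integral_M_lborel[symmetric]) auto
    also have "\<dots> \<le> (\<integral>x. 1 + dp x (norm (\<psi>' k x)) \<partial>M)"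
    proof (rule integral_mono')
      show "integrable M (\<lambda>x. 1 + dp x (norm (\<psi>' k x)))" using c1 C1c_M(4)[OF C[of k]] by simp
      show "norm (\<psi>' k x) \<le> 1 + dp x (norm (\<psi>' k x))" for x
        using one[of "norm (\<psi>' k x)" p] pq mult_nonneg_nonneg[OF \<mu>(1)[of x] powr_ge_zero[of "norm (\<psi>' k x)" q]]
        by (simp add: dpH_def)
    qed (simp add: dp_nonneg)
    also have "\<dots> = (\<integral>x. 1 \<partial>M) + (\<integral>x. dp x (norm (\<psi>' k x)) \<partial>M)"
      using c1 C1c_M(4)[OF C[of k]] by (intro Bochner_Integration.integral_add) auto
    finally show "(\<integral>x. norm (\<psi>' k x) \<partial>lborel) \<le> (\<integral>x. 1 \<partial>M) + R" using R[of k] by linarith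
  qed
  then show ?thesis using AE_M_lborel by blast
qed

text \<open>The modular controls L^1 distances through z \<le> t + z^p / t^(p-1), with t small
  compared to the measure of \<Omega>; an L^1-Cauchy sequence has an almost everywhere convergent
  subsequence.\<close>

lemma gradient_complete:
  assumes C: "\<And>k. C1c \<Omega> (\<psi> k) (\<psi>' k)"
    and cau: "\<And>e. 0 < e \<Longrightarrow> \<exists>n. \<forall>j\<ge>n. \<forall>k\<ge>n. (\<integral>x. dp x (norm (\<psi>' j x - \<psi>' k x)) \<partial>M) \<le> e"
  shows "\<exists>s::nat\<Rightarrow>nat. strict_mono s \<and> (AE x in M. convergent (\<lambda>i. \<psi>' (s i) x))"
proof (rule L1_Cauchy_AE_subseq)
  note [measurable] = C1c_M(2)[OF C]
  show "\<psi>' k \<in> borel_measurable M" for k by measurable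
  fix e :: real assume e: "0 < e"
  define v where "v = measure M (space M)"
  \<comment> \<open>Makes the constant part at most e/2; \<open>v + 1\<close> avoids a division by
    zero.\<close>
  define t where "t = e / (2 * (v + 1))"
  have v: "0 \<le> v" by (simp add: v_def)
  have t: "0 < t" "t * v \<le> e / 2" unfolding t_def using e v by (auto simp: field_simps)
  obtain n where n: "\<And>j k. n \<le> j \<Longrightarrow> n \<le> k \<Longrightarrow> (\<integral>x. dp x (norm (\<psi>' j x - \<psi>' k x)) \<partial>M) \<le> t powr (p - 1) * (e / 2)"
    using cau[of "t powr (p - 1) * (e / 2)"] t e by auto
  have c1: "integrable M (\<lambda>x. t)" by (rule finite_measure.integrable_const[OF finM])
  show "\<exists>n. \<forall>j\<ge>n. \<forall>k\<ge>n. (\<integral>\<^sup>+x. ennreal (norm (\<psi>' j x - \<psi>' k x)) \<partial>M) \<le> ennreal e"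
  proof (intro exI[of _ n] allI impI)
    fix j k assume jk: "n \<le> j" "n \<le> k"
    have di: "integrable M (\<lambda>x. dp x (norm (\<psi>' j x - \<psi>' k x)))" by (rule C1c_M(4)[OF C1c_diff[OF C C]])
    have "(\<integral>\<^sup>+x. ennreal (norm (\<psi>' j x - \<psi>' k x)) \<partial>M) \<le> (\<integral>\<^sup>+x. ennreal (t + dp x (norm (\<psi>' j x - \<psi>' k x)) / t powr (p - 1)) \<partial>M)"
    proof (intro nn_integral_mono ennreal_leI)
      fix x
      define z where "z = norm (\<psi>' j x - \<psi>' k x)"
      have z: "0 \<le> z" by (simp add: z_def)
      have "z \<le> t + z powr p / t powr (p - 1)"
      proof (cases "z \<le> t")
        case True then show ?thesis by (simp add: add_increasing2)
      next
        case False
        then have "z * t powr (p - 1) \<le> z * z powr (p - 1)" using t pq by (intro mult_left_mono powr_mono2) auto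
        also have "\<dots> = z powr p" using False t by (simp add: powr_mult_base)
        finally have "z \<le> z powr p / t powr (p - 1)" using t by (simp add: le_divide_eq)
        then show ?thesis using t by simp
      qed
      also have "\<dots> \<le> t + dp x z / t powr (p - 1)"
        using \<mu>(1)[of x] by (intro add_left_mono divide_right_mono) (auto simp: dpH_def)
      finally show "norm (\<psi>' j x - \<psi>' k x) \<le> t + dp x (norm (\<psi>' j x - \<psi>' k x)) / t powr (p - 1)" unfolding z_def .
    qed
    also have "\<dots> = ennreal (\<integral>x. t + dp x (norm (\<psi>' j x - \<psi>' k x)) / t powr (p - 1) \<partial>M)"
      using c1 di t dp_nonneg by (intro nn_integral_eq_integral) (auto intro!: AE_I2 add_nonneg_nonneg)
    also have "(\<integral>x. t + dp x (norm (\<psi>' j x - \<psi>' k x)) / t powr (p - 1) \<partial>M) = t * v + (\<integral>x. dp x (norm (\<psi>' j x - \<psi>' k x)) \<partial>M) / t powr (p - 1)"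
      using c1 di by (subst Bochner_Integration.integral_add) (auto simp: v_def mult.commute)
    also have "\<dots> \<le> e / 2 + e / 2"
      using n[OF jk] t by (intro add_mono) (auto simp: divide_le_eq mult.commute)
    finally show "(\<integral>\<^sup>+x. ennreal (norm (\<psi>' j x - \<psi>' k x)) \<partial>M) \<le> ennreal e" by (simp add: ennreal_leI)
  qed
qed

text \<open>Because r > p, the superlinear Sobolev bound is linear on bounded ranges, and only a
  linear term can be absorbed.\<close>

lemma powr_tail_le: "0 \<le> D \<Longrightarrow> D \<le> R \<Longrightarrow> D powr (r / p) \<le> R powr (r / p - 1) * D" for D R :: real
proof -
  assume D: "0 \<le> D" "D \<le> R"
  have e: "0 \<le> r / p - 1" using r_gt pq by (simp add: field_simps)
  have "D powr (r / p) = D powr (r / p - 1) * D" using D by (cases "D = 0") (auto simp: powr_diff)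
  also have "\<dots> \<le> R powr (r / p - 1) * D" using D e by (intro mult_right_mono powr_mono2) auto
  finally show ?thesis .
qed

lemma midpoint_combine:
  fixes k l :: real
  assumes "Pm + D \<le> (Pf + Pg) / 2" "k * ((Af + Ag) / 2) \<le> k * Am" "l * ((Bf + Bg) / 2 - Bm) \<le> Z"
  shows "Pm - k * Am - l * Bm + D \<le> ((Pf - k * Af - l * Bf) + (Pg - k * Ag - l * Bg)) / 2 + Z"
proof -
  have "k * ((Af + Ag) / 2) = (k * Af + k * Ag) / 2" "l * ((Bf + Bg) / 2 - Bm) = (l * Bf + l * Bg) / 2 - l * Bm"
    by (simp_all only: distrib_left right_diff_distrib times_divide_eq_right)
  then show ?thesis using assms unfolding add_divide_distrib diff_divide_distrib by linarith
qed

text \<open>For nonnegative f and g the absolute value of the midpoint is the midpoint of the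
  absolute values, so concavity gives the singular term the right sign. The sign of b does not
  matter because the defect is nonnegative and |b| \<le> \<open>Bb\<close>.\<close>

lemma midpoint_energy:
  assumes C: "C1c \<Omega> f f'" "C1c \<Omega> g g'" and pos: "\<And>x. 0 \<le> f x" "\<And>x. 0 \<le> g x"
    and c: "\<And>x \<xi> \<eta>. Fd x ((1/2) *\<^sub>R (\<xi> + \<eta>)) + c * dp x (norm (\<xi> - \<eta>)) \<le> (Fd x \<xi> + Fd x \<eta>) / 2" and lam: "0 \<le> lam"
  shows "C1c \<Omega> (\<lambda>x. (1/2) * (f x + g x)) (\<lambda>x. (1/2) *\<^sub>R (f' x + g' x))"
    "\<Phi> (\<lambda>x. (1/2) *\<^sub>R (f' x + g' x)) + c * (\<integral>x. dp x (norm (f' x - g' x)) \<partial>M) \<le> (\<Phi> f' + \<Phi> g') / 2"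
    "En lam (\<lambda>x. (1/2) * (f x + g x)) (\<lambda>x. (1/2) *\<^sub>R (f' x + g' x)) + c * (\<integral>x. dp x (norm (f' x - g' x)) \<partial>M)
      \<le> (En lam f f' + En lam g g') / 2 + lam / r * (Bb * (\<integral>x. Err (f x) (g x) \<partial>M))"
proof -
  show Cm: "C1c \<Omega> (\<lambda>x. (1/2) * (f x + g x)) (\<lambda>x. (1/2) *\<^sub>R (f' x + g' x))"
    by (intro C1c_scale C1c_add C)
  note [measurable] = C1c_M(1,2)[OF C(1)] C1c_M(1,2)[OF C(2)]
  note i1 = C1c_M[OF C(1)] and i2 = C1c_M[OF C(2)] and im = C1c_M[OF Cm]
  have id: "integrable M (\<lambda>x. dp x (norm (f' x - g' x)))" by (rule C1c_M(4)[OF C1c_diff[OF C]])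
  have "(\<integral>x. Fd x ((1/2) *\<^sub>R (f' x + g' x)) + c * dp x (norm (f' x - g' x)) \<partial>M) \<le> (\<integral>x. (Fd x (f' x) + Fd x (g' x)) / 2 \<partial>M)"
    using i1 i2 im id c by (intro integral_mono) auto
  then show P: "\<Phi> (\<lambda>x. (1/2) *\<^sub>R (f' x + g' x)) + c * (\<integral>x. dp x (norm (f' x - g' x)) \<partial>M) \<le> (\<Phi> f' + \<Phi> g') / 2"
    unfolding \<Phi>_def using i1(5) i2(5) im(5) id by simp
  have "(\<integral>x. (a x * \<bar>f x\<bar> powr (1 - \<delta>) + a x * \<bar>g x\<bar> powr (1 - \<delta>)) / 2 \<partial>M) \<le> (\<integral>x. a x * \<bar>(1/2) * (f x + g x)\<bar> powr (1 - \<delta>) \<partial>M)"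
  proof (rule integral_mono)
    fix x
    have "a x * ((\<bar>f x\<bar> powr (1 - \<delta>) + \<bar>g x\<bar> powr (1 - \<delta>)) / 2) \<le> a x * ((\<bar>f x\<bar> + \<bar>g x\<bar>) / 2) powr (1 - \<delta>)"
      by (intro mult_left_mono powr_midpoint_concave a(1)) auto
    moreover have "\<bar>(1/2) * (f x + g x)\<bar> = (\<bar>f x\<bar> + \<bar>g x\<bar>) / 2" using pos[of x] by simp
    ultimately show "(a x * \<bar>f x\<bar> powr (1 - \<delta>) + a x * \<bar>g x\<bar> powr (1 - \<delta>)) / 2 \<le> a x * \<bar>(1/2) * (f x + g x)\<bar> powr (1 - \<delta>)"
      by (simp only: distrib_left times_divide_eq_right)
  qed (use i1(6) i2(6) im(6) in auto)
  then have A: "(An f + An g) / 2 \<le> An (\<lambda>x. (1/2) * (f x + g x))"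
    unfolding An_def using i1(6) i2(6) by simp
  have ir: "integrable M (\<lambda>x. Err (f x) (g x))"
  proof -
    have "integrable M (\<lambda>x. (\<bar>f x\<bar> powr r + \<bar>g x\<bar> powr r) / 2 - \<bar>(1/2) * (f x + g x)\<bar> powr r)"
      using i1(3)[of r] i2(3)[of r] im(3)[of r] r_gt by (intro Bochner_Integration.integrable_diff integrable_divide Bochner_Integration.integrable_add) auto
    then show ?thesis unfolding Err_def by simp
  qed
  have "(\<integral>x. (b x * \<bar>f x\<bar> powr r + b x * \<bar>g x\<bar> powr r) / 2 - b x * \<bar>(1/2) * (f x + g x)\<bar> powr r \<partial>M) \<le> (\<integral>x. Bb * Err (f x) (g x) \<partial>M)"
  proof (rule integral_mono)
    fix x
    have "b x * Err (f x) (g x) \<le> Bb * Err (f x) (g x)"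
      using b(1)[of x] by (intro mult_right_mono Err_bounds) auto
    then show "(b x * \<bar>f x\<bar> powr r + b x * \<bar>g x\<bar> powr r) / 2 - b x * \<bar>(1/2) * (f x + g x)\<bar> powr r \<le> Bb * Err (f x) (g x)"
      by (simp add: Err_def algebra_simps)
  qed (use i1(7) i2(7) im(7) ir in auto)
  then have B: "(Bn f + Bn g) / 2 - Bn (\<lambda>x. (1/2) * (f x + g x)) \<le> Bb * (\<integral>x. Err (f x) (g x) \<partial>M)"
    unfolding Bn_def using i1(7) i2(7) im(7) by simp
  have A': "1 / (1 - \<delta>) * ((An f + An g) / 2) \<le> 1 / (1 - \<delta>) * An (\<lambda>x. (1/2) * (f x + g x))"
    using A \<delta> by (intro mult_left_mono) auto
  have B': "lam / r * ((Bn f + Bn g) / 2 - Bn (\<lambda>x. (1/2) * (f x + g x))) \<le> lam / r * (Bb * (\<integral>x. Err (f x) (g x) \<partial>M))"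
    using lam r_gt by (intro mult_left_mono B) auto
  show "En lam (\<lambda>x. (1/2) * (f x + g x)) (\<lambda>x. (1/2) *\<^sub>R (f' x + g' x)) + c * (\<integral>x. dp x (norm (f' x - g' x)) \<partial>M)
      \<le> (En lam f f' + En lam g g') / 2 + lam / r * (Bb * (\<integral>x. Err (f x) (g x) \<partial>M))"
    unfolding En_def by (rule midpoint_combine[OF P A' B'])
qed

end

section \<open>Minimising sequences on a ball of the modular\<close>

context dphase begin

lemma dp_continuous: "continuous_on UNIV (\<lambda>\<xi>::'a. dp x (norm \<xi>))"
  unfolding dpH_def using pq
  by (intro continuous_intros continuous_on_powr_nonneg) auto

lemma \<Phi>_nonneg: "0 \<le> \<Phi> g"
  unfolding \<Phi>_def by (simp add: Fd_nonneg)

text \<open>The midpoint of two members of the sequence is again admissible, so its energy is at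
  least m. Hence the convexity gain, a multiple of the gradient distance, is at most the energy
  excess plus the critical defect.\<close>

lemma compactness:
  assumes \<rho>: "0 < \<rho>"
  shows "\<exists>\<Lambda>>0. \<forall>lam m \<psi> \<psi>'. 0 \<le> lam \<longrightarrow> lam \<le> \<Lambda> \<longrightarrow> (\<forall>k. C1c \<Omega> (\<psi> k) (\<psi>' k)) \<longrightarrow> (\<forall>k x. 0 \<le> \<psi> k x) \<longrightarrow>
    (\<forall>k. \<Phi> (\<psi>' k) \<le> \<rho>) \<longrightarrow> (\<lambda>k. En lam (\<psi> k) (\<psi>' k)) \<longlonglongrightarrow> m \<longrightarrow>
    (\<forall>f g. C1c \<Omega> f g \<longrightarrow> \<Phi> g \<le> \<rho> \<longrightarrow> m \<le> En lam f g) \<longrightarrow>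
    (\<exists>(s::nat\<Rightarrow>nat) u G. strict_mono s \<and> sconv (\<lambda>i. \<psi> (s i)) (\<lambda>i. \<psi>' (s i)) u G)"
proof -
  obtain k1 where k1: "k1 > 0" "\<And>x \<xi>. k1 * dp x (norm \<xi>) \<le> Fd x \<xi>" using Fd_bounds by blast
  obtain c where c: "c > 0" "\<And>x \<xi> \<eta>. Fd x ((1/2) *\<^sub>R (\<xi> + \<eta>)) + c * dp x (norm (\<xi> - \<eta>)) \<le> (Fd x \<xi> + Fd x \<eta>) / 2"
    using Fd_convex by blast
  obtain S where S: "S > 0" "\<And>f g. C1c \<Omega> f g \<Longrightarrow> (\<integral>x. \<bar>f x\<bar> powr r \<partial>M) \<le> S * (\<integral>x. dp x (norm (g x)) \<partial>M) powr (r / p)"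
    using sobolev_M by blast
  \<comment> \<open>An a priori bound for all gradient distances, from the quasi-triangle inequality
    of the modular.\<close>
  define R0 where "R0 = 2 powr q * (\<rho> / k1 + \<rho> / k1)"
  have R0: "0 < R0" using \<rho> k1 by (simp add: R0_def)
  define S2 where "S2 = S * R0 powr (r / p - 1)"
  have S2: "0 < S2" using S R0 by (simp add: S2_def)
  have Bb0: "0 \<le> Bb" using order_trans[OF abs_ge_zero b(1)] .
  \<comment> \<open>Solves \<Lambda>/r (Bb + 1) 2^r 2 S2 = c/2: 2^r comes from the defect bound, 2
    S2 from the two distances to u. The critical term then consumes at most half of the convexity
    gain.\<close>
  define \<Lambda> where "\<Lambda> = c * r / (4 * 2 powr r * (Bb + 1) * S2)"
  have \<Lambda>: "0 < \<Lambda>" using c r_gt Bb0 S2 by (simp add: \<Lambda>_def)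
  have main: "\<exists>(s::nat\<Rightarrow>nat) u G. strict_mono s \<and> sconv (\<lambda>i. \<psi>0 (s i)) (\<lambda>i. \<psi>0' (s i)) u G"
    if lam: "0 \<le> lam" "lam \<le> \<Lambda>" and C0: "\<And>k. C1c \<Omega> (\<psi>0 k) (\<psi>0' k)" and pos0: "\<And>k x. 0 \<le> \<psi>0 k x"
      and \<Phi>\<rho>0: "\<And>k. \<Phi> (\<psi>0' k) \<le> \<rho>" and En0: "(\<lambda>k. En lam (\<psi>0 k) (\<psi>0' k)) \<longlonglongrightarrow> m"
      and m: "\<And>f g. C1c \<Omega> f g \<Longrightarrow> \<Phi> g \<le> \<rho> \<Longrightarrow> m \<le> En lam f g" for lam m \<psi>0 \<psi>0'
  proof -
    have dpb: "(\<integral>x. dp x (norm (g x)) \<partial>M) \<le> \<rho> / k1" if C: "C1c \<Omega> f g" and g: "\<Phi> g \<le> \<rho>" for f g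
    proof -
      have "(\<integral>x. k1 * dp x (norm (g x)) \<partial>M) \<le> \<Phi> g"
        unfolding \<Phi>_def using C1c_M(4,5)[OF C] k1 by (intro integral_mono) auto
      then have "k1 * (\<integral>x. dp x (norm (g x)) \<partial>M) \<le> \<rho>" using g by simp
      then show ?thesis using k1 by (simp add: field_simps)
    qed
    have "\<exists>s::nat\<Rightarrow>nat. strict_mono s \<and> (AE x in M. convergent (\<lambda>i. \<psi>0 (s i) x))"
      by (rule C1c_subseq_AE[of \<psi>0 \<psi>0', OF C0 dpb[OF C0 \<Phi>\<rho>0]])
    then obtain s0 :: "nat \<Rightarrow> nat" where s0: "strict_mono s0" "AE x in M. convergent (\<lambda>i. \<psi>0 (s0 i) x)"
      by (elim exE conjE)
    define \<psi> where "\<psi> = (\<lambda>i. \<psi>0 (s0 i))"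
    define \<psi>' where "\<psi>' = (\<lambda>i. \<psi>0' (s0 i))"
    have C: "C1c \<Omega> (\<psi> k) (\<psi>' k)" and pos: "0 \<le> \<psi> k x" and \<Phi>\<rho>: "\<Phi> (\<psi>' k) \<le> \<rho>" for k x
      using C0 pos0 \<Phi>\<rho>0 by (simp_all add: \<psi>_def \<psi>'_def)
    have Enlim: "(\<lambda>k. En lam (\<psi> k) (\<psi>' k)) \<longlonglongrightarrow> m"
      using LIMSEQ_subseq_LIMSEQ[OF En0 s0(1)] by (simp add: \<psi>_def \<psi>'_def comp_def)
    note [measurable] = C1c_M(1,2)[OF C]
    \<comment> \<open>Where the sequence diverges \<open>lim\<close> returns an unspecified value,
      but only on a null set.\<close>
    define u where "u = (\<lambda>x. lim (\<lambda>i. \<psi> i x))"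
    have [measurable]: "u \<in> borel_measurable M" unfolding u_def by measurable
    have ulim: "AE x in M. (\<lambda>k. \<psi> k x) \<longlonglongrightarrow> u x"
      using s0(2) unfolding u_def \<psi>_def by eventually_elim (simp add: convergent_LIMSEQ_iff)
    define D where "D = (\<lambda>j k. \<integral>x. dp x (norm (\<psi>' j x - \<psi>' k x)) \<partial>M)"
    have D0: "0 \<le> D j k" for j k unfolding D_def by (simp add: dp_nonneg)
    have iD: "integrable M (\<lambda>x. dp x (norm (\<psi>' j x - \<psi>' k x)))" for j k by (rule C1c_M(4)[OF C1c_diff[OF C C]])
    have DR: "D j k \<le> R0" for j k
    proof -
      have "D j k \<le> (\<integral>x. 2 powr q * (dp x (norm (\<psi>' j x)) + dp x (norm (\<psi>' k x))) \<partial>M)"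
        unfolding D_def
      proof (rule integral_mono[OF iD])
        show "integrable M (\<lambda>x. 2 powr q * (dp x (norm (\<psi>' j x)) + dp x (norm (\<psi>' k x))))"
          using C1c_M(4)[OF C] by simp
        show "dp x (norm (\<psi>' j x - \<psi>' k x)) \<le> 2 powr q * (dp x (norm (\<psi>' j x)) + dp x (norm (\<psi>' k x)))" for x
          using dp_diff_le[of x "\<psi>' j x - \<psi>' k x" "- \<psi>' k x"] by simp
      qed
      also have "\<dots> = 2 powr q * ((\<integral>x. dp x (norm (\<psi>' j x)) \<partial>M) + (\<integral>x. dp x (norm (\<psi>' k x)) \<partial>M))"
        using C1c_M(4)[OF C] by simp
      also have "\<dots> \<le> R0" unfolding R0_def by (intro mult_left_mono add_mono dpb[OF C \<Phi>\<rho>]) simp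
      finally show ?thesis .
    qed
    have Sob: "(\<integral>x. \<bar>\<psi> j x - \<psi> k x\<bar> powr r \<partial>M) \<le> S2 * D j k" for j k
    proof -
      have "(\<integral>x. \<bar>\<psi> j x - \<psi> k x\<bar> powr r \<partial>M) \<le> S * D j k powr (r / p)"
        unfolding D_def by (rule S(2)[OF C1c_diff[OF C C]])
      also have "\<dots> \<le> S * (R0 powr (r / p - 1) * D j k)"
        using S(1) D0 DR by (intro mult_left_mono powr_tail_le) auto
      finally show ?thesis by (simp add: S2_def)
    qed
    have pw: "(\<lambda>n. \<bar>f n\<bar> powr r) \<longlonglongrightarrow> \<bar>l\<bar> powr r" if "f \<longlonglongrightarrow> l" for f :: "nat \<Rightarrow> real" and l
      using that r_gt by (intro tendsto_powr' tendsto_intros) auto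
    \<comment> \<open>Letting k tend to infinity in the Sobolev bound for differences, Fatou turns
      it into a bound for the distance to u, although u is not yet known to have a gradient.\<close>
    have e: "integrable M (\<lambda>x. \<bar>\<psi> j x - u x\<bar> powr r) \<and> (\<integral>x. \<bar>\<psi> j x - u x\<bar> powr r \<partial>M) \<le> S2 * L"
      if "\<And>k. n \<le> k \<Longrightarrow> D j k \<le> L" for j n L
    proof (rule fatou_real[where f="\<lambda>k x. \<bar>\<psi> j x - \<psi> k x\<bar> powr r"])
      show "integrable M (\<lambda>x. \<bar>\<psi> j x - \<psi> k x\<bar> powr r)" for k using C1c_M(3)[OF C1c_diff[OF C C], of r] r_gt by simp
      show "AE x in M. (\<lambda>k. \<bar>\<psi> j x - \<psi> k x\<bar> powr r) \<longlonglongrightarrow> \<bar>\<psi> j x - u x\<bar> powr r"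
        using ulim by eventually_elim (intro pw tendsto_intros)
      show "n \<le> k \<Longrightarrow> (\<integral>x. \<bar>\<psi> j x - \<psi> k x\<bar> powr r \<partial>M) \<le> S2 * L" for k
        using order_trans[OF Sob mult_left_mono[OF that]] S2 by simp
    qed auto
    have ei: "integrable M (\<lambda>x. \<bar>\<psi> j x - u x\<bar> powr r)" for j using e[of 0 j R0] DR by blast
    have ui: "integrable M (\<lambda>x. \<bar>u x\<bar> powr r)"
    proof (rule Bochner_Integration.integrable_bound[of _ "\<lambda>x. 2 powr r * (\<bar>\<psi> 0 x - u x\<bar> powr r + \<bar>\<psi> 0 x\<bar> powr r)"])
      show "integrable M (\<lambda>x. 2 powr r * (\<bar>\<psi> 0 x - u x\<bar> powr r + \<bar>\<psi> 0 x\<bar> powr r))"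
        using ei[of 0] C1c_M(3)[OF C[of 0], of r] r_gt by simp
      show "AE x in M. norm (\<bar>u x\<bar> powr r) \<le> norm (2 powr r * (\<bar>\<psi> 0 x - u x\<bar> powr r + \<bar>\<psi> 0 x\<bar> powr r))"
        using powr_diff_le[of "u x" "\<psi> 0 x" for x] by (intro AE_I2) (simp add: abs_minus_commute)
    qed measurable
    define \<kappa> where "\<kappa> = lam / r * Bb"
    have \<kappa>: "0 \<le> \<kappa>" using lam r_gt Bb0 by (simp add: \<kappa>_def)
    have \<kappa>S: "\<kappa> * (2 powr r * (2 * S2)) \<le> c / 2"
    proof -
      have "\<kappa> \<le> \<Lambda> / r * (Bb + 1)" unfolding \<kappa>_def using lam \<Lambda> r_gt Bb0 by (intro mult_mono divide_right_mono) auto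
      then have "\<kappa> * (2 powr r * (2 * S2)) \<le> \<Lambda> / r * (Bb + 1) * (2 powr r * (2 * S2))"
        using S2 by (intro mult_right_mono) auto
      also have "\<dots> = c / 2" using r_gt Bb0 S2 by (simp add: \<Lambda>_def)
      finally show ?thesis .
    qed
    have cauchy: "\<exists>n. \<forall>j\<ge>n. \<forall>k\<ge>n. D j k \<le> \<epsilon>" if \<epsilon>: "0 < \<epsilon>" for \<epsilon>
    proof (rule double_limit_absorb[OF DR _ \<epsilon>])
      show "0 \<le> R0" using R0 by simp
      fix L \<epsilon> :: real assume L: "0 \<le> L" and \<epsilon>: "0 < \<epsilon>" and "\<exists>n. \<forall>j\<ge>n. \<forall>k\<ge>n. D j k \<le> L"
      then obtain n0 where n0: "\<And>j k. n0 \<le> j \<Longrightarrow> n0 \<le> k \<Longrightarrow> D j k \<le> L" by blast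
      \<comment> \<open>Half of the slack c\<epsilon> is reserved for the defect estimate and half
        for the energy excess; \<open>\<kappa> + 1\<close> keeps the denominator positive.\<close>
      define e' where "e' = c * \<epsilon> / (2 * (\<kappa> + 1))"
      have e': "0 < e'" "\<kappa> * e' \<le> c * \<epsilon> / 2"
        unfolding e'_def using c \<epsilon> \<kappa> by (auto simp: field_simps intro!: divide_pos_pos)
      obtain n1 where n1: "\<And>j k. n1 \<le> j \<Longrightarrow> n1 \<le> k \<Longrightarrow> (\<integral>x. Err (\<psi> j x) (\<psi> k x) \<partial>M)
        \<le> e' + 2 powr r * ((\<integral>x. \<bar>\<psi> j x - u x\<bar> powr r \<partial>M) + (\<integral>x. \<bar>\<psi> k x - u x\<bar> powr r \<partial>M))"
        using Err_integral[OF C1c_M(1)[OF C] _ ulim ei ui e'(1)] by auto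
      have "\<forall>\<^sub>F k in sequentially. En lam (\<psi> k) (\<psi>' k) < m + c * \<epsilon> / 2"
        using c \<epsilon> by (intro order_tendstoD(2)[OF Enlim]) auto
      then obtain n2 where n2: "\<And>k. n2 \<le> k \<Longrightarrow> En lam (\<psi> k) (\<psi>' k) < m + c * \<epsilon> / 2"
        unfolding eventually_sequentially by blast
      have "D j k \<le> L / 2 + \<epsilon>" if jk: "max n0 (max n1 n2) \<le> j" "max n0 (max n1 n2) \<le> k" for j k
      proof -
        note mid = midpoint_energy[OF C C pos pos c(2) lam(1), of j k]
        \<comment> \<open>Convexity of \<open>\<Phi>\<close> keeps the midpoint in the ball, so that
          m bounds its energy from below.\<close>
        have "\<Phi> (\<lambda>x. (1/2) *\<^sub>R (\<psi>' j x + \<psi>' k x)) \<le> (\<Phi> (\<psi>' j) + \<Phi> (\<psi>' k)) / 2"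
          using mid(2) mult_nonneg_nonneg[OF less_imp_le[OF c(1)] D0[of j k]] unfolding D_def by linarith
        also have "\<dots> \<le> \<rho>" using \<Phi>\<rho>[of j] \<Phi>\<rho>[of k] by simp
        finally have mle: "m \<le> En lam (\<lambda>x. (1/2) * (\<psi> j x + \<psi> k x)) (\<lambda>x. (1/2) *\<^sub>R (\<psi>' j x + \<psi>' k x))"
          by (rule m[OF mid(1)])
        have "(\<integral>x. Err (\<psi> j x) (\<psi> k x) \<partial>M) \<le> e' + 2 powr r * (S2 * L + S2 * L)"
        proof -
          have "(\<integral>x. \<bar>\<psi> j x - u x\<bar> powr r \<partial>M) \<le> S2 * L" "(\<integral>x. \<bar>\<psi> k x - u x\<bar> powr r \<partial>M) \<le> S2 * L"
            using e[of n0 j L] e[of n0 k L] n0 jk by auto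
          then have "2 powr r * ((\<integral>x. \<bar>\<psi> j x - u x\<bar> powr r \<partial>M) + (\<integral>x. \<bar>\<psi> k x - u x\<bar> powr r \<partial>M)) \<le> 2 powr r * (S2 * L + S2 * L)"
            by (intro mult_left_mono add_mono) auto
          then show ?thesis using n1[of j k] jk by linarith
        qed
        then have "lam / r * (Bb * (\<integral>x. Err (\<psi> j x) (\<psi> k x) \<partial>M)) \<le> \<kappa> * (e' + 2 powr r * (S2 * L + S2 * L))"
          unfolding \<kappa>_def mult.assoc[of "lam / r" Bb, symmetric] using \<kappa> unfolding \<kappa>_def by (rule mult_left_mono)
        also have "\<dots> = \<kappa> * e' + \<kappa> * (2 powr r * (2 * S2)) * L" by (simp add: algebra_simps)
        also have "\<dots> \<le> c * \<epsilon> / 2 + c / 2 * L" using e' \<kappa>S L by (intro add_mono mult_right_mono) auto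
        finally have t: "lam / r * (Bb * (\<integral>x. Err (\<psi> j x) (\<psi> k x) \<partial>M)) \<le> c * \<epsilon> / 2 + c / 2 * L" .
        have "(En lam (\<psi> j) (\<psi>' j) + En lam (\<psi> k) (\<psi>' k)) / 2 \<le> m + c * \<epsilon> / 2"
          using n2[of j] n2[of k] jk by simp
        then have "c * D j k \<le> c * \<epsilon> / 2 + (c * \<epsilon> / 2 + c / 2 * L)"
          using mid(3) t mle unfolding D_def by linarith
        also have "\<dots> = c * (L / 2 + \<epsilon>)" by (simp add: algebra_simps)
        finally show ?thesis using c(1) by simp
      qed
      then show "\<exists>n. \<forall>j\<ge>n. \<forall>k\<ge>n. D j k \<le> L / 2 + \<epsilon>" by blast
    qed
    have "\<exists>s::nat\<Rightarrow>nat. strict_mono s \<and> (AE x in M. convergent (\<lambda>i. \<psi>' (s i) x))"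
      by (rule gradient_complete[of \<psi> \<psi>', OF C cauchy[unfolded D_def]])
    then obtain s1 :: "nat \<Rightarrow> nat" where s1: "strict_mono s1" "AE x in M. convergent (\<lambda>i. \<psi>' (s1 i) x)"
      by (elim exE conjE)
    define G where "G = (\<lambda>x. lim (\<lambda>i. \<psi>' (s1 i) x))"
    have [measurable]: "G \<in> borel_measurable M" unfolding G_def by measurable
    have Glim: "AE x in M. (\<lambda>k. \<psi>' (s1 k) x) \<longlonglongrightarrow> G x"
      using s1(2) unfolding G_def by eventually_elim (simp add: convergent_LIMSEQ_iff)
    have gg: "integrable M (\<lambda>x. dp x (norm (\<psi>' j x - G x))) \<and> (\<integral>x. dp x (norm (\<psi>' j x - G x)) \<partial>M) \<le> L"
      if "\<And>k. n \<le> k \<Longrightarrow> D j k \<le> L" for j n L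
    proof (rule fatou_real[where f="\<lambda>k x. dp x (norm (\<psi>' j x - \<psi>' (s1 k) x))"])
      show "AE x in M. (\<lambda>k. dp x (norm (\<psi>' j x - \<psi>' (s1 k) x))) \<longlonglongrightarrow> dp x (norm (\<psi>' j x - G x))"
        using Glim by eventually_elim (rule continuous_on_tendsto_compose[OF dp_continuous], auto intro!: tendsto_intros)
      show "n \<le> k \<Longrightarrow> (\<integral>x. dp x (norm (\<psi>' j x - \<psi>' (s1 k) x)) \<partial>M) \<le> L" for k
        using that[of "s1 k"] seq_suble[OF s1(1), of k] unfolding D_def by simp
    qed (auto simp: iD dp_nonneg)
    have "sconv (\<lambda>i. \<psi> (s1 i)) (\<lambda>i. \<psi>' (s1 i)) u G"
      unfolding sconv_def
    proof (intro conjI allI)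
      show "AE x in M. (\<lambda>k. \<psi> (s1 k) x) \<longlonglongrightarrow> u x"
        using ulim by eventually_elim (use LIMSEQ_subseq_LIMSEQ[OF _ s1(1)] in \<open>auto simp: comp_def\<close>)
      show "(\<lambda>k. \<integral>x. \<bar>\<psi> (s1 k) x - u x\<bar> powr r \<partial>M) \<longlonglongrightarrow> 0"
      proof (rule LIMSEQ_I)
        fix \<epsilon> :: real assume \<epsilon>: "0 < \<epsilon>"
        then obtain n where n: "\<And>j k. n \<le> j \<Longrightarrow> n \<le> k \<Longrightarrow> D j k \<le> \<epsilon> / (2 * S2)" using cauchy[of "\<epsilon> / (2 * S2)"] S2 by auto
        have "norm ((\<integral>x. \<bar>\<psi> (s1 k) x - u x\<bar> powr r \<partial>M) - 0) < \<epsilon>" if "n \<le> k" for k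
        proof -
          have "n \<le> s1 k" using that seq_suble[OF s1(1), of k] by simp
          then have "(\<integral>x. \<bar>\<psi> (s1 k) x - u x\<bar> powr r \<partial>M) \<le> S2 * (\<epsilon> / (2 * S2))" using e[of n "s1 k"] n by blast
          also have "\<dots> < \<epsilon>" using S2 \<epsilon> by simp
          finally show ?thesis by simp
        qed
        then show "\<exists>n. \<forall>k\<ge>n. norm ((\<integral>x. \<bar>\<psi> (s1 k) x - u x\<bar> powr r \<partial>M) - 0) < \<epsilon>" by blast
      qed
      show "(\<lambda>k. \<integral>x. dp x (norm (\<psi>' (s1 k) x - G x)) \<partial>M) \<longlonglongrightarrow> 0"
      proof (rule LIMSEQ_I)
        fix \<epsilon> :: real assume \<epsilon>: "0 < \<epsilon>"
        then obtain n where n: "\<And>j k. n \<le> j \<Longrightarrow> n \<le> k \<Longrightarrow> D j k \<le> \<epsilon> / 2" using cauchy[of "\<epsilon> / 2"] by auto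
        have "norm ((\<integral>x. dp x (norm (\<psi>' (s1 k) x - G x)) \<partial>M) - 0) < \<epsilon>" if "n \<le> k" for k
        proof -
          have "n \<le> s1 k" using that seq_suble[OF s1(1), of k] by simp
          then have "(\<integral>x. dp x (norm (\<psi>' (s1 k) x - G x)) \<partial>M) \<le> \<epsilon> / 2" using gg[of n "s1 k"] n by blast
          moreover have "0 \<le> (\<integral>x. dp x (norm (\<psi>' (s1 k) x - G x)) \<partial>M)" by (simp add: dp_nonneg)
          ultimately show ?thesis using \<epsilon> by simp
        qed
        then show "\<exists>n. \<forall>k\<ge>n. norm ((\<integral>x. dp x (norm (\<psi>' (s1 k) x - G x)) \<partial>M) - 0) < \<epsilon>" by blast
      qed
      show "integrable M (\<lambda>x. dp x (norm (\<psi>' (s1 k) x - G x)))" for k using gg[of 0 "s1 k" R0] DR by blast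
    qed (use C Glim ei in auto)
    then have "sconv (\<lambda>i. \<psi>0 ((s0 \<circ> s1) i)) (\<lambda>i. \<psi>0' ((s0 \<circ> s1) i)) u G" by (simp add: \<psi>_def \<psi>'_def)
    then show ?thesis using strict_mono_o[OF s0(1) s1(1)] by blast
  qed
  show ?thesis
    by (intro exI[of _ \<Lambda>] conjI \<Lambda> allI impI) (rule main; blast)
qed

text \<open>The exponents show the roles of the terms: (1 - \<delta>)/p < 1 lets \<rho> win for
  large \<rho>, while the critical term is controlled by \<lambda> afterwards.\<close>

lemma energy_bounds:
  "\<exists>CA>0. \<exists>S>0. \<forall>\<rho>>0. \<forall>f g. C1c \<Omega> f g \<longrightarrow> \<Phi> g \<le> \<rho> \<longrightarrow>
     An f \<le> CA * \<rho> powr ((1 - \<delta>) / p) \<and> \<bar>Bn f\<bar> \<le> S * \<rho> powr (r / p)"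
proof -
  obtain k1 where k1: "k1 > 0" "\<And>x \<xi>. k1 * dp x (norm \<xi>) \<le> Fd x \<xi>" using Fd_bounds by blast
  obtain S where S: "S > 0" "\<And>f g. C1c \<Omega> f g \<Longrightarrow> (\<integral>x. \<bar>f x\<bar> powr r \<partial>M) \<le> S * (\<integral>x. dp x (norm (g x)) \<partial>M) powr (r / p)"
    using sobolev_M by blast
  define S3 where "S3 = S * (1 / k1) powr (r / p)"
  have S3: "0 < S3" using S k1 by (simp add: S3_def)
  define Ca where "Ca = (\<integral>x. a x powr (r / (r - 1 + \<delta>)) \<partial>M)"
  have Ca: "0 \<le> Ca" by (simp add: Ca_def)
  have Bb0: "0 \<le> Bb" using order_trans[OF abs_ge_zero b(1)] .
  have "An f \<le> (Ca + S3) * \<rho> powr ((1 - \<delta>) / p) \<and> \<bar>Bn f\<bar> \<le> (Bb + 1) * S3 * \<rho> powr (r / p)"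
    if \<rho>: "\<rho> > 0" and C: "C1c \<Omega> f g" and g: "\<Phi> g \<le> \<rho>" for \<rho> f g
  proof -
    have "(\<integral>x. k1 * dp x (norm (g x)) \<partial>M) \<le> \<Phi> g"
      unfolding \<Phi>_def using C1c_M(4,5)[OF C] k1 by (intro integral_mono) auto
    then have d: "(\<integral>x. dp x (norm (g x)) \<partial>M) \<le> 1 / k1 * \<rho>" using g k1 by (simp add: field_simps)
    have "(\<integral>x. \<bar>f x\<bar> powr r \<partial>M) \<le> S * (\<integral>x. dp x (norm (g x)) \<partial>M) powr (r / p)" by (rule S(2)[OF C])
    also have "\<dots> \<le> S * (1 / k1 * \<rho>) powr (r / p)"
      using S(1) d r_gt pq by (intro mult_left_mono powr_mono2) (auto simp: dp_nonneg)
    also have "\<dots> = S3 * \<rho> powr (r / p)" by (simp only: S3_def powr_mult mult.assoc)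
    finally have f: "(\<integral>x. \<bar>f x\<bar> powr r \<partial>M) \<le> S3 * \<rho> powr (r / p)" .
    \<comment> \<open>With this scale the bracket in Young's inequality is bounded independently of
      \<rho>, and the prefactor carries the power of \<rho>.\<close>
    define \<tau> where "\<tau> = \<rho> powr (1 / p)"
    have \<tau>: "0 < \<tau>" "\<tau> powr r = \<rho> powr (r / p)" "\<tau> powr (1 - \<delta>) = \<rho> powr ((1 - \<delta>) / p)"
      using \<rho> by (simp_all add: \<tau>_def powr_powr)
    have fi: "integrable M (\<lambda>x. \<bar>f x\<bar> powr r)" using C1c_M(3)[OF C, of r] r_gt by simp
    have "An f \<le> (\<integral>x. \<tau> powr (1 - \<delta>) * (a x powr (r / (r - 1 + \<delta>)) + \<bar>f x\<bar> powr r / \<tau> powr r) \<partial>M)"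
      unfolding An_def using C1c_M(6)[OF C] a(1,3) fi \<tau> \<delta> r_gt by (intro integral_mono powr_young) auto
    also have "\<dots> = \<tau> powr (1 - \<delta>) * (Ca + (\<integral>x. \<bar>f x\<bar> powr r \<partial>M) / \<tau> powr r)"
      using a(3) fi by (simp add: Ca_def)
    also have "\<dots> \<le> \<tau> powr (1 - \<delta>) * (Ca + S3)"
      using f \<tau> \<rho> by (intro mult_left_mono add_left_mono) (auto simp: divide_le_eq)
    finally have A: "An f \<le> (Ca + S3) * \<rho> powr ((1 - \<delta>) / p)" unfolding \<tau>(3) by (simp add: mult.commute)
    have "\<bar>Bn f\<bar> \<le> (\<integral>x. \<bar>b x * \<bar>f x\<bar> powr r\<bar> \<partial>M)"
      unfolding Bn_def using integral_norm_bound[of M "\<lambda>x. b x * \<bar>f x\<bar> powr r"] by simp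
    also have "\<dots> \<le> (\<integral>x. Bb * \<bar>f x\<bar> powr r \<partial>M)"
      using fi b(1) Bb0 by (intro integral_mono') (auto simp: abs_mult intro!: mult_right_mono)
    also have "\<dots> \<le> (Bb + 1) * (S3 * \<rho> powr (r / p))" using f Bb0 by (auto intro!: mult_mono)
    finally show ?thesis using A by (simp add: mult.assoc)
  qed
  moreover have "0 < Ca + S3" "0 < (Bb + 1) * S3" using Ca S3 Bb0 by auto
  ultimately show ?thesis by blast
qed

end

section \<open>Existence of a minimiser\<close>

text \<open>A smooth substitute for |s|. Subtracting e makes it vanish at 0, so supports do not
  grow; it stays below |s| and has slope at most 1, so it does not increase the gradient
  modular.\<close>

definition sabs :: "real \<Rightarrow> real \<Rightarrow> real" where
  "sabs e s = sqrt (s\<^sup>2 + e\<^sup>2) - e"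

definition sabs' :: "real \<Rightarrow> real \<Rightarrow> real" where
  "sabs' e s = s / sqrt (s\<^sup>2 + e\<^sup>2)"

lemma sabs_deriv:
  assumes "0 < e" shows "(sabs e has_real_derivative sabs' e s) (at s)"
proof -
  have "0 < s\<^sup>2 + e\<^sup>2" using assms by (simp add: add_nonneg_pos)
  then show ?thesis unfolding sabs_def[abs_def] sabs'_def
    by (auto intro!: derivative_eq_intros simp: field_simps)
qed

lemma sabs_bounds:
  assumes "0 < e" shows "0 \<le> sabs e s" "sabs e s \<le> \<bar>s\<bar>" "\<bar>s\<bar> - e \<le> sabs e s" "\<bar>sabs' e s\<bar> \<le> 1"
proof -
  have "sqrt (e\<^sup>2) \<le> sqrt (s\<^sup>2 + e\<^sup>2)" by (intro real_sqrt_le_mono) simp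
  then show "0 \<le> sabs e s" using assms by (simp add: sabs_def)
  have s: "\<bar>s\<bar> \<le> sqrt (s\<^sup>2 + e\<^sup>2)"
    by (rule real_le_rsqrt) simp
  then show "\<bar>s\<bar> - e \<le> sabs e s" by (simp add: sabs_def)
  have "sqrt (s\<^sup>2 + e\<^sup>2) \<le> \<bar>s\<bar> + e"
    using assms by (intro real_le_lsqrt) (auto simp: power2_eq_square algebra_simps abs_mult_self_eq)
  then show "sabs e s \<le> \<bar>s\<bar>" by (simp add: sabs_def)
  have "0 < sqrt (s\<^sup>2 + e\<^sup>2)" using assms by (simp add: add_nonneg_pos)
  then show "\<bar>sabs' e s\<bar> \<le> 1" using s by (simp add: sabs'_def divide_le_eq)
qed

lemma C1c_sabs:
  assumes "C1c \<Omega> f g" "0 < e"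
  shows "C1c \<Omega> (\<lambda>x. sabs e (f x)) (\<lambda>x. sabs' e (f x) *\<^sub>R g x)"
proof (rule C1c_comp[OF assms(1) sabs_deriv[OF assms(2)]])
  have "s\<^sup>2 + e\<^sup>2 \<noteq> 0" for s using assms(2) by (metis add_nonneg_pos less_irrefl zero_le_power2 zero_less_power2)
  then show "continuous_on UNIV (sabs' e)" unfolding sabs'_def[abs_def]
    by (intro continuous_intros) auto
  show "sabs e 0 = 0" using assms(2) by (simp add: sabs_def)
qed

lemma sabs_tendsto: "(\<lambda>n. sabs (1 / real (Suc n)) s) \<longlonglongrightarrow> \<bar>s\<bar>"
proof (rule tendsto_sandwich[of "\<lambda>n. \<bar>s\<bar> - 1 / real (Suc n)" _ _ "\<lambda>n. \<bar>s\<bar>"])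
  show "(\<lambda>n. \<bar>s\<bar> - 1 / real (Suc n)) \<longlonglongrightarrow> \<bar>s\<bar>"
    using tendsto_diff[OF tendsto_const LIMSEQ_inverse_real_of_nat, of "\<bar>s\<bar>"] by (simp add: divide_inverse)
qed (auto intro!: always_eventually sabs_bounds simp del: of_nat_Suc)

text \<open>An explicit C^1 bump, positive exactly on the open ball of radius R.\<close>

lemma C1c_bump:
  fixes c :: "'a::euclidean_space"
  assumes R: "0 \<le> R" and "cball c R \<subseteq> \<Omega>"
  shows "C1c \<Omega> (\<lambda>x. (max 0 (R\<^sup>2 - (x - c) \<bullet> (x - c)))\<^sup>2)
     (\<lambda>x. (- 4 * max 0 (R\<^sup>2 - (x - c) \<bullet> (x - c))) *\<^sub>R (x - c))"
proof (rule C1cI[OF _ _ compact_cball assms(2)])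
  fix x
  have "((\<lambda>x. R\<^sup>2 - (x - c) \<bullet> (x - c)) has_derivative (\<lambda>h. - 2 * ((x - c) \<bullet> h))) (at x)"
    by (auto intro!: derivative_eq_intros simp: inner_commute)
  from has_derivative_compose[OF this has_derivative_max0_square[unfolded has_field_derivative_def]]
  show "((\<lambda>x. (max 0 (R\<^sup>2 - (x - c) \<bullet> (x - c)))\<^sup>2) has_derivative
     (\<bullet>) ((- 4 * max 0 (R\<^sup>2 - (x - c) \<bullet> (x - c))) *\<^sub>R (x - c))) (at x)"
    by (rule has_derivative_eq_rhs) (simp add: fun_eq_iff)
  assume "x \<notin> cball c R"
  then have "R \<le> norm (x - c)" by (simp add: dist_norm norm_minus_commute)
  then have "R\<^sup>2 \<le> (norm (x - c))\<^sup>2" using R by (intro power_mono) auto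
  then show "(max 0 (R\<^sup>2 - (x - c) \<bullet> (x - c)))\<^sup>2 = 0"
    by (simp add: power2_norm_eq_inner)
qed (intro continuous_intros)

context dphase begin

text \<open>Replacing f by its absolute value would preserve the energy but leave the class C^1;
  \<open>sabs\<close> does not raise \<open>\<Phi>\<close>, and the lower order terms converge as
  its parameter tends to 0.\<close>

lemma nonneg_approx:
  assumes C: "C1c \<Omega> f g" and e: "0 < e"
  shows "\<exists>f2 g2. C1c \<Omega> f2 g2 \<and> (\<forall>x. 0 \<le> f2 x) \<and> \<Phi> g2 \<le> \<Phi> g \<and> En lam f2 g2 < En lam f g + e"
proof -
  define f2 where "f2 = (\<lambda>n x. sabs (1 / real (Suc n)) (f x))"
  define g2 where "g2 = (\<lambda>n x. sabs' (1 / real (Suc n)) (f x) *\<^sub>R g x)"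
  have C2: "C1c \<Omega> (f2 n) (g2 n)" for n unfolding f2_def g2_def by (rule C1c_sabs[OF C]) simp
  note [measurable] = C1c_M(1,2)[OF C] C1c_M(1,2)[OF C2]
  have f2: "0 \<le> f2 n x" "f2 n x \<le> \<bar>f x\<bar>" for n x unfolding f2_def by (rule sabs_bounds; simp)+
  have \<Phi>: "\<Phi> (g2 n) \<le> \<Phi> g" for n
    unfolding \<Phi>_def
  proof (rule integral_mono[OF C1c_M(5)[OF C2] C1c_M(5)[OF C]])
    fix x
    have "\<bar>sabs' (1 / real (Suc n)) (f x)\<bar> * H (g x) \<le> 1 * H (g x)"
      by (intro mult_right_mono sabs_bounds H_nonneg) simp
    then have h: "H (g2 n x) \<le> H (g x)" by (simp add: g2_def H_scale)
    show "Fd x (g2 n x) \<le> Fd x (g x)"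
      unfolding Fd_def using pq \<mu>(1)[of x] h H_nonneg
      by (intro add_mono divide_right_mono mult_left_mono powr_mono2) auto
  qed
  have gen: "(\<lambda>n. \<integral>x. c x * \<bar>f2 n x\<bar> powr s \<partial>M) \<longlonglongrightarrow> (\<integral>x. c x * \<bar>f x\<bar> powr s \<partial>M)"
    if [measurable]: "c \<in> borel_measurable M" and s: "0 < s" and i: "integrable M (\<lambda>x. c x * \<bar>f x\<bar> powr s)"
    for c :: "'a \<Rightarrow> real" and s
  proof (rule integral_dominated_convergence[where w="\<lambda>x. \<bar>c x * \<bar>f x\<bar> powr s\<bar>"])
    show "AE x in M. (\<lambda>n. c x * \<bar>f2 n x\<bar> powr s) \<longlonglongrightarrow> c x * \<bar>f x\<bar> powr s"
    proof (rule AE_I2)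
      fix x
      have "(\<lambda>n. \<bar>f2 n x\<bar>) \<longlonglongrightarrow> \<bar>\<bar>f x\<bar>\<bar>" unfolding f2_def by (intro tendsto_rabs sabs_tendsto)
      then show "(\<lambda>n. c x * \<bar>f2 n x\<bar> powr s) \<longlonglongrightarrow> c x * \<bar>f x\<bar> powr s"
        using s by (intro tendsto_mult tendsto_const tendsto_powr') auto
    qed
    show "AE x in M. norm (c x * \<bar>f2 n x\<bar> powr s) \<le> \<bar>c x * \<bar>f x\<bar> powr s\<bar>" for n
      using f2 s by (intro AE_I2) (auto simp: abs_mult intro!: mult_left_mono powr_mono2)
  qed (use i in auto)
  have "(\<lambda>n. \<Phi> g - 1 / (1 - \<delta>) * An (f2 n) - lam / r * Bn (f2 n)) \<longlonglongrightarrow> En lam f g"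
    unfolding En_def An_def Bn_def using \<delta> r_gt C1c_M(6,7)[OF C]
    by (intro tendsto_intros gen) auto
  then have "\<forall>\<^sub>F n in sequentially. \<Phi> g - 1 / (1 - \<delta>) * An (f2 n) - lam / r * Bn (f2 n) < En lam f g + e"
    using e by (intro order_tendstoD(2)) auto
  then obtain n where "\<Phi> g - 1 / (1 - \<delta>) * An (f2 n) - lam / r * Bn (f2 n) < En lam f g + e"
    using eventually_happens trivial_limit_sequentially by blast
  then have "En lam (f2 n) (g2 n) < En lam f g + e" using \<Phi>[of n] unfolding En_def by linarith
  then show ?thesis using C2 f2 \<Phi> by blast
qed

text \<open>For tf with t \<le> 1 all terms except the singular one are at most a multiple of t,
  while the singular one is of order t^(1-\<delta>), which is larger for small t. It is nonzero
  since a > 0 a.e.\<close>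

lemma negative_energy:
  assumes \<rho>: "0 < \<rho>" and lam: "0 \<le> lam"
  shows "\<exists>f g. C1c \<Omega> f g \<and> \<Phi> g \<le> \<rho> \<and> En lam f g < 0"
proof -
  obtain c where "c \<in> \<Omega>" using \<Omega>(3) by blast
  then obtain R where R: "R > 0" "cball c R \<subseteq> \<Omega>" using \<Omega>(1) open_contains_cball by blast
  define f where "f = (\<lambda>x. (max 0 (R\<^sup>2 - (x - c) \<bullet> (x - c)))\<^sup>2)"
  define g where "g = (\<lambda>x. (- 4 * max 0 (R\<^sup>2 - (x - c) \<bullet> (x - c))) *\<^sub>R (x - c))"
  have C: "C1c \<Omega> f g" unfolding f_def g_def using R by (intro C1c_bump) auto
  note [measurable] = C1c_M(1,2)[OF C]
  have fpos: "0 < f x" if "x \<in> ball c R" for x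
  proof -
    have "norm (x - c) < R" using that by (simp add: dist_norm norm_minus_commute)
    then have "(norm (x - c))\<^sup>2 < R\<^sup>2" by (intro power_strict_mono) auto
    then show ?thesis by (simp add: f_def power2_norm_eq_inner)
  qed
  have A0: "0 < An f"
  proof (rule ccontr)
    assume "\<not> 0 < An f"
    moreover have "0 \<le> An f" unfolding An_def by (simp add: a(1))
    ultimately have "An f = 0" by simp
    then have "AE x in M. a x * \<bar>f x\<bar> powr (1 - \<delta>) = 0"
      unfolding An_def using C1c_M(6)[OF C] by (subst (asm) integral_nonneg_eq_0_iff_AE) (auto simp: a(1))
    then have "AE x in M. x \<notin> ball c R"
      using a(4) by eventually_elim (use fpos in force)
    then have "AE x in lebesgue. x \<in> \<Omega> \<longrightarrow> x \<notin> ball c R"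
      using \<Omega>(1) by (subst (asm) AE_restrict_space_iff) auto
    then have "AE x in lebesgue. x \<notin> ball c R"
      by eventually_elim (use R(2) ball_subset_cball[of c R] in blast)
    then have "emeasure lebesgue (ball c R) = 0"
      by (subst (asm) AE_iff_measurable[of "ball c R"]) auto
    then show False using content_ball_pos[OF R(1), of c] by (simp add: measure_def)
  qed
  define CC where "CC = \<Phi> g + lam / r * \<bar>Bn f\<bar>"
  have CC: "0 \<le> CC" unfolding CC_def using \<Phi>_nonneg[of g] lam r_gt by simp
  define A' where "A' = 1 / (1 - \<delta>) * An f"
  have A': "0 < A'" using A0 \<delta> by (simp add: A'_def)
  \<comment> \<open>The entries of the minimum give t^p \<le> t, then t^\<delta> CC < A', which
    makes the energy negative, and finally admissibility in the ball.\<close>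
  define t where "t = min 1 (min ((A' / (2 * (CC + 1))) powr (1 / \<delta>)) (\<rho> / (\<Phi> g + 1)))"
  have t: "0 < t" "t \<le> 1" "t \<le> (A' / (2 * (CC + 1))) powr (1 / \<delta>)" "t \<le> \<rho> / (\<Phi> g + 1)"
    using A' CC \<rho> \<Phi>_nonneg[of g] by (auto simp: t_def intro!: divide_pos_pos add_nonneg_pos)
  have tp: "t powr s \<le> t" if "1 \<le> s" for s
    using powr_mono'[of 1 s t] that t by simp
  have Ct: "C1c \<Omega> (\<lambda>x. t * f x) (\<lambda>x. t *\<^sub>R g x)" by (rule C1c_scale[OF C])
  have \<Phi>t: "\<Phi> (\<lambda>x. t *\<^sub>R g x) \<le> t * \<Phi> g"
  proof -
    have "\<Phi> (\<lambda>x. t *\<^sub>R g x) \<le> (\<integral>x. t * Fd x (g x) \<partial>M)"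
      unfolding \<Phi>_def
    proof (rule integral_mono)
      fix x
      have *: "H (t *\<^sub>R g x) powr s / s \<le> t * (H (g x) powr s / s)" if "1 \<le> s" for s
      proof -
        have "H (t *\<^sub>R g x) powr s = t powr s * H (g x) powr s" using t by (simp add: H_scale powr_mult)
        also have "\<dots> \<le> t * H (g x) powr s" by (intro mult_right_mono tp that) auto
        finally show ?thesis using that by (simp add: divide_right_mono)
      qed
      have "\<mu> x * (H (t *\<^sub>R g x) powr q / q) \<le> \<mu> x * (t * (H (g x) powr q / q))"
        using pq by (intro mult_left_mono * \<mu>(1)) auto
      with *[of p] show "Fd x (t *\<^sub>R g x) \<le> t * Fd x (g x)"
        unfolding Fd_def using pq by (simp add: algebra_simps)
    qed (use C1c_M(5)[OF C] C1c_M(5)[OF Ct] in auto)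
    then show ?thesis by (simp add: \<Phi>_def)
  qed
  have An_t: "An (\<lambda>x. t * f x) = t powr (1 - \<delta>) * An f"
    unfolding An_def using t
    by (subst integral_mult_right_zero[symmetric])
      (intro Bochner_Integration.integral_cong refl, simp add: abs_mult powr_mult mult.left_commute)
  have Bn_t: "Bn (\<lambda>x. t * f x) = t powr r * Bn f"
    unfolding Bn_def using t
    by (subst integral_mult_right_zero[symmetric])
      (intro Bochner_Integration.integral_cong refl, simp add: abs_mult powr_mult mult.left_commute)
  have \<Phi>\<rho>: "\<Phi> (\<lambda>x. t *\<^sub>R g x) \<le> \<rho>"
  proof -
    have "t * \<Phi> g \<le> \<rho> / (\<Phi> g + 1) * (\<Phi> g + 1)" using t \<Phi>_nonneg[of g] \<rho> by (intro mult_mono) auto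
    also have "\<dots> = \<rho>" using \<Phi>_nonneg[of g] by simp
    finally show ?thesis using \<Phi>t by linarith
  qed
  have "- (lam / r * (t powr r * Bn f)) \<le> t * (lam / r * \<bar>Bn f\<bar>)"
  proof -
    have "- (lam / r * (t powr r * Bn f)) \<le> lam / r * (t powr r * \<bar>Bn f\<bar>)"
      using lam r_gt mult_left_mono[of "- (t powr r * Bn f)" "t powr r * \<bar>Bn f\<bar>" "lam / r"]
        mult_left_mono[of "- Bn f" "\<bar>Bn f\<bar>" "t powr r"] by simp
    also have "\<dots> \<le> lam / r * (t * \<bar>Bn f\<bar>)"
      using lam r_gt tp[of r] by (intro mult_left_mono mult_right_mono) auto
    finally show ?thesis by (simp add: mult.left_commute)
  qed
  then have "En lam (\<lambda>x. t * f x) (\<lambda>x. t *\<^sub>R g x) \<le> t * CC - t powr (1 - \<delta>) * A'"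
    unfolding En_def An_t Bn_t A'_def CC_def using \<Phi>t by (simp add: algebra_simps)
  also have "t * CC - t powr (1 - \<delta>) * A' = t powr (1 - \<delta>) * (t powr \<delta> * CC - A')"
    using t by (simp add: algebra_simps powr_add[symmetric])
  also have "\<dots> < 0"
  proof -
    have "t powr \<delta> \<le> ((A' / (2 * (CC + 1))) powr (1 / \<delta>)) powr \<delta>" using t \<delta> by (intro powr_mono2) auto
    also have "\<dots> = A' / (2 * (CC + 1))" using \<delta> A' CC by (simp add: powr_powr)
    finally have "t powr \<delta> * CC \<le> A' / (2 * (CC + 1)) * CC" using CC by (rule mult_right_mono)
    also have "\<dots> < A'"
    proof -
      have "0 < A' * CC + A' * 2" using A' CC by (intro add_nonneg_pos mult_nonneg_nonneg mult_pos_pos) auto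
      then show ?thesis using CC by (simp add: field_simps)
    qed
    finally show ?thesis using t by (simp add: mult_pos_neg)
  qed
  finally show ?thesis using Ct \<Phi>\<rho> by blast
qed

text \<open>Strict interiority comes from the lower bound \<open>low\<close>: a function of negative
  energy in the ball satisfies \<Phi> < 3\<rho>/4, and the bound survives the limit.\<close>

lemma minimizer_exists:
  "\<exists>\<Lambda>>0. \<forall>lam. 0 < lam \<longrightarrow> lam < \<Lambda> \<longrightarrow> (\<exists>\<rho> \<psi> \<psi>' u G. sconv \<psi> \<psi>' u G \<and> (\<forall>k x. 0 \<le> \<psi> k x) \<and>
    \<Phi> G < \<rho> \<and> En lam u G < 0 \<and> (\<forall>f g. C1c \<Omega> f g \<longrightarrow> \<Phi> g \<le> \<rho> \<longrightarrow> En lam u G \<le> En lam f g))"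
proof -
  obtain CA S where CA: "CA > 0" and S: "S > 0" and eb: "\<And>\<rho> f g. \<rho> > 0 \<Longrightarrow> C1c \<Omega> f g \<Longrightarrow> \<Phi> g \<le> \<rho> \<Longrightarrow>
     An f \<le> CA * \<rho> powr ((1 - \<delta>) / p) \<and> \<bar>Bn f\<bar> \<le> S * \<rho> powr (r / p)"
    using energy_bounds by blast
  define \<theta> where "\<theta> = (1 - \<delta>) / p"
  have \<theta>: "0 < \<theta>" "\<theta> < 1" unfolding \<theta>_def using \<delta> pq by (auto simp: field_simps)
  \<comment> \<open>Solves CA \<rho>^\<theta> / (1 - \<delta>) = \<rho>/2, possible as \<theta> < 1:
    the singular term uses up half of \<rho>.\<close>
  define \<rho> where "\<rho> = (2 * CA / (1 - \<delta>)) powr (1 / (1 - \<theta>))"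
  have \<rho>: "0 < \<rho>" unfolding \<rho>_def using CA \<delta> by simp
  have A\<rho>: "1 / (1 - \<delta>) * (CA * \<rho> powr \<theta>) = \<rho> / 2"
  proof -
    have "\<rho> powr (1 - \<theta>) = 2 * CA / (1 - \<delta>)" unfolding \<rho>_def using CA \<delta> \<theta> by (simp add: powr_powr)
    then have "1 / (1 - \<delta>) * CA = \<rho> powr (1 - \<theta>) / 2" using \<delta> by (simp add: field_simps)
    then have "1 / (1 - \<delta>) * (CA * \<rho> powr \<theta>) = \<rho> powr (1 - \<theta>) / 2 * \<rho> powr \<theta>"
      by (metis mult.assoc)
    also have "\<dots> = (\<rho> powr (1 - \<theta>) * \<rho> powr \<theta>) / 2" by simp
    also have "\<rho> powr (1 - \<theta>) * \<rho> powr \<theta> = \<rho>" using \<rho> by (simp add: powr_add[symmetric])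
    finally show ?thesis .
  qed
  obtain \<Lambda>1 where \<Lambda>1: "\<Lambda>1 > 0" and cpt: "\<And>lam m \<psi> \<psi>'. 0 \<le> lam \<Longrightarrow> lam \<le> \<Lambda>1 \<Longrightarrow> (\<forall>k. C1c \<Omega> (\<psi> k) (\<psi>' k)) \<Longrightarrow> (\<forall>k x. 0 \<le> \<psi> k x) \<Longrightarrow>
    (\<forall>k. \<Phi> (\<psi>' k) \<le> \<rho>) \<Longrightarrow> (\<lambda>k. En lam (\<psi> k) (\<psi>' k)) \<longlonglongrightarrow> m \<Longrightarrow>
    (\<forall>f g. C1c \<Omega> f g \<longrightarrow> \<Phi> g \<le> \<rho> \<longrightarrow> m \<le> En lam f g) \<Longrightarrow>
    (\<exists>(s::nat\<Rightarrow>nat) u G. strict_mono s \<and> sconv (\<lambda>i. \<psi> (s i)) (\<lambda>i. \<psi>' (s i)) u G)"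
    using compactness[OF \<rho>] by blast
  \<comment> \<open>For \<lambda> below this value the critical term costs at most another \<rho>/4
    in the ball.\<close>
  define \<Lambda>2 where "\<Lambda>2 = r * \<rho> / (4 * (S * \<rho> powr (r / p)))"
  have \<Lambda>2: "\<Lambda>2 > 0" unfolding \<Lambda>2_def using r_gt \<rho> S by simp
  have main: "\<exists>\<rho> \<psi> \<psi>' u G. sconv \<psi> \<psi>' u G \<and> (\<forall>k x. 0 \<le> \<psi> k x) \<and>
    \<Phi> G < \<rho> \<and> En lam u G < 0 \<and> (\<forall>f g. C1c \<Omega> f g \<longrightarrow> \<Phi> g \<le> \<rho> \<longrightarrow> En lam u G \<le> En lam f g)"
    if lam: "0 < lam" "lam < min \<Lambda>1 \<Lambda>2" for lam
  proof -
    have low: "\<Phi> g - 3 / 4 * \<rho> \<le> En lam f g" if "C1c \<Omega> f g" "\<Phi> g \<le> \<rho>" for f g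
    proof -
      have "1 / (1 - \<delta>) * An f \<le> 1 / (1 - \<delta>) * (CA * \<rho> powr \<theta>)"
        using eb[OF \<rho> that] \<delta> unfolding \<theta>_def by (intro mult_left_mono) auto
      moreover have "lam / r * Bn f \<le> \<rho> / 4"
      proof -
        have "Bn f \<le> S * \<rho> powr (r / p)" using eb[OF \<rho> that] by linarith
        then have "lam / r * Bn f \<le> lam / r * (S * \<rho> powr (r / p))"
          using lam r_gt by (intro mult_left_mono) auto
        also have "\<dots> \<le> \<Lambda>2 / r * (S * \<rho> powr (r / p))"
          using lam r_gt S by (intro mult_right_mono divide_right_mono) auto
        also have "\<dots> = \<rho> / 4" using r_gt S \<rho> by (simp add: \<Lambda>2_def)
        finally show ?thesis .
      qed
      ultimately show ?thesis unfolding En_def A\<rho> by linarith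
    qed
    define V where "V = {En lam f g | f g. C1c \<Omega> f g \<and> \<Phi> g \<le> \<rho>}"
    define m where "m = Inf V"
    have bdd: "bdd_below V"
    proof (rule bdd_belowI[of _ "- (3 / 4 * \<rho>)"])
      fix v assume "v \<in> V"
      then obtain f g where fg: "v = En lam f g" "C1c \<Omega> f g" "\<Phi> g \<le> \<rho>" unfolding V_def by blast
      show "- (3 / 4 * \<rho>) \<le> v" using low[OF fg(2,3)] \<Phi>_nonneg[of g] unfolding fg(1) by linarith
    qed
    obtain f0 g0 where f0: "C1c \<Omega> f0 g0" "\<Phi> g0 \<le> \<rho>" "En lam f0 g0 < 0"
      using negative_energy[OF \<rho>, of lam] lam by auto
    have mle: "m \<le> En lam f g" if "C1c \<Omega> f g" "\<Phi> g \<le> \<rho>" for f g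
      unfolding m_def using that by (intro cInf_lower bdd) (auto simp: V_def)
    have m0: "m < 0" using mle[OF f0(1,2)] f0(3) by linarith
    have "\<exists>f g. C1c \<Omega> f g \<and> (\<forall>x. 0 \<le> f x) \<and> \<Phi> g \<le> \<rho> \<and> En lam f g < m + 1 / real (Suc n)" for n
    proof -
      \<comment> \<open>The tolerance is split: half for approaching the infimum, half for making
        the function nonnegative.\<close>
      have "\<exists>v\<in>V. v < m + 1 / real (Suc n) / 2"
        unfolding m_def using f0 by (intro cInf_lessD) (auto simp: V_def)
      then obtain f g where fg: "C1c \<Omega> f g" "\<Phi> g \<le> \<rho>" "En lam f g < m + 1 / real (Suc n) / 2"
        unfolding V_def by blast
      from nonneg_approx[OF fg(1), of "1 / real (Suc n) / 2" lam] obtain f2 g2 where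
        "C1c \<Omega> f2 g2" "\<forall>x. 0 \<le> f2 x" "\<Phi> g2 \<le> \<Phi> g" "En lam f2 g2 < En lam f g + 1 / real (Suc n) / 2" by auto
      moreover from this fg have "En lam f2 g2 < m + (1 / real (Suc n) / 2 + 1 / real (Suc n) / 2)" by linarith
      ultimately show ?thesis using fg unfolding field_sum_of_halves
        by (intro exI[of _ f2] exI[of _ g2]) auto
    qed
    then obtain \<psi> \<psi>' where \<psi>: "\<And>n. C1c \<Omega> (\<psi> n) (\<psi>' n)" "\<And>n x. 0 \<le> \<psi> n x" "\<And>n. \<Phi> (\<psi>' n) \<le> \<rho>"
      "\<And>n. En lam (\<psi> n) (\<psi>' n) < m + 1 / real (Suc n)" by metis
    have lim: "(\<lambda>n. En lam (\<psi> n) (\<psi>' n)) \<longlonglongrightarrow> m"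
    proof (rule tendsto_sandwich[of "\<lambda>_. m" _ _ "\<lambda>n. m + 1 / real (Suc n)"])
      show "(\<lambda>n. m + 1 / real (Suc n)) \<longlonglongrightarrow> m"
        using tendsto_add[OF tendsto_const LIMSEQ_inverse_real_of_nat, of m] by (simp add: divide_inverse)
    qed (auto intro!: always_eventually mle \<psi> less_imp_le[OF \<psi>(4)] simp del: of_nat_Suc)
    obtain s :: "nat \<Rightarrow> nat" and u G where s: "strict_mono s" and sc: "sconv (\<lambda>i. \<psi> (s i)) (\<lambda>i. \<psi>' (s i)) u G"
      using cpt[of lam \<psi> \<psi>' m] lam \<psi> lim mle by auto
    note con = sconv_cont[OF sc]
    have "(\<lambda>i. En lam (\<psi> (s i)) (\<psi>' (s i))) \<longlonglongrightarrow> En lam u G"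
      unfolding En_def by (intro tendsto_intros con)
    moreover have "(\<lambda>i. En lam (\<psi> (s i)) (\<psi>' (s i))) \<longlonglongrightarrow> m"
      using LIMSEQ_subseq_LIMSEQ[OF lim s] by (simp add: comp_def)
    ultimately have En: "En lam u G = m" by (rule LIMSEQ_unique)
    have "\<Phi> G \<le> \<rho>" by (rule LIMSEQ_le_const2[OF con(4)]) (use \<psi>(3) in auto)
    moreover have "\<Phi> G - 3 / 4 * \<rho> \<le> m"
      unfolding En[symmetric] En_def
    proof (rule LIMSEQ_le)
      show "(\<lambda>i. \<Phi> (\<psi>' (s i)) - 3 / 4 * \<rho>) \<longlonglongrightarrow> \<Phi> G - 3 / 4 * \<rho>" by (intro tendsto_intros con)
      show "(\<lambda>i. En lam (\<psi> (s i)) (\<psi>' (s i))) \<longlonglongrightarrow> \<Phi> G - 1 / (1 - \<delta>) * An u - lam / r * Bn u"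
        unfolding En_def by (intro tendsto_intros con)
    qed (use low \<psi> in auto)
    ultimately have "\<Phi> G < \<rho>" using m0 \<rho> by linarith
    with sc \<psi>(2) m0 mle show ?thesis unfolding En[symmetric] by blast
  qed
  show ?thesis using \<Lambda>1 \<Lambda>2 main by (intro exI[of _ "min \<Lambda>1 \<Lambda>2"]) auto
qed

end

section \<open>The Euler-Lagrange equation\<close>

text \<open>Difference quotients are taken along this fixed sequence of steps, so that the
  sequential convergence theorems apply.\<close>

definition tau :: "nat \<Rightarrow> real" where "tau n = 1 / real (Suc n)"

lemma tau: "0 < tau n" "tau n \<le> 1" "tau \<longlonglongrightarrow> 0" "filterlim tau (at 0) sequentially"
proof -
  show p: "0 < tau n" for n by (simp add: tau_def)
  show "tau n \<le> 1" by (simp add: tau_def)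
  show l: "tau \<longlonglongrightarrow> 0" using LIMSEQ_inverse_real_of_nat by (simp add: tau_def[abs_def] divide_inverse)
  show "filterlim tau (at 0) sequentially"
    unfolding filterlim_at using l p by (auto intro!: always_eventually) (metis less_irrefl)
qed

lemma DERIV_tau:
  assumes "(f has_real_derivative D) (at 0)"
  shows "(\<lambda>n. (f (tau n) - f 0) / tau n) \<longlonglongrightarrow> D"
  using filterlim_compose[OF assms[unfolded DERIV_def] tau(4)] by simp

lemma flux_scale: "flux H p q m g (c *\<^sub>R w) = c * flux H p q m g w"
  by (simp add: flux_def)

lemma powr_lipschitz:
  fixes s t m r :: real
  assumes "0 \<le> s" "0 \<le> t" "s \<le> m" "t \<le> m" "1 \<le> r"
  shows "\<bar>s powr r - t powr r\<bar> \<le> r * m powr (r - 1) * \<bar>s - t\<bar>"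
proof -
  have *: "x powr r - y powr r \<le> r * m powr (r - 1) * \<bar>x - y\<bar>" if xy: "0 \<le> x" "0 \<le> y" "x \<le> m" for x y
  proof (cases "x = 0")
    case True
    have "0 \<le> r * m powr (r - 1) * \<bar>x - y\<bar>" using assms by (intro mult_nonneg_nonneg) auto
    moreover have "x powr r - y powr r \<le> 0" using True by simp
    ultimately show ?thesis by linarith
  next
    case False
    then have "x powr r - y powr r \<le> r * x powr (r - 1) * (x - y)"
      using powr_above_tangent[of r x y] xy assms by (simp add: algebra_simps)
    also have "\<dots> \<le> r * x powr (r - 1) * \<bar>x - y\<bar>" using assms by (intro mult_left_mono) auto
    also have "\<dots> \<le> r * m powr (r - 1) * \<bar>x - y\<bar>"
      using assms xy by (intro mult_right_mono mult_left_mono powr_mono2) auto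
    finally show ?thesis .
  qed
  show ?thesis using *[of s t] *[of t s] assms by (simp add: abs_minus_commute abs_le_iff)
qed

lemma powr_quotient_deriv:
  fixes s w e :: real
  assumes "0 < s"
  shows "(\<lambda>n. (\<bar>s + tau n * w\<bar> powr e - \<bar>s\<bar> powr e) / tau n) \<longlonglongrightarrow> e * s powr (e - 1) * w"
proof -
  have "((\<lambda>t. (s + t * w) powr e) has_real_derivative e * s powr (e - 1) * w) (at 0)"
    using assms by (auto intro!: derivative_eq_intros)
  then have "((\<lambda>t. \<bar>s + t * w\<bar> powr e) has_real_derivative e * s powr (e - 1) * w) (at 0)"
  proof (rule has_field_derivative_transform_within_open[where S="{t. 0 < s + t * w}"])
    show "open {t. 0 < s + t * w}" by (intro open_Collect_less continuous_intros)
  qed (use assms in auto)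
  from DERIV_tau[OF this] show ?thesis by simp
qed

text \<open>By homogeneity it reduces to |y^(1-\<delta>) - 1| \<le> |y - 1| for y \<ge> 0. Unlike a
  mean value bound it tolerates every w, even if s + w changes sign.\<close>

lemma sublinear_powr_bound:
  fixes s w \<delta> :: real
  assumes "0 < s" "0 < \<delta>" "\<delta> < 1"
  shows "\<bar>\<bar>s + w\<bar> powr (1 - \<delta>) - \<bar>s\<bar> powr (1 - \<delta>)\<bar> \<le> s powr (- \<delta>) * \<bar>w\<bar>"
proof -
  define y where "y = \<bar>s + w\<bar> / s"
  have y: "0 \<le> y" "\<bar>s + w\<bar> = s * y" using assms by (auto simp: y_def)
  have "\<bar>y powr (1 - \<delta>) - 1\<bar> \<le> \<bar>y - 1\<bar>"
  proof (cases "y \<le> 1")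
    case True
    have "y powr 1 \<le> y powr (1 - \<delta>)" by (rule powr_mono') (use True y assms in auto)
    moreover have "y powr (1 - \<delta>) \<le> 1" using True y assms by (intro powr_le1) auto
    ultimately show ?thesis using True y by simp
  next
    case False
    have "y powr (1 - \<delta>) \<le> y powr 1" by (rule powr_mono) (use False assms in auto)
    moreover have "1 \<le> y powr (1 - \<delta>)" using False assms by (intro ge_one_powr_ge_zero) auto
    ultimately show ?thesis using False by simp
  qed
  also have "\<bar>y - 1\<bar> = \<bar>\<bar>s + w\<bar> - \<bar>s\<bar>\<bar> / s" unfolding y_def using assms by (simp add: field_simps)
  also have "\<dots> \<le> \<bar>w\<bar> / s" using assms by (intro divide_right_mono) auto
  finally have "s powr (1 - \<delta>) * \<bar>y powr (1 - \<delta>) - 1\<bar> \<le> s powr (1 - \<delta>) * (\<bar>w\<bar> / s)" by (intro mult_left_mono) auto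
  also have "s powr (1 - \<delta>) * (\<bar>w\<bar> / s) = s powr (- \<delta>) * \<bar>w\<bar>" using assms by (simp add: powr_diff powr_minus field_simps)
  also have "s powr (1 - \<delta>) * \<bar>y powr (1 - \<delta>) - 1\<bar> = \<bar>\<bar>s + w\<bar> powr (1 - \<delta>) - \<bar>s\<bar> powr (1 - \<delta>)\<bar>"
  proof -
    have "\<bar>s + w\<bar> powr (1 - \<delta>) - \<bar>s\<bar> powr (1 - \<delta>) = s powr (1 - \<delta>) * (y powr (1 - \<delta>) - 1)"
      unfolding y(2) using assms by (simp add: powr_mult right_diff_distrib)
    then show ?thesis by (simp add: abs_mult)
  qed
  finally show ?thesis .
qed

context dphase begin

text \<open>The flux is of order H^(p-1) and H^(q-1) times a bounded gradient, so enlarging both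
  vectors to the sum of their norms gives the growth of the modular.\<close>

lemma flux_bound: "\<exists>C>0. \<forall>x \<zeta> \<eta>. \<bar>flux H p q (\<mu> x) \<zeta> \<eta>\<bar> \<le> C * dp x (norm \<zeta> + norm \<eta>)"
proof -
  obtain K where K: "K > 0" "\<And>x. H x \<le> K * norm x" using H_bounds by blast
  obtain Cg where Cg: "Cg > 0" "\<And>x. x \<noteq> 0 \<Longrightarrow> norm (grad H x) \<le> Cg" using grad_H_bound by blast
  define C where "C = Cg * (K powr (p - 1) + K powr (q - 1))"
  have C: "0 < C" unfolding C_def using Cg K by (intro mult_pos_pos add_pos_pos) auto
  have "\<bar>flux H p q (\<mu> x) \<zeta> \<eta>\<bar> \<le> C * dp x (norm \<zeta> + norm \<eta>)" for x \<zeta> \<eta>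
  \<comment> \<open>At 0 the gradient of H has no prescribed value, but the flux vanishes because of
    the powers of H in front.\<close>
  proof (cases "\<zeta> = 0")
    case True
    have "0 \<le> C * dp x (norm \<zeta> + norm \<eta>)" using C dp_nonneg by (intro mult_nonneg_nonneg) auto
    then show ?thesis using True by (simp add: flux_def)
  next
    case False
    define z where "z = norm \<zeta> + norm \<eta>"
    have z: "0 < z" "norm \<zeta> \<le> z" "norm \<eta> \<le> z" using False by (auto simp: z_def add_pos_nonneg)
    have Hz: "H \<zeta> powr (s - 1) \<le> K powr (s - 1) * z powr (s - 1)" if "1 \<le> s" for s
    proof -
      have "H \<zeta> \<le> K * z" using K(2)[of \<zeta>] mult_left_mono[OF z(2), of K] K(1) by linarith
      then show ?thesis unfolding powr_mult[symmetric] using that H_nonneg by (intro powr_mono2) auto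
    qed
    have zz: "z powr (s - 1) * z = z powr s" for s using z by (simp add: powr_diff)
    have "\<bar>grad H \<zeta> \<bullet> \<eta>\<bar> \<le> norm (grad H \<zeta>) * norm \<eta>" by (rule Cauchy_Schwarz_ineq2)
    also have "\<dots> \<le> Cg * z" using Cg False z by (intro mult_mono) auto
    finally have g: "\<bar>grad H \<zeta> \<bullet> \<eta>\<bar> \<le> Cg * z" .
    have "\<bar>flux H p q (\<mu> x) \<zeta> \<eta>\<bar> = (H \<zeta> powr (p - 1) + \<mu> x * H \<zeta> powr (q - 1)) * \<bar>grad H \<zeta> \<bullet> \<eta>\<bar>"
      unfolding flux_def abs_mult using \<mu>(1)[of x] by simp
    also have "\<dots> \<le> (K powr (p - 1) * z powr (p - 1) + \<mu> x * (K powr (q - 1) * z powr (q - 1))) * (Cg * z)"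
      using pq \<mu>(1)[of x] by (intro mult_mono add_mono mult_left_mono Hz g) auto
    also have "\<dots> = Cg * (K powr (p - 1) * (z powr (p - 1) * z) + K powr (q - 1) * (\<mu> x * (z powr (q - 1) * z)))"
      by (simp only: algebra_simps)
    also have "\<dots> = Cg * (K powr (p - 1) * z powr p + K powr (q - 1) * (\<mu> x * z powr q))"
      unfolding zz ..
    also have "\<dots> \<le> C * dp x z"
    proof -
      have "0 \<le> K powr (p - 1) * (\<mu> x * z powr q)" "0 \<le> K powr (q - 1) * z powr p" using \<mu>(1)[of x] by auto
      then have "K powr (p - 1) * z powr p + K powr (q - 1) * (\<mu> x * z powr q) \<le> (K powr (p - 1) + K powr (q - 1)) * dp x z"
        unfolding dpH_def by (simp add: algebra_simps)
      then show ?thesis unfolding C_def mult.assoc using Cg by (intro mult_left_mono) auto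
    qed
    finally show ?thesis unfolding z_def .
  qed
  with C show ?thesis by blast
qed

lemma Fd_deriv: "((\<lambda>t. Fd x (\<xi> + t *\<^sub>R \<eta>)) has_real_derivative flux H p q (\<mu> x) (\<xi> + t *\<^sub>R \<eta>) \<eta>) (at t)"
proof -
  have ln: "((\<lambda>t. \<xi> + t *\<^sub>R \<eta>) has_derivative (\<lambda>h. h *\<^sub>R \<eta>)) (at t)" by (auto intro!: derivative_eq_intros)
  have *: "((\<lambda>t. H (\<xi> + t *\<^sub>R \<eta>) powr s) has_real_derivative s * (H (\<xi> + t *\<^sub>R \<eta>) powr (s - 1) * (grad H (\<xi> + t *\<^sub>R \<eta>) \<bullet> \<eta>))) (at t)"
    if "1 < s" for s
    unfolding has_field_derivative_def
    by (rule has_derivative_eq_rhs[OF has_derivative_compose[OF ln H_powr_deriv[OF that]]]) (simp add: fun_eq_iff mult_ac)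
  have "((\<lambda>t. H (\<xi> + t *\<^sub>R \<eta>) powr p / p + \<mu> x * H (\<xi> + t *\<^sub>R \<eta>) powr q / q) has_real_derivative
     (p * (H (\<xi> + t *\<^sub>R \<eta>) powr (p - 1) * (grad H (\<xi> + t *\<^sub>R \<eta>) \<bullet> \<eta>))) / p +
     (\<mu> x * (q * (H (\<xi> + t *\<^sub>R \<eta>) powr (q - 1) * (grad H (\<xi> + t *\<^sub>R \<eta>) \<bullet> \<eta>)))) / q) (at t)"
    using pq by (intro DERIV_add DERIV_cdivide DERIV_cmult *) auto
  then show ?thesis unfolding Fd_def flux_def
    by (rule DERIV_cong) (use pq in \<open>simp add: algebra_simps\<close>)
qed

end

text \<open>Minimality is assumed only against C^1 competitors, although u itself is just a limit of
  such functions.\<close>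

locale dphase_min = dphase H \<Omega> \<mu> a b p q \<delta> r M\<mu> Bb
  for H :: "'a::euclidean_space \<Rightarrow> real" and \<Omega> \<mu> a b p q \<delta> r M\<mu> Bb +
  fixes lam \<rho> :: real and \<psi> :: "nat \<Rightarrow> 'a \<Rightarrow> real" and \<psi>' :: "nat \<Rightarrow> 'a \<Rightarrow> 'a" and u :: "'a \<Rightarrow> real" and G :: "'a \<Rightarrow> 'a"
  assumes lam: "0 < lam" and sc: "sconv \<psi> \<psi>' u G" and pos: "\<And>k x. 0 \<le> \<psi> k x" and \<Phi>\<rho>: "\<Phi> G < \<rho>"
    and min: "\<And>f g. C1c \<Omega> f g \<Longrightarrow> \<Phi> g \<le> \<rho> \<Longrightarrow> En lam u G \<le> En lam f g"
begin

lemmas [measurable] = sconvD(2,3)[OF sc]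

lemma u_nonneg: "AE x in M. 0 \<le> u x"
  using sconvD(4)[OF sc] by eventually_elim (rule LIMSEQ_le_const, auto simp: pos)

abbreviation fl where "fl \<phi>' x \<equiv> flux H p q (\<mu> x) (G x) (\<phi>' x)"

lemma sconv_tau:
  assumes C: "C1c \<Omega> \<phi> \<phi>'"
  shows "sconv (\<lambda>k x. \<psi> k x + tau n * \<phi> x) (\<lambda>k x. \<psi>' k x + tau n *\<^sub>R \<phi>' x) (\<lambda>x. u x + tau n * \<phi> x) (\<lambda>x. G x + tau n *\<^sub>R \<phi>' x)"
  by (rule sconv_add[OF sc C1c_scale[OF C]])

text \<open>By the mean value theorem the quotients are fluxes at intermediate points, all dominated
  by one integrable function because the steps are at most 1.\<close>

lemma \<Phi>_quot:
  assumes C: "C1c \<Omega> \<phi> \<phi>'"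
  shows "integrable M (fl \<phi>')" "(\<lambda>n. (\<Phi> (\<lambda>x. G x + tau n *\<^sub>R \<phi>' x) - \<Phi> G) / tau n) \<longlonglongrightarrow> (\<integral>x. fl \<phi>' x \<partial>M)"
proof -
  note [measurable] = C1c_M(1,2)[OF C]
  obtain K where K: "K > 0" "\<And>x \<zeta> \<eta>. \<bar>flux H p q (\<mu> x) \<zeta> \<eta>\<bar> \<le> K * dp x (norm \<zeta> + norm \<eta>)"
    using flux_bound by blast
  define W where "W = (\<lambda>x. K * (2 powr q * (dp x (norm (G x)) + (2 powr p + 2 powr q) * dp x (norm (\<phi>' x)))))"
  have Wi: "integrable M W" unfolding W_def using sconv_integrable(2)[OF sc] C1c_M(4)[OF C] by simp
  have Wb: "K * dp x (norm (G x) + 2 * norm (\<phi>' x)) \<le> W x" for x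
  proof -
    have "dp x (norm (G x) + 2 * norm (\<phi>' x)) \<le> 2 powr q * (dp x (norm (G x)) + dp x (2 * norm (\<phi>' x)))"
      using pq \<mu>(1) by (intro dpH_add) auto
    also have "\<dots> \<le> 2 powr q * (dp x (norm (G x)) + (2 powr p + 2 powr q) * dp x (norm (\<phi>' x)))"
      using \<mu>(1) by (intro mult_left_mono add_left_mono dpH_scale) auto
    finally show ?thesis unfolding W_def using K(1) by (intro mult_left_mono) auto
  qed
  have meas[measurable]: "(fl \<phi>') \<in> borel_measurable M" unfolding flux_def by measurable
  have fb: "\<bar>flux H p q (\<mu> x) (G x + s *\<^sub>R \<phi>' x) (\<phi>' x)\<bar> \<le> W x" if "0 \<le> s" "s \<le> 1" for s x
  proof -
    have "norm (G x + s *\<^sub>R \<phi>' x) \<le> norm (G x) + s * norm (\<phi>' x)" using norm_triangle_ineq[of "G x" "s *\<^sub>R \<phi>' x"] that by simp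
    also have "\<dots> \<le> norm (G x) + 1 * norm (\<phi>' x)" using that by (intro add_left_mono mult_right_mono) auto
    finally have "dp x (norm (G x + s *\<^sub>R \<phi>' x) + norm (\<phi>' x)) \<le> dp x (norm (G x) + 2 * norm (\<phi>' x))"
      using pq \<mu>(1) by (intro dpH_mono) auto
    then have "K * dp x (norm (G x + s *\<^sub>R \<phi>' x) + norm (\<phi>' x)) \<le> K * dp x (norm (G x) + 2 * norm (\<phi>' x))"
      using K(1) by (intro mult_left_mono) auto
    then show ?thesis using K(2)[of x "G x + s *\<^sub>R \<phi>' x" "\<phi>' x"] Wb[of x] by linarith
  qed
  show "integrable M (fl \<phi>')"
    by (rule Bochner_Integration.integrable_bound[OF Wi meas])
      (use fb[of 0] in \<open>auto intro!: AE_I2 order_trans[OF _ abs_ge_self]\<close>)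
  have Fi: "integrable M (\<lambda>x. Fd x (G x + tau n *\<^sub>R \<phi>' x))" for n by (rule sconv_cont(1)[OF sconv_tau[OF C]])
  have "(\<lambda>n. \<integral>x. (Fd x (G x + tau n *\<^sub>R \<phi>' x) - Fd x (G x)) / tau n \<partial>M) \<longlonglongrightarrow> (\<integral>x. fl \<phi>' x \<partial>M)"
  proof (rule integral_dominated_convergence[OF meas _ Wi])
    show "AE x in M. (\<lambda>n. (Fd x (G x + tau n *\<^sub>R \<phi>' x) - Fd x (G x)) / tau n) \<longlonglongrightarrow> fl \<phi>' x"
      using DERIV_tau[OF Fd_deriv[of _ "G _" "\<phi>' _" 0]] by (intro AE_I2) simp
    show "AE x in M. norm ((Fd x (G x + tau n *\<^sub>R \<phi>' x) - Fd x (G x)) / tau n) \<le> W x" for n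
    proof (rule AE_I2)
      fix x
      obtain z where z: "0 < z" "z < tau n" "Fd x (G x + tau n *\<^sub>R \<phi>' x) - Fd x (G x + 0 *\<^sub>R \<phi>' x) = (tau n - 0) * flux H p q (\<mu> x) (G x + z *\<^sub>R \<phi>' x) (\<phi>' x)"
        using MVT2[OF tau(1)[of n], of "\<lambda>t. Fd x (G x + t *\<^sub>R \<phi>' x)" "\<lambda>t. flux H p q (\<mu> x) (G x + t *\<^sub>R \<phi>' x) (\<phi>' x)"] Fd_deriv by blast
      then have "(Fd x (G x + tau n *\<^sub>R \<phi>' x) - Fd x (G x)) / tau n = flux H p q (\<mu> x) (G x + z *\<^sub>R \<phi>' x) (\<phi>' x)"
        using tau(1)[of n] by (simp add: field_simps)
      then show "norm ((Fd x (G x + tau n *\<^sub>R \<phi>' x) - Fd x (G x)) / tau n) \<le> W x"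
        using fb[of z x] z tau(2)[of n] by simp
    qed
  qed measurable
  moreover have eq: "(\<integral>x. (Fd x (G x + tau n *\<^sub>R \<phi>' x) - Fd x (G x)) / tau n \<partial>M) = (\<Phi> (\<lambda>x. G x + tau n *\<^sub>R \<phi>' x) - \<Phi> G) / tau n" for n
    unfolding \<Phi>_def using Fi[of n] sconv_cont(1)[OF sc] by simp
  ultimately show "(\<lambda>n. (\<Phi> (\<lambda>x. G x + tau n *\<^sub>R \<phi>' x) - \<Phi> G) / tau n) \<longlonglongrightarrow> (\<integral>x. fl \<phi>' x \<partial>M)" by (simp only: eq)
qed

lemma Bn_quot:
  assumes C: "C1c \<Omega> \<phi> \<phi>'"
  shows "integrable M (\<lambda>x. b x * u x powr (r - 1) * \<phi> x)"
    "(\<lambda>n. (Bn (\<lambda>x. u x + tau n * \<phi> x) - Bn u) / tau n) \<longlonglongrightarrow> r * (\<integral>x. b x * u x powr (r - 1) * \<phi> x \<partial>M)"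
proof -
  note [measurable] = C1c_M(1,2)[OF C]
  have Bb0: "0 \<le> Bb" using order_trans[OF abs_ge_zero b(1)] .
  define W where "W = (\<lambda>x. Bb * (r * (2 powr r * (\<bar>u x\<bar> powr r + \<bar>\<phi> x\<bar> powr r))))"
  have Wi: "integrable M W" unfolding W_def using sconv_integrable(1)[OF sc] C1c_M(3)[OF C, of r] r_gt by simp
  have zw: "(\<bar>u x\<bar> + \<bar>\<phi> x\<bar>) powr (r - 1) * \<bar>\<phi> x\<bar> \<le> 2 powr r * (\<bar>u x\<bar> powr r + \<bar>\<phi> x\<bar> powr r)" for x
  proof -
    have "(\<bar>u x\<bar> + \<bar>\<phi> x\<bar>) powr (r - 1) * \<bar>\<phi> x\<bar> \<le> (\<bar>u x\<bar> + \<bar>\<phi> x\<bar>) powr (r - 1) * (\<bar>u x\<bar> + \<bar>\<phi> x\<bar>)"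
      by (intro mult_left_mono) auto
    also have "\<dots> = (\<bar>u x\<bar> + \<bar>\<phi> x\<bar>) powr r"
      by (cases "\<bar>u x\<bar> + \<bar>\<phi> x\<bar> = 0") (auto simp: powr_diff)
    also have "\<dots> \<le> 2 powr r * (\<bar>u x\<bar> powr r + \<bar>\<phi> x\<bar> powr r)" using r_gt by (intro powr_add_le) auto
    finally show ?thesis .
  qed
  have meas[measurable]: "(\<lambda>x. r * (b x * u x powr (r - 1) * \<phi> x)) \<in> borel_measurable M" by measurable
  have qb: "norm ((b x * \<bar>u x + tau n * \<phi> x\<bar> powr r - b x * \<bar>u x\<bar> powr r) / tau n) \<le> W x" for n x
  proof -
    have tp: "tau n * \<bar>\<phi> x\<bar> \<le> 1 * \<bar>\<phi> x\<bar>" using tau(1,2)[of n] by (intro mult_right_mono) auto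
    have 1: "\<bar>u x + tau n * \<phi> x\<bar> \<le> \<bar>u x\<bar> + \<bar>\<phi> x\<bar>"
      using abs_triangle_ineq[of "u x" "tau n * \<phi> x"] tp tau(1)[of n] by (simp add: abs_mult)
    have 2: "\<bar>\<bar>u x + tau n * \<phi> x\<bar> - \<bar>u x\<bar>\<bar> \<le> tau n * \<bar>\<phi> x\<bar>"
      using abs_triangle_ineq3[of "u x + tau n * \<phi> x" "u x"] tau(1)[of n] by (simp add: abs_mult)
    have "\<bar>\<bar>u x + tau n * \<phi> x\<bar> powr r - \<bar>u x\<bar> powr r\<bar> \<le> r * (\<bar>u x\<bar> + \<bar>\<phi> x\<bar>) powr (r - 1) * \<bar>\<bar>u x + tau n * \<phi> x\<bar> - \<bar>u x\<bar>\<bar>"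
      using 1 r_gt by (intro powr_lipschitz) auto
    also have "\<dots> \<le> r * (\<bar>u x\<bar> + \<bar>\<phi> x\<bar>) powr (r - 1) * (tau n * \<bar>\<phi> x\<bar>)"
      using 2 r_gt by (intro mult_left_mono) auto
    also have "\<dots> = tau n * (r * ((\<bar>u x\<bar> + \<bar>\<phi> x\<bar>) powr (r - 1) * \<bar>\<phi> x\<bar>))" by simp
    also have "\<dots> \<le> tau n * (r * (2 powr r * (\<bar>u x\<bar> powr r + \<bar>\<phi> x\<bar> powr r)))"
      using tau(1)[of n] r_gt by (intro mult_left_mono zw) auto
    finally have 3: "\<bar>\<bar>u x + tau n * \<phi> x\<bar> powr r - \<bar>u x\<bar> powr r\<bar> \<le> tau n * (r * (2 powr r * (\<bar>u x\<bar> powr r + \<bar>\<phi> x\<bar> powr r)))" .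
    have "\<bar>b x * \<bar>u x + tau n * \<phi> x\<bar> powr r - b x * \<bar>u x\<bar> powr r\<bar> \<le> Bb * (tau n * (r * (2 powr r * (\<bar>u x\<bar> powr r + \<bar>\<phi> x\<bar> powr r))))"
      unfolding right_diff_distrib[symmetric] abs_mult using b(1) Bb0 3 by (intro mult_mono) auto
    then have "\<bar>b x * \<bar>u x + tau n * \<phi> x\<bar> powr r - b x * \<bar>u x\<bar> powr r\<bar> \<le> W x * tau n" by (simp add: W_def mult_ac)
    then show ?thesis using tau(1)[of n] by (simp add: divide_le_eq)
  qed
  have lim: "AE x in M. (\<lambda>n. (b x * \<bar>u x + tau n * \<phi> x\<bar> powr r - b x * \<bar>u x\<bar> powr r) / tau n) \<longlonglongrightarrow> r * (b x * u x powr (r - 1) * \<phi> x)"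
    using u_nonneg
  proof eventually_elim
    case (elim x)
    have "(\<lambda>n. (\<bar>u x + tau n * \<phi> x\<bar> powr r - \<bar>u x\<bar> powr r) / tau n) \<longlonglongrightarrow> r * u x powr (r - 1) * \<phi> x"
    \<comment> \<open>Where u vanishes the power is not differentiated by the chain rule; the
      quotient is a multiple of the step to the power r - 1 > 0.\<close>
    proof (cases "u x = 0")
      case True
      have "(\<lambda>n. tau n powr (r - 1) * \<bar>\<phi> x\<bar> powr r) \<longlonglongrightarrow> 0 powr (r - 1) * \<bar>\<phi> x\<bar> powr r"
        using r_gt tau less_imp_le[OF tau(1)] by (intro tendsto_mult tendsto_const tendsto_powr') auto
      moreover have "(\<bar>u x + tau n * \<phi> x\<bar> powr r - \<bar>u x\<bar> powr r) / tau n = tau n powr (r - 1) * \<bar>\<phi> x\<bar> powr r" for n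
        using True tau(1)[of n] r_gt by (simp add: abs_mult powr_mult powr_diff)
      ultimately show ?thesis using True r_gt by simp
    next
      case False
      then show ?thesis using elim by (intro powr_quotient_deriv) auto
    qed
    from tendsto_mult_left[OF this, of "b x"] show ?case by (simp add: algebra_simps)
  qed
  have i: "integrable M (\<lambda>x. r * (b x * u x powr (r - 1) * \<phi> x))"
    by (rule integrable_dominated_convergence[OF meas _ Wi lim]) (use qb in \<open>auto intro!: AE_I2\<close>)
  then show "integrable M (\<lambda>x. b x * u x powr (r - 1) * \<phi> x)" using r_gt by simp
  have "(\<lambda>n. \<integral>x. (b x * \<bar>u x + tau n * \<phi> x\<bar> powr r - b x * \<bar>u x\<bar> powr r) / tau n \<partial>M) \<longlonglongrightarrow> (\<integral>x. r * (b x * u x powr (r - 1) * \<phi> x) \<partial>M)"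
    by (rule integral_dominated_convergence[OF meas _ Wi lim]) (use qb in \<open>auto intro!: AE_I2\<close>)
  moreover have eq: "(\<integral>x. (b x * \<bar>u x + tau n * \<phi> x\<bar> powr r - b x * \<bar>u x\<bar> powr r) / tau n \<partial>M) = (Bn (\<lambda>x. u x + tau n * \<phi> x) - Bn u) / tau n" for n
    unfolding Bn_def using sconv_cont(3)[OF sc] sconv_cont(3)[OF sconv_tau[OF C]] by simp
  ultimately show "(\<lambda>n. (Bn (\<lambda>x. u x + tau n * \<phi> x) - Bn u) / tau n) \<longlonglongrightarrow> r * (\<integral>x. b x * u x powr (r - 1) * \<phi> x \<partial>M)" by (simp only: eq integral_mult_right_zero)
qed

text \<open>The derivative at u in direction \<phi> of the energy without its singular term.\<close>

definition Lim where "Lim \<phi> \<phi>' = (\<integral>x. fl \<phi>' x \<partial>M) - lam * (\<integral>x. b x * u x powr (r - 1) * \<phi> x \<partial>M)"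

text \<open>The perturbed minimiser is approximated by the perturbed sequence. By strictness of
  \<Phi> G < \<rho> it lies in the open ball for small steps, hence so do its late approximants, to
  which minimality applies.\<close>

lemma min_tau:
  assumes C: "C1c \<Omega> \<phi> \<phi>'"
  shows "\<forall>\<^sub>F n in sequentially. En lam u G \<le> En lam (\<lambda>x. u x + tau n * \<phi> x) (\<lambda>x. G x + tau n *\<^sub>R \<phi>' x)"
proof -
  have "(\<lambda>n. \<Phi> G + tau n * ((\<Phi> (\<lambda>x. G x + tau n *\<^sub>R \<phi>' x) - \<Phi> G) / tau n)) \<longlonglongrightarrow> \<Phi> G + 0 * (\<integral>x. fl \<phi>' x \<partial>M)"
    by (intro tendsto_intros tau \<Phi>_quot(2)[OF C])
  moreover have "\<Phi> G + tau n * ((\<Phi> (\<lambda>x. G x + tau n *\<^sub>R \<phi>' x) - \<Phi> G) / tau n) = \<Phi> (\<lambda>x. G x + tau n *\<^sub>R \<phi>' x)" for n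
    using tau(1)[of n] by simp
  ultimately have "(\<lambda>n. \<Phi> (\<lambda>x. G x + tau n *\<^sub>R \<phi>' x)) \<longlonglongrightarrow> \<Phi> G" by simp
  from order_tendstoD(2)[OF this \<Phi>\<rho>] show ?thesis
  proof eventually_elim
    case (elim n)
    note s = sconv_tau[OF C, of n]
    note con = sconv_cont[OF s]
    have lim: "(\<lambda>k. En lam (\<lambda>x. \<psi> k x + tau n * \<phi> x) (\<lambda>x. \<psi>' k x + tau n *\<^sub>R \<phi>' x)) \<longlonglongrightarrow> En lam (\<lambda>x. u x + tau n * \<phi> x) (\<lambda>x. G x + tau n *\<^sub>R \<phi>' x)"
      unfolding En_def by (intro tendsto_intros con)
    show ?case
    proof (rule tendsto_lowerbound[OF lim])
      show "\<forall>\<^sub>F k in sequentially. En lam u G \<le> En lam (\<lambda>x. \<psi> k x + tau n * \<phi> x) (\<lambda>x. \<psi>' k x + tau n *\<^sub>R \<phi>' x)"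
        using order_tendstoD(2)[OF con(4) elim] by eventually_elim (intro min sconvD(1)[OF s] less_imp_le)
    qed simp
  qed
qed

text \<open>Minimality solved for the singular quotient, the only one whose limit is not yet known
  to be finite.\<close>

lemma An_quot_le:
  assumes C: "C1c \<Omega> \<phi> \<phi>'" and e: "0 < e"
  shows "\<forall>\<^sub>F n in sequentially. (An (\<lambda>x. u x + tau n * \<phi> x) - An u) / tau n \<le> (1 - \<delta>) * (Lim \<phi> \<phi>' + e)"
proof -
  define P where "P = (\<lambda>n. (\<Phi> (\<lambda>x. G x + tau n *\<^sub>R \<phi>' x) - \<Phi> G) / tau n - lam / r * ((Bn (\<lambda>x. u x + tau n * \<phi> x) - Bn u) / tau n))"
  have "P \<longlonglongrightarrow> (\<integral>x. fl \<phi>' x \<partial>M) - lam / r * (r * (\<integral>x. b x * u x powr (r - 1) * \<phi> x \<partial>M))"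
    unfolding P_def by (intro tendsto_intros \<Phi>_quot(2)[OF C] Bn_quot(2)[OF C])
  also have "(\<integral>x. fl \<phi>' x \<partial>M) - lam / r * (r * (\<integral>x. b x * u x powr (r - 1) * \<phi> x \<partial>M)) = Lim \<phi> \<phi>'"
    unfolding Lim_def using r_gt by simp
  finally have "\<forall>\<^sub>F n in sequentially. P n < Lim \<phi> \<phi>' + e" using e by (intro order_tendstoD(2)) auto
  with min_tau[OF C] show ?thesis
  proof eventually_elim
    case (elim n)
    let ?A = "An (\<lambda>x. u x + tau n * \<phi> x) - An u"
    have "1 / (1 - \<delta>) * ?A \<le> (\<Phi> (\<lambda>x. G x + tau n *\<^sub>R \<phi>' x) - \<Phi> G) - lam / r * (Bn (\<lambda>x. u x + tau n * \<phi> x) - Bn u)"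
      using elim(1) unfolding En_def by (simp add: algebra_simps diff_divide_distrib)
    then have "(1 / (1 - \<delta>) * ?A) / tau n \<le> ((\<Phi> (\<lambda>x. G x + tau n *\<^sub>R \<phi>' x) - \<Phi> G) - lam / r * (Bn (\<lambda>x. u x + tau n * \<phi> x) - Bn u)) / tau n"
      using tau(1)[of n] by (intro divide_right_mono) auto
    also have "\<dots> = P n"
    proof -
      have "(A - k * B) / t = A / t - k * (B / t)" for A B k t :: real by (simp add: diff_divide_distrib)
      then show ?thesis unfolding P_def by blast
    qed
    also note elim(2)
    finally have "(1 - \<delta>) * ((1 / (1 - \<delta>) * ?A) / tau n) \<le> (1 - \<delta>) * (Lim \<phi> \<phi>' + e)" using \<delta> by (intro mult_left_mono) auto
    moreover have "(1 - \<delta>) * ((1 / (1 - \<delta>) * ?A) / tau n) = ?A / tau n" using \<delta> by simp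
    ultimately show ?case by simp
  qed
qed

text \<open>Minimality bounds the integral of this difference quotient from above although its pointwise limit blows up where u = 0; by Fatou
  this forces u > 0 wherever \<phi> > 0.\<close>

definition qa where "qa \<phi> n x = (a x * \<bar>u x + tau n * \<phi> x\<bar> powr (1 - \<delta>) - a x * \<bar>u x\<bar> powr (1 - \<delta>)) / tau n"

lemma qa_integral:
  assumes C: "C1c \<Omega> \<phi> \<phi>'"
  shows "integrable M (qa \<phi> n)" "(\<integral>x. qa \<phi> n x \<partial>M) = (An (\<lambda>x. u x + tau n * \<phi> x) - An u) / tau n"
  unfolding qa_def An_def using sconv_cont(2)[OF sc] sconv_cont(2)[OF sconv_tau[OF C]] by simp_all

lemma qa_nonneg: "0 \<le> u x \<Longrightarrow> 0 \<le> \<phi> x \<Longrightarrow> 0 \<le> qa \<phi> n x"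
  unfolding qa_def right_diff_distrib[symmetric] using tau(1)[of n] a(1)[of x] \<delta>
  by (intro divide_nonneg_pos mult_nonneg_nonneg) (auto intro!: powr_mono2)

lemma qa_lim:
  assumes "0 < u x"
  shows "(\<lambda>n. qa \<phi> n x) \<longlonglongrightarrow> (1 - \<delta>) * (a x * u x powr (- \<delta>) * \<phi> x)"
  using tendsto_mult_left[OF powr_quotient_deriv[OF assms, of "\<phi> x" "1 - \<delta>"], of "a x"]
  unfolding qa_def by (simp add: algebra_simps)

text \<open>Nonnegative \<phi> makes the quotients nonnegative, as Fatou requires. The +1 is the
  slack e = 1 of \<open>An_quot_le\<close>; a finite bound is all that is wanted at this
  stage.\<close>

lemma singular_bound_nonneg:
  assumes C: "C1c \<Omega> \<phi> \<phi>'" and \<phi>: "\<And>x. 0 \<le> \<phi> x"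
  shows "AE x in M. 0 < \<phi> x \<longrightarrow> 0 < u x"
    "integrable M (\<lambda>x. a x * u x powr (- \<delta>) * \<phi> x) \<and> (\<integral>x. a x * u x powr (- \<delta>) * \<phi> x \<partial>M) \<le> Lim \<phi> \<phi>' + 1"
proof -
  note [measurable] = C1c_M(1,2)[OF C] borel_measurable_integrable[OF qa_integral(1)[OF C]]
  obtain N where N: "\<And>n. N \<le> n \<Longrightarrow> (\<integral>x. qa \<phi> n x \<partial>M) \<le> (1 - \<delta>) * (Lim \<phi> \<phi>' + 1)"
    using An_quot_le[OF C zero_less_one] unfolding eventually_sequentially qa_integral(2)[OF C] by blast
  have q0: "AE x in M. 0 \<le> qa \<phi> n x" for n using u_nonneg by eventually_elim (rule qa_nonneg[OF _ \<phi>])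
  have "(\<integral>\<^sup>+x. liminf (\<lambda>n. ennreal (qa \<phi> n x)) \<partial>M) \<le> liminf (\<lambda>n. \<integral>\<^sup>+x. ennreal (qa \<phi> n x) \<partial>M)"
    by (rule nn_integral_liminf) measurable
  also have "\<dots> \<le> ennreal ((1 - \<delta>) * (Lim \<phi> \<phi>' + 1))"
  proof (rule order_trans[OF Liminf_mono[of _ "\<lambda>_. ennreal ((1 - \<delta>) * (Lim \<phi> \<phi>' + 1))"]])
    show "\<forall>\<^sub>F n in sequentially. (\<integral>\<^sup>+x. ennreal (qa \<phi> n x) \<partial>M) \<le> ennreal ((1 - \<delta>) * (Lim \<phi> \<phi>' + 1))"
      using eventually_ge_at_top[of N]
    proof eventually_elim
      case (elim n)
      then show ?case using nn_integral_eq_integral[OF qa_integral(1)[OF C] q0] N by (simp add: ennreal_leI)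
    qed
  qed (simp add: Liminf_const)
  also have "\<dots> < \<infinity>" by simp
  finally have "(\<integral>\<^sup>+x. liminf (\<lambda>n. ennreal (qa \<phi> n x)) \<partial>M) \<noteq> \<infinity>" by simp
  then have fin: "AE x in M. liminf (\<lambda>n. ennreal (qa \<phi> n x)) \<noteq> \<infinity>"
    by (intro nn_integral_noteq_infinite) measurable
  show pu: "AE x in M. 0 < \<phi> x \<longrightarrow> 0 < u x"
    using fin u_nonneg a(4)
  proof eventually_elim
    case (elim x)
    show ?case
    proof (rule impI, rule ccontr)
      assume f: "0 < \<phi> x" and "\<not> 0 < u x"
      then have u0: "u x = 0" using elim by simp
      \<comment> \<open>At a zero of u the quotient is explicit and grows like (n+1)^\<delta>,
        contradicting the finite lower limit.\<close>
      have eq: "qa \<phi> n x = a x * \<phi> x powr (1 - \<delta>) * real (Suc n) powr \<delta>" for n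
      proof -
        have "qa \<phi> n x = a x * \<phi> x powr (1 - \<delta>) * (tau n powr (1 - \<delta>) / tau n)"
          using u0 f tau(1)[of n] \<delta> by (simp add: qa_def abs_mult powr_mult)
        also have "tau n powr (1 - \<delta>) / tau n = tau n powr (- \<delta>)" using tau(1)[of n] by (simp add: powr_diff powr_minus field_simps)
        also have "\<dots> = real (Suc n) powr \<delta>" by (simp add: tau_def powr_minus powr_divide del: of_nat_Suc)
        finally show ?thesis .
      qed
      have "filterlim (\<lambda>n. real (Suc n) powr \<delta>) at_top sequentially"
        using \<delta>(1) by real_asymp
      then have "filterlim (\<lambda>n. qa \<phi> n x) at_top sequentially"
        unfolding eq using elim f by (intro filterlim_tendsto_pos_mult_at_top[OF tendsto_const]) auto
      then have "(\<lambda>n. ennreal (qa \<phi> n x)) \<longlonglongrightarrow> \<infinity>"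
        by (simp add: ennreal_tendsto_top_eq_at_top)
      then have "liminf (\<lambda>n. ennreal (qa \<phi> n x)) = \<infinity>" by (intro lim_imp_Liminf) auto
      with elim show False by simp
    qed
  qed
  have "integrable M (\<lambda>x. (1 - \<delta>) * (a x * u x powr (- \<delta>) * \<phi> x)) \<and> (\<integral>x. (1 - \<delta>) * (a x * u x powr (- \<delta>) * \<phi> x) \<partial>M) \<le> (1 - \<delta>) * (Lim \<phi> \<phi>' + 1)"
  \<comment> \<open>Absolute values are inserted because \<open>fatou_real\<close> wants
    nonnegativity everywhere, whereas the quotients have it almost everywhere.\<close>
  proof (rule fatou_real[where f="\<lambda>n x. \<bar>qa \<phi> n x\<bar>" and n=N])
    show "integrable M (\<lambda>x. \<bar>qa \<phi> n x\<bar>)" for n using qa_integral(1)[OF C] by simp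
    show "AE x in M. (\<lambda>n. \<bar>qa \<phi> n x\<bar>) \<longlonglongrightarrow> (1 - \<delta>) * (a x * u x powr (- \<delta>) * \<phi> x)"
      using pu
    proof eventually_elim
      case (elim x)
      show ?case
      proof (cases "0 < \<phi> x")
        case True
        have "0 \<le> (1 - \<delta>) * (a x * u x powr (- \<delta>) * \<phi> x)" using \<delta> a(1)[of x] True by simp
        then show ?thesis using tendsto_rabs[OF qa_lim[of x \<phi>]] elim True by simp
      next
        case False
        then have "\<phi> x = 0" using \<phi>[of x] by simp
        then show ?thesis by (simp add: qa_def)
      qed
    qed
    fix n assume "N \<le> n"
    have "(\<integral>x. \<bar>qa \<phi> n x\<bar> \<partial>M) = (\<integral>x. qa \<phi> n x \<partial>M)"
      by (rule integral_cong_AE) (use q0[of n] in \<open>auto elim!: eventually_mono\<close>)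
    with N[OF \<open>N \<le> n\<close>] show "(\<integral>x. \<bar>qa \<phi> n x\<bar> \<partial>M) \<le> (1 - \<delta>) * (Lim \<phi> \<phi>' + 1)" by simp
  qed auto
  then show "integrable M (\<lambda>x. a x * u x powr (- \<delta>) * \<phi> x) \<and> (\<integral>x. a x * u x powr (- \<delta>) * \<phi> x \<partial>M) \<le> Lim \<phi> \<phi>' + 1"
    using \<delta> by simp
qed

text \<open>No single test function is positive on all of \<Omega> here; countably many bumps on
  balls exhausting \<Omega> combine their null sets.\<close>

lemma u_pos: "AE x in M. 0 < u x"
proof -
  define F where "F = {ball c R | c R. 0 < R \<and> cball c R \<subseteq> \<Omega>}"
  obtain F' where F': "F' \<subseteq> F" "countable F'" "\<Union>F' = \<Union>F"
    by (rule Lindelof[of F]) (auto simp: F_def)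
  have "\<forall>B\<in>F'. AE x in M. x \<in> B \<longrightarrow> 0 < u x"
  proof
    fix B assume "B \<in> F'"
    then obtain c R where B: "B = ball c R" "0 < R" "cball c R \<subseteq> \<Omega>" using F'(1) unfolding F_def by blast
    from singular_bound_nonneg(1)[OF C1c_bump[OF less_imp_le[OF B(2)] B(3)]]
    have "AE x in M. 0 < (max 0 (R\<^sup>2 - (x - c) \<bullet> (x - c)))\<^sup>2 \<longrightarrow> 0 < u x" by simp
    then show "AE x in M. x \<in> B \<longrightarrow> 0 < u x"
    proof eventually_elim
      case (elim x)
      have "0 < R\<^sup>2 - (x - c) \<bullet> (x - c)" if "x \<in> B"
      proof -
        have "norm (x - c) < R" using that B by (simp add: dist_norm norm_minus_commute)
        then have "(norm (x - c))\<^sup>2 < R\<^sup>2" by (intro power_strict_mono) auto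
        then show ?thesis by (simp add: power2_norm_eq_inner)
      qed
      then show ?case using elim by auto
    qed
  qed
  then have "AE x in M. \<forall>B\<in>F'. x \<in> B \<longrightarrow> 0 < u x" 
    using AE_ball_countable[OF F'(2), of "\<lambda>x B. x \<in> B \<longrightarrow> 0 < u x" M] by blast
  moreover have "AE x in M. x \<in> \<Omega>" using \<Omega>(1) by (intro AE_I2) simp
  ultimately show ?thesis
  proof eventually_elim
    case (elim x)
    obtain R where "0 < R" "cball x R \<subseteq> \<Omega>" using elim(2) \<Omega>(1) open_contains_cball by blast
    then have "x \<in> \<Union>F" unfolding F_def by (force intro: centre_in_ball[THEN iffD2])
    then show ?case using elim(1) F'(3) by blast
  qed
qed

text \<open>For signed \<phi> the absolute value is not C^1. Its regularisations are admissible, and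
  their bounds stay below L because \<open>sabs\<close> increases neither values nor slopes.\<close>

lemma singular_integrable:
  assumes C: "C1c \<Omega> \<phi> \<phi>'"
  shows "integrable M (\<lambda>x. a x * u x powr (- \<delta>) * \<bar>\<phi> x\<bar>)"
proof -
  note [measurable] = C1c_M(1,2)[OF C]
  define L where "L = (\<integral>x. \<bar>fl \<phi>' x\<bar> \<partial>M) + lam * (\<integral>x. \<bar>b x * u x powr (r - 1) * \<phi> x\<bar> \<partial>M) + 1"
  have CS: "C1c \<Omega> (\<lambda>x. sabs (tau n) (\<phi> x)) (\<lambda>x. sabs' (tau n) (\<phi> x) *\<^sub>R \<phi>' x)" for n by (rule C1c_sabs[OF C tau(1)])
  note sb = singular_bound_nonneg(2)[OF CS sabs_bounds(1)[OF tau(1)]]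
  have "integrable M (\<lambda>x. a x * u x powr (- \<delta>) * \<bar>\<phi> x\<bar>) \<and> (\<integral>x. a x * u x powr (- \<delta>) * \<bar>\<phi> x\<bar> \<partial>M) \<le> L"
  proof (rule fatou_real[where f="\<lambda>n x. a x * u x powr (- \<delta>) * sabs (tau n) (\<phi> x)" and n=0])
    show "integrable M (\<lambda>x. a x * u x powr (- \<delta>) * sabs (tau n) (\<phi> x))" for n using sb by blast
    show "AE x in M. (\<lambda>n. a x * u x powr (- \<delta>) * sabs (tau n) (\<phi> x)) \<longlonglongrightarrow> a x * u x powr (- \<delta>) * \<bar>\<phi> x\<bar>"
      unfolding tau_def by (intro AE_I2 tendsto_mult tendsto_const sabs_tendsto)
    show "0 \<le> a x * u x powr (- \<delta>) * sabs (tau n) (\<phi> x)" for n x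
      using a(1) sabs_bounds(1)[OF tau(1)] by simp
    fix n :: nat
    have 1: "(\<integral>x. fl (\<lambda>x. sabs' (tau n) (\<phi> x) *\<^sub>R \<phi>' x) x \<partial>M) \<le> (\<integral>x. \<bar>fl \<phi>' x\<bar> \<partial>M)"
    proof (rule integral_mono)
      fix x
      have "fl (\<lambda>x. sabs' (tau n) (\<phi> x) *\<^sub>R \<phi>' x) x \<le> \<bar>sabs' (tau n) (\<phi> x)\<bar> * \<bar>fl \<phi>' x\<bar>"
        unfolding flux_scale abs_mult[symmetric] by simp
      also have "\<dots> \<le> 1 * \<bar>fl \<phi>' x\<bar>" by (intro mult_right_mono sabs_bounds tau) simp
      finally show "fl (\<lambda>x. sabs' (tau n) (\<phi> x) *\<^sub>R \<phi>' x) x \<le> \<bar>fl \<phi>' x\<bar>" by simp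
    qed (use \<Phi>_quot(1)[OF C] \<Phi>_quot(1)[OF CS[of n]] in auto)
    have 2: "- (\<integral>x. b x * u x powr (r - 1) * sabs (tau n) (\<phi> x) \<partial>M) \<le> (\<integral>x. \<bar>b x * u x powr (r - 1) * \<phi> x\<bar> \<partial>M)"
      unfolding Bochner_Integration.integral_minus[symmetric]
    proof (rule integral_mono)
      fix x
      have "- (b x * u x powr (r - 1) * sabs (tau n) (\<phi> x)) \<le> \<bar>b x * u x powr (r - 1)\<bar> * \<bar>sabs (tau n) (\<phi> x)\<bar>"
        unfolding abs_mult[symmetric] by simp
      also have "\<dots> \<le> \<bar>b x * u x powr (r - 1)\<bar> * \<bar>\<phi> x\<bar>"
        using sabs_bounds[OF tau(1)[of n], of "\<phi> x"] by (intro mult_left_mono) auto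
      finally show "- (b x * u x powr (r - 1) * sabs (tau n) (\<phi> x)) \<le> \<bar>b x * u x powr (r - 1) * \<phi> x\<bar>" by (simp add: abs_mult)
    qed (use Bn_quot(1)[OF C] Bn_quot(1)[OF CS[of n]] in auto)
    have "Lim (\<lambda>x. sabs (tau n) (\<phi> x)) (\<lambda>x. sabs' (tau n) (\<phi> x) *\<^sub>R \<phi>' x) + 1 \<le> L"
      unfolding Lim_def L_def using 1 mult_left_mono[OF 2, of lam] lam by simp
    then show "(\<integral>x. a x * u x powr (- \<delta>) * sabs (tau n) (\<phi> x) \<partial>M) \<le> L" using sb[of n] by linarith
  qed measurable
  then show ?thesis ..
qed

text \<open>With u > 0 and the integrable majorant a u^(-\<delta>) |\<phi>| available, the singular
  quotients now converge by domination. Replacing \<phi> by its negative later gives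
  equality.\<close>

lemma EL_le:
  assumes C: "C1c \<Omega> \<phi> \<phi>'"
  shows "integrable M (\<lambda>x. a x * u x powr (- \<delta>) * \<phi> x)" "(\<integral>x. a x * u x powr (- \<delta>) * \<phi> x \<partial>M) \<le> Lim \<phi> \<phi>'"
proof -
  note [measurable] = C1c_M(1,2)[OF C]
  show i: "integrable M (\<lambda>x. a x * u x powr (- \<delta>) * \<phi> x)"
    by (rule Bochner_Integration.integrable_bound[OF singular_integrable[OF C]]) (auto simp: abs_mult)
  have "(\<lambda>n. \<integral>x. qa \<phi> n x \<partial>M) \<longlonglongrightarrow> (\<integral>x. (1 - \<delta>) * (a x * u x powr (- \<delta>) * \<phi> x) \<partial>M)"
  proof (rule integral_dominated_convergence[OF _ _ singular_integrable[OF C]])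
    show "AE x in M. (\<lambda>n. qa \<phi> n x) \<longlonglongrightarrow> (1 - \<delta>) * (a x * u x powr (- \<delta>) * \<phi> x)"
      using u_pos by eventually_elim (rule qa_lim)
    show "AE x in M. norm (qa \<phi> n x) \<le> a x * u x powr (- \<delta>) * \<bar>\<phi> x\<bar>" for n
      using u_pos
    proof eventually_elim
      case (elim x)
      have "\<bar>a x * (\<bar>u x + tau n * \<phi> x\<bar> powr (1 - \<delta>) - \<bar>u x\<bar> powr (1 - \<delta>))\<bar> \<le> a x * (u x powr (- \<delta>) * \<bar>tau n * \<phi> x\<bar>)"
        using mult_left_mono[OF sublinear_powr_bound[OF elim \<delta>] a(1)[of x]] a(1)[of x]
        by (simp only: abs_mult[of "a x"] abs_of_nonneg)
      also have "\<dots> = a x * u x powr (- \<delta>) * \<bar>\<phi> x\<bar> * tau n" using tau(1)[of n] by (simp add: abs_mult)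
      finally show ?case unfolding qa_def right_diff_distrib[symmetric] using tau(1)[of n] by (simp add: divide_le_eq)
    qed
  qed (use borel_measurable_integrable[OF qa_integral(1)[OF C]] in auto)
  then have lim: "(\<lambda>n. (An (\<lambda>x. u x + tau n * \<phi> x) - An u) / tau n) \<longlonglongrightarrow> (1 - \<delta>) * (\<integral>x. a x * u x powr (- \<delta>) * \<phi> x \<partial>M)"
    using i unfolding qa_integral(2)[OF C] by simp
  show "(\<integral>x. a x * u x powr (- \<delta>) * \<phi> x \<partial>M) \<le> Lim \<phi> \<phi>'"
  proof (rule field_le_epsilon)
    fix e :: real assume e: "0 < e"
    have "(1 - \<delta>) * (\<integral>x. a x * u x powr (- \<delta>) * \<phi> x \<partial>M) \<le> (1 - \<delta>) * (Lim \<phi> \<phi>' + e)"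
      by (rule tendsto_upperbound[OF lim An_quot_le[OF C e]]) simp
    then show "(\<integral>x. a x * u x powr (- \<delta>) * \<phi> x \<partial>M) \<le> Lim \<phi> \<phi>' + e" using \<delta> by simp
  qed
qed

lemma euler_lagrange:
  assumes C: "C1c \<Omega> \<phi> \<phi>'"
  shows "integrable M (fl \<phi>')" "integrable M (\<lambda>x. (a x * u x powr (- \<delta>) + lam * b x * u x powr (r - 1)) * \<phi> x)"
    "(\<integral>x. fl \<phi>' x \<partial>M) = (\<integral>x. (a x * u x powr (- \<delta>) + lam * b x * u x powr (r - 1)) * \<phi> x \<partial>M)"
proof -
  show "integrable M (fl \<phi>')" by (rule \<Phi>_quot(1)[OF C])
  have eq: "(\<lambda>x. (a x * u x powr (- \<delta>) + lam * b x * u x powr (r - 1)) * \<phi> x)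
     = (\<lambda>x. a x * u x powr (- \<delta>) * \<phi> x + lam * (b x * u x powr (r - 1) * \<phi> x))" by (simp add: fun_eq_iff algebra_simps)
  note i1 = EL_le(1)[OF C] and i2 = Bn_quot(1)[OF C]
  show "integrable M (\<lambda>x. (a x * u x powr (- \<delta>) + lam * b x * u x powr (r - 1)) * \<phi> x)"
    unfolding eq using i1 i2 by simp
  have Cm: "C1c \<Omega> (\<lambda>x. (-1) * \<phi> x) (\<lambda>x. (-1) *\<^sub>R \<phi>' x)" by (rule C1c_scale[OF C])
  have "Lim (\<lambda>x. (-1) * \<phi> x) (\<lambda>x. (-1) *\<^sub>R \<phi>' x) = - Lim \<phi> \<phi>'"
    unfolding Lim_def flux_scale by simp
  with EL_le(2)[OF Cm] EL_le(2)[OF C] have "(\<integral>x. a x * u x powr (- \<delta>) * \<phi> x \<partial>M) = Lim \<phi> \<phi>'" by simp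
  then show "(\<integral>x. fl \<phi>' x \<partial>M) = (\<integral>x. (a x * u x powr (- \<delta>) + lam * b x * u x powr (r - 1)) * \<phi> x \<partial>M)"
    unfolding eq Lim_def using i1 i2 by simp
qed

end

section \<open>Membership in the Sobolev space and conclusion\<close>

lemma C1c_mult:
  assumes "C1c \<Omega> f f'" "C1c \<Omega> g g'"
  shows "C1c \<Omega> (\<lambda>x. f x * g x) (\<lambda>x. f x *\<^sub>R g' x + g x *\<^sub>R f' x)"
proof (rule C1cI[where K="tsupp f"])
  show "((\<lambda>x. f x * g x) has_derivative (\<bullet>) (f x *\<^sub>R g' x + g x *\<^sub>R f' x)) (at x)" for x
    by (rule has_derivative_eq_rhs[OF has_derivative_mult[OF C1cD(1)[OF assms(1)] C1cD(1)[OF assms(2)]]])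
      (simp add: fun_eq_iff inner_add_left mult.commute)
  show "continuous_on UNIV (\<lambda>x. f x *\<^sub>R g' x + g x *\<^sub>R f' x)"
    by (intro continuous_intros C1cD(2,3)[OF assms(1)] C1cD(2,3)[OF assms(2)])
qed (use C1cD(4,5)[OF assms(1)] in \<open>auto simp: tsupp_vanish\<close>)

text \<open>Differentiates the translation invariance of the integral of f; applied to a product it
  is integration by parts.\<close>

lemma integral_grad_zero:
  fixes f :: "'a::euclidean_space \<Rightarrow> real"
  assumes C: "C1c \<Omega> f g"
  shows "(\<integral>x. g x \<bullet> v \<partial>lborel) = 0"
proof -
  note [measurable] = C1c_measurable[OF C]
  obtain B where B: "B > 0" "\<And>x. norm (g x) \<le> B"
    using continuous_cpt_bounded[OF C1cD(2,4)[OF C] C1c_grad_vanish[OF C]] by blast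
  \<comment> \<open>Contains the supports of all difference quotients with steps up to 1, which
    gives an integrable majorant.\<close>
  define K where "K = {x + y |x y. x \<in> tsupp f \<and> y \<in> cball 0 (norm v)}"
  have K: "compact K" unfolding K_def by (intro compact_sums C1cD(4)[OF C] compact_cball)
  have fi: "integrable lborel f"
    by (rule continuous_cpt_integrable[OF C1cD(3,4)[OF C] tsupp_vanish[of _ f]])
  have tr: "integrable lborel (\<lambda>x. f (c + x))" "(\<integral>x. f (c + x) \<partial>lborel) = (\<integral>x. f x \<partial>lborel)" for c
  proof -
    have "integrable (distr lborel borel ((+) c)) f" using fi by (simp add: lborel_distr_plus)
    then show "integrable lborel (\<lambda>x. f (c + x))" by (subst (asm) integrable_distr_eq) auto
    have "(\<integral>x. f x \<partial>lborel) = (\<integral>x. f x \<partial>distr lborel borel ((+) c))" by (simp add: lborel_distr_plus)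
    also have "\<dots> = (\<integral>x. f (c + x) \<partial>lborel)" by (subst integral_distr) auto
    finally show "(\<integral>x. f (c + x) \<partial>lborel) = (\<integral>x. f x \<partial>lborel)" by simp
  qed
  have der: "((\<lambda>t. f (x + t *\<^sub>R v)) has_real_derivative g (x + t *\<^sub>R v) \<bullet> v) (at t)" for x t
  proof -
    have "((\<lambda>t. x + t *\<^sub>R v) has_derivative (\<lambda>h. h *\<^sub>R v)) (at t)" by (auto intro!: derivative_eq_intros)
    from has_derivative_compose[OF this C1cD(1)[OF C]] show ?thesis
      unfolding has_field_derivative_def by (rule has_derivative_eq_rhs) (simp add: fun_eq_iff)
  qed
  have "(\<lambda>n. \<integral>x. (f (tau n *\<^sub>R v + x) - f x) / tau n \<partial>lborel) \<longlonglongrightarrow> (\<integral>x. g x \<bullet> v \<partial>lborel)"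
  proof (rule integral_dominated_convergence[where w="\<lambda>x. indicator K x *\<^sub>R (B * norm v)"])
    show "integrable lborel (\<lambda>x. indicator K x *\<^sub>R (B * norm v))" by (rule borel_integrable_compact[OF K]) simp
    show "AE x in lborel. (\<lambda>n. (f (tau n *\<^sub>R v + x) - f x) / tau n) \<longlonglongrightarrow> g x \<bullet> v"
      using DERIV_tau[OF der[of _ 0]] by (intro AE_I2) (simp add: add.commute)
    show "AE x in lborel. norm ((f (tau n *\<^sub>R v + x) - f x) / tau n) \<le> indicator K x *\<^sub>R (B * norm v)" for n
    proof (rule AE_I2)
      fix x
      show "norm ((f (tau n *\<^sub>R v + x) - f x) / tau n) \<le> indicator K x *\<^sub>R (B * norm v)"
      proof (cases "x \<in> K")
        case True
        obtain z where z: "f (x + tau n *\<^sub>R v) - f (x + 0 *\<^sub>R v) = (tau n - 0) * (g (x + z *\<^sub>R v) \<bullet> v)"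
          using MVT2[OF tau(1)[of n], of "\<lambda>t. f (x + t *\<^sub>R v)" "\<lambda>t. g (x + t *\<^sub>R v) \<bullet> v"] der by blast
        have "(f (tau n *\<^sub>R v + x) - f x) / tau n = g (x + z *\<^sub>R v) \<bullet> v"
          using z tau(1)[of n] by (simp add: add.commute)
        moreover have "\<bar>g (x + z *\<^sub>R v) \<bullet> v\<bar> \<le> B * norm v"
          by (rule order_trans[OF Cauchy_Schwarz_ineq2]) (intro mult_right_mono B; simp)
        ultimately show ?thesis using True by simp
      next
        case False
        have "x \<notin> tsupp f"
        proof
          assume "x \<in> tsupp f" then have "x + 0 \<in> K" unfolding K_def by (intro CollectI exI[of _ x] exI[of _ 0]) auto
          with False show False by simp
        qed
        moreover have "tau n *\<^sub>R v + x \<notin> tsupp f"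
        proof
          assume t: "tau n *\<^sub>R v + x \<in> tsupp f"
          have "norm (- (tau n *\<^sub>R v)) \<le> 1 * norm v" using tau(1,2)[of n] by (simp add: mult_left_le_one_le)
          then have "(tau n *\<^sub>R v + x) + - (tau n *\<^sub>R v) \<in> K" unfolding K_def using t
            by (intro CollectI exI[of _ "tau n *\<^sub>R v + x"] exI[of _ "- (tau n *\<^sub>R v)"]) auto
          with False show False by simp
        qed
        ultimately show ?thesis using B(1) by (simp add: tsupp_vanish)
      qed
    qed
  qed measurable
  moreover have z: "(\<integral>x. (f (tau n *\<^sub>R v + x) - f x) / tau n \<partial>lborel) = 0" for n
    using tr[of "tau n *\<^sub>R v"] fi by simp
  ultimately have "(\<lambda>n. 0) \<longlonglongrightarrow> (\<integral>x. g x \<bullet> v \<partial>lborel)" by (simp only: z)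
  from LIMSEQ_unique[OF this tendsto_const] show ?thesis .
qed

section \<open>Weak gradients and convergence in the Luxemburg norm\<close>

context dphase begin

lemma M\<mu>_nonneg: "0 \<le> M\<mu>"
  using order_trans[OF \<mu>(1) \<mu>(2)] .

lemma powr_le_one_plus:
  fixes t s e :: real
  assumes "0 \<le> t" "0 \<le> s" "s \<le> e"
  shows "t powr s \<le> 1 + t powr e"
proof (cases "t \<le> 1")
  case True
  then have "t powr s \<le> 1" using assms by (intro powr_le1) auto
  then show ?thesis using powr_ge_zero[of t e] by linarith
next
  case False
  then have "t powr s \<le> t powr e" using assms by (intro powr_mono) auto
  then show ?thesis by simp
qed

text \<open>Since p < q < r and \<mu> is bounded, L^r convergence controls the modular of the
  functions themselves.\<close>

lemma dp_le_r: "0 \<le> t \<Longrightarrow> dp x t \<le> (1 + M\<mu>) * (1 + t powr r)"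
proof -
  assume t: "0 \<le> t"
  have "\<mu> x * t powr q \<le> M\<mu> * (1 + t powr r)"
    using \<mu>(1,2)[of x] t pq r by (intro mult_mono powr_le_one_plus) auto
  moreover have "t powr p \<le> 1 + t powr r" using t pq r_gt by (intro powr_le_one_plus) auto
  ultimately show ?thesis unfolding dpH_def distrib_right[of 1] mult_1 by linarith
qed

lemma norm_le_dp: "norm \<xi> \<le> 1 + dp x (norm \<xi>)"
proof -
  have "norm \<xi> powr 1 \<le> 1 + norm \<xi> powr p" using pq by (intro powr_le_one_plus) auto
  moreover have "0 \<le> \<mu> x * norm \<xi> powr q" using \<mu>(1)[of x] by simp
  ultimately show ?thesis unfolding dpH_def by simp
qed

lemma abs_le_r: "\<bar>t\<bar> \<le> 1 + \<bar>t\<bar> powr r" for t :: real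
proof -
  have "\<bar>t\<bar> powr 1 \<le> 1 + \<bar>t\<bar> powr r" using r_gt by (intro powr_le_one_plus) auto
  then show ?thesis by simp
qed

lemma const_integrable: "integrable M (\<lambda>x. c::real)"
  by (rule finite_measure.integrable_const[OF finM])

lemma sconv_L1:
  assumes s: "sconv \<psi> \<psi>' u G"
  shows "integrable M u" "integrable M G"
proof -
  note [measurable] = sconvD(2,3)[OF s]
  show "integrable M u"
  proof (rule Bochner_Integration.integrable_bound[of _ "\<lambda>x. 1 + \<bar>u x\<bar> powr r"])
    show "integrable M (\<lambda>x. 1 + \<bar>u x\<bar> powr r)" using sconv_integrable(1)[OF s] const_integrable by simp
    show "AE x in M. norm (u x) \<le> norm (1 + \<bar>u x\<bar> powr r)"
      by (intro AE_I2) (use abs_le_r in \<open>auto intro: order_trans[OF _ abs_ge_self]\<close>)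
  qed measurable
  show "integrable M G"
  proof (rule Bochner_Integration.integrable_bound[of _ "\<lambda>x. 1 + dp x (norm (G x))"])
    show "integrable M (\<lambda>x. 1 + dp x (norm (G x)))" using sconv_integrable(2)[OF s] const_integrable by simp
    show "AE x in M. norm (G x) \<le> norm (1 + dp x (norm (G x)))"
      by (intro AE_I2) (use norm_le_dp in \<open>auto intro: order_trans[OF _ abs_ge_self]\<close>)
  qed measurable
qed

lemma set_integrable_M:
  fixes h :: "'a \<Rightarrow> 'c::{banach, second_countable_topology}"
  assumes "integrable M h" "compact K" "K \<subseteq> \<Omega>"
  shows "set_integrable lebesgue K h"
proof -
  have "set_integrable lebesgue \<Omega> h"
    using assms(1) \<Omega>(1) unfolding set_integrable_def by (subst (asm) integrable_restrict_space) auto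
  then show ?thesis by (rule set_integrable_subset) (use assms(2,3) in \<open>auto intro: fmeasurableD lmeasurable_compact\<close>)
qed

text \<open>Integration by parts holds for the C^1 approximants, and both sides are continuous along
  the sequence.\<close>

lemma sconv_weak_gradient:
  assumes s: "sconv \<psi> \<psi>' u G"
  shows "weak_gradient \<Omega> u G"
  unfolding weak_gradient_def
proof (intro conjI allI impI ballI)
  note sD = sconvD[OF s] and sI = sconv_integrable[OF s]
  note [measurable] = sD(2,3) C1c_M(1,2)[OF sD(1)]
  show "u \<in> borel_measurable M" "G \<in> borel_measurable M" by measurable
  show "set_integrable lebesgue K u" "set_integrable lebesgue K G" if "compact K \<and> K \<subseteq> \<Omega>" for K
    using that by (auto intro: set_integrable_M sconv_L1[OF s])
  fix \<zeta> e assume "\<zeta> \<in> Cc_infty \<Omega>" and "e \<in> (Basis :: 'a set)"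
  then have C: "C1c \<Omega> \<zeta> (grad \<zeta>)" by (intro Cc_infty_C1c)
  note [measurable] = C1c_M(1,2)[OF C]
  have fd: "frechet_derivative \<zeta> (at x) e = grad \<zeta> x \<bullet> e" for x
    using frechet_derivative_at[OF C1cD(1)[OF C]] by metis
  obtain B1 where B1: "B1 > 0" "\<And>x. norm (\<zeta> x) \<le> B1"
    using continuous_cpt_bounded[OF C1cD(3,4)[OF C] tsupp_vanish[of _ \<zeta>]] by blast
  obtain B2 where B2: "B2 > 0" "\<And>x. norm (grad \<zeta> x) \<le> B2"
    using continuous_cpt_bounded[OF C1cD(2,4)[OF C] C1c_grad_vanish[OF C]] by blast
  have e1: "\<bar>v \<bullet> e\<bar> \<le> norm v" for v using Basis_le_norm[OF \<open>e \<in> Basis\<close>] .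
  have L1: "integrable M (\<lambda>x. u x * (grad \<zeta> x \<bullet> e)) \<and> (\<lambda>k. \<integral>x. \<psi> k x * (grad \<zeta> x \<bullet> e) \<partial>M) \<longlonglongrightarrow> (\<integral>x. u x * (grad \<zeta> x \<bullet> e) \<partial>M)"
  proof (rule dominated_convergence_perturbed[where f="\<lambda>k x. \<psi> k x * (grad \<zeta> x \<bullet> e)" and
        w="\<lambda>k x. B2 * (2 powr r * \<bar>\<psi> k x - u x\<bar> powr r)" and g="\<lambda>x. B2 * (1 + 2 powr r * \<bar>u x\<bar> powr r)"])
    have b: "\<bar>t * (grad \<zeta> x \<bullet> e)\<bar> \<le> B2 * (1 + \<bar>t\<bar> powr r)" for t x
    proof -
      have "\<bar>t * (grad \<zeta> x \<bullet> e)\<bar> \<le> (1 + \<bar>t\<bar> powr r) * B2"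
        unfolding abs_mult using abs_le_r[of t] order_trans[OF e1 B2(2)] by (intro mult_mono) auto
      then show ?thesis by (simp add: mult.commute)
    qed
    show "AE x in M. (\<lambda>k. \<psi> k x * (grad \<zeta> x \<bullet> e)) \<longlonglongrightarrow> u x * (grad \<zeta> x \<bullet> e)"
      using sD(4) by eventually_elim (intro tendsto_intros)
    show "AE x in M. \<bar>\<psi> k x * (grad \<zeta> x \<bullet> e)\<bar> \<le> B2 * (2 powr r * \<bar>\<psi> k x - u x\<bar> powr r) + B2 * (1 + 2 powr r * \<bar>u x\<bar> powr r)" for k
    proof (rule AE_I2)
      fix x
      have "B2 * \<bar>\<psi> k x\<bar> powr r \<le> B2 * (2 powr r * (\<bar>\<psi> k x - u x\<bar> powr r + \<bar>u x\<bar> powr r))"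
        using B2(1) by (intro mult_left_mono powr_diff_le) auto
      with b[of "\<psi> k x" x] show "\<bar>\<psi> k x * (grad \<zeta> x \<bullet> e)\<bar> \<le> B2 * (2 powr r * \<bar>\<psi> k x - u x\<bar> powr r) + B2 * (1 + 2 powr r * \<bar>u x\<bar> powr r)"
        by (simp add: algebra_simps)
    qed
    show "AE x in M. \<bar>u x * (grad \<zeta> x \<bullet> e)\<bar> \<le> B2 * (1 + 2 powr r * \<bar>u x\<bar> powr r)"
    proof (rule AE_I2)
      fix x
      have "B2 * (1 + 1 * \<bar>u x\<bar> powr r) \<le> B2 * (1 + 2 powr r * \<bar>u x\<bar> powr r)"
        using B2(1) r_gt by (intro mult_left_mono add_left_mono mult_right_mono) (auto simp: ge_one_powr_ge_zero)
      with b[of "u x" x] show "\<bar>u x * (grad \<zeta> x \<bullet> e)\<bar> \<le> B2 * (1 + 2 powr r * \<bar>u x\<bar> powr r)" by simp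
    qed
    show "(\<lambda>k. \<integral>x. B2 * (2 powr r * \<bar>\<psi> k x - u x\<bar> powr r) \<partial>M) \<longlonglongrightarrow> 0"
      using tendsto_mult_right_zero[OF tendsto_mult_right_zero[OF sD(7)]] by simp
  qed (use B2(1) sD(6) sI(1) const_integrable in auto)
  have L2: "integrable M (\<lambda>x. (G x \<bullet> e) * \<zeta> x) \<and> (\<lambda>k. \<integral>x. (\<psi>' k x \<bullet> e) * \<zeta> x \<partial>M) \<longlonglongrightarrow> (\<integral>x. (G x \<bullet> e) * \<zeta> x \<partial>M)"
  proof (rule dominated_convergence_perturbed[where f="\<lambda>k x. (\<psi>' k x \<bullet> e) * \<zeta> x" and
        w="\<lambda>k x. B1 * (2 powr q * dp x (norm (\<psi>' k x - G x)))" and g="\<lambda>x. B1 * (1 + 2 powr q * dp x (norm (G x)))"])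
    have b: "\<bar>(v \<bullet> e) * \<zeta> x\<bar> \<le> B1 * (1 + dp x (norm v))" for v x
    proof -
      have "\<bar>(v \<bullet> e) * \<zeta> x\<bar> \<le> (1 + dp x (norm v)) * B1"
        unfolding abs_mult using order_trans[OF e1 norm_le_dp] B1(2)[of x] dp_nonneg by (intro mult_mono) auto
      then show ?thesis by (simp add: mult.commute)
    qed
    show "AE x in M. (\<lambda>k. (\<psi>' k x \<bullet> e) * \<zeta> x) \<longlonglongrightarrow> (G x \<bullet> e) * \<zeta> x"
      using sD(5) by eventually_elim (intro tendsto_intros)
    show "AE x in M. \<bar>(\<psi>' k x \<bullet> e) * \<zeta> x\<bar> \<le> B1 * (2 powr q * dp x (norm (\<psi>' k x - G x))) + B1 * (1 + 2 powr q * dp x (norm (G x)))" for k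
    proof (rule AE_I2)
      fix x
      have "B1 * dp x (norm (\<psi>' k x)) \<le> B1 * (2 powr q * (dp x (norm (\<psi>' k x - G x)) + dp x (norm (G x))))"
        using B1(1) by (intro mult_left_mono dp_diff_le) auto
      with b[of "\<psi>' k x" x] show "\<bar>(\<psi>' k x \<bullet> e) * \<zeta> x\<bar> \<le> B1 * (2 powr q * dp x (norm (\<psi>' k x - G x))) + B1 * (1 + 2 powr q * dp x (norm (G x)))"
        by (simp add: algebra_simps)
    qed
    show "AE x in M. \<bar>(G x \<bullet> e) * \<zeta> x\<bar> \<le> B1 * (1 + 2 powr q * dp x (norm (G x)))"
    proof (rule AE_I2)
      fix x
      have "B1 * (1 + 1 * dp x (norm (G x))) \<le> B1 * (1 + 2 powr q * dp x (norm (G x)))"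
        using B1(1) pq dp_nonneg by (intro mult_left_mono add_left_mono mult_right_mono) (auto simp: ge_one_powr_ge_zero)
      with b[of "G x" x] show "\<bar>(G x \<bullet> e) * \<zeta> x\<bar> \<le> B1 * (1 + 2 powr q * dp x (norm (G x)))" by simp
    qed
    show "(\<lambda>k. \<integral>x. B1 * (2 powr q * dp x (norm (\<psi>' k x - G x))) \<partial>M) \<longlonglongrightarrow> 0"
      using tendsto_mult_right_zero[OF tendsto_mult_right_zero[OF sD(9)]] by simp
  qed (use B1(1) sD(8) sI(2) const_integrable dp_nonneg in auto)
  have ibp: "(\<integral>x. \<psi> k x * (grad \<zeta> x \<bullet> e) \<partial>M) = - (\<integral>x. (\<psi>' k x \<bullet> e) * \<zeta> x \<partial>M)" for k
  proof -
    note Ck = sD(1)[of k]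
    have Cm: "C1c \<Omega> (\<lambda>x. \<psi> k x * \<zeta> x) (\<lambda>x. \<psi> k x *\<^sub>R grad \<zeta> x + \<zeta> x *\<^sub>R \<psi>' k x)" by (rule C1c_mult[OF Ck C])
    have c: "continuous_on UNIV (\<lambda>x. \<psi> k x * (grad \<zeta> x \<bullet> e))" "continuous_on UNIV (\<lambda>x. (\<psi>' k x \<bullet> e) * \<zeta> x)"
      by (intro continuous_intros C1cD(2,3)[OF Ck] C1cD(2,3)[OF C])+
    have z: "\<psi> k x * (grad \<zeta> x \<bullet> e) = 0" "(\<psi>' k x \<bullet> e) * \<zeta> x = 0" if "x \<notin> tsupp \<zeta>" for x
      using that tsupp_vanish[of x \<zeta>] C1c_grad_vanish[OF C that] by auto
    note i = continuous_cpt_integrable[OF c(1) C1cD(4)[OF C] z(1)] continuous_cpt_integrable[OF c(2) C1cD(4)[OF C] z(2)]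
    have "0 = (\<integral>x. (\<psi> k x *\<^sub>R grad \<zeta> x + \<zeta> x *\<^sub>R \<psi>' k x) \<bullet> e \<partial>lborel)" by (rule integral_grad_zero[OF Cm, symmetric])
    also have "\<dots> = (\<integral>x. \<psi> k x * (grad \<zeta> x \<bullet> e) + (\<psi>' k x \<bullet> e) * \<zeta> x \<partial>lborel)"
      by (simp add: inner_add_left mult.commute)
    also have "\<dots> = (\<integral>x. \<psi> k x * (grad \<zeta> x \<bullet> e) \<partial>lborel) + (\<integral>x. (\<psi>' k x \<bullet> e) * \<zeta> x \<partial>lborel)"
      using i by (rule Bochner_Integration.integral_add)
    also have "(\<integral>x. \<psi> k x * (grad \<zeta> x \<bullet> e) \<partial>lborel) = (\<integral>x. \<psi> k x * (grad \<zeta> x \<bullet> e) \<partial>M)"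
      using z(1) C1cD(5)[OF C] by (intro integral_M_lborel[symmetric] borel_measurable_continuous_onI c) blast
    also have "(\<integral>x. (\<psi>' k x \<bullet> e) * \<zeta> x \<partial>lborel) = (\<integral>x. (\<psi>' k x \<bullet> e) * \<zeta> x \<partial>M)"
      using z(2) C1cD(5)[OF C] by (intro integral_M_lborel[symmetric] borel_measurable_continuous_onI c) blast
    finally show ?thesis by simp
  qed
  have l1: "(\<lambda>k. - (\<integral>x. (\<psi>' k x \<bullet> e) * \<zeta> x \<partial>M)) \<longlonglongrightarrow> - (\<integral>x. (G x \<bullet> e) * \<zeta> x \<partial>M)"
    using L2 by (intro tendsto_minus) blast
  have l2: "(\<lambda>k. - (\<integral>x. (\<psi>' k x \<bullet> e) * \<zeta> x \<partial>M)) \<longlonglongrightarrow> (\<integral>x. u x * (grad \<zeta> x \<bullet> e) \<partial>M)"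
    using L1 unfolding ibp by blast
  show "(\<integral>x. u x * frechet_derivative \<zeta> (at x) e \<partial>M) = - (\<integral>x. (G x \<bullet> e) * \<zeta> x \<partial>M)"
    unfolding fd by (rule LIMSEQ_unique[OF l2 l1])
qed

lemma modular_eq:
  assumes "integrable M (\<lambda>x. dp x \<bar>f x\<bar>)"
  shows "modular p q \<mu> \<Omega> f = ennreal (\<integral>x. dp x \<bar>f x\<bar> \<partial>M)"
  unfolding modular_def using assms by (intro nn_integral_eq_integral) (auto simp: dp_nonneg)

text \<open>Dividing by a fixed t multiplies the modular by at most a constant, so small modulars
  put t into the set whose infimum is the norm. The choice t = e/2 makes the inequality
  strict.\<close>

lemma lux_tendsto:
  assumes f: "\<And>k::nat. integrable M (\<lambda>x. dp x \<bar>f k x\<bar>)" "(\<lambda>k. \<integral>x. dp x \<bar>f k x\<bar> \<partial>M) \<longlonglongrightarrow> 0"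
    and [measurable]: "\<And>k. f k \<in> borel_measurable M"
  shows "(\<lambda>k. lux_norm p q \<mu> \<Omega> (f k)) \<longlonglongrightarrow> 0"
proof (rule LIMSEQ_I)
  fix e :: real assume e: "0 < e"
  define t where "t = e / 2"
  have t: "0 < t" "t < e" using e by (auto simp: t_def)
  define c where "c = (1 / t) powr p + (1 / t) powr q"
  have c: "0 < c" unfolding c_def using t by (intro add_pos_pos) auto
  have "\<forall>\<^sub>F k in sequentially. (\<integral>x. dp x \<bar>f k x\<bar> \<partial>M) < 1 / c" using c by (intro order_tendstoD(2)[OF f(2)]) auto
  then obtain N where N: "\<And>k. N \<le> k \<Longrightarrow> (\<integral>x. dp x \<bar>f k x\<bar> \<partial>M) < 1 / c" unfolding eventually_sequentially by blast
  have "norm (lux_norm p q \<mu> \<Omega> (f k) - 0) < e" if k: "N \<le> k" for k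
  proof -
    let ?T = "{\<tau>. \<tau> > 0 \<and> modular p q \<mu> \<Omega> (\<lambda>x. f k x / \<tau>) \<le> 1}"
    have le: "dp x \<bar>f k x / t\<bar> \<le> c * dp x \<bar>f k x\<bar>" for x
      using dpH_scale[of \<mu> x "1 / t" "\<bar>f k x\<bar>" p q] \<mu>(1)[of x] t by (simp add: c_def)
    have ci: "integrable M (\<lambda>x. c * dp x \<bar>f k x\<bar>)" using f(1) by simp
    have i: "integrable M (\<lambda>x. dp x \<bar>f k x / t\<bar>)"
      by (rule Bochner_Integration.integrable_bound[OF ci])
        (use le dp_nonneg in \<open>auto intro!: AE_I2 intro: order_trans[OF _ abs_ge_self]\<close>)
    have "(\<integral>x. dp x \<bar>f k x / t\<bar> \<partial>M) \<le> c * (\<integral>x. dp x \<bar>f k x\<bar> \<partial>M)"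
      using integral_mono[OF i ci le] by simp
    also have "\<dots> \<le> c * (1 / c)" using N[OF k] c by (intro mult_left_mono) auto
    finally have "modular p q \<mu> \<Omega> (\<lambda>x. f k x / t) \<le> 1"
      unfolding modular_eq[OF i] using c by (simp add: ennreal_le_1)
    then have tT: "t \<in> ?T" using t by simp
    have "lux_norm p q \<mu> \<Omega> (f k) \<le> t"
      unfolding lux_norm_def by (rule cInf_lower[OF tT]) (auto intro!: bdd_belowI[of _ 0])
    moreover have "0 \<le> lux_norm p q \<mu> \<Omega> (f k)"
      unfolding lux_norm_def using tT by (intro cInf_greatest) auto
    ultimately show ?thesis using t by simp
  qed
  then show "\<exists>N. \<forall>k\<ge>N. norm (lux_norm p q \<mu> \<Omega> (f k) - 0) < e" by blast
qed

lemma dp_tendsto_0: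
  assumes "t \<longlonglongrightarrow> 0" "\<And>k. 0 \<le> t k"
  shows "(\<lambda>k. dp x (t k)) \<longlonglongrightarrow> 0"
proof -
  have l: "(\<lambda>k. t k powr s) \<longlonglongrightarrow> 0 powr s" if "0 < s" for s
    using assms that by (intro tendsto_powr' tendsto_const) auto
  have "(\<lambda>k. t k powr p + \<mu> x * t k powr q) \<longlonglongrightarrow> 0 powr p + \<mu> x * 0 powr q"
    using pq by (intro tendsto_add tendsto_mult tendsto_const l) auto
  then show ?thesis by (simp add: dpH_def)
qed

text \<open>The C^1 approximants are mollified with uniform errors tending to 0. On the bounded set
  \<Omega> uniform errors have small modulars, so the smooth functions converge as well.\<close>

lemma sconv_W0H:
  assumes s: "sconv \<psi> \<psi>' u G"
  shows "W0H H p q \<mu> \<Omega> u"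
  unfolding W0H_def
proof (intro exI[of _ G] conjI sconv_weak_gradient[OF s])
  note sD = sconvD[OF s] and sI = sconv_integrable[OF s]
  note [measurable] = sD(2,3) C1c_M(1,2)[OF sD(1)]
  obtain K where K: "K > 0" "\<And>x \<xi>. dp x (H \<xi>) \<le> K * dp x (norm \<xi>)" using Fd_bounds by blast
  have rM: "integrable M (\<lambda>x. (1 + M\<mu>) * (1 + \<bar>u x\<bar> powr r))" using sI(1) const_integrable by simp
  have "integrable M (\<lambda>x. dp x \<bar>u x\<bar>)"
    by (rule Bochner_Integration.integrable_bound[OF rM])
      (use dp_le_r dp_nonneg in \<open>auto intro!: AE_I2 intro: order_trans[OF _ abs_ge_self]\<close>)
  from modular_eq[OF this] show "in_LH p q \<mu> \<Omega> u" unfolding in_LH_def by simp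
  have KM: "integrable M (\<lambda>x. K * dp x (norm (G x)))" using sI(2) by simp
  have "integrable M (\<lambda>x. dp x \<bar>H (G x)\<bar>)"
    by (rule Bochner_Integration.integrable_bound[OF KM])
      (use K dp_nonneg H_nonneg in \<open>auto intro!: AE_I2 intro: order_trans[OF _ abs_ge_self]\<close>)
  from modular_eq[OF this] show "in_LH p q \<mu> \<Omega> (\<lambda>x. H (G x))" unfolding in_LH_def by simp
  have "\<forall>k. \<exists>\<zeta>\<in>Cc_infty \<Omega>. \<forall>x. \<bar>\<zeta> x - \<psi> k x\<bar> \<le> tau k \<and> norm (grad \<zeta> x - \<psi>' k x) \<le> tau k"
    using mollify[OF sD(1) \<Omega>(1) tau(1)] by blast
  then obtain \<zeta> where \<zeta>: "\<And>k. \<zeta> k \<in> Cc_infty \<Omega>" "\<And>k x. \<bar>\<zeta> k x - \<psi> k x\<bar> \<le> tau k" "\<And>k x. norm (grad (\<zeta> k) x - \<psi>' k x) \<le> tau k"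
    by metis
  note [measurable] = C1c_M(1,2)[OF Cc_infty_C1c[OF \<zeta>(1)]]
  have dpt: "dp x (tau k) \<le> 1 + M\<mu>" for x k
  proof -
    have t1: "tau k powr s \<le> 1" if "0 \<le> s" for s using tau(1,2)[of k] that by (intro powr_le1) auto
    have "\<mu> x * tau k powr q \<le> M\<mu> * 1" using \<mu>(1,2)[of x] M\<mu>_nonneg pq by (intro mult_mono t1) auto
    then show ?thesis unfolding dpH_def using t1[of p] pq by simp
  qed
  have near: "dp x t \<le> 2 powr q * (dp x (tau k) + dp x t')" if "0 \<le> t" "t \<le> tau k + t'" "0 \<le> t'" for x t t' k
  proof -
    have "dp x t \<le> dp x (tau k + t')" using that pq \<mu>(1) by (intro dpH_mono) auto
    also have "\<dots> \<le> 2 powr q * (dp x (tau k) + dp x t')" using that pq \<mu>(1) less_imp_le[OF tau(1)] by (intro dpH_add) auto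
    finally show ?thesis .
  qed
  have su: "\<bar>\<zeta> k x - u x\<bar> \<le> tau k + \<bar>\<psi> k x - u x\<bar>" for k x using \<zeta>(2)[of k x] by linarith
  have sg: "norm (grad (\<zeta> k) x - G x) \<le> tau k + norm (\<psi>' k x - G x)" for k x
    using norm_triangle_ineq[of "grad (\<zeta> k) x - \<psi>' k x" "\<psi>' k x - G x"] \<zeta>(3)[of k x] by simp
  define c where "c = 2 powr q * (1 + M\<mu>)"
  have c: "0 \<le> c" unfolding c_def using M\<mu>_nonneg by simp
  have bu: "dp x \<bar>\<zeta> k x - u x\<bar> \<le> c * \<bar>\<psi> k x - u x\<bar> powr r + c * 2" for k x
  proof -
    have "dp x \<bar>\<zeta> k x - u x\<bar> \<le> 2 powr q * (dp x (tau k) + dp x \<bar>\<psi> k x - u x\<bar>)" by (rule near[OF _ su]) auto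
    also have "\<dots> \<le> 2 powr q * ((1 + M\<mu>) + (1 + M\<mu>) * (1 + \<bar>\<psi> k x - u x\<bar> powr r))"
      by (intro mult_left_mono add_mono dpt dp_le_r) auto
    finally show ?thesis by (simp add: c_def algebra_simps)
  qed
  have bg: "dp x \<bar>H (grad (\<zeta> k) x - G x)\<bar> \<le> K * 2 powr q * dp x (norm (\<psi>' k x - G x)) + K * c" for k x
  proof -
    have "dp x \<bar>H (grad (\<zeta> k) x - G x)\<bar> \<le> K * dp x (norm (grad (\<zeta> k) x - G x))" using K(2) H_nonneg by simp
    also have "\<dots> \<le> K * (2 powr q * (dp x (tau k) + dp x (norm (\<psi>' k x - G x))))"
      using K(1) by (intro mult_left_mono near[OF _ sg]) auto
    also have "\<dots> \<le> K * (2 powr q * ((1 + M\<mu>) + dp x (norm (\<psi>' k x - G x))))"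
      using K(1) by (intro mult_left_mono add_mono dpt) auto
    finally show ?thesis by (simp add: c_def algebra_simps)
  qed
  have absd: "\<bar>dp x t\<bar> = dp x t" for x t using dp_nonneg by simp
  have U: "integrable M (\<lambda>x. 0::real) \<and> (\<lambda>k. \<integral>x. dp x \<bar>\<zeta> k x - u x\<bar> \<partial>M) \<longlonglongrightarrow> (\<integral>x. (0::real) \<partial>M)"
  proof (rule dominated_convergence_perturbed[where f="\<lambda>k x. dp x \<bar>\<zeta> k x - u x\<bar>" and M=M and w="\<lambda>k x. c * \<bar>\<psi> k x - u x\<bar> powr r" and g="\<lambda>x. c * 2"])
    show "AE x in M. (\<lambda>k. dp x \<bar>\<zeta> k x - u x\<bar>) \<longlonglongrightarrow> 0"
      using sD(4)
    proof eventually_elim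
      case (elim x)
      have l: "(\<lambda>k. \<bar>\<zeta> k x - u x\<bar>) \<longlonglongrightarrow> 0"
      proof (rule tendsto_sandwich[OF _ _ tendsto_const])
        show "(\<lambda>k. tau k + \<bar>\<psi> k x - u x\<bar>) \<longlonglongrightarrow> 0"
          using tendsto_add[OF tau(3) tendsto_rabs_zero[OF LIM_zero[OF elim]]] by simp
      qed (auto intro!: always_eventually su)
      then show ?case by (rule dp_tendsto_0) simp
    qed
    show "(\<lambda>k. \<integral>x. c * \<bar>\<psi> k x - u x\<bar> powr r \<partial>M) \<longlonglongrightarrow> 0" using tendsto_mult_right_zero[OF sD(7)] by simp
  qed (use c sD(6) const_integrable bu in \<open>auto simp: absd\<close>)
  have Gc: "integrable M (\<lambda>x. 0::real) \<and> (\<lambda>k. \<integral>x. dp x \<bar>H (grad (\<zeta> k) x - G x)\<bar> \<partial>M) \<longlonglongrightarrow> (\<integral>x. (0::real) \<partial>M)"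
  proof (rule dominated_convergence_perturbed[where f="\<lambda>k x. dp x \<bar>H (grad (\<zeta> k) x - G x)\<bar>" and M=M and w="\<lambda>k x. K * 2 powr q * dp x (norm (\<psi>' k x - G x))" and g="\<lambda>x. K * c"])
    show "AE x in M. (\<lambda>k. dp x \<bar>H (grad (\<zeta> k) x - G x)\<bar>) \<longlonglongrightarrow> 0"
      using sD(5)
    proof eventually_elim
      case (elim x)
      have l: "(\<lambda>k. norm (grad (\<zeta> k) x - G x)) \<longlonglongrightarrow> 0"
      proof (rule tendsto_sandwich[OF _ _ tendsto_const])
        show "(\<lambda>k. tau k + norm (\<psi>' k x - G x)) \<longlonglongrightarrow> 0"
          using tendsto_add[OF tau(3) tendsto_norm_zero[OF LIM_zero[OF elim]]] by simp
      qed (auto intro!: always_eventually sg)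
      have "(\<lambda>k. K * dp x (norm (grad (\<zeta> k) x - G x))) \<longlonglongrightarrow> 0"
        by (intro tendsto_mult_right_zero dp_tendsto_0 l) simp
      then show ?case
        by (rule tendsto_sandwich[OF _ _ tendsto_const, rotated 2])
          (use K(2) H_nonneg dp_nonneg in \<open>auto intro!: always_eventually\<close>)
    qed
    show "(\<lambda>k. \<integral>x. K * 2 powr q * dp x (norm (\<psi>' k x - G x)) \<partial>M) \<longlonglongrightarrow> 0" using tendsto_mult_right_zero[OF sD(9)] by simp
  qed (use c K(1) sD(8) const_integrable bg dp_nonneg in \<open>auto simp: absd\<close>)
  show "\<exists>\<phi>. (\<forall>k. \<phi> k \<in> Cc_infty \<Omega>) \<and> (\<lambda>k. lux_norm p q \<mu> \<Omega> (\<lambda>x. \<phi> k x - u x)) \<longlonglongrightarrow> 0 \<and>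
     (\<lambda>k. lux_norm p q \<mu> \<Omega> (\<lambda>x. H (grad (\<phi> k) x - G x))) \<longlonglongrightarrow> 0"
  proof -
    have i1: "integrable M (\<lambda>x. c * \<bar>\<psi> k x - u x\<bar> powr r + c * 2)" for k using sD(6) const_integrable by simp
    have Iu: "integrable M (\<lambda>x. dp x \<bar>\<zeta> k x - u x\<bar>)" for k
      by (rule Bochner_Integration.integrable_bound[OF i1])
        (use bu dp_nonneg in \<open>auto intro!: AE_I2 intro: order_trans[OF _ abs_ge_self]\<close>)
    have i2: "integrable M (\<lambda>x. K * 2 powr q * dp x (norm (\<psi>' k x - G x)) + K * c)" for k using sD(8) const_integrable by simp
    have Ig: "integrable M (\<lambda>x. dp x \<bar>H (grad (\<zeta> k) x - G x)\<bar>)" for k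
      by (rule Bochner_Integration.integrable_bound[OF i2])
        (use bg dp_nonneg in \<open>auto intro!: AE_I2 intro: order_trans[OF _ abs_ge_self]\<close>)
    have "(\<lambda>k. lux_norm p q \<mu> \<Omega> (\<lambda>x. \<zeta> k x - u x)) \<longlonglongrightarrow> 0"
      by (rule lux_tendsto[OF Iu]) (use U in \<open>simp; fail\<close>, measurable)
    moreover have "(\<lambda>k. lux_norm p q \<mu> \<Omega> (\<lambda>x. H (grad (\<zeta> k) x - G x))) \<longlonglongrightarrow> 0"
      by (rule lux_tendsto[OF Ig]) (use Gc in \<open>simp; fail\<close>, measurable)
    ultimately show ?thesis using \<zeta>(1) by blast
  qed
qed

end

text \<open>Only the values of \<mu> on \<Omega> enter, which permits replacing \<mu> by its
  extension by zero.\<close>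

lemma W0H_cong:
  assumes "\<And>x. x \<in> \<Omega> \<Longrightarrow> \<mu> x = \<mu>' x"
  shows "W0H H p q \<mu> \<Omega> u \<longleftrightarrow> W0H H p q \<mu>' \<Omega> u"
proof -
  have "modular p q \<mu> \<Omega> f = modular p q \<mu>' \<Omega> f" for f
    unfolding modular_def using assms by (intro nn_integral_cong) (simp add: dpH_def)
  then show ?thesis unfolding W0H_def in_LH_def lux_norm_def by simp
qed

theorem mainTheorem2:
  fixes \<Omega> :: "'a::euclidean_space set"
    and H :: "'a \<Rightarrow> real"
    and \<mu> a b :: "'a \<Rightarrow> real"
    and p q \<delta> \<alpha> :: real
  assumes dim: "DIM('a) \<ge> 2"
    and dom: "lipschitz_domain \<Omega>" and bdd: "bounded \<Omega>"
    and fm: "finsler_minkowski H"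
    and \<delta>: "0 < \<delta>" "\<delta> < 1"
    and pq: "2 \<le> p" "p < q" "q < real DIM('a)"
    and \<alpha>crit: "\<alpha> = crit_exp (real DIM('a)) p - 1"
    and q\<alpha>: "q < \<alpha> + 1"
    and qp: "q / p < 1 + 1 / real DIM('a)"
    and \<mu>nn: "\<forall>x\<in>closure \<Omega>. 0 \<le> \<mu> x"
    and \<mu>lip: "\<exists>L. lipschitz_on L (closure \<Omega>) \<mu>"
    and H3pos: "AE x in lebesgue_on \<Omega>. a x > 0"
    and H3int: "a \<in> borel_measurable (lebesgue_on \<Omega>)"
      "integrable (lebesgue_on \<Omega>) (\<lambda>x. \<bar>a x\<bar> powr (crit_exp (real DIM('a)) p / (crit_exp (real DIM('a)) p - 1 + \<delta>)))"
    and H4: "b \<in> borel_measurable (lebesgue_on \<Omega>)"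
      "\<exists>M. AE x in lebesgue_on \<Omega>. \<bar>b x\<bar> \<le> M"
    and H4pos: "\<not> (AE x in lebesgue_on \<Omega>. max (b x) 0 = 0)"
  shows "\<exists>\<Lambda>>0. \<forall>lam. 0 < lam \<and> lam < \<Lambda> \<longrightarrow>
           (\<exists>u G. weak_solution H p q \<mu> \<Omega> a b \<delta> lam \<alpha> u G
                  \<and> energy H p q \<mu> \<Omega> a b \<delta> lam \<alpha> u G < 0)"
proof -
  let ?M = "lebesgue_on \<Omega>"
  define r where "r = crit_exp (real DIM('a)) p"
  have \<Omega>: "open \<Omega>" "\<Omega> \<noteq> {}" using dom by (auto simp: lipschitz_domain_def)
  \<comment> \<open>The three representatives \<mu>', a' and b' satisfy the pointwise conditions of
    \<open>dphase\<close> everywhere; the first equals \<mu> on \<Omega>, the others equal a and b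
    almost everywhere there.\<close>
  define \<mu>' where "\<mu>' = (\<lambda>x. if x \<in> \<Omega> then \<mu> x else 0)"
  define a' where "a' = (\<lambda>x. \<bar>a x\<bar>)"
  obtain B where B: "AE x in ?M. \<bar>b x\<bar> \<le> B" using H4(2) by blast
  define b' where "b' = (\<lambda>x. max (- \<bar>B\<bar>) (min \<bar>B\<bar> (b x)))"
  have \<mu>c: "continuous_on (closure \<Omega>) \<mu>" using \<mu>lip by (auto intro: lipschitz_on_continuous_on)
  have "bounded (\<mu> ` closure \<Omega>)"
    using bdd \<mu>c by (intro compact_imp_bounded compact_continuous_image) (auto simp: compact_closure)
  then obtain M\<mu> where M\<mu>: "M\<mu> > 0" "\<And>x. x \<in> closure \<Omega> \<Longrightarrow> \<bar>\<mu> x\<bar> \<le> M\<mu>" unfolding bounded_pos by auto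
  have cl: "x \<in> closure \<Omega>" if "x \<in> \<Omega>" for x using that closure_subset by blast
  have "\<mu> \<in> borel_measurable ?M"
    using \<Omega>(1) continuous_on_subset[OF \<mu>c closure_subset]
    by (intro continuous_imp_measurable_on_sets_lebesgue) auto
  then have \<mu>'m: "\<mu>' \<in> borel_measurable ?M"
    by (rule measurable_cong[THEN iffD1, rotated]) (simp add: \<mu>'_def)
  have a'm[measurable]: "a' \<in> borel_measurable ?M" unfolding a'_def using H3int(1) by measurable
  have b'm[measurable]: "b' \<in> borel_measurable ?M" unfolding b'_def using H4(1) by measurable
  note [measurable] = H3int(1) H4(1) \<mu>'m
  have aa: "AE x in ?M. a' x = a x" using H3pos by eventually_elim (simp add: a'_def)
  have bb: "AE x in ?M. b' x = b x" using B by eventually_elim (auto simp: b'_def)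
  have "dphase H \<Omega> \<mu>' a' b' p q \<delta> r M\<mu> \<bar>B\<bar>"
  proof (unfold_locales)
    show "integrable ?M (\<lambda>x. a' x powr (r / (r - 1 + \<delta>)))" using H3int(2) by (simp add: a'_def r_def)
    show "AE x in ?M. 0 < a' x" using H3pos by eventually_elim (simp add: a'_def)
    show "q < r" using q\<alpha> \<alpha>crit by (simp add: r_def)
    show "0 \<le> \<mu>' x" for x using \<mu>nn cl by (auto simp: \<mu>'_def)
    show "\<mu>' x \<le> M\<mu>" for x using M\<mu>(1) M\<mu>(2)[OF cl, of x] by (auto simp: \<mu>'_def)
    show "\<bar>b' x\<bar> \<le> \<bar>B\<bar>" for x by (auto simp: b'_def)
    show "r = crit_exp (real DIM('a)) p" by (rule r_def)
    show "0 \<le> a' x" for x by (simp add: a'_def)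
  qed (rule fm \<Omega> bdd pq \<delta> \<mu>'m a'm b'm)+
  then interpret D: dphase H \<Omega> \<mu>' a' b' p q \<delta> r M\<mu> "\<bar>B\<bar>" .
  obtain \<Lambda> where \<Lambda>: "\<Lambda> > 0" "\<And>lam. 0 < lam \<Longrightarrow> lam < \<Lambda> \<Longrightarrow> (\<exists>\<rho> \<psi> \<psi>' u G. D.sconv \<psi> \<psi>' u G \<and> (\<forall>k x. 0 \<le> \<psi> k x) \<and>
    D.\<Phi> G < \<rho> \<and> D.En lam u G < 0 \<and> (\<forall>f g. C1c \<Omega> f g \<longrightarrow> D.\<Phi> g \<le> \<rho> \<longrightarrow> D.En lam u G \<le> D.En lam f g))"
    using D.minimizer_exists by blast
  have "\<exists>u G. weak_solution H p q \<mu> \<Omega> a b \<delta> lam \<alpha> u G \<and> energy H p q \<mu> \<Omega> a b \<delta> lam \<alpha> u G < 0"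
    if lam: "0 < lam" "lam < \<Lambda>" for lam
  proof -
    obtain \<rho> \<psi> \<psi>' u G where sc: "D.sconv \<psi> \<psi>' u G" and rest: "\<And>k x. 0 \<le> \<psi> k x" "D.\<Phi> G < \<rho>"
      "\<And>f g. C1c \<Omega> f g \<Longrightarrow> D.\<Phi> g \<le> \<rho> \<Longrightarrow> D.En lam u G \<le> D.En lam f g" and neg: "D.En lam u G < 0"
      using \<Lambda>(2)[OF lam] by blast
    interpret E: dphase_min H \<Omega> \<mu>' a' b' p q \<delta> r M\<mu> "\<bar>B\<bar>" lam \<rho> \<psi> \<psi>' u G
      by unfold_locales (use lam sc rest in auto)
    have ur: "\<alpha> = r - 1" using \<alpha>crit by (simp add: r_def)
    have \<mu>eq: "\<mu>' x = \<mu> x" if "x \<in> \<Omega>" for x using that by (simp add: \<mu>'_def)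
    note [measurable] = D.sconvD(2,3)[OF sc]
    have "weak_solution H p q \<mu> \<Omega> a b \<delta> lam \<alpha> u G"
      unfolding weak_solution_def
    proof (intro conjI ballI D.sconv_weak_gradient[OF sc] E.u_pos)
      show "W0H H p q \<mu> \<Omega> u" using D.sconv_W0H[OF sc] W0H_cong[of \<Omega> \<mu>' \<mu>] \<mu>eq by blast
      fix \<phi> assume "\<phi> \<in> Cc_1 \<Omega>"
      then have C: "C1c \<Omega> \<phi> (grad \<phi>)" by (simp add: Cc_1_iff)
      note [measurable] = D.C1c_M(1,2)[OF C]
      note el = E.euler_lagrange[OF C]
      show "integrable ?M (\<lambda>x. flux H p q (\<mu> x) (G x) (grad \<phi> x))"
        using el(1) by (rule Bochner_Integration.integrable_cong[THEN iffD1, OF refl, rotated]) (simp add: \<mu>eq)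
      \<comment> \<open>Since a' and b' are equal to the data only almost everywhere, the reaction
        term is transferred up to a null set; the flux is transferred pointwise on \<Omega>.\<close>
      have ae: "AE x in ?M. (a' x * u x powr (- \<delta>) + lam * b' x * u x powr (r - 1)) * \<phi> x = (a x * u x powr (- \<delta>) + lam * b x * u x powr \<alpha>) * \<phi> x"
        using aa bb by eventually_elim (simp add: ur)
      show "integrable ?M (\<lambda>x. (a x * u x powr (- \<delta>) + lam * b x * u x powr \<alpha>) * \<phi> x)"
        using el(2) by (rule integrable_cong_AE_imp) (use ae in \<open>auto elim!: eventually_mono\<close>)
      have "(\<integral>x. flux H p q (\<mu> x) (G x) (grad \<phi> x) \<partial>?M) = (\<integral>x. flux H p q (\<mu>' x) (G x) (grad \<phi> x) \<partial>?M)"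
        by (intro Bochner_Integration.integral_cong) (simp_all add: \<mu>eq)
      also note el(3)
      also have "(\<integral>x. (a' x * u x powr (- \<delta>) + lam * b' x * u x powr (r - 1)) * \<phi> x \<partial>?M) = (\<integral>x. (a x * u x powr (- \<delta>) + lam * b x * u x powr \<alpha>) * \<phi> x \<partial>?M)"
        by (rule integral_cong_AE[OF _ _ ae]) measurable
      finally show "(\<integral>x. flux H p q (\<mu> x) (G x) (grad \<phi> x) \<partial>?M) = (\<integral>x. (a x * u x powr (- \<delta>) + lam * b x * u x powr \<alpha>) * \<phi> x \<partial>?M)" .
    qed
    moreover have "energy H p q \<mu> \<Omega> a b \<delta> lam \<alpha> u G = D.En lam u G"
    proof -
      have "(\<integral>x. H (G x) powr p / p + \<mu> x * H (G x) powr q / q \<partial>?M) = D.\<Phi> G"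
        unfolding D.\<Phi>_def D.Fd_def by (intro Bochner_Integration.integral_cong) (simp_all add: \<mu>eq)
      moreover have "(\<integral>x. a x * \<bar>u x\<bar> powr (1 - \<delta>) \<partial>?M) = D.An u"
        unfolding D.An_def by (rule integral_cong_AE) (use aa in \<open>auto elim!: eventually_mono\<close>)
      moreover have "(\<integral>x. b x * \<bar>u x\<bar> powr (\<alpha> + 1) \<partial>?M) = D.Bn u"
        unfolding D.Bn_def by (rule integral_cong_AE) (use bb in \<open>auto elim!: eventually_mono simp: ur\<close>)
      ultimately show ?thesis unfolding energy_def D.En_def by (simp add: ur)
    qed
    ultimately show ?thesis using neg by metis
  qed
  with \<Lambda>(1) show ?thesis by blast
qed

end
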